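(* There is an algorithm which takes as input a finite simple connected undirected graph $G=(V,\mathcal{E})$ and decides whether $G$ is (isomorphic to) the cocircuit graph $G_{\mathcal{M}}$ of a uniform oriented matroid $\mathcal{M}=(E,\mathcal{C}^* )$; in the affirmative case it returns the set $\mathcal{C}^*$ of signed cocircuits of such an oriented matroid $\mathcal{M}$. If there are integers $n\ge r$ such that $G$ is $2(r-1)$-regular and $|V|=2\binom{n}{n-r+1}$ (a necessary condition for $G$ to be the cocircuit graph of a uniform oriented matroid of rank $r$ on $n$ elements; if it fails, the algorithm rejects), then the running time of the algorithm is $O\big(r\,(n-r+1)\,|V|^3\big)$.
   Context: Let $E$ be a finite ground set with $|E|=n$. A sign vector on $E$ is an element $X\in\{+,-,0\}^E$. Write $X^0=\{e\in E: X_e=0\}$ and $\underline{X}=E\setminus X^0$ (the support); $-X$ is $X$ with all signs reversed. The separator of $X,Y$ is $S(X,Y)=\{e\in E:\{X_e,Y_e\}=\{+,-\}\}$. $\Delta$ denotes symmetric difference. A uniform oriented matroid of rank $r$ ($1\le r\le n$) is a pair $\mathcal{M}=(E,\mathcal{C}^* )$ where $\mathcal{C}^*\subseteq\{+,-,0\}^E$ (the set of cocircuits) satisfies: (C1) Every $X\in\mathcal{C}^*$ has support of size $n-r+1$. (C2) For every $I\subseteq E$ of size $n-r+1$ there are exactly two cocircuits $X,Y$ with support $I$; moreover $Y=-X$. (C3) For all $X,Y\in\mathcal{C}^*$ with $X\neq -Y$ and every $e\in S(X,Y)$ there is $Z\in\mathcal{C}^*$ with $Z_e=0$ and $Z_f\in\{X_f,Y_f,0\}$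 for every $f\in E\setminus\{e\}$. The cocircuit graph $G_{\mathcal{M}}$ has vertex set $\mathcal{C}^*$, with $X$ and $Y$ adjacent if and only if $|X^0\,\Delta\,Y^0|=2$ and $S(X,Y)=\emptyset$. Running time counts elementary operations in the standard unit-cost model. *)

theory Defs
  imports
    "HOL-Library.FuncSet"
    "Graph_Theory.Pair_Digraph"
    "Graph_Theory.Digraph_Component"
    "Graph_Theory.Digraph_Isomorphism"
begin

section \<open>Uniform oriented matroids and their cocircuit graphs\<close>

datatype sign = Plus | Minus | Zero

fun flip :: "sign \<Rightarrow> sign" where
  "flip Plus = Minus"
| "flip Minus = Plus"
| "flip Zero = Zero"

text \<open>Sign vectors on \<open>E\<close> are the elements of \<open>E \<rightarrow>\<^sub>E UNIV\<close>, i.e. they are \<open>undefined\<close>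
  outside \<open>E\<close>, so that two sign vectors on \<open>E\<close> are equal iff they agree on \<open>E\<close>.\<close>

definition opposite :: "'e set \<Rightarrow> ('e \<Rightarrow> sign) \<Rightarrow> 'e \<Rightarrow> sign" where
  "opposite E X = (\<lambda>e\<in>E. flip (X e))"

definition zero_set :: "'e set \<Rightarrow> ('e \<Rightarrow> sign) \<Rightarrow> 'e set" where
  "zero_set E X = {e \<in> E. X e = Zero}"

definition support :: "'e set \<Rightarrow> ('e \<Rightarrow> sign) \<Rightarrow> 'e set" where
  "support E X = E - zero_set E X"

definition separator :: "'e set \<Rightarrow> ('e \<Rightarrow> sign) \<Rightarrow> ('e \<Rightarrow> sign) \<Rightarrow> 'e set" where
  "separator E X Y = {e \<in> E. {X e, Y e} = {Plus, Minus}}"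

locale uniform_oriented_matroid =
  fixes E :: "'e set" and r :: nat and C :: "('e \<Rightarrow> sign) set"
  assumes finite_ground: "finite E"
    and rank_bounds: "1 \<le> r" "r \<le> card E"
    and sign_vectors: "C \<subseteq> E \<rightarrow>\<^sub>E UNIV"
    and C1: "\<forall>X\<in>C. card (support E X) = card E - r + 1"
    and C2: "\<forall>I. I \<subseteq> E \<and> card I = card E - r + 1 \<longrightarrow>
               (\<exists>X Y. X \<noteq> Y \<and> {Z \<in> C. support E Z = I} = {X, Y} \<and> Y = opposite E X)"
    and C3: "\<forall>X\<in>C. \<forall>Y\<in>C. X \<noteq> opposite E Y \<longrightarrow>
               (\<forall>e\<in>separator E X Y. \<exists>Z\<in>C. Z e = Zero \<and> (\<forall>f\<in>E - {e}. Z f \<in> {X f, Y f, Zero}))"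

text \<open>Undirected simple graphs are represented as symmetric loop-free digraphs (\<open>pair_graph\<close>).\<close>

definition cocircuit_graph :: "'e set \<Rightarrow> ('e \<Rightarrow> sign) set \<Rightarrow> ('e \<Rightarrow> sign) pair_pre_digraph" where
  "cocircuit_graph E C =
     \<lparr> pverts = C,
       parcs = {(X, Y). X \<in> C \<and> Y \<in> C \<and>
         card ((zero_set E X - zero_set E Y) \<union> (zero_set E Y - zero_set E X)) = 2 \<and>
         separator E X Y = {}} \<rparr>"

text \<open>For digraphs given by pairs, the library's isomorphism (which has separate components for
  vertices and arcs) is the usual one.\<close>

lemma digraph_iso_with_proj:
  assumes "pair_wf_digraph G"
  shows "digraph_iso (with_proj G) (with_proj H) \<longleftrightarrow>
    (\<exists>f. inj_on f (pverts G) \<and> pverts H = f ` pverts G \<and> parcs H = map_prod f f ` parcs G)"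
    (is "?L \<longleftrightarrow> ?R")
proof
  assume ?L
  then obtain h where h: "pre_digraph.digraph_isomorphism (with_proj G) h"
    "with_proj H = app_iso h (with_proj G)"
    by (auto simp: digraph_iso_def)
  let ?f = "iso_verts h"
  have eqs: "pverts H = ?f ` pverts G" "parcs H = iso_arcs h ` parcs G"
    "iso_tail h = fst" "iso_head h = snd"
    using h(2) by (simp_all add: with_proj_def app_iso_def)
  have "iso_arcs h a = map_prod ?f ?f a" if "a \<in> parcs G" for a
    using h(1) that eqs(3,4)
    by (auto simp: pre_digraph.digraph_isomorphism_def prod_eq_iff)
  then have "parcs H = map_prod ?f ?f ` parcs G"
    unfolding eqs(2) by (rule image_cong[OF refl])
  moreover have "inj_on ?f (pverts G)"
    using h(1) by (simp add: pre_digraph.digraph_isomorphism_def)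
  ultimately show ?R using eqs(1) by blast
next
  assume ?R
  then obtain f where f: "inj_on f (pverts G)" "pverts H = f ` pverts G"
    "parcs H = map_prod f f ` parcs G" by blast
  interpret pair_wf_digraph G by fact
  let ?h = "\<lparr> iso_verts = f, iso_arcs = map_prod f f, iso_head = snd, iso_tail = fst \<rparr>"
  have "parcs G \<subseteq> pverts G \<times> pverts G"
    using in_arcsD1 in_arcsD2 by auto
  then have "inj_on (map_prod f f) (parcs G)"
    using map_prod_inj_on[OF f(1) f(1)] by (rule inj_on_subset[rotated])
  then have "pre_digraph.digraph_isomorphism (with_proj G) ?h"
    using f(1) wf_digraph by (simp add: pre_digraph.digraph_isomorphism_def)
  moreover have "with_proj H = app_iso ?h (with_proj G)"
    using f by (simp add: app_iso_def with_proj_def)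
  ultimately show ?L by (auto simp: digraph_iso_def)
qed

definition regular :: "nat \<Rightarrow> 'a pair_pre_digraph \<Rightarrow> bool" where
  "regular d G \<longleftrightarrow> (\<forall>v\<in>pverts G. out_degree (with_proj G) v = d)"

text \<open>The bound \<open>1 \<le> r\<close> is needed because \<open>r - 1\<close> is a truncated subtraction.\<close>

definition has_parameters :: "'a pair_pre_digraph \<Rightarrow> nat \<Rightarrow> nat \<Rightarrow> bool" where
  "has_parameters G n r \<longleftrightarrow>
     1 \<le> r \<and> r \<le> n \<and> regular (2 * (r - 1)) G \<and> card (pverts G) = 2 * (n choose (n - r + 1))"


section \<open>A unit-cost random access machine\<close>

text \<open>
  The machine model is the unit-cost RAM (with addition and truncated subtraction as its only
  arithmetic, so that no computing power is hidden in products of long numbers), presented as a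
  structured programming language.  A program works on a fixed finite number of named, unbounded
  arrays of natural numbers; scalar variables are arrays of which only cell 0 is used.  Every
  node of an expression or condition (constant, memory access, operation, comparison), every
  assignment and every evaluation of a branching or loop condition costs one step.
\<close>

datatype expr =
    Num nat
  | Get string expr
  | Add expr expr
  | Sub expr expr

datatype test =
    Less expr expr
  | Equal expr expr
  | Neg test
  | Conj test test

datatype prog =
    Skip
  | Put string expr expr  \<comment> \<open>\<open>Put a i e\<close> is the assignment \<open>a[i] := e\<close>\<close>
  | Seq prog prog
  | Branch test prog prog
  | Loop test prog

type_synonym store = "string \<Rightarrow> nat \<Rightarrow> nat"

primrec val :: "expr \<Rightarrow> store \<Rightarrow> nat" where
  "val (Num k) s = k"
| "val (Get a i) s = s a (val i s)"
| "val (Add d e) s = val d s + val e s"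
| "val (Sub d e) s = val d s - val e s"

primrec holds :: "test \<Rightarrow> store \<Rightarrow> bool" where
  "holds (Less d e) s \<longleftrightarrow> val d s < val e s"
| "holds (Equal d e) s \<longleftrightarrow> val d s = val e s"
| "holds (Neg b) s \<longleftrightarrow> \<not> holds b s"
| "holds (Conj b c) s \<longleftrightarrow> holds b s \<and> holds c s"

primrec expr_cost :: "expr \<Rightarrow> nat" where
  "expr_cost (Num k) = 1"
| "expr_cost (Get a i) = 1 + expr_cost i"
| "expr_cost (Add d e) = 1 + expr_cost d + expr_cost e"
| "expr_cost (Sub d e) = 1 + expr_cost d + expr_cost e"

primrec test_cost :: "test \<Rightarrow> nat" where
  "test_cost (Less d e) = 1 + expr_cost d + expr_cost e"
| "test_cost (Equal d e) = 1 + expr_cost d + expr_cost e"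
| "test_cost (Neg b) = 1 + test_cost b"
| "test_cost (Conj b c) = 1 + test_cost b + test_cost c"

text \<open>\<open>runs p s t s'\<close>: started in store \<open>s\<close>, program \<open>p\<close> halts after exactly \<open>t\<close> steps in
  store \<open>s'\<close>.\<close>

inductive runs :: "prog \<Rightarrow> store \<Rightarrow> nat \<Rightarrow> store \<Rightarrow> bool" where
  Skip: "runs Skip s 1 s"
| Put: "runs (Put a i e) s (1 + expr_cost i + expr_cost e) (s(a := (s a)(val i s := val e s)))"
| Seq: "runs p s t s' \<Longrightarrow> runs q s' u s'' \<Longrightarrow> runs (Seq p q) s (t + u) s''"
| BranchTrue: "holds b s \<Longrightarrow> runs p s t s' \<Longrightarrow> runs (Branch b p q) s (1 + test_cost b + t) s'"
| BranchFalse: "\<not> holds b s \<Longrightarrow> runs q s t s' \<Longrightarrow> runs (Branch b p q) s (1 + test_cost b + t) s'"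
| LoopFalse: "\<not> holds b s \<Longrightarrow> runs (Loop b p) s (1 + test_cost b) s"
| LoopTrue: "holds b s \<Longrightarrow> runs p s t s' \<Longrightarrow> runs (Loop b p) s' u s'' \<Longrightarrow>
    runs (Loop b p) s (1 + test_cost b + t + u) s''"

lemma runs_deterministic:
  "runs p s t s' \<Longrightarrow> runs p s u s'' \<Longrightarrow> t = u \<and> s' = s''"
proof (induction arbitrary: u s'' rule: runs.induct)
  case (Skip s)
  then show ?case by cases simp
next
  case (Put a i e s)
  then show ?case by cases simp
next
  case (Seq p s t s' q v s1)
  from Seq.prems obtain t' v' s2 where
    "runs p s t' s2" "runs q s2 v' s''" "u = t' + v'" by cases simp
  then show ?case using Seq.IH by metis
next
  case (BranchTrue b s p t s' q)
  from BranchTrue.prems obtain t' where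
    "runs p s t' s''" "u = 1 + test_cost b + t'" by cases (use BranchTrue.hyps in simp_all)
  then show ?case using BranchTrue.IH by metis
next
  case (BranchFalse b s q t s' p)
  from BranchFalse.prems obtain t' where
    "runs q s t' s''" "u = 1 + test_cost b + t'" by cases (use BranchFalse.hyps in simp_all)
  then show ?case using BranchFalse.IH by metis
next
  case (LoopFalse b s p)
  from LoopFalse.prems show ?case by cases (use LoopFalse.hyps in simp_all)
next
  case (LoopTrue b s p t s' v s1)
  from LoopTrue.prems obtain t' v' s2 where
    "runs p s t' s2" "runs (Loop b p) s2 v' s''" "u = 1 + test_cost b + t' + v'"
    by cases (use LoopTrue.hyps in simp_all)
  then show ?case using LoopTrue.IH by metis
qed


section \<open>Encoding of inputs and outputs\<close>

text \<open>An input graph has vertex set \<open>{..<N}\<close>; it is given by \<open>N\<close> and its adjacency matrix, stored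
  row by row.  All other memory cells are initially 0.\<close>

definition input_graph :: "nat pair_pre_digraph \<Rightarrow> bool" where
  "input_graph G \<longleftrightarrow>
     pair_graph G \<and> Digraph_Component.connected (with_proj G) \<and> pverts G = {..<card (pverts G)}"

definition input_store :: "nat pair_pre_digraph \<Rightarrow> store" where
  "input_store G = (\<lambda>a k.
     let N = card (pverts G) in
     if a = ''N'' \<and> k = 0 then N
     else if a = ''adj'' \<and> k < N * N \<and> (k div N, k mod N) \<in> parcs G then 1
     else 0)"

definition accepting :: "store \<Rightarrow> bool" where
  "accepting s \<longleftrightarrow> s ''accept'' 0 = 1"

definition sign_of_nat :: "nat \<Rightarrow> sign" where
  "sign_of_nat k = (if k = 0 then Zero else if k = 1 then Plus else Minus)"

text \<open>The output is a set of sign vectors on the ground set \<open>{..<n}\<close>, where \<open>n\<close> is found in the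
  cell \<open>n[0]\<close>, the number of listed sign vectors in \<open>m[0]\<close>, and the list itself, as an
  \<open>m \<times> n\<close> matrix stored row by row, in the array \<open>cocircuits\<close>.\<close>

definition output_ground :: "store \<Rightarrow> nat set" where
  "output_ground s = {..<s ''n'' 0}"

definition output_cocircuits :: "store \<Rightarrow> (nat \<Rightarrow> sign) set" where
  "output_cocircuits s =
     (\<lambda>i. \<lambda>e\<in>output_ground s. sign_of_nat (s ''cocircuits'' (i * s ''n'' 0 + e))) ` {..<s ''m'' 0}"

end

theory Submission
  imports Defs
begin

text \<open>
  Write \<open>m = r - 1\<close> for the size of the zero sets and \<open>k = n - m\<close> for that of the supports.  A walk in
  the cocircuit graph from \<open>P\<close> to \<open>- Q\<close> has at least \<open>k - |S(P, Q)|\<close> steps, since each step puts one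
  element into the zero set, and along a coline this bound is attained.  It follows that, once the
  antipode of one vertex is known, distances determine everything.  If \<open>Y\<close>, \<open>W\<close> are neighbours of
  \<open>X\<close>, then \<open>d(Y, - W) > k\<close> iff \<open>Y = W\<close>, which propagates the antipodal map; and
  \<open>d(Y, - W) \<le> k - 1\<close> iff some element vanishes at \<open>X\<close> and has opposite signs at \<open>Y\<close> and \<open>W\<close>.  The
  same test, for neighbours \<open>Y\<close> of \<open>X\<close> and \<open>W\<close> of \<open>X'\<close> with \<open>X\<close>, \<open>X'\<close> adjacent and \<open>Y\<close>,
  \<open>W\<close> not on the coline of \<open>X\<close> and \<open>X'\<close>, transports an element from \<open>X\<close> to \<open>X'\<close>, so that the vertices at which it vanishes are found by a graph search;
  outside of them its sign is locally constant.

  The algorithm tries all antipodes of vertex 0.  For each it computes a sign matrix in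
  \<open>O(N\<^sup>2 n)\<close> steps, whatever the input, and then checks in \<open>O(N\<^sup>2 n)\<close> steps that the rows have the
  right zero sets, that their adjacencies are those of the graph, and that every vertex has two
  neighbours on each of its colines, one on each side.  By walking along colines the last condition
  gives cocircuit elimination for pairs on a common coline, and this implies elimination for all
  pairs, by induction over minors.  Hence an accepted matrix is correct, even if the guess was not.
\<close>

section \<open>Sign vectors and colines\<close>

text \<open>The cubic time bound shapes the proof. With \<open>N\<close> guesses for one antipode, a
  single guess may use only \<open>N * N\<close> times a factor of order
  \<open>r * (n - r + 1)\<close>, and a naive test of (C3) for all pairs of rows and all separating
  elements would exceed this. Hence (C3) is replaced by a condition on single vertices, and the
  balls of radius \<open>k\<close> and \<open>k - 1\<close>, which do not depend on the guess, are
  computed once. The price is a theorem about sign vectors: elimination on colines must imply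
  elimination in general. The obstacle there is that a path in a deletion may run on the wrong side
  of the deleted element; it is repaired by a detour through the contraction, and uniformity
  guarantees that the ends of the detour are not antipodes. In the other direction the elements are
  known only through the graph. An arc is labelled by the element that leaves the zero set along it,
  and an element is recovered as the set of its arcs, up to a reorientation that the conditions on
  the matrix do not see. Connectedness of the input excludes rank 1, so that every element vanishes
  somewhere.\<close>

lemma flip_flip [simp]: "flip (flip s) = s"
  by (cases s) auto

lemma flip_eq_Zero_iff [simp]: "flip s = Zero \<longleftrightarrow> s = Zero" "Zero = flip s \<longleftrightarrow> s = Zero"
  by (cases s; auto)+

lemma flip_eq_self_iff [simp]: "flip s = s \<longleftrightarrow> s = Zero" "s = flip s \<longleftrightarrow> s = Zero"
  by (cases s; auto)+

lemma nonzero_signs: "s \<noteq> Zero \<Longrightarrow> t \<noteq> Zero \<Longrightarrow> s \<noteq> t \<longleftrightarrow> t = flip s"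
  by (cases s; cases t) auto

lemma mem_separator_iff:
  "e \<in> separator E X Y \<longleftrightarrow> e \<in> E \<and> X e \<noteq> Zero \<and> Y e = flip (X e)"
  by (cases "X e"; cases "Y e") (auto simp: separator_def doubleton_eq_iff)

lemma separator_eq_empty_iff:
  "separator E X Y = {} \<longleftrightarrow> (\<forall>e\<in>E. X e = Zero \<or> Y e = Zero \<or> X e = Y e)"
proof -
  have "e \<notin> separator E X Y \<longleftrightarrow> X e = Zero \<or> Y e = Zero \<or> X e = Y e" if "e \<in> E" for e
    using that by (cases "X e"; cases "Y e") (simp_all add: mem_separator_iff)
  moreover have "separator E X Y \<subseteq> E" by (auto simp: separator_def)
  ultimately show ?thesis by blast
qed

lemma separator_commute: "separator E X Y = separator E Y X"
  by (auto simp: separator_def insert_commute)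

lemma mem_zero_set_iff [simp]: "e \<in> zero_set E X \<longleftrightarrow> e \<in> E \<and> X e = Zero"
  by (auto simp: zero_set_def)

lemma zero_set_insertD: "zero_set E X = insert a A \<Longrightarrow> a \<in> E \<and> X a = Zero"
proof -
  assume "zero_set E X = insert a A"
  then have "a \<in> zero_set E X" by simp
  then show ?thesis by simp
qed

lemma opposite_apply [simp]: "e \<in> E \<Longrightarrow> opposite E X e = flip (X e)"
  by (simp add: opposite_def)

lemma zero_set_opposite [simp]: "zero_set E (opposite E X) = zero_set E X"
  by auto

lemma opposite_opposite: "X \<in> extensional E \<Longrightarrow> opposite E (opposite E X) = X"
  by (rule ext) (auto simp: opposite_def extensional_def)

text \<open>The edge relation of the cocircuit graph with the membership conditions split off, so
  that it makes sense for arbitrary sign vectors.\<close>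

definition adjacent :: "'e set \<Rightarrow> ('e \<Rightarrow> sign) \<Rightarrow> ('e \<Rightarrow> sign) \<Rightarrow> bool" where
  "adjacent E X Y \<longleftrightarrow>
     card ((zero_set E X - zero_set E Y) \<union> (zero_set E Y - zero_set E X)) = 2 \<and>
     separator E X Y = {}"

lemma adjacent_commute: "adjacent E X Y \<longleftrightarrow> adjacent E Y X"
  by (simp add: adjacent_def separator_commute Un_commute)

text \<open>Sets of equal size have set differences of equal size, so a symmetric difference of size
  2 is exactly one exchange.\<close>

lemma card_symdiff_eq_2_iff:
  assumes "finite A" "finite B" "card A = card B"
  shows "card ((A - B) \<union> (B - A)) = 2 \<longleftrightarrow> (\<exists>a b. a \<in> A \<and> b \<notin> A \<and> B = insert b (A - {a}))"
proof -
  have "card (A - B) = card (B - A)"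
    using assms by (metis card_le_sym_Diff le_antisym order_refl)
  moreover have "card ((A - B) \<union> (B - A)) = card (A - B) + card (B - A)"
    using assms by (intro card_Un_disjoint) auto
  ultimately have *: "card ((A - B) \<union> (B - A)) = 2 \<longleftrightarrow> card (A - B) = 1 \<and> card (B - A) = 1"
    by auto
  show ?thesis
  proof
    assume "card ((A - B) \<union> (B - A)) = 2"
    then obtain a b where "A - B = {a}" "B - A = {b}"
      using * by (metis card_1_singletonE)
    then have "a \<in> A" "b \<notin> A" "B = insert b (A - {a})" by auto
    then show "\<exists>a b. a \<in> A \<and> b \<notin> A \<and> B = insert b (A - {a})" by blast
  next
    assume "\<exists>a b. a \<in> A \<and> b \<notin> A \<and> B = insert b (A - {a})"
    then obtain a b where "a \<in> A" "b \<notin> A" "B = insert b (A - {a})" by blast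
    then have "A - B = {a}" "B - A = {b}" by auto
    then show "card ((A - B) \<union> (B - A)) = 2" using * by simp
  qed
qed

text \<open>The sign condition of (C3) on a subset \<open>D\<close>; shrinking \<open>D\<close>
  amounts to deleting the other elements.\<close>

definition between :: "'e set \<Rightarrow> ('e \<Rightarrow> sign) \<Rightarrow> ('e \<Rightarrow> sign) \<Rightarrow> ('e \<Rightarrow> sign) \<Rightarrow> bool" where
  "between D X Y W \<longleftrightarrow> (\<forall>f\<in>D. W f \<in> {X f, Y f, Zero})"

text \<open>Axioms (C1) and (C2) in terms of the zero sets, whose size is \<open>m = r - 1\<close>.\<close>

locale cocircuit_system =
  fixes E :: "'e set" and m :: nat and C :: "('e \<Rightarrow> sign) set"
  assumes finite_E: "finite E"
    and m_less: "m < card E"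
    and extensional: "X \<in> C \<Longrightarrow> X \<in> extensional E"
    and card_zero: "X \<in> C \<Longrightarrow> card (zero_set E X) = m"
    and opposite_closed: "X \<in> C \<Longrightarrow> opposite E X \<in> C"
    and ex_zero_set: "L \<subseteq> E \<Longrightarrow> card L = m \<Longrightarrow> \<exists>X\<in>C. zero_set E X = L"
    and eq_zero_set: "X \<in> C \<Longrightarrow> Y \<in> C \<Longrightarrow> zero_set E X = zero_set E Y \<Longrightarrow>
          Y = X \<or> Y = opposite E X"
begin

abbreviation "zs \<equiv> zero_set E"
abbreviation "opp \<equiv> opposite E"
abbreviation "sep \<equiv> separator E"

lemma zs_subset: "zs X \<subseteq> E" by auto

lemma finite_zs [simp]: "finite (zs X)"
  using finite_E by (rule finite_subset[OF zs_subset])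

lemma finite_sep [simp]: "finite (sep X Y)"
  using finite_E by (auto simp: separator_def)

lemma opp_opp [simp]: "X \<in> C \<Longrightarrow> opp (opp X) = X"
  using extensional by (simp add: opposite_opposite)

lemma opp_neq: assumes "X \<in> C" shows "opp X \<noteq> X"
proof -
  have "zs X \<noteq> E" using card_zero[OF assms] m_less by auto
  then obtain e where "e \<in> E" "X e \<noteq> Zero" by (metis mem_zero_set_iff subsetI subset_antisym)
  then show ?thesis by (metis flip_eq_self_iff(1) opposite_apply)
qed

lemma ex_sign:
  assumes "L \<subseteq> E" "card L = m" "a \<in> E - L" "s \<noteq> Zero"
  obtains X where "X \<in> C" "zs X = L" "X a = s"
proof -
  obtain X where X: "X \<in> C" "zs X = L" using ex_zero_set assms by blast
  then have "X a \<noteq> Zero" using assms(3) by auto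
  then have "X a = s \<or> opp X a = s" using assms(3,4) nonzero_signs by auto
  then show thesis using X that opposite_closed zero_set_opposite by metis
qed

text \<open>A zero set carries an antipodal pair, and one nonzero coordinate tells its two members
  apart; cocircuits are identified in this way throughout.\<close>

lemma eq_if_sign:
  assumes "X \<in> C" "Y \<in> C" "zs X = zs Y" "a \<in> E" "X a \<noteq> Zero" "X a = Y a"
  shows "Y = X"
  using eq_zero_set[OF assms(1-3)] assms(4-6) by (metis flip_eq_self_iff(1) opposite_apply)

lemma opp_if_sign:
  assumes "X \<in> C" "Y \<in> C" "zs X = zs Y" "a \<in> E" "X a \<noteq> Y a"
  shows "Y = opp X"
  using eq_zero_set[OF assms(1-3)] assms(4-5) by auto

lemma zs_eq_if_subset: "X \<in> C \<Longrightarrow> A \<subseteq> zs X \<Longrightarrow> card A = m \<Longrightarrow> zs X = A"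
  using card_zero by (metis card_subset_eq finite_zs)

lemma adjacent_iff:
  assumes "X \<in> C" "Y \<in> C"
  shows "adjacent E X Y \<longleftrightarrow>
    (\<exists>a b. a \<in> zs X \<and> b \<in> E \<and> X b \<noteq> Zero \<and> zs Y = insert b (zs X - {a})) \<and> sep X Y = {}"
proof -
  have "b \<in> E" if "zs Y = insert b A" for b A using that by auto
  then show ?thesis
    unfolding adjacent_def using card_symdiff_eq_2_iff[of "zs X" "zs Y"] card_zero assms
    by (simp add: finite_E) blast
qed

text \<open>\<open>L\<close> has \<open>m - 1\<close> elements, so one further zero exhausts the
  zero set of \<open>W\<close>.\<close>

lemma coline_zs:
  assumes "X \<in> C" "W \<in> C" "zs X = insert a L" "a \<notin> L" "L \<subseteq> zs W" "e \<in> zs W" "e \<notin> L"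
  shows "zs W = insert e L"
proof -
  have "finite L" using assms(5) finite_zs finite_subset by blast
  then have "card (insert e L) = card (insert a L)" using assms by simp
  also have "\<dots> = m" using assms card_zero by metis
  finally show ?thesis using zs_eq_if_subset assms by simp
qed

end

text \<open>Cocircuit elimination for pairs on a common coline, i.e. with zero sets
  \<open>insert a L\<close> and \<open>insert b L\<close>.\<close>

locale modular_system = cocircuit_system +
  assumes modular_elim: "X \<in> C \<Longrightarrow> Y \<in> C \<Longrightarrow> zs X = insert a L \<Longrightarrow> zs Y = insert b L \<Longrightarrow>
      a \<notin> L \<Longrightarrow> b \<notin> L \<Longrightarrow> X \<noteq> opp Y \<Longrightarrow> e \<in> sep X Y \<Longrightarrow>
      \<exists>W\<in>C. zs W = insert e L \<and> between E X Y W"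

text \<open>The local condition that the program verifies: as \<open>s\<close> may be either sign,
  each cocircuit has a neighbour on both sides along each of its colines.\<close>

locale coline_system = cocircuit_system +
  assumes coline_step: "X \<in> C \<Longrightarrow> a \<in> zs X \<Longrightarrow> s \<noteq> Zero \<Longrightarrow>
      \<exists>Y\<in>C. Y a = s \<and> zs X - {a} \<subseteq> zs Y \<and> sep X Y = {}"
begin

text \<open>Walking along a coline from \<open>X\<close>, starting towards the side \<open>s\<close> of \<open>a\<close> and crossing every
  element that is met: \<open>chain X s a L A g\<close> says that \<open>A\<close> has been crossed and the walk is at a
  cocircuit that vanishes at \<open>g\<close>.\<close>

definition walked :: "('a \<Rightarrow> sign) \<Rightarrow> sign \<Rightarrow> 'a \<Rightarrow> 'a set \<Rightarrow> 'a set \<Rightarrow> 'a \<Rightarrow> 'a \<Rightarrow> sign" where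
  "walked X s a L A g = (\<lambda>h\<in>E. if h \<in> insert g L then Zero else if h = a then s
     else if h \<in> A then flip (X h) else X h)"

inductive chain :: "('a \<Rightarrow> sign) \<Rightarrow> sign \<Rightarrow> 'a \<Rightarrow> 'a set \<Rightarrow> 'a set \<Rightarrow> 'a \<Rightarrow> bool"
  for X s a L where
  start: "chain X s a L {} a"
| step: "chain X s a L A g \<Longrightarrow> g' \<in> E - L - insert g A \<Longrightarrow>
    walked X s a L (insert g A) g' \<in> C \<Longrightarrow> chain X s a L (insert g A) g'"

context
  fixes X s a L
  assumes X: "X \<in> C" and L: "zs X = insert a L" "a \<notin> L" and s: "s \<noteq> Zero"
begin

lemma a_in: "a \<in> E" "L \<subseteq> E" using L by auto

lemma X_nonzero: "h \<in> E \<Longrightarrow> h \<notin> L \<Longrightarrow> h \<noteq> a \<Longrightarrow> X h \<noteq> Zero"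
  using L by (metis insert_iff mem_zero_set_iff)

lemma chain_facts:
  assumes "chain X s a L A g"
  shows "g \<in> E - L - A \<and> A \<subseteq> E - L \<and> walked X s a L A g \<in> C \<and> (g \<noteq> a \<longrightarrow> a \<in> A) \<and> (g = a \<longrightarrow> A = {})"
  using assms
proof induction
  case start
  have "walked X s a L {} a = X"
  proof
    fix h show "walked X s a L {} a h = X h"
    proof (cases "h \<in> insert a L")
      case True
      then have "X h = Zero" "h \<in> E" using L(1) by (metis mem_zero_set_iff)+
      then show ?thesis using True by (auto simp: walked_def)
    qed (use extensional[OF X] in \<open>auto simp: walked_def extensional_def\<close>)
  qed
  then show ?case using X a_in L(2) by simp
qed auto

text \<open>Each crossed element was once the current zero, and at that stage fewer elements had
  been crossed. This serves both to exclude a return and to find the eliminating cocircuit.\<close>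

lemma chain_history:
  assumes "chain X s a L A g" "h \<in> A"
  shows "\<exists>A'\<subseteq>A. h \<notin> A' \<and> chain X s a L A' h"
  using assms
proof induction
  case (step A g g')
  show ?case
  proof (cases "h = g")
    case True
    then show ?thesis using step chain_facts by blast
  qed (use step in blast)
qed auto

lemma zs_walked:
  assumes "chain X s a L A g" shows "zs (walked X s a L A g) = insert g L"
  using chain_facts[OF assms] a_in s X_nonzero by (auto simp: walked_def split: if_splits)

text \<open>The neighbour \<open>W\<close> beyond \<open>g\<close> has a zero \<open>g'\<close>
  outside \<open>L\<close>. Had \<open>g'\<close> been met before, \<open>W\<close> and the
  cocircuit \<open>?U\<close> of that earlier visit would have the same zero set; they differ at
  \<open>g\<close>, hence are antipodes, yet both agree with \<open>X\<close> at \<open>b\<close>.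
  An element \<open>b\<close> still to be crossed thus prevents the walk from closing up.\<close>

lemma chain_extend:
  assumes ch: "chain X s a L A g" and b: "b \<in> E - L" "b \<notin> insert g A"
  shows "\<exists>g'. chain X s a L (insert g A) g'"
proof -
  note f = chain_facts[OF ch]
  let ?V = "walked X s a L A g"
  \<comment> \<open>The far side of \<open>g\<close>: until \<open>g\<close> is crossed, the sign
    there is that of \<open>X\<close>; only at the start is the side chosen by
    \<open>s\<close>.\<close>
  define t where "t = (if g = a then s else flip (X g))"
  have t: "t \<noteq> Zero" using f s X_nonzero by (auto simp: t_def)
  obtain W where W: "W \<in> C" "W g = t" "L \<subseteq> zs W" "sep ?V W = {}"
  proof -
    have "?V \<in> C" "g \<in> zs ?V" "zs ?V - {g} = L"
      using f zs_walked[OF ch] by auto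
    then show thesis using coline_step[of ?V g t] t that by auto
  qed
  have "\<exists>g'. g' \<in> zs W \<and> g' \<notin> L"
  proof -
    have "finite L" using a_in finite_E finite_subset by blast
    then have "card L < card (zs W)" using card_zero[OF W(1)] card_zero[OF X] L by simp
    then show ?thesis using W(3) by (metis less_irrefl subset_antisym subsetI)
  qed
  then obtain g' where g': "g' \<in> zs W" "g' \<notin> L" by blast
  have zW: "zs W = insert g' L" using coline_zs[OF X W(1) L W(3) g'] .
  have g'g: "g' \<noteq> g" using W(2) t g' by auto
  have W_other: "W h = ?V h" if "h \<in> E" "h \<notin> L" "h \<noteq> g" "h \<noteq> g'" for h
  proof -
    have "h \<notin> zs W" "h \<notin> zs ?V" using that zW zs_walked[OF ch] by simp_all
    then show ?thesis using W(4) that(1) unfolding separator_eq_empty_iff by force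
  qed
  have "g' \<notin> A"
  proof
    assume "g' \<in> A"
    then obtain A' where A': "A' \<subseteq> A" "g' \<notin> A'" "chain X s a L A' g'"
      using chain_history[OF ch] by blast
    let ?U = "walked X s a L A' g'"
    have ga: "g \<noteq> a" using f \<open>g' \<in> A\<close> by auto
    have U: "?U \<in> C" "zs ?U = zs W" using chain_facts[OF A'(3)] zs_walked[OF A'(3)] zW by auto
    have bb: "b \<noteq> a" "b \<noteq> g'" "b \<notin> A'" using b f \<open>g' \<in> A\<close> A'(1) by auto
    have "W g \<noteq> ?U g"
      using W(2) f ga A' g'g X_nonzero by (auto simp: t_def walked_def)
    then have "W = opp ?U" using opp_if_sign[OF U(1) W(1) U(2), of g] f by auto
    moreover have "W b = ?U b" 
      using W_other[of b] b bb by (auto simp: walked_def)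
    ultimately have "?U b = Zero" using b by auto
    then show False using bb b X_nonzero by (auto simp: walked_def split: if_splits)
  qed
  moreover have "W = walked X s a L (insert g A) g'"
  proof
    fix h show "W h = walked X s a L (insert g A) g' h"
    proof (cases "h \<in> E")
      case True
      consider "h \<in> insert g' L" | "h \<notin> insert g' L" "h = g" | "h \<notin> insert g' L" "h \<noteq> g" by blast
      then show ?thesis
      proof cases
        case 1
        then have "W h = Zero" using zW by (metis mem_zero_set_iff)
        then show ?thesis using True 1 by (auto simp: walked_def)
      next
        case 2
        then show ?thesis using True W(2) f by (auto simp: walked_def t_def)
      next
        case 3
        then have "W h = ?V h" using W_other True by simp
        then show ?thesis using 3 True by (auto simp: walked_def)
      qed
    next
      case False
      then show ?thesis using extensional[OF W(1)] by (auto simp: walked_def extensional_def)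
    qed
  qed
  ultimately have "chain X s a L (insert g A) g'"
    using chain.step[OF ch] W(1) g' g'g by auto
  then show ?thesis by blast
qed

lemma chain_reaches:
  assumes "chain X s a L A g" "b \<in> E - L" "b \<notin> A"
  shows "\<exists>A'. chain X s a L A' b"
  using assms
proof (induction "card (E - A)" arbitrary: A g rule: less_induct)
  case less
  show ?case
  proof (cases "b = g")
    case False
    obtain g' where g': "chain X s a L (insert g A) g'"
      using chain_extend[OF less.prems(1,2)] less.prems(3) False by blast
    have "g \<in> E - A" using chain_facts[OF less.prems(1)] by auto
    then have "card (E - insert g A) < card (E - A)"
      using finite_E by (intro psubset_card_mono) auto
    then show ?thesis using less.hyps g' less.prems False by blast
  qed (use less in blast)
qed

end

text \<open>The walk from \<open>X\<close> towards the side of \<open>a\<close> on which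
  \<open>Y\<close> lies reaches the zero \<open>b\<close> of \<open>Y\<close>, and there it is at
  \<open>Y\<close>, having its sign at \<open>a\<close>. The separating elements have been crossed
  on the way, so the eliminating cocircuit is found at the moment when \<open>e\<close> was
  met.\<close>

lemma coline_elim:
  assumes X: "X \<in> C" and Y: "Y \<in> C" and zX: "zs X = insert a L" and zY: "zs Y = insert b L"
    and aL: "a \<notin> L" "b \<notin> L" and ne: "X \<noteq> opp Y" and e: "e \<in> sep X Y"
  shows "\<exists>W\<in>C. zs W = insert e L \<and> between E X Y W"
proof -
  have e': "e \<in> E" "X e \<noteq> Zero" "Y e = flip (X e)" using e by (auto simp: mem_separator_iff)
  have ab: "a \<noteq> b"
  proof
    assume "a = b"
    then have "zs Y = zs X" using zX zY by simp
    moreover have "Y e \<noteq> X e" using e' by simp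
    ultimately have "X = opp Y" by (rule opp_if_sign[OF Y X _ e'(1)])
    then show False using ne by simp
  qed
  have aE: "a \<in> E" "b \<in> E" "b \<in> E - L" "L \<subseteq> E" using zX zY aL by auto
  define s where "s = Y a"
  have s: "s \<noteq> Zero" using zY ab aL aE by (auto simp: s_def)
  obtain A where A: "chain X s a L A b"
    using chain_reaches[OF X zX aL(1) s chain.start aE(3)] by auto
  note fA = chain_facts[OF X zX aL(1) s A]
  have "Y = walked X s a L A b"
  proof (rule eq_if_sign)
    show "walked X s a L A b \<in> C" using fA by blast
    show "zs (walked X s a L A b) = zs Y" using zs_walked[OF X zX aL(1) s A] zY by simp
    show "a \<in> E" "walked X s a L A b a \<noteq> Zero" "walked X s a L A b a = Y a"
      using aE ab aL s by (auto simp: walked_def s_def)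
  qed fact
  then have Yv: "Y h = (if h \<in> insert b L then Zero else if h = a then s
     else if h \<in> A then flip (X h) else X h)" if "h \<in> E" for h using that by (simp add: walked_def)
  have Xz: "X h = Zero \<longleftrightarrow> h = a \<or> h \<in> L" if "h \<in> E" for h
    using zX that by (metis insert_iff mem_zero_set_iff)
  have ea: "e \<noteq> a" "e \<notin> L" using e' Xz[of e] by auto
  have "e \<noteq> b"
  proof
    assume "e = b"
    then have "Y e = Zero" using Yv[OF aE(2)] by simp
    then show False using e' by simp
  qed
  have "e \<in> A" using Yv[of e] e' ea \<open>e \<noteq> b\<close> by (simp split: if_splits)
  then obtain A' where A': "A' \<subseteq> A" "chain X s a L A' e"
    using chain_history[OF X zX aL(1) s A] by blast
  let ?W = "walked X s a L A' e"
  have "?W \<in> C" using chain_facts[OF X zX aL(1) s A'(2)] by blast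
  moreover have "zs ?W = insert e L" using zs_walked[OF X zX aL(1) s A'(2)] .
  moreover have "between E X Y ?W"
    unfolding between_def
  proof
    fix f assume f: "f \<in> E"
    have "f = b \<Longrightarrow> f \<notin> A'" using fA A'(1) by blast
    moreover have "f \<in> A' \<Longrightarrow> f \<in> A" using A'(1) by blast
    ultimately show "?W f \<in> {X f, Y f, Zero}"
      using f aL(1) ab by (simp add: walked_def Yv[OF f])
  qed
  ultimately show ?thesis by blast
qed

sublocale modular_system
  by unfold_locales (rule coline_elim)

end

section \<open>Modular elimination implies elimination\<close>

lemma between_mono:
  "between D X Y U \<Longrightarrow> between D X Y V \<Longrightarrow> between D U V W \<Longrightarrow> between D X Y W"
  by (fastforce simp: between_def)

lemma between_subset: "between E X Y W \<Longrightarrow> D \<subseteq> E \<Longrightarrow> between D X Y W"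
  by (auto simp: between_def)

lemma between_refl: "between D X Y X" "between D X Y Y"
  by (auto simp: between_def)

context modular_system
begin

text \<open>Only the elements of \<open>D\<close> are respected by \<open>link\<close>, and only cocircuits that vanish on \<open>K\<close>
  are used: this is the cocircuit graph of the minor obtained by deleting \<open>E - D\<close> and
  contracting \<open>K\<close>.\<close>

definition link :: "'a set \<Rightarrow> 'a set \<Rightarrow> ('a \<Rightarrow> sign) \<Rightarrow> ('a \<Rightarrow> sign) \<Rightarrow> bool" where
  "link D K U W \<longleftrightarrow> U \<in> C \<and> W \<in> C \<and> zs U \<subseteq> D \<and> zs W \<subseteq> D \<and> U \<noteq> opp W \<and>
     (\<exists>a b L. zs U = insert a L \<and> zs W = insert b L \<and> a \<notin> L \<and> b \<notin> L \<and> K \<subseteq> L) \<and>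
     (\<forall>f\<in>D. U f = Zero \<or> W f = Zero \<or> U f = W f)"

text \<open>The bounds \<open>X\<close>, \<open>Y\<close> are independent of the endpoints, so that
  pieces with narrower bounds can be concatenated.\<close>

definition path :: "'a set \<Rightarrow> 'a set \<Rightarrow> ('a \<Rightarrow> sign) \<Rightarrow> ('a \<Rightarrow> sign) \<Rightarrow> ('a \<Rightarrow> sign) \<Rightarrow> ('a \<Rightarrow> sign) \<Rightarrow> bool" where
  "path D K X Y = (\<lambda>U W. link D K U W \<and> between D X Y W)\<^sup>*\<^sup>*"

lemma path_trans: "path D K X Y U V \<Longrightarrow> path D K X Y V W \<Longrightarrow> path D K X Y U W"
  unfolding path_def by (rule rtranclp_trans)

lemma link_mono: "link D K U W \<Longrightarrow> K' \<subseteq> K \<Longrightarrow> link D K' U W"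
  unfolding link_def by (metis subset_trans)

lemma path_mono:
  assumes "path D K U V P Q" "between D X Y U" "between D X Y V" "K' \<subseteq> K"
  shows "path D K' X Y P Q"
  using assms(1) unfolding path_def
proof (rule rtranclp_mono[THEN predicate2D, rotated])
  show "(\<lambda>Ua W. link D K Ua W \<and> between D U V W) \<le> (\<lambda>U W. link D K' U W \<and> between D X Y W)"
    using link_mono[OF _ assms(4)] between_mono[OF assms(2,3)] by blast
qed

lemma path_step: "path D K X Y U V \<Longrightarrow> link D K V W \<Longrightarrow> between D X Y W \<Longrightarrow> path D K X Y U W"
  unfolding path_def by (simp add: rtranclp.rtrancl_into_rtrancl)

text \<open>Elimination splits the separator into disjoint parts that both omit \<open>e\<close>.
  This is the measure for inductions along a coline, and it makes the lengths of walks
  additive.\<close>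

lemma elim_sep_subset:
  assumes "between E U W V" "V e = Zero" "e \<in> sep U W"
  shows "sep U V \<subset> sep U W" "sep V W \<subset> sep U W" "sep U V \<inter> sep V W = {}"
proof -
  have e: "e \<in> sep U W" "e \<notin> sep U V" "e \<notin> sep V W"
    using assms(2,3) by (metis flip_eq_Zero_iff mem_separator_iff)+
  have *: "f \<in> E \<Longrightarrow> V f = U f \<or> V f = W f \<or> V f = Zero" for f
    using assms(1) by (auto simp: between_def)
  have "sep U V \<subseteq> sep U W"
  proof
    fix f assume "f \<in> sep U V"
    then have "f \<in> E" "U f \<noteq> Zero" "V f = flip (U f)" by (auto simp: mem_separator_iff)
    then show "f \<in> sep U W" using *[of f] by (metis flip_eq_Zero_iff flip_eq_self_iff(1) mem_separator_iff)
  qed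
  then show "sep U V \<subset> sep U W" using e by blast
  have "sep V W \<subseteq> sep U W"
  proof
    fix f assume "f \<in> sep V W"
    then have "f \<in> E" "V f \<noteq> Zero" "W f = flip (V f)" by (auto simp: mem_separator_iff)
    then show "f \<in> sep U W" using *[of f] by (metis flip_eq_self_iff(1) mem_separator_iff)
  qed
  then show "sep V W \<subset> sep U W" using e by blast
  show "sep U V \<inter> sep V W = {}"
    using * by (auto simp: mem_separator_iff) (metis flip_eq_self_iff(1) flip_flip)
qed

lemma sep_nonempty_neq_opp: "V e = Zero \<Longrightarrow> e \<in> sep U W \<Longrightarrow> U \<noteq> opp V \<and> V \<noteq> opp W"
  by (auto simp: mem_separator_iff)

text \<open>If nothing in \<open>D\<close> separates the ends, they form a link; otherwise
  eliminating such an element yields an intermediate cocircuit with smaller separators to both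
  ends.\<close>

lemma coline_path:
  assumes "U \<in> C" "W \<in> C" "zs U \<subseteq> D" "zs W \<subseteq> D" "D \<subseteq> E" "U \<noteq> opp W"
    "zs U = insert a L" "zs W = insert b L" "a \<notin> L" "b \<notin> L" "K \<subseteq> L"
  shows "path D K U W U W"
  using assms
proof (induction "card (sep U W)" arbitrary: U W a b rule: less_induct)
  case less
  note l = less.prems
  show ?case
  proof (cases "sep U W \<inter> D = {}")
    case True
    have "U f = Zero \<or> W f = Zero \<or> U f = W f" if "f \<in> D" for f
    proof -
      have "f \<notin> sep U W" "f \<in> E" using True that l(5) by auto
      then show ?thesis using nonzero_signs mem_separator_iff by metis
    qed
    then have "link D K U W" unfolding link_def using l by blast
    then show ?thesis unfolding path_def using between_refl by blast
  next
    case False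
    then obtain e where e: "e \<in> sep U W" "e \<in> D" by blast
    then obtain V where V: "V \<in> C" "zs V = insert e L" "between E U W V"
      using modular_elim[OF l(1,2,7-10,6)] by blast
    have Ve: "V e = Zero" using V(2) by (metis insertI1 mem_zero_set_iff)
    note s = elim_sep_subset[OF V(3) Ve e(1)]
    have ne: "U \<noteq> opp V" "V \<noteq> opp W" using sep_nonempty_neq_opp[of V, OF Ve e(1)] by auto
    have eL: "e \<notin> L" using e(1) l(7) by (metis insertI2 mem_separator_iff mem_zero_set_iff)
    have zV: "zs V \<subseteq> D" using V(2) l(3,7) e(2) by auto
    have "path D K U V U V"
      using less.hyps[OF psubset_card_mono[OF finite_sep s(1)] l(1) V(1) l(3) zV l(5) ne(1) l(7) V(2) l(9) eL l(11)] .
    moreover have "path D K V W V W"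
      using less.hyps[OF psubset_card_mono[OF finite_sep s(2)] V(1) l(2) zV l(4) l(5) ne(2) V(2) l(8) eL l(10,11)] .
    ultimately show ?thesis
      using path_mono between_refl between_subset[OF V(3) l(5)] path_trans by (metis order_refl)
  qed
qed

text \<open>A link of the deletion whose ends differ at \<open>f\<close> is subdivided by
  eliminating \<open>f\<close>. The new cocircuit vanishes at \<open>f\<close>, so it lies between
  \<open>X\<close> and \<open>Y\<close> on all of \<open>D\<close>, and both halves are links
  there.\<close>

lemma agreeing_step:
  assumes XY: "X f = Y f" "X f \<noteq> Zero" and f: "f \<in> D" and D: "D \<subseteq> E"
    and l: "link (D - {f}) K U W" and bU: "between (D - {f}) X Y U" and bW: "between (D - {f}) X Y W"
    and ne: "U f \<noteq> W f"
  obtains V where "V \<in> C" "V f = Zero" "zs V \<subseteq> D" "insert f K \<subseteq> zs V" "between D X Y V"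
    "link D K U V" "link D K V W"
proof -
  obtain a b L where L: "zs U = insert a L" "zs W = insert b L" "a \<notin> L" "b \<notin> L" "K \<subseteq> L"
    using l unfolding link_def by (elim conjE exE) (rule that)
  have l': "U \<in> C" "W \<in> C" "zs U \<subseteq> D - {f}" "zs W \<subseteq> D - {f}" "U \<noteq> opp W"
    "\<And>g. g \<in> D - {f} \<Longrightarrow> U g = Zero \<or> W g = Zero \<or> U g = W g" using l by (auto simp: link_def)
  have "f \<notin> zs U" "f \<notin> zs W" "f \<in> E" using l'(3,4) f D by blast+
  then have nz: "U f \<noteq> Zero" "W f \<noteq> Zero" by auto
  then have fs: "f \<in> sep U W" using ne f D nonzero_signs by (metis mem_separator_iff subsetD)
  then obtain V where V: "V \<in> C" "zs V = insert f L" "between E U W V"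
    using modular_elim[OF l'(1,2) L(1-4) l'(5)] by blast
  have Vf: "V f = Zero" using V(2) by (metis insertI1 mem_zero_set_iff)
  have fL: "f \<notin> L" using l'(3) L(1) by auto
  have zV: "zs V \<subseteq> D" using V(2) l'(3) L(1) f by auto
  have bV: "between (D - {f}) U W V" using V(3) D by (auto simp: between_def)
  have "between (D - {f}) X Y V" using between_mono[OF bU bW bV] .
  then have "between D X Y V" using Vf by (auto simp: between_def)
  moreover have agree: "(U g = Zero \<or> V g = Zero \<or> U g = V g) \<and> (V g = Zero \<or> W g = Zero \<or> V g = W g)"
    if "g \<in> D" for g
  proof (cases "g = f")
    case False
    then have "g \<in> D - {f}" using that by simp
    then show ?thesis using l'(6)[of g] bV unfolding between_def by (metis empty_iff insert_iff)
  qed (use Vf in simp)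
  moreover have "link D K U V"
    unfolding link_def
  proof (intro conjI)
    show "\<exists>a b L. zs U = insert a L \<and> zs V = insert b L \<and> a \<notin> L \<and> b \<notin> L \<and> K \<subseteq> L"
      using L V fL by blast
    show "\<forall>g\<in>D. U g = Zero \<or> V g = Zero \<or> U g = V g"
      using agree by blast
  qed (use l' V zV sep_nonempty_neq_opp[of V, OF Vf fs] in auto)
  moreover have "link D K V W"
    unfolding link_def
  proof (intro conjI)
    show "\<exists>a b L. zs V = insert a L \<and> zs W = insert b L \<and> a \<notin> L \<and> b \<notin> L \<and> K \<subseteq> L"
      using L V fL by blast
    show "\<forall>g\<in>D. V g = Zero \<or> W g = Zero \<or> V g = W g"
      using agree by blast
  qed (use l' V zV sep_nonempty_neq_opp[of V, OF Vf fs] in auto)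
  ultimately show thesis using that V(1) Vf zV V(2) L(5) by blast
qed

text \<open>Where \<open>V\<close> is nonzero, both signs occur among \<open>X\<close> and
  \<open>Y\<close>, so within \<open>D\<close> the support of \<open>V\<close> lies in that of
  \<open>X\<close> and avoids \<open>f\<close>. By uniformity these supports have the same
  size.\<close>

lemma not_opposite_if_agreeing:
  assumes C: "X \<in> C" "V \<in> C" and D: "D \<subseteq> E" "zs X \<subseteq> D" "zs V \<subseteq> D" and f: "f \<in> D" "X f = Y f" "X f \<noteq> Zero"
    and b: "between D X Y V" "between D X Y (opp V)"
  shows False
proof -
  have fin: "finite D" using D(1) finite_E finite_subset by blast
  have "D - zs V \<subseteq> (D - zs X) - {f}"
  proof
    fix g assume g: "g \<in> D - zs V"
    then have "g \<in> E" "V g \<noteq> Zero" using D by auto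
    then have "V g \<in> {X g, Y g}" "flip (V g) \<in> {X g, Y g}"
      using b g by (auto simp: between_def)
    then have "X g \<noteq> Zero \<and> X g \<noteq> Y g" using \<open>V g \<noteq> Zero\<close>
      by (metis empty_iff flip_eq_Zero_iff flip_eq_self_iff(1) insert_iff)
    then show "g \<in> (D - zs X) - {f}" using g f by auto
  qed
  then have "card (D - zs V) \<le> card ((D - zs X) - {f})" using fin by (intro card_mono) auto
  moreover have "f \<in> D - zs X" using f by auto
  moreover have "card (D - zs V) = card D - m" "card (D - zs X) = card D - m"
    using card_Diff_subset C D card_zero finite_zs by metis+
  ultimately show False using fin by (metis card_Diff1_less finite_Diff not_less)
qed

text \<open>Induction over minors. If \<open>X\<close> and \<open>Y\<close> share a nonzero sign at
  some \<open>f\<close> in \<open>D\<close>, a path in the deletion of \<open>f\<close> is repaired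
  where it has the wrong sign at \<open>f\<close>: the points of exit and re-entry vanish at
  \<open>f\<close> and are joined in the contraction of \<open>f\<close>. If they share none,
  \<open>X\<close> is joined along a coline to a cocircuit \<open>P\<close> that has a further zero
  \<open>b\<close> in common with \<open>Y\<close>, and the contraction of \<open>b\<close> does the
  rest.\<close>

theorem path_exists:
  assumes "X \<in> C" "Y \<in> C" "K \<subseteq> zs X" "K \<subseteq> zs Y" "zs X \<subseteq> D" "zs Y \<subseteq> D" "D \<subseteq> E" "X \<noteq> opp Y"
  shows "path D K X Y X Y"
  using assms
proof (induction "(m - card K) + card D" arbitrary: D K X Y rule: less_induct)
  case less
  note l = less.prems
  have fin: "finite D" using l(7) finite_E finite_subset by blast
  have measure_K: "(m - card (insert f K)) + card D < (m - card K) + card D"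
    if "f \<notin> K" "insert f K \<subseteq> zs V" "V \<in> C" for f V
  proof -
    have "card (insert f K) \<le> m" using that card_zero by (metis card_mono finite_zs)
    moreover have "finite K" using that finite_zs finite_subset by (metis finite_insert)
    ultimately show ?thesis using that(1) by simp
  qed
  consider "X = Y" | f where "X \<noteq> Y" "f \<in> D" "X f = Y f" "X f \<noteq> Zero"
    | "X \<noteq> Y" "\<forall>f\<in>D. X f = Zero \<or> Y f = Zero \<or> X f \<noteq> Y f" by metis
  then show ?case
  proof cases
    case 1
    then show ?thesis by (simp add: path_def)
  next
    case (2 f)
    let ?D = "D - {f}"
    have "(m - card K) + card ?D < (m - card K) + card D"
      using card_Diff1_less[OF fin 2(2)] by simp
    moreover have "zs X \<subseteq> ?D" "zs Y \<subseteq> ?D" "?D \<subseteq> E" using l 2 by auto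
    ultimately have "path ?D K X Y X Y" by (intro less.hyps l)
    then have "(path D K X Y X Y \<and> Y f = X f) \<or> Y f \<noteq> X f" 
      unfolding path_def
    proof -
      \<comment> \<open>On the wrong side of \<open>f\<close> the invariant remembers a cocircuit
        \<open>V\<close> that vanishes at \<open>f\<close> and has been reached within bounds; from
        there the path will be resumed.\<close>
      define good where "good W \<longleftrightarrow> between ?D X Y W \<and>
        (if W f = X f then path D K X Y X W
         else (\<exists>V\<in>C. zs V \<subseteq> D \<and> insert f K \<subseteq> zs V \<and> between D X Y V \<and> path D K X Y X V))" for W
      assume "(\<lambda>U W. link ?D K U W \<and> between ?D X Y W)\<^sup>*\<^sup>* X Y"
      then have "good Y"
      proof induction
        case base
        then show ?case by (simp add: good_def between_refl path_def)
      next
        case (step U W)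
        have lk: "link ?D K U W" and bU: "between ?D X Y U" and bW: "between ?D X Y W"
          using step by (auto simp: good_def)
        show ?case
        proof (cases "U f = W f")
          case True
          show ?thesis
          proof (cases "W f = X f")
            case eq: True
            have "link D K U W"
              using lk True unfolding link_def by blast
            moreover have "between D X Y W" using bW eq by (auto simp: between_def)
            ultimately have "path D K X Y X W" using step.IH True eq path_step by (auto simp: good_def)
            then show ?thesis using bW eq by (simp add: good_def)
          next
            case False
            then show ?thesis using step.IH True bW by (simp add: good_def)
          qed
        next
          case False
          obtain V where V: "V \<in> C" "V f = Zero" "zs V \<subseteq> D" "insert f K \<subseteq> zs V" "between D X Y V"
            "link D K U V" "link D K V W"
            using agreeing_step[OF 2(3,4,2) l(7) lk bU bW False] .
          show ?thesis
          proof (cases "W f = X f")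
            case eq: True
            then obtain V1 where V1: "V1 \<in> C" "zs V1 \<subseteq> D" "insert f K \<subseteq> zs V1" "between D X Y V1" "path D K X Y X V1"
              using step.IH False by (auto simp: good_def)
            have "f \<notin> K" using l(3) 2(4) by auto
            \<comment> \<open>Both lie between \<open>X\<close> and \<open>Y\<close>, which agree at
              \<open>f\<close>; equal support sizes then exclude antipodes, and the induction
              hypothesis applies to the contraction.\<close>
            moreover have "V1 \<noteq> opp V"
              using not_opposite_if_agreeing[OF l(1) V(1) l(7,5) V(3) 2(2,3,4) V(5)] V1(4) by blast
            ultimately have "path D (insert f K) V1 V V1 V"
              using less.hyps[OF measure_K[OF _ V(4,1)] V1(1) V(1) V1(3) V(4) V1(2) V(3) l(7)] by blast
            then have "path D K X Y V1 V" using path_mono V1(4) V(5) by blast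
            then have "path D K X Y X V" using path_trans V1(5) by blast
            moreover have "between D X Y W" using bW eq by (auto simp: between_def)
            ultimately have "path D K X Y X W" using V(7) path_step by blast
            then show ?thesis using bW eq by (simp add: good_def)
          next
            case neq: False
            have "U f = X f"
            proof -
              have "U \<in> C" "W \<in> C" "zs U \<subseteq> ?D" "zs W \<subseteq> ?D" using lk by (auto simp: link_def)
              then have "f \<notin> zs U" "f \<notin> zs W" "f \<in> E" using 2(2) l(7) by blast+
              then have "U f \<noteq> Zero" "W f \<noteq> Zero" by auto
              then show ?thesis using False neq 2(4) nonzero_signs by metis
            qed
            then have "path D K X Y X V" using step.IH V(5,6) path_step by (auto simp: good_def)
            then show ?thesis using V bW neq by (auto simp: good_def)
          qed
        qed
      qed
      then show "(rtranclp (\<lambda>U W. link D K U W \<and> between D X Y W) X Y \<and> Y f = X f) \<or> Y f \<noteq> X f"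
        by (auto simp: good_def path_def)
    qed
    then show ?thesis using 2 by simp
  next
    case 3
    have "zs X \<noteq> zs Y" using eq_zero_set[OF l(2,1)] 3(1) l(8) by metis
    then obtain a where a: "a \<in> zs X" "a \<notin> zs Y"
      using card_zero[OF l(1)] card_zero[OF l(2)] by (metis card_subset_eq finite_zs subsetI)
    obtain b0 where b0: "b0 \<in> zs Y" "b0 \<notin> zs X"
      using \<open>zs X \<noteq> zs Y\<close> card_zero[OF l(1)] card_zero[OF l(2)] by (metis card_subset_eq finite_zs subsetI)
    define L where "L = zs X - {a}"
    have L: "zs X = insert a L" "a \<notin> L" "K \<subseteq> L" "L \<subseteq> E"
      using a l(3,4) by (auto simp: L_def)
    have finL: "finite L" unfolding L_def by simp
    have cardL: "card (insert b L) = m" if "b \<notin> zs X" for b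
      using that card_zero[OF l(1)] L finL by simp
    have Ya: "Y a \<noteq> Zero" "a \<in> E" using a by auto
    \<comment> \<open>Cocircuits on the coline of \<open>X\<close> along which \<open>a\<close> is
      dropped, on the side of \<open>Y\<close>, at a zero of \<open>Y\<close> that \<open>X\<close>
      lacks. Such a zero is common to \<open>P\<close> and \<open>Y\<close> and can be
      contracted.\<close>
    define good where "good P \<longleftrightarrow> P \<in> C \<and> P a = Y a \<and> (\<exists>b\<in>zs Y - zs X. zs P = insert b L)" for P
    have "\<exists>P. good P"
    proof -
      have "a \<in> E - insert b0 L" using L b0 Ya a by auto
      moreover have "insert b0 L \<subseteq> E" using b0 L by auto
      ultimately obtain P where "P \<in> C" "zs P = insert b0 L" "P a = Y a"
        using ex_sign[of "insert b0 L" a "Y a"] cardL b0(2) Ya by metis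
      then have "good P" using b0 unfolding good_def by blast
      then show ?thesis by blast
    qed
    then obtain P where P: "good P" and min: "\<And>P'. good P' \<Longrightarrow> card (sep X P \<inter> zs Y) \<le> card (sep X P' \<inter> zs Y)"
      using ex_has_least_nat[of good _ "\<lambda>P. card (sep X P \<inter> zs Y)"] by blast
    obtain b where PC: "P \<in> C" "P a = Y a" and b: "b \<in> zs Y" "b \<notin> zs X" "zs P = insert b L"
      using P by (auto simp: good_def)
    have bL: "b \<notin> L" using b L by auto
    have XP: "X \<noteq> opp P" using a Ya PC by auto
    \<comment> \<open>Minimality concerns zeros of \<open>Y\<close> only: where \<open>X\<close> and
      \<open>Y\<close> are both nonzero they are opposite on \<open>D\<close>, so any sign is
      between them. A zero of \<open>Y\<close> that separates \<open>X\<close> from \<open>P\<close>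
      could be eliminated to give a better \<open>P\<close>.\<close>
    have first: "sep X P \<inter> zs Y = {}"
    proof (rule ccontr)
      assume "sep X P \<inter> zs Y \<noteq> {}"
      then obtain e where e: "e \<in> sep X P" "e \<in> zs Y" by blast
      obtain W where W: "W \<in> C" "zs W = insert e L" "between E X P W"
        using modular_elim[OF l(1) PC(1) L(1) b(3) L(2) bL XP e(1)] by blast
      have We: "W e = Zero" using W(2) by (metis insertI1 mem_zero_set_iff)
      have eX: "e \<notin> zs X" using e(1) by (simp add: mem_separator_iff)
      have "a \<notin> zs W" using W(2) L eX a by auto
      then have "W a = Y a" using W(3) a Ya PC(2) by (auto simp: between_def)
      then have "good W" using W e eX by (auto simp: good_def)
      moreover have "e \<notin> sep X W" using We eX e(2) by (auto simp: mem_separator_iff)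
      then have "sep X W \<inter> zs Y \<subset> sep X P \<inter> zs Y"
        using elim_sep_subset(1)[OF W(3) We e(1)] e by blast
      then have "card (sep X W \<inter> zs Y) < card (sep X P \<inter> zs Y)" by (intro psubset_card_mono) auto
      ultimately show False using min by (metis not_less)
    qed
    have bP: "between D X Y P"
      unfolding between_def
    proof
      fix g assume g: "g \<in> D"
      then have gE: "g \<in> E" using l(7) by auto
      show "P g \<in> {X g, Y g, Zero}"
      proof (cases "g = a \<or> P g = Zero")
        case True
        then show ?thesis using PC by auto
      next
        case False
        then have "g \<notin> zs P" "g \<noteq> a" by auto
        then have Xg: "X g \<noteq> Zero" using L b(3) gE by (metis insert_iff mem_zero_set_iff)
        show ?thesis
        proof (cases "Y g = Zero")
          case True
          then have "g \<notin> sep X P" using first gE by auto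
          then show ?thesis using Xg False gE nonzero_signs by (metis insert_iff mem_separator_iff)
        next
          case nz: False
          then have "X g \<noteq> Y g" using 3(2) g Xg by auto
          then show ?thesis using Xg nz by (cases "X g"; cases "Y g"; cases "P g") auto
        qed
      qed
    qed
    have zP: "zs P \<subseteq> D" using b l(5,6) L by auto
    have "path D K X P X P" using coline_path[OF l(1) PC(1) l(5) zP l(7) XP L(1) b(3) L(2) bL L(3)] .
    then have "path D K X Y X P" using path_mono bP between_refl by blast
    moreover have "path D (insert b K) P Y P Y"
    proof (rule less.hyps)
      show "(m - card (insert b K)) + card D < (m - card K) + card D"
      proof (rule measure_K)
        show "b \<notin> K" using b(2) l(3) by blast
        show "insert b K \<subseteq> zs Y" using b(1) l(4) by blast
      qed (rule l(2))
      show "P \<noteq> opp Y" using PC Ya by auto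
      show "insert b K \<subseteq> zs P" using b L by auto
      show "insert b K \<subseteq> zs Y" using b l by auto
    qed (use PC l zP in auto)
    then have "path D K X Y P Y" using path_mono[OF _ bP between_refl(2)] by blast
    ultimately show ?thesis using path_trans by blast
  qed
qed

text \<open>Consecutive vertices of a path are never opposite at \<open>e\<close>, so a path from
  \<open>X\<close> to \<open>Y\<close> passes a cocircuit that vanishes there; being on the path, it
  lies between \<open>X\<close> and \<open>Y\<close>.\<close>

theorem cocircuit_elim:
  assumes X: "X \<in> C" and Y: "Y \<in> C" and ne: "X \<noteq> opp Y" and e: "e \<in> sep X Y"
  shows "\<exists>W\<in>C. W e = Zero \<and> between E X Y W"
proof (rule ccontr)
  assume no: "\<not> ?thesis"
  have eE: "e \<in> E" "Y e \<noteq> X e" using e by (auto simp: mem_separator_iff)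
  have "path E {} X Y X Y" using path_exists X Y ne by (metis empty_subsetI order_refl zs_subset)
  then have "X e \<noteq> Zero \<longrightarrow> Y e = X e"
    unfolding path_def
  proof induction
    case (step U W)
    have "W \<in> C" "between E X Y W" "U e = Zero \<or> W e = Zero \<or> U e = W e"
      using step eE by (auto simp: link_def)
    then show ?case using step no by metis
  qed simp
  then show False using e eE by (simp add: mem_separator_iff)
qed

end

section \<open>Neighbours and distances in the cocircuit graph\<close>

context cocircuit_system
begin

text \<open>An edge with the exchanged elements made explicit. That the other coordinates are kept
  replaces the empty separator.\<close>

definition step :: "('e \<Rightarrow> sign) \<Rightarrow> 'e \<Rightarrow> 'e \<Rightarrow> ('e \<Rightarrow> sign) \<Rightarrow> bool" where
  "step X a b Y \<longleftrightarrow> X \<in> C \<and> Y \<in> C \<and> a \<in> zs X \<and> b \<in> E - zs X \<and>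
     zs Y = insert b (zs X - {a}) \<and> (\<forall>f\<in>E. f \<notin> insert b (zs X) \<longrightarrow> Y f = X f)"

lemma stepD:
  assumes "step X a b Y"
  shows "X \<in> C" "Y \<in> C" "a \<in> E" "b \<in> E" "X a = Zero" "X b \<noteq> Zero" "Y b = Zero" "Y a \<noteq> Zero" "a \<noteq> b"
    "zs Y = insert b (zs X - {a})"
    "\<And>f. f \<in> E \<Longrightarrow> X f \<noteq> Zero \<Longrightarrow> f \<noteq> b \<Longrightarrow> Y f = X f"
    "\<And>f. f \<in> E \<Longrightarrow> Y f \<noteq> Zero \<Longrightarrow> X f \<noteq> Zero \<Longrightarrow> Y f = X f"
    "\<And>f. f \<in> E \<Longrightarrow> Y f = Zero \<longleftrightarrow> f = b \<or> (X f = Zero \<and> f \<noteq> a)"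
proof -
  show zY: "zs Y = insert b (zs X - {a})" using assms by (simp add: step_def)
  show ab: "X \<in> C" "Y \<in> C" "a \<in> E" "b \<in> E" "X a = Zero" "X b \<noteq> Zero" "a \<noteq> b"
    using assms by (auto simp: step_def)
  show *: "Y f = Zero \<longleftrightarrow> f = b \<or> (X f = Zero \<and> f \<noteq> a)" if "f \<in> E" for f
    using that zY by (metis Diff_iff insert_iff mem_zero_set_iff singletonD singletonI)
  show "Y b = Zero" "Y a \<noteq> Zero" using * ab by auto
  show "Y f = X f" if "f \<in> E" "X f \<noteq> Zero" "f \<noteq> b" for f
    using that assms by (simp add: step_def)
  then show "Y f = X f" if "f \<in> E" "Y f \<noteq> Zero" "X f \<noteq> Zero" for f
    using that \<open>Y b = Zero\<close> by metis
qed

lemma adjacent_iff_step: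
  assumes "X \<in> C" "Y \<in> C"
  shows "adjacent E X Y \<longleftrightarrow> (\<exists>a b. step X a b Y)"
proof
  assume "adjacent E X Y"
  then obtain a b where ab: "a \<in> zs X" "b \<in> E" "X b \<noteq> Zero" "zs Y = insert b (zs X - {a})" "sep X Y = {}"
    using adjacent_iff[OF assms] by blast
  have "Y f = X f" if "f \<in> E" "f \<notin> insert b (zs X)" for f
  proof -
    have "f \<notin> zs Y" using ab(4) that by simp
    then show ?thesis using that ab(5) by (auto simp: separator_eq_empty_iff)
  qed
  then show "\<exists>a b. step X a b Y" using ab assms by (auto simp: step_def)
next
  assume "\<exists>a b. step X a b Y"
  then obtain a b where ab: "step X a b Y" by blast
  note d = stepD[OF ab]
  have "sep X Y = {}" unfolding separator_eq_empty_iff using d(12) by metis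
  moreover have "a \<in> zs X" "b \<in> E" using d by auto
  ultimately show "adjacent E X Y" using adjacent_iff[OF assms] d(6,10) by blast
qed

lemma step_sym: "step X a b Y \<Longrightarrow> step Y b a X"
proof -
  assume s: "step X a b Y"
  note d = stepD[OF s]
  have "zs X = insert a (zs Y - {b})"
    using d(3,5,6,10) by auto
  then show ?thesis unfolding step_def using d(1-4,7,8,11,13) by auto
qed

lemma card_nonzero: "X \<in> C \<Longrightarrow> card (E - zs X) = card E - m"
  using card_Diff_subset[OF finite_zs zs_subset] card_zero by simp

fun ball :: "nat \<Rightarrow> ('e \<Rightarrow> sign) \<Rightarrow> ('e \<Rightarrow> sign) \<Rightarrow> bool" where
  "ball 0 X Y \<longleftrightarrow> X = Y"
| "ball (Suc j) X Y \<longleftrightarrow> ball j X Y \<or> (\<exists>Z\<in>C. ball j X Z \<and> adjacent E Z Y)"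

lemma ball_mono: "ball i X Y \<Longrightarrow> i \<le> j \<Longrightarrow> ball j X Y"
  by (induction j) (auto simp: le_Suc_eq)

lemma ball_trans: "ball i X Y \<Longrightarrow> ball j Y Z \<Longrightarrow> ball (i + j) X Z"
  by (induction j arbitrary: Z) auto

text \<open>Every element of the separator, and every element at which \<open>Q\<close> but not \<open>P\<close> vanishes,
  enters the zero set along a walk from \<open>P\<close> to \<open>Q\<close>, and each step adds one element to it.\<close>

lemma ball_lower_bound:
  assumes "ball j P Q" "P \<in> C" "Q \<in> C"
  shows "card (sep P Q \<union> (zs Q - zs P)) \<le> j"
  using assms
proof (induction j arbitrary: Q)
  case 0
  then have "sep P Q \<union> (zs Q - zs P) = {}" by (auto simp: mem_separator_iff)
  then show ?case by simp
next
  case (Suc j)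
  show ?case
  proof (cases "ball j P Q")
    case True
    then show ?thesis using Suc.IH Suc.prems by fastforce
  next
    case False
    then obtain Z where Z: "Z \<in> C" "ball j P Z" "adjacent E Z Q" using Suc.prems by auto
    then obtain a b where ab: "step Z a b Q" using adjacent_iff_step Suc.prems(3) by blast
    note d = stepD[OF ab]
    have "sep P Q \<union> (zs Q - zs P) \<subseteq> insert b (sep P Z \<union> (zs Z - zs P))"
    proof
      fix g assume "g \<in> sep P Q \<union> (zs Q - zs P)"
      then have g: "g \<in> E" "P g \<noteq> Zero" "Q g = flip (P g) \<or> Q g = Zero" by (auto simp: mem_separator_iff)
      show "g \<in> insert b (sep P Z \<union> (zs Z - zs P))"
      proof (cases "g = b \<or> Z g = Zero")
        case False
        then have "Q g = Z g" using d(11) g(1) by blast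
        then show ?thesis using False g by (auto simp: mem_separator_iff)
      qed (use g in auto)
    qed
    then have "card (sep P Q \<union> (zs Q - zs P)) \<le> card (insert b (sep P Z \<union> (zs Z - zs P)))"
      by (intro card_mono) auto
    also have "\<dots> \<le> Suc (card (sep P Z \<union> (zs Z - zs P)))" by (simp add: card_insert_if)
    finally show ?thesis using Suc.IH[OF Z(2) Suc.prems(2) Z(1)] by simp
  qed
qed

text \<open>The support of \<open>P\<close> splits into the elements that a walk to
  \<open>opp Q\<close> has to bring into the zero set and those at which \<open>P\<close> and
  \<open>Q\<close> are already opposite. So the lower bound for this walk is
  \<open>card E - m\<close> minus the size of the separator.\<close>

lemma card_agreement:
  assumes "P \<in> C" "Q \<in> C"
  shows "card (sep P (opp Q) \<union> (zs Q - zs P)) + card (sep P Q) = card E - m"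
proof -
  have "sep P (opp Q) \<union> (zs Q - zs P) \<union> sep P Q = E - zs P"
    by (auto simp: mem_separator_iff) (metis nonzero_signs)
  moreover have "(sep P (opp Q) \<union> (zs Q - zs P)) \<inter> sep P Q = {}"
    by (auto simp: mem_separator_iff)
  ultimately show ?thesis
    using card_nonzero[OF assms(1)] by (metis card_Un_disjoint finite_Diff finite_UnI finite_sep finite_zs)
qed

lemma ball_opp_imp_sep:
  assumes "ball (card E - m - 1) P (opp Q)" "P \<in> C" "Q \<in> C"
  shows "sep P Q \<noteq> {}"
proof
  assume "sep P Q = {}"
  then show False
    using ball_lower_bound[OF assms(1,2) opposite_closed[OF assms(3)]] card_agreement[OF assms(2,3)] m_less
    by simp
qed

text \<open>The lower bound for the antipode itself is only \<open>card E - m\<close>. One more step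
  is gained from the vertex \<open>Z\<close> before \<open>opp P\<close> on the walk: it is not
  separated from \<open>opp P\<close>, so the lower bound for \<open>Z\<close> is already
  \<open>card E - m\<close>.\<close>

lemma not_ball_antipode:
  assumes "P \<in> C" shows "\<not> ball (card E - m) P (opp P)"
proof -
  have "card E - m < j" if "ball j P (opp P)" for j
    using that
  proof (induction j)
    case 0
    then show ?case using opp_neq[OF assms] by simp
  next
    case (Suc j)
    show ?case
    proof (cases "ball j P (opp P)")
      case False
      then obtain Z where Z: "Z \<in> C" "ball j P Z" "adjacent E Z (opp P)" using Suc.prems by auto
      then have "sep Z (opp P) = {}" by (auto simp: adjacent_def)
      then have "sep P (opp Z) = {}"
        by (auto simp: mem_separator_iff set_eq_iff)
      then have "card (sep P Z \<union> (zs Z - zs P)) = card E - m"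
        using card_agreement[OF assms opposite_closed[OF Z(1)]] Z(1) by simp
      then show ?thesis using ball_lower_bound[OF Z(2) assms Z(1)] by simp
    qed (use Suc in simp)
  qed
  then show ?thesis by blast
qed

end

section \<open>The order of cocircuits along a coline, and upper bounds for distances\<close>

context modular_system
begin

text \<open>\<open>P\<close> and \<open>Q\<close> lie on one coline through \<open>X\<close>, on the
  same side of \<open>c\<close>. Eliminating \<open>c\<close> between \<open>P\<close> and
  \<open>opp Q\<close> leads back to \<open>X\<close> or its antipode. Comparing signs at
  \<open>p\<close> and \<open>q\<close> shows that exactly one of the two is met first, namely the
  one that keeps the sign of \<open>X\<close> at the zero of the other.\<close>

lemma coline_order:
  assumes C: "X \<in> C" "P \<in> C" "Q \<in> C" and c: "c \<in> zs X"
    and zP: "zs P = insert p (zs X - {c})" and zQ: "zs Q = insert q (zs X - {c})"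
    and pq: "p \<noteq> q" "p \<notin> zs X" "q \<notin> zs X" and sg: "P c = Q c" "P c \<noteq> Zero"
  shows "P q = X q \<longleftrightarrow> Q p \<noteq> X p"
proof -
  let ?L = "zs X - {c}"
  have E: "c \<in> E" "p \<in> E" "q \<in> E" using c zero_set_insertD[OF zP] zero_set_insertD[OF zQ] by simp_all
  have pL: "p \<notin> ?L" "q \<notin> ?L" using pq by blast+
  have "P \<noteq> Q" using zP zQ pq by auto
  then have "P \<noteq> opp (opp Q)" using C by simp
  moreover have "c \<in> sep P (opp Q)" using sg E by (simp add: mem_separator_iff)
  ultimately obtain W where W: "W \<in> C" "zs W = insert c ?L" "between E P (opp Q) W"
    using modular_elim[OF C(2) opposite_closed[OF C(3)] zP _ pL, of c] zQ by auto
  have "zs W = zs X" using W(2) c by auto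
  then have WX: "W = X \<or> W = opp X" using eq_zero_set C(1) W(1) by metis
  have nz: "W p \<noteq> Zero" "W q \<noteq> Zero" using \<open>zs W = zs X\<close> pq E by auto
  have "P p = Zero" "Q q = Zero" using zP zQ by (metis insertI1 mem_zero_set_iff)+
  then have "W p = flip (Q p)" "W q = P q" using W(3) nz E by (auto simp: between_def)
  moreover have "Q p \<noteq> Zero" "P q \<noteq> Zero" using nz calculation by auto
  moreover have "X p \<noteq> Zero" "X q \<noteq> Zero" using pq E by auto
  ultimately show ?thesis using WX E by (cases "X p"; cases "X q"; cases "Q p") auto
qed

text \<open>Two different first cocircuits on the same side would each keep the sign of
  \<open>X\<close> at the zero of the other, against \<open>coline_order\<close>.\<close>

lemma step_unique:
  assumes "step X a b Y" "step X a b' Y'" "Y a = Y' a"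
  shows "Y = Y'" "b = b'"
proof -
  note d = stepD[OF assms(1)] and d' = stepD[OF assms(2)]
  show bb: "b = b'"
  proof (rule ccontr)
    assume ne: "b \<noteq> b'"
    have "Y b' = X b' \<longleftrightarrow> Y' b \<noteq> X b"
      using coline_order[OF d(1,2) d'(2) _ d(10) d'(10) ne _ _ assms(3) d(8)] d(3-6) d'(4,6) by auto
    moreover have "Y b' = X b'" "Y' b = X b" using d d' ne by metis+
    ultimately show False by simp
  qed
  then have "zs Y' = zs Y" using d(10) d'(10) by simp
  then show "Y = Y'" using eq_if_sign[OF d'(2) d(2)] d d' assms(3) by metis
qed

text \<open>\<open>Y\<close> is the first cocircuit on its side, so every other one on this side has
  crossed its zero \<open>d\<close>.\<close>

lemma beyond_step:
  assumes st: "step X c d Y" and Q: "Q \<in> C" "zs Q = insert q (zs X - {c})" "q \<notin> zs X" "q \<noteq> d" "Q c = Y c"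
  shows "Q d = flip (X d)"
proof -
  note d = stepD[OF st]
  have q: "q \<in> E" using zero_set_insertD[OF Q(2)] by simp
  have qz: "X q \<noteq> Zero" using Q(3) q by auto
  have c: "c \<in> zs X" "d \<notin> zs X" using d by auto
  have "Y q = X q \<longleftrightarrow> Q d \<noteq> X d"
    using coline_order[OF d(1,2) Q(1) c(1) d(10) Q(2) Q(4)[symmetric] c(2) Q(3) Q(5)[symmetric] d(8)] .
  moreover have "Y q = X q" using d(11) q qz Q(4) by blast
  ultimately have "Q d \<noteq> X d" by blast
  moreover have "d \<notin> zs Q" using Q(2,4) c by auto
  then have "Q d \<noteq> Zero" using d(4) by auto
  ultimately show ?thesis using d(6) nonzero_signs by metis
qed

text \<open>Among the cocircuits of the coline with sign \<open>s\<close> at \<open>a\<close>, one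
  with the smallest separator from \<open>X\<close> is a neighbour; otherwise elimination would
  produce a better one.\<close>

lemma step_exists:
  assumes X: "X \<in> C" and a: "a \<in> zs X" and s: "s \<noteq> Zero"
  obtains b Y where "step X a b Y" "Y a = s"
proof -
  define L where "L = zs X - {a}"
  have L: "zs X = insert a L" "a \<notin> L" "L \<subseteq> E" using a by (auto simp: L_def)
  define good where "good P \<longleftrightarrow> P \<in> C \<and> P a = s \<and> (\<exists>b\<in>E - zs X. zs P = insert b L)" for P
  have "\<exists>P. good P"
  proof -
    have "card (E - zs X) > 0" using card_nonzero[OF X] m_less by simp
    then obtain b0 where b0: "b0 \<in> E" "b0 \<notin> zs X" by (metis DiffE card_gt_0_iff ex_in_conv)
    have "finite L" by (simp add: L_def)
    then have "card (insert b0 L) = m" using b0 card_zero[OF X] L by simp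
    moreover have "a \<in> E - insert b0 L" using L(2) a b0 by auto
    moreover have "insert b0 L \<subseteq> E" using L b0 by auto
    ultimately obtain P where "P \<in> C" "zs P = insert b0 L" "P a = s" using ex_sign s by metis
    then have "good P" using b0 unfolding good_def by blast
    then show ?thesis by blast
  qed
  then obtain P where P: "good P" and min: "\<And>P'. good P' \<Longrightarrow> card (sep X P) \<le> card (sep X P')"
    using ex_has_least_nat[of good _ "\<lambda>P. card (sep X P)"] by blast
  obtain b where PC: "P \<in> C" "P a = s" and b: "b \<in> E" "b \<notin> zs X" "zs P = insert b L"
    using P by (auto simp: good_def)
  have bL: "b \<notin> L" using b L by auto
  have XP: "X \<noteq> opp P" using a s PC by auto
  have "sep X P = {}"
  proof (rule ccontr)
    assume "sep X P \<noteq> {}"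
    then obtain e where e: "e \<in> sep X P" by blast
    obtain W where W: "W \<in> C" "zs W = insert e L" "between E X P W"
      using modular_elim[OF X PC(1) L(1) b(3) L(2) bL XP e] by blast
    have We: "W e = Zero" using W(2) by (metis insertI1 mem_zero_set_iff)
    have eX: "e \<in> E" "e \<notin> zs X" using e by (simp_all add: mem_separator_iff)
    have "a \<notin> zs W" using W(2) L eX a by auto
    then have "W a = s" using W(3) a PC(2) by (auto simp: between_def)
    then have "good W" using W eX unfolding good_def by blast
    moreover have "card (sep X W) < card (sep X P)"
      using elim_sep_subset(1)[OF W(3) We e] by (intro psubset_card_mono) auto
    ultimately show False using min by (metis not_less)
  qed
  then have "adjacent E X P" using adjacent_iff[OF X PC(1)] a b by (auto simp: L_def)
  then obtain a' b' where st: "step X a' b' P" using adjacent_iff_step X PC(1) by blast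
  have "a' = a" using stepD(13)[OF st, of a] a PC s by auto
  then show thesis using that st PC(2) by blast
qed

text \<open>A neighbour is determined by the zero that it drops and the sign that it takes there,
  and both signs occur.\<close>

lemma card_adjacent:
  assumes X: "X \<in> C" shows "card {Y \<in> C. adjacent E X Y} = 2 * m"
proof -
  define F where "F a s = (SOME Y. (\<exists>b. step X a b Y) \<and> Y a = s)" for a s
  have F: "\<exists>b. step X a b (F a s)" "F a s a = s" if "a \<in> zs X" "s \<in> {Plus, Minus}" for a s
  proof -
    have "s \<noteq> Zero" using that by auto
    then have "\<exists>Y. (\<exists>b. step X a b Y) \<and> Y a = s" using step_exists[OF X that(1)] by metis
    then have "(\<exists>b. step X a b (F a s)) \<and> F a s a = s" unfolding F_def by (rule someI_ex)
    then show "\<exists>b. step X a b (F a s)" "F a s a = s" by blast+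
  qed
  have "bij_betw (case_prod F) (zs X \<times> {Plus, Minus}) {Y \<in> C. adjacent E X Y}"
    (is "bij_betw _ ?A ?B")
  proof (rule bij_betw_imageI)
    show "inj_on (case_prod F) ?A"
    proof (rule inj_onI, clarify)
      fix a s a' s' assume as: "a \<in> zs X" "s \<in> {Plus, Minus}" "a' \<in> zs X" "s' \<in> {Plus, Minus}"
        and eq: "F a s = F a' s'"
      obtain b where 1: "step X a b (F a s)" using F(1)[OF as(1,2)] by blast
      obtain b' where 2: "step X a' b' (F a s)" using F(1)[OF as(3,4)] unfolding eq by blast
      have "a = a'" using stepD(3,5,8)[OF 1] stepD(13)[OF 2] by blast
      moreover have "s = s'" using F(2)[OF as(1,2)] F(2)[OF as(3,4)] \<open>a = a'\<close> unfolding eq by simp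
      ultimately show "a = a' \<and> s = s'" by simp
    qed
    show "case_prod F ` ?A = ?B"
    proof (intro set_eqI iffI)
      fix Y assume "Y \<in> case_prod F ` ?A"
      then obtain u where u: "u \<in> ?A" "Y = F (fst u) (snd u)" by (auto simp: case_prod_beta)
      then obtain b where "step X (fst u) b Y" using F(1) by (metis mem_Times_iff)
      then show "Y \<in> ?B" using adjacent_iff_step X stepD(2) by blast
    next
      fix Y assume "Y \<in> ?B"
      then obtain a b where st: "step X a b Y" using adjacent_iff_step X by blast
      have "Y a \<noteq> Zero" using stepD(8)[OF st] .
      then have "Y a \<in> {Plus, Minus}" by (cases "Y a") auto
      moreover have "a \<in> zs X" using stepD(3,5)[OF st] by simp
      ultimately have as: "(a, Y a) \<in> ?A" by blast
      then obtain b' where "step X a b' (F a (Y a))" "F a (Y a) a = Y a" using F by blast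
      then have "Y = F a (Y a)" using step_unique(1)[OF st] by metis
      then show "Y \<in> case_prod F ` ?A" using as by (metis case_prod_conv image_eqI)
    qed
  qed
  then have "card {Y \<in> C. adjacent E X Y} = card (zs X \<times> {Plus, Minus})"
    by (rule bij_betw_same_card[symmetric])
  then show ?thesis using card_zero[OF X] by (simp add: card_cartesian_product)
qed

text \<open>An eliminated element splits the walk; the two separators are disjoint and omit it, so
  the lengths add up to at most \<open>card (sep P Q) + 1\<close>.\<close>

lemma coline_ball:
  assumes "P \<in> C" "Q \<in> C" "zs P = insert a L" "zs Q = insert b L" "a \<notin> L" "b \<notin> L" "a \<noteq> b"
  shows "ball (card (sep P Q) + 1) P Q"
  using assms
proof (induction "card (sep P Q)" arbitrary: P Q a b rule: less_induct)
  case less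
  note l = less.prems
  have E: "a \<in> E" "b \<in> E" "a \<in> zs P" "b \<in> zs Q" "b \<notin> zs P" using l by auto
  have ne: "P \<noteq> opp Q" using l E by auto
  show ?case
  proof (cases "sep P Q = {}")
    case True
    have "zs Q = insert b (zs P - {a})" using l by auto
    then have "adjacent E P Q" using adjacent_iff[OF l(1,2)] True E by auto
    then have "ball (Suc 0) P Q" using l by auto
    then show ?thesis using True by simp
  next
    case False
    then obtain e where e: "e \<in> sep P Q" by blast
    obtain W where W: "W \<in> C" "zs W = insert e L" "between E P Q W"
      using modular_elim[OF l(1-6) ne e] by blast
    have We: "W e = Zero" using W(2) by (metis insertI1 mem_zero_set_iff)
    have nz: "e \<notin> zs P" "e \<notin> zs Q" using e by (auto simp: mem_separator_iff)
    then have ee: "e \<notin> L" "e \<noteq> a" "e \<noteq> b" using l by auto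
    note s = elim_sep_subset[OF W(3) We e]
    have "ball ((card (sep P W) + 1) + (card (sep W Q) + 1)) P Q"
    proof (rule ball_trans)
      show "ball (card (sep P W) + 1) P W"
        using less.hyps[OF psubset_card_mono[OF finite_sep s(1)] l(1) W(1) l(3) W(2) l(5) ee(1)] ee by metis
      show "ball (card (sep W Q) + 1) W Q"
        using less.hyps[OF psubset_card_mono[OF finite_sep s(2)] W(1) l(2) W(2) l(4) ee(1) l(6)] ee by metis
    qed
    moreover have "card (sep P W) + card (sep W Q) < card (sep P Q)"
    proof -
      have "e \<notin> sep P W \<union> sep W Q" using We by (auto simp: mem_separator_iff)
      then have "sep P W \<union> sep W Q \<subset> sep P Q" using s e by blast
      then have "card (sep P W \<union> sep W Q) < card (sep P Q)" by (intro psubset_card_mono) auto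
      then show ?thesis using s(3) by (simp add: card_Un_disjoint)
    qed
    ultimately show ?thesis using ball_mono by (metis (no_types, lifting) Suc_eq_plus1 add_Suc add_Suc_right Suc_leI add_le_mono1 less_eq_Suc_le)
  qed
qed

text \<open>The separator lies in the support of \<open>P\<close> but misses \<open>b\<close>, where
  \<open>Q\<close> vanishes, and \<open>c\<close>, so it has at most \<open>card E - m - 2\<close>
  elements.\<close>

lemma coline_ball_agreeing:
  assumes C: "P \<in> C" "Q \<in> C" and z: "zs P = insert a L" "zs Q = insert b L" "a \<notin> L" "b \<notin> L" "a \<noteq> b"
    and c: "c \<in> E" "P c = Q c" "P c \<noteq> Zero"
  shows "ball (card E - m - 1) P Q"
proof -
  have bE: "b \<in> E" "Q b = Zero" using zero_set_insertD[OF z(2)] by auto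
  moreover have "b \<notin> zs P" using z by simp
  ultimately have bc: "b \<in> E - zs P" "c \<in> E - zs P" "b \<noteq> c" using c by auto
  have "sep P Q \<subseteq> (E - zs P) - {b, c}"
  proof
    fix g assume g: "g \<in> sep P Q"
    then have "g \<notin> zs P" "g \<notin> zs Q" "g \<in> E" "g \<noteq> c" using c by (auto simp: mem_separator_iff)
    then show "g \<in> (E - zs P) - {b, c}" using z by auto
  qed
  then have "card (sep P Q) \<le> card ((E - zs P) - {b, c})" using finite_E by (intro card_mono) auto
  also have "\<dots> = card (E - zs P) - card {b, c}" using bc by (intro card_Diff_subset) auto
  also have "\<dots> = card E - m - 2" using bc card_nonzero[OF C(1)] by simp
  finally have 1: "card (sep P Q) \<le> card E - m - 2" .
  have "card {b, c} \<le> card (E - zs P)" using bc finite_E by (intro card_mono) auto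
  then have "2 \<le> card E - m" using bc card_nonzero[OF C(1)] by simp
  then show ?thesis using ball_mono[OF coline_ball[OF C z]] 1 by simp
qed

text \<open>A walk that turns at \<open>Q\<close>. An element of both separators would return to its
  sign at \<open>P\<close>, but on \<open>T\<close> the ends are opposite; so the separators are
  disjoint and together have at most \<open>card T\<close> elements.\<close>

lemma two_coline_ball:
  assumes "ball (card (sep P Q) + 1) P Q" "ball (card (sep Q V) + 1) Q V"
    and "sep P Q \<subseteq> T" "sep Q V \<subseteq> T" "finite T" "\<And>g. g \<in> T \<Longrightarrow> V g = flip (P g)"
    and "card T + 2 \<le> j"
  shows "ball j P V"
proof -
  have "sep P Q \<inter> sep Q V = {}"
  proof (rule equals0I)
    fix g assume "g \<in> sep P Q \<inter> sep Q V"
    then have "Q g = flip (P g)" "V g = flip (Q g)" "P g \<noteq> Zero" "g \<in> T"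
      using assms(3) by (auto simp: mem_separator_iff)
    then show False using assms(6)[of g] by simp
  qed
  then have "card (sep P Q) + card (sep Q V) = card (sep P Q \<union> sep Q V)"
    by (simp add: card_Un_disjoint)
  also have "\<dots> \<le> card T" using assms(3-5) by (intro card_mono) auto
  finally have "(card (sep P Q) + 1) + (card (sep Q V) + 1) \<le> j" using assms(7) by simp
  then show ?thesis using ball_trans[OF assms(1,2)] ball_mono by blast
qed

lemma same_coline_ball:
  assumes Y: "step X c d Y" and W: "step X c f W" and s: "W c = flip (Y c)"
  shows "ball (card E - m - 1) Y (opp W)"
proof -
  note y = stepD[OF Y] and w = stepD[OF W]
  have sc: "opp W c = Y c" using s y(3) by simp
  show ?thesis
  proof (cases "d = f")
    case True
    then have "Y = opp W"
      using eq_if_sign[OF y(2) opposite_closed[OF w(2)] _ y(3) y(8)] sc y(10) w(10) by simp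
    then show ?thesis using ball_mono[of 0] by simp
  next
    case False
    show ?thesis
    proof (rule coline_ball_agreeing[OF y(2) opposite_closed[OF w(2)] y(10) _ _ _ False y(3)])
      show "zs (opp W) = insert f (zs X - {c})" using w(10) by simp
      show "d \<notin> zs X - {c}" "f \<notin> zs X - {c}" using y w by auto
      show "Y c = opp W c" "Y c \<noteq> Zero" using sc y(8) by auto
    qed
  qed
qed

text \<open>Neighbours of \<open>X\<close> agree with \<open>X\<close> wherever neither vanishes, so
  two of them can be opposite only at a zero of \<open>X\<close> that both drop.\<close>

lemma same_coline_iff:
  assumes Y: "step X c d Y" and W: "step X c' f W"
  shows "ball (card E - m - 1) Y (opp W) \<longleftrightarrow> c' = c \<and> W c = flip (Y c)"
proof
  note y = stepD[OF Y] and w = stepD[OF W]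
  assume "ball (card E - m - 1) Y (opp W)"
  then obtain g where "g \<in> sep Y W" using ball_opp_imp_sep[OF _ y(2) w(2)] by blast
  then have g: "g \<in> E" "Y g \<noteq> Zero" "W g = flip (Y g)" by (auto simp: mem_separator_iff)
  then have "W g \<noteq> Zero" "Y g \<noteq> W g" by auto
  then have "X g = Zero" using y(12) w(12) g by metis
  moreover have "W g \<noteq> Zero" using g by simp
  ultimately have "g = c" "g = c'" using y(13)[OF g(1)] w(13)[OF g(1)] g(2) by blast+
  then show "c' = c \<and> W c = flip (Y c)" using g by simp
qed (use same_coline_ball Y W in blast)

text \<open>In the general case the walk turns at the cocircuit \<open>Q\<close> of the coline of
  \<open>X\<close> and \<open>Y\<close> that vanishes at \<open>d\<close>. As \<open>Q\<close> lies
  beyond \<open>Y\<close>, it has crossed \<open>b\<close>; this keeps \<open>b\<close> out of both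
  separators and leaves \<open>card E - m - 2\<close> elements for the two colines.\<close>

lemma neighbour_antipodes:
  assumes Y: "step X a b Y" and W: "step X c d W"
  shows "ball (card E - m) Y (opp W) \<longleftrightarrow> Y \<noteq> W"
proof
  note y = stepD[OF Y] and w = stepD[OF W]
  assume "ball (card E - m) Y (opp W)"
  then show "Y \<noteq> W" using not_ball_antipode[OF y(2)] by auto
next
  note y = stepD[OF Y] and w = stepD[OF W]
  let ?V = "opp W"
  have V: "?V \<in> C" "zs ?V = insert d (zs X - {c})" using opposite_closed w by auto
  assume ne: "Y \<noteq> W"
  show "ball (card E - m) Y ?V"
  proof (cases "a = c")
    case True
    then have "W c = flip (Y c)" using step_unique(1) Y W ne nonzero_signs[OF y(8)] w(8) by metis
    then have "ball (card E - m - 1) Y ?V" using same_coline_ball Y W True by blast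
    then show ?thesis using ball_mono by (metis diff_le_self)
  next
    case ac: False
    show ?thesis
    proof (cases "b = d")
      case True
      \<comment> \<open>With a common new zero \<open>b\<close> one coline suffices:
        \<open>Y\<close> and \<open>?V\<close> differ by exchanging \<open>c\<close> for
        \<open>a\<close>.\<close>
      let ?L = "insert b (zs X - {a, c})"
      have ac': "a \<in> zs X" "c \<in> zs X" "b \<notin> zs X" using y(3,5,6) w(3,5) by simp_all
      have z: "zs Y = insert c ?L" "zs ?V = insert a ?L" "c \<notin> ?L" "a \<notin> ?L"
        unfolding y(10) V(2) True[symmetric] using ac ac' by blast+
      have "sep Y ?V \<subseteq> (E - zs Y) - {a}"
        using zero_set_insertD[OF z(2)] by (auto simp: mem_separator_iff)
      then have "card (sep Y ?V) \<le> card ((E - zs Y) - {a})" using finite_E by (intro card_mono) auto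
      also have "\<dots> < card (E - zs Y)" using y(3,8) finite_E by (intro card_Diff1_less) auto
      finally show ?thesis
        using ball_mono[OF coline_ball[OF y(2) V(1) z(1,2,3,4)]] ac card_nonzero[OF y(2)] by simp
    next
      case bd: False
      have "finite (zs X)" by simp
      then have "card (insert d (zs X - {a})) = m"
        using y(3,5) w(6) card_zero[OF y(1)] by (simp add: card_insert_if card_Suc_Diff1 del: card_Diff_insert)
      moreover have "insert d (zs X - {a}) \<subseteq> E" "a \<in> E - insert d (zs X - {a})"
        using w y by auto
      ultimately obtain Q where Q: "Q \<in> C" "zs Q = insert d (zs X - {a})" "Q a = Y a"
        using ex_sign[of _ a "Y a"] y(8) by metis
      have Qb: "Q b = flip (X b)" using beyond_step[OF Y Q(1,2)] w(6) bd Q(3) by auto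
      let ?T = "(E - zs X) - {b, d}"
      have T: "card ?T + 2 = card E - m"
      proof -
        have "card ?T = card (E - zs X) - card {b, d}" using y w by (intro card_Diff_subset) auto
        moreover have "card {b, d} \<le> card (E - zs X)" using y w finite_E by (intro card_mono) auto
        ultimately show ?thesis using bd card_nonzero[OF y(1)] by simp
      qed
      have Qz: "Q g = Zero \<longleftrightarrow> g = d \<or> (X g = Zero \<and> g \<noteq> a)" if "g \<in> E" for g
        using that Q(2) by (metis Diff_iff insert_iff mem_zero_set_iff singletonD singletonI)
      show ?thesis
      proof (rule two_coline_ball[where Q = Q and T = ?T])
        show "ball (card (sep Y Q) + 1) Y Q"
          using coline_ball[OF y(2) Q(1) y(10) Q(2)] y(6) w(6) bd by simp
        show "ball (card (sep Q ?V) + 1) Q ?V"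
        proof (rule coline_ball[OF Q(1) V(1)])
          have ac': "a \<in> zs X" "c \<in> zs X" "d \<notin> zs X" using y(3,5) w(3,5,6) by simp_all
          show "zs Q = insert c (insert d (zs X - {a, c}))" "zs ?V = insert a (insert d (zs X - {a, c}))"
            unfolding Q(2) V(2) using ac' ac by blast+
          show "c \<notin> insert d (zs X - {a, c})" "a \<notin> insert d (zs X - {a, c})" "c \<noteq> a"
            using ac ac' by blast+
        qed
        show "sep Y Q \<subseteq> ?T"
        proof
          fix g assume "g \<in> sep Y Q"
          then have g: "g \<in> E" "Y g \<noteq> Zero" "Q g = flip (Y g)" by (auto simp: mem_separator_iff)
          then have "Q g \<noteq> Zero" "g \<noteq> a" using Q(3) by auto
          then show "g \<in> ?T" using g Qz[OF g(1)] y(13)[OF g(1)] by auto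
        qed
        show "sep Q ?V \<subseteq> ?T"
        proof
          fix g assume "g \<in> sep Q ?V"
          then have g: "g \<in> E" "Q g \<noteq> Zero" "flip (W g) = flip (Q g)" by (auto simp: mem_separator_iff)
          then have WQ: "W g = Q g" by (metis flip_flip)
          then have "g \<noteq> a" using w(13)[OF g(1)] y(5) g ac by auto
          moreover have "g \<noteq> b"
            using WQ Qb w(11)[OF y(4,6) bd] y(6) by auto
          ultimately show "g \<in> ?T" using g Qz[OF g(1)] by auto
        qed
        show "?V g = flip (Y g)" if "g \<in> ?T" for g
        proof -
          have "W g = X g" "Y g = X g" using that w(11) y(11) by auto
          then show ?thesis using that by simp
        qed
      qed (use T finite_E in auto)
    qed
  qed
qed

text \<open>The walk to the antipode of \<open>W\<close> turns either at the cocircuit \<open>Q1\<close> or at \<open>Q2\<close>, depending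
  on which of \<open>b\<close> and \<open>f\<close> is met first when the coline of \<open>X\<close> and \<open>Y\<close> is continued beyond \<open>Y\<close>.\<close>

lemma transport_ball:
  assumes X': "step X a b X'" and Y: "step X c d Y" and W: "step X' c f W"
    and s: "W c = flip (Y c)" and ca: "c \<noteq> a"
  shows "ball (card E - m - 1) Y (opp W)"
proof -
  note x = stepD[OF X'] and y = stepD[OF Y] and w = stepD[OF W]
  define L where "L = zs X - {a, c}"
  let ?V = "opp W"
  have zX: "zs X = insert a (insert c L)"
  proof -
    have "a \<in> zs X" "c \<in> zs X" using x(3,5) y(3,5) by simp_all
    then show ?thesis unfolding L_def by blast
  qed
  have V: "?V \<in> C" "?V c = Y c" using opposite_closed[OF w(2)] s w(3) by auto
  have XLb: "b \<notin> insert a (insert c L)" "d \<notin> insert a (insert c L)" "a \<notin> L" "c \<notin> L"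
  proof -
    have "b \<notin> zs X" "d \<notin> zs X" using x(6) y(6) by simp_all
    then show "b \<notin> insert a (insert c L)" "d \<notin> insert a (insert c L)" unfolding zX .
  qed (simp_all add: L_def)
  have zY: "zs Y = insert d (insert a L)" unfolding y(10) zX using XLb ca by blast
  have zX': "zs X' = insert b (insert c L)" unfolding x(10) zX using XLb ca by blast
  have bc: "b \<noteq> c" using XLb by auto
  have zW: "zs W = insert f (insert b L)" unfolding w(10) zX' using XLb bc by blast
  have f: "f \<noteq> b" "f \<noteq> c" "f \<notin> L" "f \<in> E"
  proof -
    have "f \<notin> zs X'" using w(6) by simp
    then show "f \<noteq> b" "f \<noteq> c" "f \<notin> L" using zX' by auto
  qed (rule w(4))
  have zV: "zs ?V = insert f (insert b L)" using zW by simp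
  note agree = coline_ball_agreeing[OF y(2) V(1) _ _ _ _ _ y(3) V(2)[symmetric] y(8)]
  \<comment> \<open>In the first four cases the zero sets of \<open>Y\<close> and \<open>?V\<close>
    coincide or share all but one element, so at most one coline is used. In the last they share
    only \<open>L\<close>, and the walk has to turn.\<close>
  consider "zs Y = zs ?V" | "zs Y \<noteq> zs ?V" "d = b" | "zs Y \<noteq> zs ?V" "d = f" | "zs Y \<noteq> zs ?V" "a = f"
    | "d \<noteq> b" "d \<noteq> f" "a \<noteq> f" by blast
  then show ?thesis
  proof cases
    case 1
    then have "Y = ?V" using eq_if_sign[OF V(1) y(2)] V(2) y(3,8) by metis
    then show ?thesis using ball_mono[of 0] by simp
  next
    case 2
    have "a \<noteq> f" using 2 zY zV by auto
    show ?thesis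
      by (rule agree[of a "insert b L" f]) (use 2 zY zV XLb f \<open>a \<noteq> f\<close> in auto)
  next
    case 3
    show ?thesis
      by (rule agree[of a "insert f L" b]) (use 3 zY zV XLb f in auto)
  next
    case 4
    then have "d \<noteq> b" using zY zV by auto
    show ?thesis
      by (rule agree[of d "insert a L" b]) (use 4 zY zV XLb f \<open>d \<noteq> b\<close> in auto)
  next
    case 5
    have Lc: "zs X - {c} = insert a L" using zX XLb ca by auto
    have bdf: "b \<in> E - zs X" "d \<in> E - zs X" "f \<in> E - zs X"
      using x y f zX 5 by auto
    have ex: "\<exists>Q\<in>C. zs Q = insert z (zs X - {c}) \<and> Q c = Y c" if "z \<in> E - zs X" for z
    proof -
      have "c \<in> zs X" using y by auto
      then have "card (insert z (zs X - {c})) = m"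
        using that card_zero[OF x(1)] by (simp add: card_insert_if card_Suc_Diff1 del: card_Diff_insert)
      moreover have "insert z (zs X - {c}) \<subseteq> E" "c \<in> E - insert z (zs X - {c})"
        using that y \<open>c \<in> zs X\<close> by auto
      ultimately show ?thesis using ex_sign[of _ c "Y c"] y(8) by metis
    qed
    have main: ?thesis if zo: "(z = b \<and> z' = f) \<or> (z = f \<and> z' = b)"
      and Q: "Q \<in> C" "zs Q = insert z (zs X - {c})" "Q c = Y c" and Qz': "Q z' = X z'" for z z' Q
    proof -
      have zz: "z \<in> E - zs X" "z' \<in> E - zs X" "z \<noteq> d" "z' \<noteq> d" "z \<noteq> z'" "z \<noteq> a" "z' \<noteq> a"
        using zo bdf 5 f x(9) by auto
      have Qd: "Q d = flip (X d)" using beyond_step[OF Y Q(1,2)] zz Q(3) by blast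
      \<comment> \<open>All of \<open>b\<close>, \<open>d\<close>, \<open>f\<close> are avoided: the
        two colines cost at most \<open>card ?T + 2\<close>, which is
        \<open>card E - m - 1\<close>.\<close>
      let ?T = "(E - zs X) - {b, d, f}"
      have T: "card ?T + 3 = card E - m"
      proof -
        have "card ?T = card (E - zs X) - card {b, d, f}" using bdf by (intro card_Diff_subset) auto
        moreover have "card {b, d, f} \<le> card (E - zs X)" using bdf finite_E by (intro card_mono) auto
        ultimately show ?thesis using 5 f card_nonzero[OF x(1)] by simp
      qed
      have Qz: "Q g = Zero \<longleftrightarrow> g = z \<or> (X g = Zero \<and> g \<noteq> c)" if "g \<in> E" for g
        using that Q(2) by (metis Diff_iff insert_iff mem_zero_set_iff singletonD singletonI)
      have WX: "W g = X g" if "g \<in> E - zs X" "g \<noteq> b" "g \<noteq> f" for g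
      proof -
        have "X' g = X g" using that x(11) by auto
        moreover have "W g = X' g" using that calculation w(11) by auto
        ultimately show ?thesis by simp
      qed
      show ?thesis
      proof (rule two_coline_ball[where Q = Q and T = ?T])
        show "ball (card (sep Y Q) + 1) Y Q"
        proof (rule coline_ball[OF y(2) Q(1) zY])
          show "zs Q = insert z (insert a L)" using Q(2) Lc by simp
        qed (use zz zX XLb in auto)
        show "ball (card (sep Q ?V) + 1) Q ?V"
        proof (rule coline_ball[OF Q(1) V(1)])
          show "zs Q = insert a (insert z L)" using Q(2) Lc by auto
          show "zs ?V = insert z' (insert z L)" using zV zo by auto
        qed (use zz zX XLb in auto)
        show "sep Y Q \<subseteq> ?T"
        proof
          fix g assume "g \<in> sep Y Q"
          then have g: "g \<in> E" "Y g \<noteq> Zero" "Q g = flip (Y g)" by (auto simp: mem_separator_iff)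
          then have gc: "Q g \<noteq> Zero" "g \<noteq> c" using Q(3) by auto
          have "Y z' = X z'" using zz y(11) by auto
          then have "g \<noteq> z'" using g Qz' by auto
          moreover have "g \<noteq> z" "g \<noteq> d" "X g \<noteq> Zero" using gc g Qz[OF g(1)] y(7) by auto
          ultimately show "g \<in> ?T" using g zo by auto
        qed
        show "sep Q ?V \<subseteq> ?T"
        proof
          fix g assume "g \<in> sep Q ?V"
          then have g: "g \<in> E" "Q g \<noteq> Zero" "?V g = flip (Q g)" by (auto simp: mem_separator_iff)
          have "g \<noteq> c" using g V(2) Q(3) by auto
          moreover have "?V g \<noteq> Zero" using g(2,3) by simp
          then have "g \<notin> zs ?V" by (metis mem_zero_set_iff)
          then have "g \<noteq> b" "g \<noteq> f" using zV by auto
          moreover have "g \<noteq> d"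
          proof
            assume "g = d"
            then have "?V g = flip (X g)" using WX[of d] bdf 5 by auto
            then show False using g Qd \<open>g = d\<close> y(6) by auto
          qed
          ultimately show "g \<in> ?T" using g Qz[OF g(1)] by auto
        qed
        show "?V g = flip (Y g)" if "g \<in> ?T" for g
        proof -
          have "W g = X g" "Y g = X g" using that WX y(11) by auto
          then show ?thesis using that by simp
        qed
      qed (use T finite_E in auto)
    qed
    obtain Q1 Q2 where Q1: "Q1 \<in> C" "zs Q1 = insert f (zs X - {c})" "Q1 c = Y c"
      and Q2: "Q2 \<in> C" "zs Q2 = insert b (zs X - {c})" "Q2 c = Y c"
      using ex bdf by metis
    \<comment> \<open>Exactly one of \<open>Q1\<close>, \<open>Q2\<close> has not yet crossed the
      zero of the other; the walk turns there.\<close>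
    have "Q1 b = X b \<longleftrightarrow> Q2 f \<noteq> X f"
    proof (rule coline_order[OF x(1) Q1(1) Q2(1) _ Q1(2) Q2(2) f(1)])
      show "c \<in> zs X" using y by auto
    qed (use bdf Q1(3) Q2(3) y(8) in auto)
    then show ?thesis using main[of f b Q1] main[of b f Q2] Q1 Q2 by blast
  qed
qed

text \<open>The second test removes the neighbour of \<open>X'\<close> that continues the coline of
  \<open>X\<close> and \<open>X'\<close>: it is opposite to \<open>X\<close> at \<open>b\<close>,
  where \<open>Y\<close> may still agree with \<open>X\<close>, and so could pass the first test for
  the wrong reason. Every other separation from \<open>Y\<close> happens at
  \<open>c\<close>.\<close>

lemma transport_iff:
  assumes X': "step X a b X'" and Y: "step X c d Y" and ca: "c \<noteq> a" and W: "W \<in> C" "adjacent E X' W"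
  shows "ball (card E - m - 1) Y (opp W) \<and> \<not> ball (card E - m - 1) X (opp W) \<longleftrightarrow>
    (\<exists>f. step X' c f W) \<and> W c = flip (Y c)"
proof -
  note x = stepD[OF X'] and y = stepD[OF Y]
  obtain c' f where W': "step X' c' f W" using adjacent_iff_step[OF x(2) W(1)] W(2) by blast
  note w = stepD[OF W']
  have backward: "ball (card E - m - 1) X (opp W) \<longleftrightarrow> c' = b \<and> W b = flip (X b)"
    using same_coline_iff[OF step_sym[OF X'] W'] .
  show ?thesis
  proof
    assume A: "ball (card E - m - 1) Y (opp W) \<and> \<not> ball (card E - m - 1) X (opp W)"
    then obtain g where "g \<in> sep Y W" using ball_opp_imp_sep[OF _ y(2) w(2)] by blast
    then have g: "g \<in> E" "Y g \<noteq> Zero" "W g = flip (Y g)" by (auto simp: mem_separator_iff)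
    have Wg: "W g \<noteq> Zero" "W g \<noteq> Y g" using g by auto
    have "X g = Zero"
    proof (rule ccontr)
      assume Xg: "X g \<noteq> Zero"
      then have YX: "Y g = X g" using y(12) g by blast
      show False
      proof (cases "g = b")
        case True
        then have "c' = b" using w(13)[OF g(1)] Wg x(7) by auto
        then show False using A backward True g YX by auto
      next
        case False
        then have "X' g = X g" using x(11) g Xg by blast
        then have "W g = X g" using w(12) g Wg Xg by metis
        then show False using Wg YX by simp
      qed
    qed
    then have gc: "g = c" using y(13)[OF g(1)] g by auto
    then have "X' c = Zero" using x(13)[OF y(3)] ca y(5) by auto
    then have "c = c'" using w(13)[OF y(3)] Wg(1) gc by simp
    then show "(\<exists>f. step X' c f W) \<and> W c = flip (Y c)" using W' g gc by auto
  next
    assume A: "(\<exists>f. step X' c f W) \<and> W c = flip (Y c)"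
    then obtain f' where f': "step X' c f' W" by blast
    have "c \<noteq> b" using y(5) x(6) by auto
    moreover have "c' = c" using stepD(5,8)[OF f'] w(13)[OF y(3)] by auto
    ultimately have "\<not> ball (card E - m - 1) X (opp W)" using backward by auto
    then show "ball (card E - m - 1) Y (opp W) \<and> \<not> ball (card E - m - 1) X (opp W)"
      using transport_ball[OF X' Y f' _ ca] A by blast
  qed
qed

end

section \<open>Uniform oriented matroids and sign matrices\<close>

lemma extensional_iff: "X \<in> E \<rightarrow>\<^sub>E UNIV \<longleftrightarrow> X \<in> extensional E"
  by (auto simp: PiE_def)

lemma zero_set_eq_iff_support: "L \<subseteq> E \<Longrightarrow> zero_set E X = L \<longleftrightarrow> support E X = E - L"
  by (auto simp: support_def zero_set_def)

lemma card_zero_set_add_support: "finite E \<Longrightarrow> card (zero_set E X) + card (support E X) = card E"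
  unfolding support_def
  by (metis card_Diff_subset card_mono finite_subset le_add_diff_inverse mem_zero_set_iff subsetI)

lemma zero_set_subset: "zero_set E X \<subseteq> E"
  by auto

text \<open>For two cocircuits on a coline, the vector from (C3) vanishes on
  \<open>insert e L\<close>, and the common size of the zero sets leaves no room for further zeros.
  So (C3) yields elimination within the coline.\<close>

lemma uniform_oriented_matroid_modular_system:
  assumes "uniform_oriented_matroid E r C"
  shows "modular_system E (r - 1) C"
proof -
  interpret uniform_oriented_matroid E r C by fact
  have card0: "card (zero_set E X) = r - 1" if "X \<in> C" for X
  proof -
    have "card (support E X) = card E - r + 1" using C1 that by blast
    then show ?thesis using card_zero_set_add_support[OF finite_ground, of X] rank_bounds by linarith
  qed
  have C2': "\<exists>X Y. X \<noteq> Y \<and> {Z \<in> C. zero_set E Z = L} = {X, Y} \<and> Y = opposite E X"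
    if "L \<subseteq> E" "card L = r - 1" for L
  proof -
    have "card (E - L) = card E - r + 1"
      using that finite_ground rank_bounds card_Diff_subset[of L E] finite_subset[of L E] by auto
    then show ?thesis using C2 zero_set_eq_iff_support[OF that(1)] by auto
  qed
  show ?thesis
  proof
    show "finite E" by (rule finite_ground)
    show "r - 1 < card E" using rank_bounds by simp
    show "X \<in> extensional E" if "X \<in> C" for X
      using that sign_vectors extensional_iff by blast
    show "card (zero_set E X) = r - 1" if "X \<in> C" for X using card0 that .
    show "opposite E X \<in> C" if X: "X \<in> C" for X
    proof -
      obtain U V where UV: "{Z \<in> C. zero_set E Z = zero_set E X} = {U, V}" "V = opposite E U"
        using C2'[OF zero_set_subset card0[OF X]] by blast
      then have "X = U \<or> X = V" "U \<in> C" "V \<in> C" using X by blast+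
      moreover have "U \<in> extensional E" using \<open>U \<in> C\<close> sign_vectors extensional_iff by blast
      ultimately show ?thesis using UV(2) by (metis opposite_opposite)
    qed
    show "\<exists>X\<in>C. zero_set E X = L" if "L \<subseteq> E" "card L = r - 1" for L
      using C2'[OF that] by blast
    show "Y = X \<or> Y = opposite E X" if XY: "X \<in> C" "Y \<in> C" "zero_set E X = zero_set E Y" for X Y
    proof -
      obtain U V where UV: "{Z \<in> C. zero_set E Z = zero_set E X} = {U, V}" "V = opposite E U"
        using C2'[OF zero_set_subset card0[OF XY(1)]] by blast
      then have "X \<in> {U, V}" "Y \<in> {U, V}" "U \<in> C" using XY by blast+
      moreover have "U \<in> extensional E" using \<open>U \<in> C\<close> sign_vectors extensional_iff by blast
      ultimately show ?thesis using UV(2) by (metis empty_iff insert_iff opposite_opposite)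
    qed
    fix X Y a b L e
    assume XY: "X \<in> C" "Y \<in> C" and z: "zero_set E X = insert a L" "zero_set E Y = insert b L"
      "a \<notin> L" "b \<notin> L" and ne: "X \<noteq> opposite E Y" and e: "e \<in> separator E X Y"
    obtain Z where Z: "Z \<in> C" "Z e = Zero" "\<forall>f\<in>E - {e}. Z f \<in> {X f, Y f, Zero}"
      using C3 XY ne e by blast
    have eE: "e \<in> E" "X e \<noteq> Zero" using e by (auto simp: mem_separator_iff)
    have L0: "X f = Zero \<and> Y f = Zero \<and> f \<in> E \<and> f \<noteq> e" if "f \<in> L" for f
    proof -
      have "f \<in> zero_set E X" "f \<in> zero_set E Y" using that z by simp_all
      then show ?thesis using eE by auto
    qed
    have "insert e L \<subseteq> zero_set E Z"
    proof
      fix f assume "f \<in> insert e L"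
      then consider "f = e" | "f \<noteq> e" "f \<in> L" by blast
      then show "f \<in> zero_set E Z"
      proof cases
        case 2
        then have "Z f \<in> {X f, Y f, Zero}" using Z(3) L0[of f] by blast
        then show ?thesis using L0[OF 2(2)] by simp
      qed (use Z(2) eE in simp)
    qed
    moreover have "card (insert e L) = card (zero_set E Z)"
    proof -
      have "finite (zero_set E X)" using finite_ground by (rule rev_finite_subset) auto
      then have "finite L" using z(1) by simp
      moreover have "e \<notin> L" using L0 by blast
      ultimately have "card (insert e L) = card (insert a L)" using z(3) by simp
      then show ?thesis using card0 XY(1) Z(1) z(1) by metis
    qed
    moreover have "finite (zero_set E Z)" using finite_ground by (rule rev_finite_subset) auto
    ultimately have "zero_set E Z = insert e L" by (metis card_subset_eq)
    moreover have "between E X Y Z"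
      unfolding between_def using Z(2,3) by auto
    ultimately show "\<exists>W\<in>C. zero_set E W = insert e L \<and> between E X Y W" using Z(1) by blast
  qed
qed

lemma (in cocircuit_system) same_zero_set:
  assumes X: "X \<in> C" shows "{Z \<in> C. zs Z = zs X} = {X, opp X}"
proof (intro set_eqI iffI)
  fix Z assume "Z \<in> {Z \<in> C. zs Z = zs X}"
  then have "Z \<in> C" "zs X = zs Z" by auto
  then have "Z = X \<or> Z = opp X" by (rule eq_zero_set[OF X])
  then show "Z \<in> {X, opp X}" by simp
next
  fix Z assume "Z \<in> {X, opp X}"
  then show "Z \<in> {Z \<in> C. zs Z = zs X}"
    using X opposite_closed[OF X] zero_set_opposite[of E X] by (elim insertE) simp_all
qed

lemma (in modular_system) uniform_oriented_matroid:
  "uniform_oriented_matroid E (m + 1) C"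
proof
  show "finite E" "1 \<le> m + 1" "m + 1 \<le> card E" using finite_E m_less by auto
  show "C \<subseteq> E \<rightarrow>\<^sub>E UNIV"
  proof
    fix X assume "X \<in> C"
    then show "X \<in> E \<rightarrow>\<^sub>E UNIV" using extensional extensional_iff[of X E] by simp
  qed
  show "\<forall>X\<in>C. card (support E X) = card E - (m + 1) + 1"
  proof
    fix X assume "X \<in> C"
    then show "card (support E X) = card E - (m + 1) + 1"
      using card_zero_set_add_support[OF finite_E, of X] card_zero[of X] m_less by linarith
  qed
  show "\<forall>I. I \<subseteq> E \<and> card I = card E - (m + 1) + 1 \<longrightarrow>
    (\<exists>X Y. X \<noteq> Y \<and> {Z \<in> C. support E Z = I} = {X, Y} \<and> Y = opp X)"
  proof (intro allI impI)
    fix I assume I: "I \<subseteq> E \<and> card I = card E - (m + 1) + 1"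
    then have "card (E - I) = m"
      using card_Diff_subset[of I E] finite_subset[of I E] finite_E m_less by simp
    then obtain X where X: "X \<in> C" "zs X = E - I" using ex_zero_set[of "E - I"] by blast
    have "support E Z = I \<longleftrightarrow> zs Z = zs X" for Z
      using zero_set_eq_iff_support[of "E - I" E Z] I X(2) by (simp add: double_diff)
    then have "{Z \<in> C. support E Z = I} = {X, opp X}"
      using same_zero_set[OF X(1)] by simp
    then show "\<exists>X Y. X \<noteq> Y \<and> {Z \<in> C. support E Z = I} = {X, Y} \<and> Y = opp X"
      using opp_neq[OF X(1)] by metis
  qed
  show "\<forall>X\<in>C. \<forall>Y\<in>C. X \<noteq> opp Y \<longrightarrow>
      (\<forall>e\<in>sep X Y. \<exists>Z\<in>C. Z e = Zero \<and> (\<forall>f\<in>E - {e}. Z f \<in> {X f, Y f, Zero}))"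
  proof (intro ballI impI)
    fix X Y e assume "X \<in> C" "Y \<in> C" "X \<noteq> opp Y" "e \<in> sep X Y"
    then obtain W where "W \<in> C" "W e = Zero" "between E X Y W" using cocircuit_elim by blast
    then show "\<exists>Z\<in>C. Z e = Zero \<and> (\<forall>f\<in>E - {e}. Z f \<in> {X f, Y f, Zero})"
      unfolding between_def by blast
  qed
qed

lemma (in cocircuit_system) card_cocircuits: "card C = 2 * (card E choose m)"
proof -
  let ?T = "{L. L \<subseteq> E \<and> card L = m}"
  have fin: "finite ?T" using finite_E by simp
  have "C = (\<Union>L\<in>?T. {X \<in> C. zs X = L})" using card_zero zs_subset by blast
  then have "card C = card (\<Union>L\<in>?T. {X \<in> C. zs X = L})" by simp
  have two: "\<exists>X. {Y \<in> C. zs Y = L} = {X, opp X} \<and> X \<noteq> opp X" if L: "L \<in> ?T" for L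
  proof -
    obtain X where X: "X \<in> C" "zs X = L" using ex_zero_set L by blast
    then have "{Y \<in> C. zs Y = L} = {X, opp X}"
      using same_zero_set[OF X(1)] by simp
    then show ?thesis using opp_neq[OF X(1)] by metis
  qed
  have fin2: "finite {Y \<in> C. zs Y = L}" "card {Y \<in> C. zs Y = L} = 2" if "L \<in> ?T" for L
    using two[OF that] by auto
  have "card (\<Union>L\<in>?T. {X \<in> C. zs X = L}) = (\<Sum>L\<in>?T. card {X \<in> C. zs X = L})"
    using fin fin2(1) by (intro card_UN_disjoint) auto
  also have "\<dots> = (\<Sum>L\<in>?T. 2)" using fin2(2) by (intro sum.cong) auto
  also have "\<dots> = 2 * (card E choose m)" using n_subsets[OF finite_E, of m] by simp
  finally show ?thesis using \<open>card C = _\<close> by simp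
qed

section \<open>Isomorphisms with the cocircuit graph, its degrees and its order\<close>

lemma parcs_cocircuit_graph:
  "(X, Y) \<in> parcs (cocircuit_graph E C) \<longleftrightarrow> X \<in> C \<and> Y \<in> C \<and> adjacent E X Y"
  by (simp add: cocircuit_graph_def adjacent_def)

lemma pverts_cocircuit_graph [simp]: "pverts (cocircuit_graph E C) = C"
  by (simp add: cocircuit_graph_def)

lemma cocircuit_graph_isoD:
  assumes "pair_graph G" "digraph_iso (with_proj G) (with_proj (cocircuit_graph E C))"
  obtains f where "bij_betw f (pverts G) C"
    "\<And>x y. x \<in> pverts G \<Longrightarrow> y \<in> pverts G \<Longrightarrow> (x, y) \<in> parcs G \<longleftrightarrow> adjacent E (f x) (f y)"
proof -
  interpret pair_graph G by fact
  have wf: "pair_wf_digraph G" ..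
  obtain f where f: "inj_on f (pverts G)" "C = f ` pverts G"
    "parcs (cocircuit_graph E C) = map_prod f f ` parcs G"
    using assms(2) unfolding digraph_iso_with_proj[OF wf] by auto
  have "(x, y) \<in> parcs G \<longleftrightarrow> adjacent E (f x) (f y)" if xy: "x \<in> pverts G" "y \<in> pverts G" for x y
  proof -
    have "adjacent E (f x) (f y) \<longleftrightarrow> (f x, f y) \<in> map_prod f f ` parcs G"
      using xy f(2) parcs_cocircuit_graph[of "f x" "f y" E C] f(3) by auto
    also have "\<dots> \<longleftrightarrow> (x, y) \<in> parcs G"
    proof
      assume "(f x, f y) \<in> map_prod f f ` parcs G"
      then obtain u v where uv: "(u, v) \<in> parcs G" "f u = f x" "f v = f y" by auto
      then have "u \<in> pverts G" "v \<in> pverts G" using in_arcsD1 in_arcsD2 by auto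
      then show "(x, y) \<in> parcs G" using uv f(1) xy by (metis inj_onD)
    qed (force)
    finally show ?thesis by simp
  qed
  then show thesis using that f by (simp add: bij_betw_def)
qed

lemma cocircuit_graph_isoI:
  assumes "pair_graph G" "bij_betw f (pverts G) C"
    "\<And>x y. x \<in> pverts G \<Longrightarrow> y \<in> pverts G \<Longrightarrow> (x, y) \<in> parcs G \<longleftrightarrow> adjacent E (f x) (f y)"
  shows "digraph_iso (with_proj G) (with_proj (cocircuit_graph E C))"
proof -
  interpret pair_graph G by fact
  have wf: "pair_wf_digraph G" ..
  have "parcs (cocircuit_graph E C) = map_prod f f ` parcs G"
  proof (intro set_eqI iffI)
    fix a assume "a \<in> parcs (cocircuit_graph E C)"
    then obtain X Y where a: "a = (X, Y)" "X \<in> C" "Y \<in> C" "adjacent E X Y"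
      using parcs_cocircuit_graph by (metis surj_pair)
    then obtain x y where "x \<in> pverts G" "y \<in> pverts G" "X = f x" "Y = f y"
      using assms(2) by (metis bij_betw_imp_surj_on imageE)
    then show "a \<in> map_prod f f ` parcs G" using assms(3) a by force
  next
    fix a assume "a \<in> map_prod f f ` parcs G"
    then obtain x y where xy: "(x, y) \<in> parcs G" "a = (f x, f y)" by auto
    then have "x \<in> pverts G" "y \<in> pverts G" using in_arcsD1 in_arcsD2 by auto
    then show "a \<in> parcs (cocircuit_graph E C)"
      using xy assms(2,3) parcs_cocircuit_graph by (metis bij_betwE)
  qed
  then show ?thesis
    unfolding digraph_iso_with_proj[OF wf] using assms(2) by (auto simp: bij_betw_def)
qed

lemma out_degree_eq: "out_degree (with_proj G) v = card {w. (v, w) \<in> parcs G}"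
proof -
  have "out_arcs (with_proj G) v = Pair v ` {w. (v, w) \<in> parcs G}"
    by (auto simp: out_arcs_def)
  then show ?thesis by (simp add: out_degree_def card_image inj_on_def)
qed

lemma has_parameters_if_iso:
  assumes G: "pair_graph G" and M: "uniform_oriented_matroid E r C"
    and iso: "digraph_iso (with_proj G) (with_proj (cocircuit_graph E C))"
  shows "has_parameters G (card E) r"
proof -
  interpret pair_graph G by fact
  interpret modular_system E "r - 1" C by (rule uniform_oriented_matroid_modular_system[OF M])
  have r: "1 \<le> r" "r \<le> card E" using M by (auto simp: uniform_oriented_matroid_def)
  obtain f where f: "bij_betw f (pverts G) C"
    "\<And>x y. x \<in> pverts G \<Longrightarrow> y \<in> pverts G \<Longrightarrow> (x, y) \<in> parcs G \<longleftrightarrow> adjacent E (f x) (f y)"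
    using cocircuit_graph_isoD[OF G iso] by blast
  have "card {w. (v, w) \<in> parcs G} = 2 * (r - 1)" if v: "v \<in> pverts G" for v
  proof -
    have bij: "bij_betw f {w. (v, w) \<in> parcs G} {Y \<in> C. adjacent E (f v) Y}"
    proof (rule bij_betw_imageI)
      have sub: "{w. (v, w) \<in> parcs G} \<subseteq> pverts G" using in_arcsD2 by auto
      show "inj_on f {w. (v, w) \<in> parcs G}"
        using f(1) sub by (meson bij_betw_imp_inj_on inj_on_subset)
      show "f ` {w. (v, w) \<in> parcs G} = {Y \<in> C. adjacent E (f v) Y}"
      proof (intro set_eqI iffI)
        fix Y assume "Y \<in> f ` {w. (v, w) \<in> parcs G}"
        then obtain w where w: "(v, w) \<in> parcs G" "Y = f w" by blast
        then have "w \<in> pverts G" using sub by blast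
        then show "Y \<in> {Y \<in> C. adjacent E (f v) Y}" using f v w bij_betwE by fastforce
      next
        fix Y assume Y: "Y \<in> {Y \<in> C. adjacent E (f v) Y}"
        then obtain w where "w \<in> pverts G" "Y = f w" using f(1) by (metis (no_types, lifting) bij_betw_imp_surj_on imageE mem_Collect_eq)
        then show "Y \<in> f ` {w. (v, w) \<in> parcs G}" using f(2) v Y by blast
      qed
    qed
    have "f v \<in> C" using bij_betwE[OF f(1)] v by blast
    then show ?thesis using card_adjacent bij_betw_same_card[OF bij] by simp
  qed
  then have "regular (2 * (r - 1)) G" by (simp add: regular_def out_degree_eq)
  moreover have "card (pverts G) = 2 * (card E choose (card E - r + 1))"
  proof -
    have "card E choose (card E - r + 1) = card E choose (r - 1)"
      using r by (subst binomial_symmetric) auto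
    then show ?thesis using card_cocircuits bij_betw_same_card[OF f(1)] by simp
  qed
  ultimately show ?thesis using r by (simp add: has_parameters_def)
qed

text \<open>The entries 0, 1, 2 encode the signs, and \<open>z\<close> is the size of the zero sets.
  Closure under negation and the occurrence of every zero set are not listed: they follow by
  counting rows. The last clause is the condition of \<open>coline_system\<close>. Each clause can
  be tested in time of order \<open>N * N * n\<close>.\<close>

definition valid_matrix :: "nat \<Rightarrow> nat \<Rightarrow> nat \<Rightarrow> (nat \<Rightarrow> nat \<Rightarrow> bool) \<Rightarrow> (nat \<Rightarrow> nat \<Rightarrow> nat) \<Rightarrow> bool" where
  "valid_matrix N n z A \<sigma> \<longleftrightarrow>
     (\<forall>x<N. (\<forall>e<n. \<sigma> x e < 3) \<and> card {e. e < n \<and> \<sigma> x e = 0} = z) \<and>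
     (\<forall>x<N. \<forall>y<N. x \<noteq> y \<longrightarrow>
        ((\<forall>e<n. \<sigma> x e = 0 \<longleftrightarrow> \<sigma> y e = 0) \<longrightarrow> (\<forall>e<n. \<sigma> x e = 0 \<or> \<sigma> x e \<noteq> \<sigma> y e)) \<and>
        (A x y \<longleftrightarrow> card {e. e < n \<and> (\<sigma> x e = 0) \<noteq> (\<sigma> y e = 0)} = 2 \<and>
           (\<forall>e<n. \<sigma> x e = 0 \<or> \<sigma> y e = 0 \<or> \<sigma> x e = \<sigma> y e))) \<and>
     (\<forall>x<N. \<forall>e<n. \<sigma> x e = 0 \<longrightarrow>
        (\<exists>y<N. A x y \<and> \<sigma> y e = 1) \<and> (\<exists>y<N. A x y \<and> \<sigma> y e = 2))"

text \<open>Pigeonhole: \<open>2 * card T\<close> points in fibres of size at most 2 fill every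
  fibre.\<close>

lemma card_fibres_eq_2:
  assumes fin: "finite T" and g: "g ` S \<subseteq> T" and S: "card S = 2 * card T" "finite S"
    and le: "\<And>t. t \<in> T \<Longrightarrow> card {x \<in> S. g x = t} \<le> 2" and t: "t \<in> T"
  shows "card {x \<in> S. g x = t} = 2"
proof (rule ccontr)
  assume "card {x \<in> S. g x = t} \<noteq> 2"
  then have "card {x \<in> S. g x = t} < 2" using le[OF t] by simp
  then have "(\<Sum>t\<in>T. card {x \<in> S. g x = t}) < (\<Sum>t\<in>T. 2)"
    using fin le t by (intro sum_strict_mono_ex1) auto
  moreover have "(\<Sum>t\<in>T. card {x \<in> S. g x = t}) = card S"
    using sum.group[OF S(2) fin g, of "\<lambda>_. 1::nat"] by simp
  ultimately show False using S by simp
qed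

text \<open>Different rows with equal zero sets are opposite, so at most two rows share one. As
  there are twice as many rows as possible zero sets, each of these occurs exactly twice, which
  gives existence in (C2) and closure under negation.\<close>

lemma valid_matrix_sound:
  assumes v: "valid_matrix N n z A \<sigma>" and N: "N = 2 * (n choose z)" and z: "z < n"
    and A: "\<And>x. \<not> A x x"
  defines "row \<equiv> \<lambda>x. \<lambda>e\<in>{..<n}. sign_of_nat (\<sigma> x e)"
  shows "coline_system {..<n} z (row ` {..<N})" "inj_on row {..<N}"
    "\<And>x y. x < N \<Longrightarrow> y < N \<Longrightarrow> A x y \<longleftrightarrow> adjacent {..<n} (row x) (row y)"
proof -
  let ?E = "{..<n}"
  have K1: "\<sigma> x e < 3" "card {e. e < n \<and> \<sigma> x e = 0} = z" if "x < N" "e < n" for x e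
    using v that by (auto simp: valid_matrix_def)
  have K2: "\<sigma> x e = 0 \<or> \<sigma> x e \<noteq> \<sigma> y e"
    if "x < N" "y < N" "x \<noteq> y" "\<forall>e<n. \<sigma> x e = 0 \<longleftrightarrow> \<sigma> y e = 0" "e < n" for x y e
    using v that unfolding valid_matrix_def by blast
  have K3: "A x y \<longleftrightarrow> card {e. e < n \<and> (\<sigma> x e = 0) \<noteq> (\<sigma> y e = 0)} = 2 \<and>
           (\<forall>e<n. \<sigma> x e = 0 \<or> \<sigma> y e = 0 \<or> \<sigma> x e = \<sigma> y e)" if "x < N" "y < N" "x \<noteq> y" for x y
    using v that unfolding valid_matrix_def by blast
  have K4: "\<exists>y<N. A x y \<and> \<sigma> y e = t" if "x < N" "e < n" "\<sigma> x e = 0" "t = 1 \<or> t = 2" for x e t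
    using v that unfolding valid_matrix_def by blast
  have row_Zero: "row x e = Zero \<longleftrightarrow> \<sigma> x e = 0" if "e < n" for x e
    using that by (simp add: row_def sign_of_nat_def)
  have sgn_eq: "row x e = row y e \<longleftrightarrow> \<sigma> x e = \<sigma> y e" if "e < n" "x < N" "y < N" for x y e
    using that K1(1)[of x e] K1(1)[of y e] by (auto simp: row_def sign_of_nat_def)
  have zrow: "zero_set ?E (row x) = {e. e < n \<and> \<sigma> x e = 0}" for x
    using row_Zero by auto
  have zeq: "zero_set ?E (row x) = zero_set ?E (row y) \<longleftrightarrow> (\<forall>e<n. \<sigma> x e = 0 \<longleftrightarrow> \<sigma> y e = 0)" for x y
    unfolding zrow by auto
  have cz: "card (zero_set ?E (row x)) = z" if "x < N" for x
    using K1(2)[OF that] z unfolding zrow by auto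
  have ext: "row x \<in> extensional ?E" for x by (simp add: row_def)
  have rneq: "row y = opposite ?E (row x) \<and> row y \<noteq> row x"
    if xy: "x < N" "y < N" "x \<noteq> y" "zero_set ?E (row x) = zero_set ?E (row y)" for x y
  proof
    have same: "\<forall>e<n. \<sigma> x e = 0 \<longleftrightarrow> \<sigma> y e = 0" using xy(4) zeq by blast
    show "row y = opposite ?E (row x)"
    proof
      fix e show "row y e = opposite ?E (row x) e"
      proof (cases "e < n")
        case True
        have "\<sigma> x e = 0 \<or> \<sigma> x e \<noteq> \<sigma> y e" using K2[OF xy(1-3) same True] .
        then have "row x e = Zero \<and> row y e = Zero \<or> row x e \<noteq> Zero \<and> row y e \<noteq> Zero \<and> row x e \<noteq> row y e"
          using row_Zero[OF True] sgn_eq[OF True xy(1,2)] same True by auto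
        then show ?thesis using True nonzero_signs by auto
      next
        case False
        then show ?thesis by (simp add: row_def opposite_def)
      qed
    qed
    have "zero_set ?E (row x) \<noteq> ?E"
    proof
      assume eq: "zero_set ?E (row x) = ?E"
      show False using cz[OF xy(1)] z unfolding eq by simp
    qed
    then have "\<not> ?E \<subseteq> zero_set ?E (row x)" using zrow by blast
    then obtain e where "e \<in> ?E" "e \<notin> zero_set ?E (row x)" by blast
    then have "e < n" "row x e \<noteq> Zero" by simp_all
    then show "row y \<noteq> row x"
      using \<open>row y = _\<close> by (metis flip_eq_self_iff(1) lessThan_iff opposite_apply)
  qed
  show inj: "inj_on row {..<N}"
    using rneq by (metis inj_onI lessThan_iff)
  let ?T = "{L. L \<subseteq> ?E \<and> card L = z}"
  have fibre: "card {x \<in> {..<N}. zero_set ?E (row x) = L} = 2" if "L \<in> ?T" for L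
  proof (rule card_fibres_eq_2[of ?T "\<lambda>x. zero_set ?E (row x)"])
    show "(\<lambda>x. zero_set ?E (row x)) ` {..<N} \<subseteq> ?T" using cz by auto
    show "card {..<N} = 2 * card ?T" using N n_subsets[of ?E z] by simp
    \<comment> \<open>Two rows opposite to the same third row would be equal.\<close>
    show "card {x \<in> {..<N}. zero_set ?E (row x) = L} \<le> 2" for L
    proof (rule ccontr)
      assume "\<not> card {x \<in> {..<N}. zero_set ?E (row x) = L} \<le> 2"
      then have three: "3 \<le> card {x \<in> {..<N}. zero_set ?E (row x) = L}" by simp
      obtain S where S: "S \<subseteq> {x \<in> {..<N}. zero_set ?E (row x) = L}" "card S = 3"
        using obtain_subset_with_card_n[OF three] by metis
      then obtain x y w where d: "x \<noteq> y" "x \<noteq> w" "y \<noteq> w" "S = {x, y, w}"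
        unfolding card_3_iff by blast
      then have "x < N" "y < N" "w < N" "zero_set ?E (row x) = L" "zero_set ?E (row y) = L" "zero_set ?E (row w) = L"
        using S(1) by auto
      then have "row y = row w" "y < N" "w < N" "y \<noteq> w" using rneq[of x y] rneq[of x w] d by simp_all
      then show False using inj by (auto dest: inj_onD)
    qed
  qed (use that in auto)
  show adj: "A x y \<longleftrightarrow> adjacent ?E (row x) (row y)" if xy: "x < N" "y < N" for x y
  proof (cases "x = y")
    case True
    then show ?thesis using A by (simp add: adjacent_def)
  next
    case False
    have "(zero_set ?E (row x) - zero_set ?E (row y)) \<union> (zero_set ?E (row y) - zero_set ?E (row x))
      = {e. e < n \<and> (\<sigma> x e = 0) \<noteq> (\<sigma> y e = 0)}"
      unfolding zrow by auto
    moreover have "separator ?E (row x) (row y) = {} \<longleftrightarrow>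
      (\<forall>e<n. \<sigma> x e = 0 \<or> \<sigma> y e = 0 \<or> \<sigma> x e = \<sigma> y e)"
      unfolding separator_eq_empty_iff using row_Zero sgn_eq[OF _ xy] by (simp add: Ball_def)
    ultimately show ?thesis unfolding K3[OF xy False] adjacent_def by simp
  qed
  show "coline_system ?E z (row ` {..<N})"
  proof
    show "z < card ?E" using z by simp
    show "X \<in> extensional ?E" if "X \<in> row ` {..<N}" for X using that ext by auto
    show "card (zero_set ?E X) = z" if "X \<in> row ` {..<N}" for X using that cz by auto
    show "opposite ?E X \<in> row ` {..<N}" if X: "X \<in> row ` {..<N}" for X
    proof -
      obtain x where x: "x < N" "X = row x" using X by auto
      have "card {y \<in> {..<N}. zero_set ?E (row y) = zero_set ?E (row x)} = 2"
        using fibre[of "zero_set ?E (row x)"] cz[OF x(1)] zero_set_subset[of ?E "row x"] by blast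
      then obtain y w where yw: "{y \<in> {..<N}. zero_set ?E (row y) = zero_set ?E (row x)} = {y, w}" "y \<noteq> w"
        unfolding card_2_iff by blast
      then have mem: "y < N \<and> zero_set ?E (row y) = zero_set ?E (row x)" "w < N \<and> zero_set ?E (row w) = zero_set ?E (row x)"
        by blast+
      obtain y where y: "y < N" "zero_set ?E (row y) = zero_set ?E (row x)" "x \<noteq> y"
      proof (cases "x = y")
        case True
        then show ?thesis using that[of w] mem(2) yw(2) by simp
      next
        case False
        then show ?thesis using that[of y] mem(1) by simp
      qed
      have "row y = opposite ?E (row x)" using rneq[OF x(1) y(1,3)] y(2) by simp
      then show ?thesis using x y(1) by force
    qed
    show "\<exists>X\<in>row ` {..<N}. zero_set ?E X = L" if "L \<subseteq> ?E" "card L = z" for L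
    proof -
      have "card {x \<in> {..<N}. zero_set ?E (row x) = L} = 2" using fibre that by blast
      then obtain x w where "{x \<in> {..<N}. zero_set ?E (row x) = L} = {x, w}"
        unfolding card_2_iff by blast
      then have "x < N \<and> zero_set ?E (row x) = L" by blast
      then show ?thesis by blast
    qed
    show "Y = X \<or> Y = opposite ?E X" if XY: "X \<in> row ` {..<N}" "Y \<in> row ` {..<N}"
      and z: "zero_set ?E X = zero_set ?E Y" for X Y
    proof -
      obtain x y where xy: "x < N" "X = row x" "y < N" "Y = row y" using XY by blast
      then show ?thesis using rneq[of x y] z by (cases "x = y") simp_all
    qed
    fix X a s assume X: "X \<in> row ` {..<N}" and a: "a \<in> zero_set ?E X" and s: "s \<noteq> Zero"
    obtain x where x: "x < N" "X = row x" using X by auto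
    define t where "t = (if s = Plus then 1 else 2 :: nat)"
    have t: "t = 1 \<or> t = 2" "sign_of_nat t = s" using s by (cases s; simp add: t_def sign_of_nat_def)+
    have an: "a < n" "\<sigma> x a = 0" using a row_Zero x(2) by auto
    obtain y where y: "y < N" "A x y" "\<sigma> y a = t" using K4[OF x(1) an t(1)] by blast
    have ya: "row y a = s" using y an t by (simp add: row_def)
    have ad: "adjacent ?E X (row y)" using adj x y by blast
    then have "card ((zero_set ?E X - zero_set ?E (row y)) \<union> (zero_set ?E (row y) - zero_set ?E X)) = 2"
      by (simp add: adjacent_def)
    moreover have "finite (zero_set ?E X)" "finite (zero_set ?E (row y))" unfolding x(2) zrow by auto
    ultimately obtain a' b where ab: "zero_set ?E (row y) = insert b (zero_set ?E X - {a'})" "b \<notin> zero_set ?E X"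
      using card_symdiff_eq_2_iff cz x y by (metis (no_types, lifting))
    have "a' = a"
    proof (rule ccontr)
      assume "a' \<noteq> a"
      then have "a \<in> zero_set ?E (row y)" unfolding ab(1) using a by blast
      then show False using ya s by simp
    qed
    then have "zero_set ?E X - {a} \<subseteq> zero_set ?E (row y)" unfolding ab(1) by blast
    then show "\<exists>Y\<in>row ` {..<N}. Y a = s \<and> zero_set ?E X - {a} \<subseteq> zero_set ?E Y \<and> separator ?E X Y = {}"
      using y(1) ya ad by (auto simp: adjacent_def)
  qed simp
qed

section \<open>Recovering the structure from the graph\<close>

fun gball :: "nat \<Rightarrow> (nat \<Rightarrow> nat \<Rightarrow> bool) \<Rightarrow> nat \<Rightarrow> nat \<Rightarrow> nat \<Rightarrow> bool" where
  "gball N A 0 x y \<longleftrightarrow> x = y"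
| "gball N A (Suc j) x y \<longleftrightarrow> gball N A j x y \<or> (\<exists>w<N. A w y \<and> gball N A j x w)"

context modular_system
begin

text \<open>\<open>L\<close> leaves room for only one further zero, so a link exchanges at most this
  one. If it is not exchanged, the zero sets agree, and \<open>U \<noteq> opp W\<close> leaves only
  equality.\<close>

lemma link_imp_adjacent:
  assumes "link E L U W" "card L + 1 = m"
  shows "U = W \<or> adjacent E U W"
proof -
  obtain a b L' where L': "zs U = insert a L'" "zs W = insert b L'" "a \<notin> L'" "b \<notin> L'" "L \<subseteq> L'"
    and UW: "U \<in> C" "W \<in> C" "U \<noteq> opp W" and eq: "\<forall>f\<in>E. U f = Zero \<or> W f = Zero \<or> U f = W f"
    using assms(1) unfolding link_def by (elim conjE exE) (rule that)
  show ?thesis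
  proof (cases "a = b")
    case True
    then show ?thesis using L' UW eq_zero_set[OF UW(2,1)] by auto
  next
    case False
    have "sep U W = {}" using eq by (simp add: separator_eq_empty_iff)
    moreover have "b \<in> E" "a \<in> zs U" "b \<notin> zs U" "zs W = insert b (zs U - {a})"
      using zero_set_insertD[OF L'(2)] L' False by auto
    ultimately show ?thesis using adjacent_iff[OF UW(1,2)] by auto
  qed
qed

text \<open>The zero sets are brought closer by walking to a cocircuit \<open>P\<close> that
  exchanges a zero \<open>a\<close> of \<open>X\<close> for a zero \<open>b\<close> of
  \<open>Y\<close>, on a coline on which \<open>e\<close> vanishes. When the zero sets coincide, an
  antipode may remain to be reached, hence the hypothesis on \<open>opp\<close>.\<close>

lemma contraction_connected:
  assumes S: "X \<in> S" "X \<in> C" "X e = Zero" and e: "e \<in> E"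
    and opp: "\<And>U. U \<in> S \<Longrightarrow> U \<in> C \<Longrightarrow> opp U \<in> S"
    and adj: "\<And>U W. U \<in> S \<Longrightarrow> U \<in> C \<Longrightarrow> U e = Zero \<Longrightarrow> W \<in> C \<Longrightarrow> W e = Zero \<Longrightarrow> adjacent E U W \<Longrightarrow> W \<in> S"
    and Y: "Y \<in> C" "Y e = Zero"
  shows "Y \<in> S"
  using S
proof (induction "card (zs Y - zs X)" arbitrary: X rule: less_induct)
  case less
  show ?case
  proof (cases "zs Y \<subseteq> zs X")
    case True
    then have "zs X = zs Y" using zs_eq_if_subset[OF less.prems(2) _ card_zero[OF Y(1)]] by blast
    then have "Y = X \<or> Y = opp X" by (rule eq_zero_set[OF less.prems(2) Y(1)])
    then show ?thesis using opp less.prems by blast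
  next
    case False
    then obtain b where b: "b \<in> zs Y" "b \<notin> zs X" by blast
    have "\<not> zs X \<subseteq> zs Y"
      using zs_eq_if_subset[OF Y(1) _ card_zero[OF less.prems(2)]] b by blast
    then obtain a where a: "a \<in> zs X" "a \<notin> zs Y" by blast
    define L where "L = zs X - {a}"
    \<comment> \<open>\<open>e\<close> is a zero of \<open>Y\<close> and \<open>a\<close> is not, so
      dropping \<open>a\<close> does not drop \<open>e\<close>.\<close>
    have eL: "e \<in> L" using less.prems(3) a Y(2) e by (auto simp: L_def)
    have zX: "zs X = insert a L" "a \<notin> L" "b \<notin> L" "finite L" using a b by (auto simp: L_def)
    have cL: "card L + 1 = m" using card_zero[OF less.prems(2)] zX by simp
    have bE: "b \<in> E" using b by simp
    have "insert b L \<subseteq> E" using bE by (auto simp: L_def)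
    moreover have "card (insert b L) = m" using zX cL by simp
    ultimately obtain P where P: "P \<in> C" "zs P = insert b L" using ex_zero_set by blast
    have Pe: "P e = Zero" using eL P(2) by (metis insertI2 mem_zero_set_iff)
    have "X \<noteq> opp P"
    proof
      assume "X = opp P"
      then have "insert a L = insert b L" using zX(1) P(2) by simp
      then show False using a b zX by blast
    qed
    then have "path E L X P X P"
      using coline_path[OF less.prems(2) P(1) zs_subset zs_subset _ _ zX(1) P(2) zX(2,3)] by blast
    then have "P \<in> S"
      unfolding path_def
    proof induction
      case (step U W)
      have lk: "link E L U W" using step.hyps by blast
      then have UW: "U \<in> C" "W \<in> C" "L \<subseteq> zs U" "L \<subseteq> zs W" by (auto simp: link_def)
      then have "U e = Zero" "W e = Zero" using eL by auto
      then show ?case using link_imp_adjacent[OF lk cL] adj UW step.IH by blast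
    qed (use less.prems(1) in simp)
    moreover have "card (zs Y - zs P) < card (zs Y - zs X)"
    proof (intro psubset_card_mono)
      have "a \<noteq> b" using a b by blast
      then have "b \<in> zs Y - insert a L" "zs Y - insert b L \<subseteq> zs Y - insert a L"
        using a(2) b(1) zX(3) by blast+
      then show "zs Y - zs P \<subset> zs Y - zs X" unfolding P(2) zX(1) by blast
    qed simp
    ultimately show ?thesis using less.hyps P(1) Pe by blast
  qed
qed

lemma adjacent_opp: "X \<in> C \<Longrightarrow> Y \<in> C \<Longrightarrow> adjacent E (opp X) (opp Y) \<longleftrightarrow> adjacent E X Y"
proof -
  have "sep (opp X) (opp Y) = sep X Y"
  proof (rule set_eqI)
    fix g show "g \<in> sep (opp X) (opp Y) \<longleftrightarrow> g \<in> sep X Y"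
      by (cases "g \<in> E"; cases "X g"; cases "Y g") (simp_all add: mem_separator_iff)
  qed
  then show ?thesis by (simp add: adjacent_def)
qed

end

text \<open>The setting for completeness: \<open>f\<close> is an isomorphism that exists by
  assumption but is unknown to the program, which sees only \<open>A\<close>.\<close>

locale labelled_graph = modular_system E m C for E :: "nat set" and m and C +
  fixes N :: nat and A :: "nat \<Rightarrow> nat \<Rightarrow> bool" and f :: "nat \<Rightarrow> nat \<Rightarrow> sign"
  assumes bij: "bij_betw f {..<N} C"
    and A_iff: "x < N \<Longrightarrow> y < N \<Longrightarrow> A x y \<longleftrightarrow> adjacent E (f x) (f y)"
begin

abbreviation "k \<equiv> card E - m"

lemma f_in [simp]: "x < N \<Longrightarrow> f x \<in> C"
  using bij_betwE[OF bij] by simp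

lemma f_inj: "x < N \<Longrightarrow> y < N \<Longrightarrow> f x = f y \<Longrightarrow> x = y"
  using bij_betw_imp_inj_on[OF bij] by (simp add: inj_on_def)

lemma f_surj: assumes "X \<in> C" obtains x where "x < N" "f x = X"
  using bij_betw_imp_surj_on[OF bij] assms by (metis imageE lessThan_iff)

lemma gball_iff: "x < N \<Longrightarrow> y < N \<Longrightarrow> gball N A j x y \<longleftrightarrow> ball j (f x) (f y)"
proof (induction j arbitrary: y)
  case 0
  then show ?case using f_inj by auto
next
  case (Suc j)
  have "(\<exists>w<N. A w y \<and> gball N A j x w) \<longleftrightarrow> (\<exists>Z\<in>C. ball j (f x) Z \<and> adjacent E Z (f y))"
    using Suc A_iff f_in f_surj by metis
  then show ?case using Suc by simp
qed

definition anti :: "nat \<Rightarrow> nat" where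
  "anti x = (THE y. y < N \<and> f y = opp (f x))"

lemma anti: assumes "x < N" shows "anti x < N" "f (anti x) = opp (f x)"
proof -
  have "opp (f x) \<in> C" using assms opposite_closed by simp
  then obtain y where "y < N \<and> f y = opp (f x)" using f_surj by metis
  moreover have "y = y'" if "y < N \<and> f y = opp (f x)" "y' < N \<and> f y' = opp (f x)" for y y'
    using that f_inj by metis
  ultimately have "anti x < N \<and> f (anti x) = opp (f x)"
    unfolding anti_def by (intro theI[of "\<lambda>y. y < N \<and> f y = opp (f x)"]) auto
  then show "anti x < N" "f (anti x) = opp (f x)" by auto
qed

lemma anti_anti [simp]: "x < N \<Longrightarrow> anti (anti x) = x"
  by (rule f_inj) (simp_all add: anti)

lemma A_sym: "x < N \<Longrightarrow> y < N \<Longrightarrow> A x y \<longleftrightarrow> A y x"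
  by (simp add: A_iff adjacent_commute)

lemma A_anti: "x < N \<Longrightarrow> y < N \<Longrightarrow> A (anti x) (anti y) \<longleftrightarrow> A x y"
  by (simp add: A_iff anti adjacent_opp)

lemma A_step: "x < N \<Longrightarrow> y < N \<Longrightarrow> A x y \<longleftrightarrow> (\<exists>a b. step (f x) a b (f y))"
  by (simp add: A_iff adjacent_iff_step)

text \<open>The arc from \<open>x\<close> to \<open>y\<close> is labelled by the element that leaves
  the zero set. Each arc has one such label, and the elements of the ground set are recovered
  through their arcs.\<close>

definition drops :: "nat \<Rightarrow> nat \<Rightarrow> nat \<Rightarrow> bool" where
  "drops e x y \<longleftrightarrow> x < N \<and> y < N \<and> (\<exists>b. step (f x) e b (f y))"

lemma drops_iff: "x < N \<Longrightarrow> y < N \<Longrightarrow> drops e x y \<longleftrightarrow> A x y \<and> e \<in> E \<and> f x e = Zero \<and> f y e \<noteq> Zero"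
proof
  assume "x < N" "y < N" "drops e x y"
  then obtain b where "step (f x) e b (f y)" by (auto simp: drops_def)
  then show "A x y \<and> e \<in> E \<and> f x e = Zero \<and> f y e \<noteq> Zero"
    using \<open>x < N\<close> \<open>y < N\<close> A_iff adjacent_iff_step stepD(3,5,8) f_in by metis
next
  assume xy: "x < N" "y < N" and a: "A x y \<and> e \<in> E \<and> f x e = Zero \<and> f y e \<noteq> Zero"
  then obtain a b where st: "step (f x) a b (f y)" using A_iff adjacent_iff_step by auto
  then have "e = a" using stepD(13)[OF st, of e] a by blast
  then show "drops e x y" using xy st by (auto simp: drops_def)
qed

text \<open>Both \<open>x\<close> and \<open>anti w\<close> are neighbours of \<open>p\<close>, so
  by \<open>neighbour_antipodes\<close> the distance from \<open>x\<close> to \<open>w\<close>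
  exceeds \<open>k\<close> only if they coincide.\<close>

lemma antipode_search:
  assumes "x < N" "p < N" "A p x" "w < N"
  shows "A (anti p) w \<and> \<not> gball N A k x w \<longleftrightarrow> w = anti x"
proof
  assume aw: "A (anti p) w \<and> \<not> gball N A k x w"
  have w': "anti w < N" "f (anti w) = opp (f w)" using anti assms(4) by auto
  have "A p (anti w)" using A_anti[of p "anti w"] aw assms w' by simp
  then obtain a b where 1: "step (f p) a b (f (anti w))" using A_step[OF assms(2) w'(1)] by blast
  obtain c d where 2: "step (f p) c d (f x)" using A_step assms by blast
  have "f w = opp (f (anti w))" using w' assms(4) by simp
  then have "f x = f (anti w)"
    using neighbour_antipodes[OF 2 1] gball_iff assms(1,4) aw by auto
  then show "w = anti x" using f_inj assms w' anti_anti by metis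
next
  assume w: "w = anti x"
  have "A (anti p) w" using A_anti w assms by simp
  moreover have "\<not> gball N A k x w" using not_ball_antipode gball_iff anti w assms by simp
  ultimately show "A (anti p) w \<and> \<not> gball N A k x w" by blast
qed

lemma opposite_search:
  assumes "drops e x y" "w < N"
  shows "A x w \<and> gball N A (k - 1) y (anti w) \<longleftrightarrow> drops e x w \<and> f w e = flip (f y e)"
proof -
  have xy: "x < N" "y < N" using assms by (auto simp: drops_def)
  obtain b where Y: "step (f x) e b (f y)" using assms by (auto simp: drops_def)
  show ?thesis
  proof
    assume a: "A x w \<and> gball N A (k - 1) y (anti w)"
    then obtain c d where W: "step (f x) c d (f w)" using A_iff adjacent_iff_step xy assms(2) by auto
    then have "c = e \<and> f w e = flip (f y e)"
      using same_coline_iff[OF Y W] a gball_iff xy assms(2) anti by auto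
    then show "drops e x w \<and> f w e = flip (f y e)" using W xy assms(2) by (auto simp: drops_def)
  next
    assume a: "drops e x w \<and> f w e = flip (f y e)"
    then obtain d where W: "step (f x) e d (f w)" by (auto simp: drops_def)
    then show "A x w \<and> gball N A (k - 1) y (anti w)"
      using same_coline_iff[OF Y W] a gball_iff xy assms(2) anti drops_iff by auto
  qed
qed

lemma transport_search:
  assumes "A p x" "x < N" "f x e = Zero" "drops e p y" "w < N"
  shows "A x w \<and> gball N A (k - 1) y (anti w) \<and> \<not> gball N A (k - 1) p (anti w) \<longleftrightarrow>
    drops e x w \<and> f w e = flip (f y e)"
proof -
  have py: "p < N" "y < N" using assms by (auto simp: drops_def)
  obtain d where Y: "step (f p) e d (f y)" using assms by (auto simp: drops_def)
  obtain a b where X: "step (f p) a b (f x)" using A_iff adjacent_iff_step assms py by auto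
  have "e \<noteq> a" using stepD(8)[OF X] assms(3) by auto
  note iff = transport_iff[OF X Y this]
  show ?thesis
  proof (cases "A x w")
    case True
    then have "adjacent E (f x) (f w)" using A_iff assms by simp
    then show ?thesis
      using iff[of "f w"] True gball_iff py assms(2,5) anti by (auto simp: drops_def)
  next
    case False
    then show ?thesis using drops_iff assms by auto
  qed
qed

lemma drops_exists:
  assumes "x < N" "e \<in> E" "f x e = Zero" "s \<noteq> Zero"
  obtains w where "drops e x w" "f w e = s"
proof -
  obtain b Y where st: "step (f x) e b Y" "Y e = s"
    using step_exists[of "f x" e s] assms by auto
  obtain w where "w < N" "f w = Y" using f_surj stepD(2)[OF st(1)] by metis
  then show thesis using that[of w] st assms by (auto simp: drops_def)
qed

lemma drops_unique: "drops e x w \<Longrightarrow> drops e x w' \<Longrightarrow> f w e = f w' e \<Longrightarrow> w = w'"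
  unfolding drops_def using step_unique(1) f_inj by metis

lemma sign_constant:
  assumes "x < N" "y < N" "A x y" "e \<in> E" "f x e \<noteq> Zero" "f y e \<noteq> Zero"
  shows "f y e = f x e"
proof -
  have "sep (f x) (f y) = {}" using assms A_iff by (auto simp: adjacent_def)
  then show ?thesis using assms unfolding separator_eq_empty_iff by metis
qed

lemma zero_class_connected:
  assumes S: "x \<in> S" "x < N" "f x e = Zero" "e \<in> E"
    and opp: "\<And>u. u \<in> S \<Longrightarrow> u < N \<Longrightarrow> anti u \<in> S"
    and adj: "\<And>u w. u \<in> S \<Longrightarrow> u < N \<Longrightarrow> w < N \<Longrightarrow> f u e = Zero \<Longrightarrow> f w e = Zero \<Longrightarrow> A u w \<Longrightarrow> w \<in> S"
    and y: "y < N" "f y e = Zero"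
  shows "y \<in> S"
proof -
  let ?S = "f ` (S \<inter> {..<N})"
  have "f y \<in> ?S"
  proof (rule contraction_connected[of "f x" ?S e])
    show "opp U \<in> ?S" if "U \<in> ?S" "U \<in> C" for U
    proof -
      obtain u where "u \<in> S" "u < N" "U = f u" using \<open>U \<in> ?S\<close> by auto
      then have "anti u \<in> S \<inter> {..<N}" "opp U = f (anti u)" using opp anti by auto
      then show ?thesis by blast
    qed
    show "W \<in> ?S" if U: "U \<in> ?S" "U e = Zero" and W: "W \<in> C" "W e = Zero" and a: "adjacent E U W" for U W
    proof -
      obtain u where u: "u \<in> S" "u < N" "U = f u" using U by auto
      obtain w where w: "w < N" "f w = W" using f_surj W(1) by metis
      have "A u w" using A_iff u w a by simp
      then have "w \<in> S" using adj u w U W by auto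
      then show ?thesis using w by auto
    qed
  qed (use S y in auto)
  then obtain u where "u \<in> S" "u < N" "f y = f u" by auto
  then show ?thesis using f_inj y by metis
qed

text \<open>Columns may be permuted by \<open>el\<close> and reoriented by \<open>h\<close>:
  validity depends only on which entries vanish and which entries of a column agree, and the last
  clause treats both signs alike.\<close>

lemma valid_matrix_complete:
  assumes el: "bij_betw el {..<n} E" and sg: "\<And>e. e < n \<Longrightarrow> h e = id \<or> h e = flip"
    and \<sigma>: "\<And>x e. x < N \<Longrightarrow> e < n \<Longrightarrow> \<sigma> x e < 3 \<and> sign_of_nat (\<sigma> x e) = h e (f x (el e))"
  shows "valid_matrix N n m A \<sigma>"
proof -
  have elE: "el e \<in> E" if "e < n" for e using that el bij_betwE by fastforce
  have h0: "h e s = Zero \<longleftrightarrow> s = Zero" and hinj: "h e s = h e s' \<longleftrightarrow> s = s'" if "e < n" for e s s'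
    using sg[OF that] by (auto, metis flip_flip)
  have Z: "\<sigma> x e = 0 \<longleftrightarrow> f x (el e) = Zero" if "x < N" "e < n" for x e
    using \<sigma>[OF that] h0[OF that(2), of "f x (el e)"] by (auto simp: sign_of_nat_def split: if_splits)
  have Eq: "\<sigma> x e = \<sigma> y e \<longleftrightarrow> f x (el e) = f y (el e)" if "x < N" "y < N" "e < n" for x y e
  proof -
    have "\<sigma> x e = \<sigma> y e \<longleftrightarrow> sign_of_nat (\<sigma> x e) = sign_of_nat (\<sigma> y e)"
      using \<sigma>[OF that(1,3)] \<sigma>[OF that(2,3)] by (auto simp: sign_of_nat_def split: if_splits)
    then show ?thesis using \<sigma> that hinj by simp
  qed
  have all: "(\<forall>e<n. P (el e)) \<longleftrightarrow> (\<forall>g\<in>E. P g)" for P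
    using el by (metis bij_betw_imp_surj_on elE imageE lessThan_iff)
  have card: "card {e. e < n \<and> P (el e)} = card {g\<in>E. P g}" for P
  proof (rule bij_betw_same_card[of el], rule bij_betw_imageI)
    show "inj_on el {e. e < n \<and> P (el e)}"
      using bij_betw_imp_inj_on[OF el] by (rule inj_on_subset) auto
    show "el ` {e. e < n \<and> P (el e)} = {g \<in> E. P g}"
      unfolding bij_betw_imp_surj_on[OF el, symmetric] by auto
  qed
  show ?thesis
    unfolding valid_matrix_def
  proof (intro conjI allI impI)
    fix x assume x: "x < N"
    show "\<sigma> x e < 3" if "e < n" for e using \<sigma> x that by blast
    have "{e. e < n \<and> \<sigma> x e = 0} = {e. e < n \<and> f x (el e) = Zero}" using Z x by auto
    then show "card {e. e < n \<and> \<sigma> x e = 0} = m"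
      using card[of "\<lambda>g. f x g = Zero"] card_zero[of "f x"] x by (simp add: zero_set_def)
  next
    fix x y e assume xy: "x < N" "y < N" "x \<noteq> y" and e: "e < n" and same: "\<forall>e<n. \<sigma> x e = 0 \<longleftrightarrow> \<sigma> y e = 0"
    have "\<forall>e<n. f x (el e) = Zero \<longleftrightarrow> f y (el e) = Zero" using same Z xy by auto
    then have "zs (f x) = zs (f y)" using all[of "\<lambda>g. f x g = Zero \<longleftrightarrow> f y g = Zero"] by auto
    then have "f y = f x \<or> f y = opp (f x)" using xy by (intro eq_zero_set) auto
    then have "f y = opp (f x)" using f_inj xy by metis
    then have "f y (el e) = flip (f x (el e))" using elE[OF e] by simp
    then show "\<sigma> x e = 0 \<or> \<sigma> x e \<noteq> \<sigma> y e"
      using Z[OF xy(1) e] Eq[OF xy(1,2) e] by auto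
  next
    fix x y assume xy: "x < N" "y < N" "x \<noteq> y"
    have "{e. e < n \<and> (\<sigma> x e = 0) \<noteq> (\<sigma> y e = 0)} = {e. e < n \<and> (f x (el e) = Zero) \<noteq> (f y (el e) = Zero)}"
      by (simp add: Z[OF xy(1)] Z[OF xy(2)] cong: conj_cong)
    moreover have "{g \<in> E. (f x g = Zero) \<noteq> (f y g = Zero)} = (zs (f x) - zs (f y)) \<union> (zs (f y) - zs (f x))"
      by auto
    ultimately have 1: "card {e. e < n \<and> (\<sigma> x e = 0) \<noteq> (\<sigma> y e = 0)} = card ((zs (f x) - zs (f y)) \<union> (zs (f y) - zs (f x)))"
      using card[of "\<lambda>g. (f x g = Zero) \<noteq> (f y g = Zero)"] by simp
    have 2: "(\<forall>e<n. \<sigma> x e = 0 \<or> \<sigma> y e = 0 \<or> \<sigma> x e = \<sigma> y e) \<longleftrightarrow> sep (f x) (f y) = {}"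
      unfolding separator_eq_empty_iff
        all[of "\<lambda>g. f x g = Zero \<or> f y g = Zero \<or> f x g = f y g", symmetric]
      by (simp add: Z[OF xy(1)] Z[OF xy(2)] Eq[OF xy(1,2)])
    show "A x y \<longleftrightarrow> card {e. e < n \<and> (\<sigma> x e = 0) \<noteq> (\<sigma> y e = 0)} = 2 \<and>
           (\<forall>e<n. \<sigma> x e = 0 \<or> \<sigma> y e = 0 \<or> \<sigma> x e = \<sigma> y e)"
      unfolding 1 2 A_iff[OF xy(1,2)] adjacent_def by simp
  next
    fix x e assume x: "x < N" and e: "e < n" and z: "\<sigma> x e = 0"
    have "f x (el e) = Zero" using Z x e z by simp
    note ex = drops_exists[OF x elE[OF e] this]
    have "\<exists>y<N. A x y \<and> \<sigma> y e = t" if t: "t = 1 \<or> t = 2" for t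
    proof -
      define s where "s = h e (sign_of_nat t)"
      have st: "h e s = sign_of_nat t" using sg[OF e] by (auto simp: s_def)
      have "sign_of_nat t \<noteq> Zero" using t by (auto simp: sign_of_nat_def)
      then have "s \<noteq> Zero" using h0[OF e] by (simp add: s_def)
      then obtain y where y: "drops (el e) x y" "f y (el e) = s" using ex by metis
      then have "y < N" by (simp add: drops_def)
      then have "sign_of_nat (\<sigma> y e) = sign_of_nat t" "\<sigma> y e < 3" using \<sigma>[of y e] e y st by auto
      then have "\<sigma> y e = t" using t by (auto simp: sign_of_nat_def split: if_splits)
      then show ?thesis using y \<open>y < N\<close> drops_iff x by blast
    qed
    then show "\<exists>y<N. A x y \<and> \<sigma> y e = 1" "\<exists>y<N. A x y \<and> \<sigma> y e = 2" by auto
  qed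
qed

end

section \<open>A for-language with static time bounds\<close>

text \<open>Loops run over a range whose bound is a stored scalar, so termination and a time bound
  can be read off the program text once the bounds are known. In particular a wrong guess cannot
  prolong the computation.\<close>

datatype fprog =
    FSkip
  | FPut string expr expr
  | FSeq fprog fprog
  | FIf test fprog fprog
  | FFor string string fprog  \<comment> \<open>\<open>FFor v b p\<close>: run \<open>p\<close> for \<open>v[0] = 0, \<dots>, b[0] - 1\<close>\<close>

abbreviation "V x \<equiv> Get x (Num 0)"
abbreviation "FSet x e \<equiv> FPut x (Num 0) e"
abbreviation "FWhen b p \<equiv> FIf b p FSkip"

primrec compile :: "fprog \<Rightarrow> prog" where
  "compile FSkip = Skip"
| "compile (FPut a i e) = Put a i e"
| "compile (FSeq p q) = Seq (compile p) (compile q)"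
| "compile (FIf b p q) = Branch b (compile p) (compile q)"
| "compile (FFor v b p) = Seq (Put v (Num 0) (Num 0))
     (Loop (Less (V v) (V b)) (Seq (compile p) (Put v (Num 0) (Add (V v) (Num 1)))))"

definition setv :: "store \<Rightarrow> string \<Rightarrow> nat \<Rightarrow> store" where
  "setv s v i = s(v := (s v)(0 := i))"

lemma setv_same [simp]: "setv s v i v 0 = i"
  by (simp add: setv_def)

lemma setv_other [simp]: "a \<noteq> v \<Longrightarrow> setv s v i a = s a"
  by (simp add: setv_def)

text \<open>The bound of a loop is read once on entry, whereas the compiled loop reads it in every
  round; \<open>runs_compile\<close> therefore demands that bounds are never written and that a loop
  body leaves its counter alone.\<close>

primrec exec :: "fprog \<Rightarrow> store \<Rightarrow> store" where
  "exec FSkip s = s"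
| "exec (FPut a i e) s = s(a := (s a)(val i s := val e s))"
| "exec (FSeq p q) s = exec q (exec p s)"
| "exec (FIf b p q) s = (if holds b s then exec p s else exec q s)"
| "exec (FFor v b p) s = fold (\<lambda>i t. setv (exec p t) v (Suc i)) [0..<s b 0] (setv s v 0)"

primrec writes :: "fprog \<Rightarrow> string set" where
  "writes FSkip = {}"
| "writes (FPut a i e) = {a}"
| "writes (FSeq p q) = writes p \<union> writes q"
| "writes (FIf b p q) = writes p \<union> writes q"
| "writes (FFor v b p) = insert v (writes p)"

primrec bounds :: "fprog \<Rightarrow> string set" where
  "bounds FSkip = {}"
| "bounds (FPut a i e) = {}"
| "bounds (FSeq p q) = bounds p \<union> bounds q"
| "bounds (FIf b p q) = bounds p \<union> bounds q"
| "bounds (FFor v b p) = insert b (bounds p)"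

primrec counters_ok :: "fprog \<Rightarrow> bool" where
  "counters_ok FSkip \<longleftrightarrow> True"
| "counters_ok (FPut a i e) \<longleftrightarrow> True"
| "counters_ok (FSeq p q) \<longleftrightarrow> counters_ok p \<and> counters_ok q"
| "counters_ok (FIf b p q) \<longleftrightarrow> counters_ok p \<and> counters_ok q"
| "counters_ok (FFor v b p) \<longleftrightarrow> v \<notin> writes p \<and> counters_ok p"

text \<open>A loop costs 3 for setting the counter and 6 for the failing test, together 9; each
  round adds 6 for the test and 6 for the increment, together 12. Both branches of a conditional are
  charged.\<close>

primrec time_bound :: "(string \<Rightarrow> nat) \<Rightarrow> fprog \<Rightarrow> nat" where
  "time_bound \<rho> FSkip = 1"
| "time_bound \<rho> (FPut a i e) = 1 + expr_cost i + expr_cost e"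
| "time_bound \<rho> (FSeq p q) = time_bound \<rho> p + time_bound \<rho> q"
| "time_bound \<rho> (FIf b p q) = 1 + test_cost b + time_bound \<rho> p + time_bound \<rho> q"
| "time_bound \<rho> (FFor v b p) = 9 + \<rho> b * (12 + time_bound \<rho> p)"

lemma exec_unchanged: "a \<notin> writes p \<Longrightarrow> exec p s a = s a"
proof (induction p arbitrary: s)
  case (FFor v b p)
  have "fold (\<lambda>i t. setv (exec p t) v (Suc i)) xs t a = t a" for xs t
    using FFor by (induction xs arbitrary: t) auto
  then show ?case using FFor.prems by simp
qed auto

lemma runs_compile:
  assumes "counters_ok p" "writes p \<inter> bounds p = {}" "\<And>b. b \<in> bounds p \<Longrightarrow> s b 0 = \<rho> b"
  shows "\<exists>t\<le>time_bound \<rho> p. runs (compile p) s t (exec p s)"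
  using assms
proof (induction p arbitrary: s)
  case FSkip
  then show ?case using runs.Skip by auto
next
  case (FPut a i e)
  show ?case unfolding compile.simps exec.simps time_bound.simps using runs.Put by blast
next
  case (FSeq p q)
  have "exec p s b = s b" if "b \<in> bounds q" for b
    using FSeq.prems(2) that by (intro exec_unchanged) auto
  then have "\<exists>t\<le>time_bound \<rho> q. runs (compile q) (exec p s) t (exec q (exec p s))"
    using FSeq.prems by (intro FSeq.IH(2)) auto
  moreover have "\<exists>t\<le>time_bound \<rho> p. runs (compile p) s t (exec p s)"
    using FSeq.prems by (intro FSeq.IH(1)) auto
  ultimately obtain t u where "t \<le> time_bound \<rho> p" "runs (compile p) s t (exec p s)"
    "u \<le> time_bound \<rho> q" "runs (compile q) (exec p s) u (exec q (exec p s))" by blast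
  then show ?case by (intro exI[of _ "t + u"]) (auto intro: runs.Seq)
next
  case (FIf b p q)
  show ?case
  proof (cases "holds b s")
    case True
    have "\<exists>t\<le>time_bound \<rho> p. runs (compile p) s t (exec p s)"
      using FIf.prems by (intro FIf.IH(1)) auto
    then obtain t where "t \<le> time_bound \<rho> p" "runs (compile p) s t (exec p s)" by blast
    then show ?thesis using True by (intro exI[of _ "1 + test_cost b + t"]) (auto intro: runs.BranchTrue[simplified])
  next
    case False
    have "\<exists>t\<le>time_bound \<rho> q. runs (compile q) s t (exec q s)"
      using FIf.prems by (intro FIf.IH(2)) auto
    then obtain t where "t \<le> time_bound \<rho> q" "runs (compile q) s t (exec q s)" by blast
    then show ?thesis using False by (intro exI[of _ "1 + test_cost b + t"]) (auto intro: runs.BranchFalse[simplified])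
  qed
next
  case (FFor v b p)
  let ?c = "Less (V v) (V b)" and ?i = "Put v (Num 0) (Add (V v) (Num 1))"
  let ?body = "Seq (compile p) ?i"
  let ?step = "\<lambda>i t. setv (exec p t) v (Suc i)"
  have v: "v \<notin> writes p" "v \<notin> bounds (FFor v b p)" using FFor.prems by auto
  have loop: "\<exists>u\<le>6 + (\<rho> b - i) * (12 + time_bound \<rho> p). runs (Loop ?c ?body) t u (fold ?step [i..<\<rho> b] t)"
    if "i \<le> \<rho> b" "t v 0 = i" "\<And>a. a \<in> bounds (FFor v b p) \<Longrightarrow> t a 0 = \<rho> a" for i t
    using that
  proof (induction "\<rho> b - i" arbitrary: i t)
    case 0
    then have "\<not> holds ?c t" by simp
    then have "runs (Loop ?c ?body) t 6 t" using runs.LoopFalse[of ?c t ?body] by (simp add: eval_nat_numeral)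
    then show ?case using 0 by auto
  next
    case (Suc d)
    then have lt: "i < \<rho> b" by simp
    then have h: "holds ?c t" using Suc.prems by simp
    have "\<exists>u\<le>time_bound \<rho> p. runs (compile p) t u (exec p t)"
      using FFor.prems Suc.prems by (intro FFor.IH) auto
    then obtain u1 where u1: "u1 \<le> time_bound \<rho> p" "runs (compile p) t u1 (exec p t)" by blast
    have "exec p t v 0 = i" using exec_unchanged[OF v(1)] Suc.prems by simp
    then have "runs ?i (exec p t) 6 (?step i t)"
      using runs.Put[of v "Num 0" "Add (V v) (Num 1)" "exec p t"]
      by (simp add: setv_def eval_nat_numeral)
    then have body: "runs ?body t (u1 + 6) (?step i t)" using u1(2) by (rule runs.Seq[rotated])
    have "?step i t a 0 = \<rho> a" if a: "a \<in> bounds (FFor v b p)" for a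
    proof -
      have "exec p t a = t a" using FFor.prems(2) a by (intro exec_unchanged) auto
      moreover have "a \<noteq> v" using v(2) a by blast
      ultimately show ?thesis using Suc.prems(3)[OF a] by simp
    qed
    then have "\<exists>u\<le>6 + (\<rho> b - Suc i) * (12 + time_bound \<rho> p).
        runs (Loop ?c ?body) (?step i t) u (fold ?step [Suc i..<\<rho> b] (?step i t))"
      using Suc.hyps(2) lt by (intro Suc.hyps(1)) simp_all
    then obtain u2 where u2: "u2 \<le> 6 + (\<rho> b - Suc i) * (12 + time_bound \<rho> p)"
      "runs (Loop ?c ?body) (?step i t) u2 (fold ?step [Suc i..<\<rho> b] (?step i t))" by blast
    have "runs (Loop ?c ?body) t (1 + test_cost ?c + (u1 + 6) + u2) (fold ?step [Suc i..<\<rho> b] (?step i t))"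
      using runs.LoopTrue[OF h body u2(2)] .
    moreover have "1 + test_cost ?c + (u1 + 6) + u2 \<le> 6 + (\<rho> b - i) * (12 + time_bound \<rho> p)"
    proof -
      have "\<rho> b - i = Suc (\<rho> b - Suc i)" using lt by simp
      then show ?thesis using u1(1) u2(1) by simp
    qed
    moreover have "fold ?step [Suc i..<\<rho> b] (?step i t) = fold ?step [i..<\<rho> b] t"
      using lt by (simp add: upt_conv_Cons)
    ultimately show ?case by metis
  qed
  have init: "runs (Put v (Num 0) (Num 0)) s 3 (setv s v 0)"
    using runs.Put[of v "Num 0" "Num 0" s] by (simp add: setv_def eval_nat_numeral)
  have "\<exists>u\<le>6 + (\<rho> b - 0) * (12 + time_bound \<rho> p).
      runs (Loop ?c ?body) (setv s v 0) u (fold ?step [0..<\<rho> b] (setv s v 0))"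
  proof (rule loop)
    fix a assume a: "a \<in> bounds (FFor v b p)"
    then have "a \<noteq> v" using v(2) by blast
    then show "setv s v 0 a 0 = \<rho> a" using FFor.prems(3)[OF a] by simp
  qed simp_all
  then obtain u where "u \<le> 6 + \<rho> b * (12 + time_bound \<rho> p)"
    "runs (Loop ?c ?body) (setv s v 0) u (fold ?step [0..<\<rho> b] (setv s v 0))" by auto
  moreover have "s b 0 = \<rho> b" using FFor.prems by simp
  ultimately show ?case using runs.Seq[OF init] by (intro exI[of _ "3 + u"]) auto
qed

section \<open>Rules for common loops: invariants, selection, flags, counting, array updates,
  searches\<close>

lemma exec_For:
  assumes "I 0 (setv s v 0)" "v \<noteq> b" "b \<notin> writes p" "v \<notin> writes p"
    and "\<And>i t. i < s b 0 \<Longrightarrow> I i t \<Longrightarrow> t v 0 = i \<Longrightarrow> (\<And>a. a \<notin> insert v (writes p) \<Longrightarrow> t a = s a) \<Longrightarrow>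
        I (Suc i) (setv (exec p t) v (Suc i))"
  shows "I (s b 0) (exec (FFor v b p) s)"
proof -
  have "I n (fold (\<lambda>i t. setv (exec p t) v (Suc i)) [0..<n] (setv s v 0)) \<and>
    fold (\<lambda>i t. setv (exec p t) v (Suc i)) [0..<n] (setv s v 0) v 0 = n" if "n \<le> s b 0" for n
    using that
  proof (induction n)
    case 0
    have "fold (\<lambda>i t. setv (exec p t) v (Suc i)) [0..<0] (setv s v 0) = setv s v 0" by simp
    moreover have "setv s v 0 v 0 = 0" by simp
    ultimately show ?case using assms(1) by metis
  next
    case (Suc n)
    let ?t = "fold (\<lambda>i t. setv (exec p t) v (Suc i)) [0..<n] (setv s v 0)"
    have "?t a = s a" if "a \<notin> insert v (writes p)" for a
    proof -
      have "fold (\<lambda>i t. setv (exec p t) v (Suc i)) xs u a = u a" for xs u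
        using that by (induction xs arbitrary: u) (auto simp: exec_unchanged)
      then show ?thesis using that by simp
    qed
    moreover have "n < s b 0" "I n ?t" "?t v 0 = n" using Suc by auto
    ultimately have "I (Suc n) (setv (exec p ?t) v (Suc n))" using assms(5)[of n ?t] by blast
    moreover have "fold (\<lambda>i t. setv (exec p t) v (Suc i)) [0..<Suc n] (setv s v 0) = setv (exec p ?t) v (Suc n)"
      by simp
    ultimately show ?case by (metis setv_same)
  qed
  from this[of "s b 0"] show ?thesis by simp
qed

text \<open>Later hits overwrite earlier ones; only the fact that the result comes from some hit is
  recorded, which suffices where the hit is unique or arbitrary.\<close>

lemma exec_For_select:
  assumes "v \<noteq> b" "b \<notin> writes p" "v \<notin> writes p" "d \<noteq> v"
    and "\<And>i t. i < s b 0 \<Longrightarrow> t v 0 = i \<Longrightarrow> (\<And>a. a \<notin> insert v (writes p) \<Longrightarrow> t a = s a) \<Longrightarrow>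
        exec p t d 0 = (if Q i then w i else t d 0)"
  shows "(\<exists>i<s b 0. Q i \<and> exec (FFor v b p) s d 0 = w i) \<or>
    ((\<forall>i<s b 0. \<not> Q i) \<and> exec (FFor v b p) s d 0 = s d 0)"
proof -
  let ?I = "\<lambda>i t. (\<exists>j<i. Q j \<and> t d 0 = w j) \<or> ((\<forall>j<i. \<not> Q j) \<and> t d 0 = s d 0)"
  show ?thesis
  proof (rule exec_For[where I = ?I])
    fix i t assume i: "i < s b 0" and I: "?I i t" and t: "t v 0 = i" "\<And>a. a \<notin> insert v (writes p) \<Longrightarrow> t a = s a"
    have e: "exec p t d 0 = (if Q i then w i else t d 0)" by (rule assms(5)[OF i t])
    have d: "setv (exec p t) v (Suc i) d = exec p t d" using assms(4) by simp
    show "?I (Suc i) (setv (exec p t) v (Suc i))"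
      unfolding d e using I by (cases "Q i") (auto simp: less_Suc_eq)
  qed (use assms(1-4) in simp_all)
qed

lemma exec_For_flag:
  assumes "v \<noteq> b" "b \<notin> writes p" "v \<notin> writes p" "d \<noteq> v"
    and "\<And>i t. i < s b 0 \<Longrightarrow> t v 0 = i \<Longrightarrow> (\<And>a. a \<notin> insert v (writes p) \<Longrightarrow> t a = s a) \<Longrightarrow>
        exec p t d 0 = (if Q i then c else t d 0)"
  shows "exec (FFor v b p) s d 0 = (if \<exists>i<s b 0. Q i then c else s d 0)"
proof -
  have "(\<exists>i<s b 0. Q i \<and> exec (FFor v b p) s d 0 = c) \<or>
      ((\<forall>i<s b 0. \<not> Q i) \<and> exec (FFor v b p) s d 0 = s d 0)"
    by (rule exec_For_select[OF assms(1-4)]) (rule assms(5))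
  then show ?thesis by metis
qed

lemma exec_For_count:
  assumes "v \<noteq> b" "b \<notin> writes p" "v \<notin> writes p" "d \<noteq> v"
    and "\<And>i t. i < s b 0 \<Longrightarrow> t v 0 = i \<Longrightarrow> (\<And>a. a \<notin> insert v (writes p) \<Longrightarrow> t a = s a) \<Longrightarrow>
        exec p t d 0 = (if Q i then Suc (t d 0) else t d 0)"
  shows "exec (FFor v b p) s d 0 = s d 0 + card {i. i < s b 0 \<and> Q i}"
proof (rule exec_For[where I = "\<lambda>i t. t d 0 = s d 0 + card {j. j < i \<and> Q j}"])
  fix i t assume i: "i < s b 0" and I: "t d 0 = s d 0 + card {j. j < i \<and> Q j}"
    and t: "t v 0 = i" "\<And>a. a \<notin> insert v (writes p) \<Longrightarrow> t a = s a"
  have "{j. j < Suc i \<and> Q j} = (if Q i then insert i {j. j < i \<and> Q j} else {j. j < i \<and> Q j})"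
    by (auto simp: less_Suc_eq)
  then show "setv (exec p t) v (Suc i) d 0 = s d 0 + card {j. j < Suc i \<and> Q j}"
    using assms(4) assms(5)[OF i t] I by simp
qed (use assms(1-4) in simp_all)

lemma exec_For_update:
  assumes "v \<noteq> b" "b \<notin> writes p" "v \<notin> writes p" "d \<noteq> v"
    and "\<And>i t. i < s b 0 \<Longrightarrow> t v 0 = i \<Longrightarrow> (\<And>a. a \<notin> insert v (writes p) \<Longrightarrow> t a = s a) \<Longrightarrow>
        t d i = s d i \<Longrightarrow> exec p t d = (t d)(i := h i)"
  shows "exec (FFor v b p) s d c = (if c < s b 0 then h c else s d c)"
proof -
  have "\<forall>c. exec (FFor v b p) s d c = (if c < s b 0 then h c else s d c)"
  proof (rule exec_For[where I = "\<lambda>i t. \<forall>c. t d c = (if c < i then h c else s d c)"])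
    fix i t assume i: "i < s b 0" and I: "\<forall>c. t d c = (if c < i then h c else s d c)"
      and t: "t v 0 = i" "\<And>a. a \<notin> insert v (writes p) \<Longrightarrow> t a = s a"
    have "t d i = s d i" using I by simp
    then have "exec p t d = (t d)(i := h i)" using assms(5)[OF i t] by blast
    then show "\<forall>c. setv (exec p t) v (Suc i) d c = (if c < Suc i then h c else s d c)"
      using assms(4) I by (simp add: less_Suc_eq)
  qed (use assms(1-4) in simp_all)
  then show ?thesis by blast
qed

lemma matrix_index_eq: "y < N \<Longrightarrow> y' < N \<Longrightarrow> x * N + y = x' * N + y' \<longleftrightarrow> x = x' \<and> y = (y' :: nat)"
  by (metis add.commute add_right_cancel div_mult_self1 div_less mod_less mod_mult_self1 add_0 not_less_zero)

text \<open>Every cell is written in its own round only. The body may therefore rely on the initial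
  content of that cell, as the growth of balls does.\<close>

lemma exec_For_matrix:
  assumes "u \<noteq> v" "u \<noteq> b" "v \<noteq> b" "b \<notin> writes p" "u \<notin> writes p" "v \<notin> writes p" "d \<noteq> u" "d \<noteq> v"
    and N: "s b 0 = N"
    and body: "\<And>x y t. x < N \<Longrightarrow> y < N \<Longrightarrow> t u 0 = x \<Longrightarrow> t v 0 = y \<Longrightarrow>
        (\<And>a. a \<notin> insert u (insert v (writes p)) \<Longrightarrow> t a = s a) \<Longrightarrow>
        t d (x * N + y) = s d (x * N + y) \<Longrightarrow> exec p t d = (t d)(x * N + y := h x y)"
  shows "x < N \<Longrightarrow> y < N \<Longrightarrow> exec (FFor u b (FFor v b p)) s d (x * N + y) = h x y"
proof -
  have "\<forall>x<N. \<forall>y<N. exec (FFor u b (FFor v b p)) s d (x * N + y) = (if x < s b 0 then h x y else s d (x * N + y))"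
  proof (rule exec_For[where I = "\<lambda>i t. \<forall>x<N. \<forall>y<N. t d (x * N + y) = (if x < i then h x y else s d (x * N + y))"])
    fix i t assume i: "i < s b 0" "t u 0 = i"
      and I: "\<forall>x<N. \<forall>y<N. t d (x * N + y) = (if x < i then h x y else s d (x * N + y))"
      and fr: "\<And>a. a \<notin> insert u (writes (FFor v b p)) \<Longrightarrow> t a = s a"
    have tb: "t b 0 = N" using fr[of b] assms N by simp
    have "\<forall>x<N. \<forall>y<N. exec (FFor v b p) t d (x * N + y) =
        (if x = i \<and> y < t b 0 then h x y else t d (x * N + y))"
    proof (rule exec_For[where I = "\<lambda>j w. \<forall>x<N. \<forall>y<N. w d (x * N + y) = (if x = i \<and> y < j then h x y else t d (x * N + y))"])
      fix j w assume j: "j < t b 0" "w v 0 = j"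
        and J: "\<forall>x<N. \<forall>y<N. w d (x * N + y) = (if x = i \<and> y < j then h x y else t d (x * N + y))"
        and fr': "\<And>a. a \<notin> insert v (writes p) \<Longrightarrow> w a = t a"
      have "exec p w d = (w d)(i * N + j := h i j)"
      proof (rule body)
        show "w u 0 = i" using fr'[of u] assms i by simp
        show "w a = s a" if "a \<notin> insert u (insert v (writes p))" for a
          using fr'[of a] fr[of a] that by simp
        show "w d (i * N + j) = s d (i * N + j)" using I J i j N tb by simp
      qed (use i j N tb in simp_all)
      then show "\<forall>x<N. \<forall>y<N. setv (exec p w) v (Suc j) d (x * N + y) =
          (if x = i \<and> y < Suc j then h x y else t d (x * N + y))"
        using J j tb assms(8) by (auto simp: matrix_index_eq less_Suc_eq)
    qed (use assms in simp_all)
    then show "\<forall>x<N. \<forall>y<N. setv (exec (FFor v b p) t) u (Suc i) d (x * N + y) =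
        (if x < Suc i then h x y else s d (x * N + y))"
      using I tb assms(7) by (simp add: less_Suc_eq del: exec.simps)
  qed (use assms in simp_all)
  then show "x < N \<Longrightarrow> y < N \<Longrightarrow> exec (FFor u b (FFor v b p)) s d (x * N + y) = h x y"
    using N by simp
qed

lemma exec_For_search:
  assumes "v \<noteq> b" "b \<noteq> d" "d \<noteq> v"
    and "\<And>i t. i < s b 0 \<Longrightarrow> t v 0 = i \<Longrightarrow> (\<And>a. a \<notin> {v, d} \<Longrightarrow> t a = s a) \<Longrightarrow> holds c t \<longleftrightarrow> Q i"
  shows "(exec (FFor v b (FWhen c (FSet d (V v)))) s d 0 < s b 0 \<and> Q (exec (FFor v b (FWhen c (FSet d (V v)))) s d 0)) \<or>
    ((\<forall>i<s b 0. \<not> Q i) \<and> exec (FFor v b (FWhen c (FSet d (V v)))) s d 0 = s d 0)"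
proof -
  have "(\<exists>i<s b 0. Q i \<and> exec (FFor v b (FWhen c (FSet d (V v)))) s d 0 = i) \<or>
    ((\<forall>i<s b 0. \<not> Q i) \<and> exec (FFor v b (FWhen c (FSet d (V v)))) s d 0 = s d 0)"
  proof (rule exec_For_select)
    fix i t assume i: "i < s b 0" "t v 0 = i" and fr: "\<And>a. a \<notin> insert v (writes (FWhen c (FSet d (V v)))) \<Longrightarrow> t a = s a"
    have "holds c t \<longleftrightarrow> Q i" using i fr by (intro assms(4)) auto
    then show "exec (FWhen c (FSet d (V v))) t d 0 = (if Q i then i else t d 0)" using i by simp
  qed (use assms in simp_all)
  then show ?thesis by metis
qed

section \<open>Verification of a sign matrix\<close>

text \<open>Row offsets are looked up in tables \<open>row\<close> and \<open>rn\<close>, which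
  \<open>offsets\<close> fills by repeated addition: the machine has no product to form
  \<open>x * N + y\<close>.\<close>

abbreviation adjT :: "expr \<Rightarrow> expr \<Rightarrow> test" where
  "adjT x y \<equiv> Equal (Get ''adj'' (Add (Get ''row'' x) y)) (Num 1)"

abbreviation signE :: "string \<Rightarrow> expr" where
  "signE x \<equiv> Get ''cocircuits'' (Add (Get ''rn'' (V x)) (V ''e''))"

abbreviation "incr x \<equiv> FSet x (Add (V x) (Num 1))"
abbreviation "reject \<equiv> FSet ''accept'' (Num 0)"

definition graph_store :: "nat \<Rightarrow> (nat \<Rightarrow> nat \<Rightarrow> bool) \<Rightarrow> store \<Rightarrow> bool" where
  "graph_store N A s \<longleftrightarrow> s ''N'' 0 = N \<and> (\<forall>x<N. s ''row'' x = x * N) \<and>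
     (\<forall>x<N. \<forall>y<N. s ''adj'' (x * N + y) = (if A x y then 1 else 0))"

definition matrix_store :: "nat \<Rightarrow> nat \<Rightarrow> store \<Rightarrow> bool" where
  "matrix_store N n s \<longleftrightarrow> s ''n'' 0 = n \<and> (\<forall>x<N. s ''rn'' x = x * n)"

lemma graph_store_cong:
  "graph_store N A s \<Longrightarrow> t ''N'' = s ''N'' \<Longrightarrow> t ''row'' = s ''row'' \<Longrightarrow> t ''adj'' = s ''adj'' \<Longrightarrow> graph_store N A t"
  by (simp add: graph_store_def)

lemma matrix_store_cong:
  "matrix_store N n s \<Longrightarrow> t ''n'' = s ''n'' \<Longrightarrow> t ''rn'' = s ''rn'' \<Longrightarrow> matrix_store N n t"
  by (simp add: matrix_store_def)

lemma holds_adjT: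
  "graph_store N A s \<Longrightarrow> val x s < N \<Longrightarrow> val y s < N \<Longrightarrow> holds (adjT x y) s \<longleftrightarrow> A (val x s) (val y s)"
  by (simp add: graph_store_def)

definition check_row :: fprog where
  "check_row = FSeq (FSet ''d'' (Num 0))
     (FSeq (FFor ''e'' ''n'' (FSeq (FWhen (Equal (signE ''x'') (Num 0)) (incr ''d''))
                                (FWhen (Neg (Less (signE ''x'') (Num 3))) reject)))
       (FWhen (Neg (Equal (V ''d'') (V ''z''))) reject))"

text \<open>\<open>q\<close> counts the positions where exactly one row vanishes, \<open>g\<close>
  records an equal pair of nonzero entries and \<open>h\<close> a different one. So
  \<open>q = 0\<close> means equal zero sets, and \<open>q = 2\<close> with \<open>h = 0\<close>
  means adjacency.\<close>

definition check_pair :: fprog where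
  "check_pair = FSeq (FSet ''q'' (Num 0)) (FSeq (FSet ''h'' (Num 0)) (FSeq (FSet ''g'' (Num 0))
     (FSeq (FFor ''e'' ''n''
        (FIf (Equal (signE ''x'') (Num 0))
           (FIf (Equal (signE ''y'') (Num 0)) FSkip (incr ''q''))
           (FIf (Equal (signE ''y'') (Num 0)) (incr ''q'')
             (FIf (Equal (signE ''x'') (signE ''y'')) (FSet ''g'' (Num 1)) (FSet ''h'' (Num 1))))))
       (FSeq (FWhen (Conj (Equal (V ''q'') (Num 0)) (Equal (V ''g'') (Num 1))) reject)
         (FIf (Conj (Equal (V ''q'') (Num 2)) (Equal (V ''h'') (Num 0)))
            (FWhen (Neg (adjT (V ''x'') (V ''y''))) reject)
            (FWhen (adjT (V ''x'') (V ''y'')) reject))))))"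

definition check_element :: fprog where
  "check_element = FWhen (Equal (signE ''x'') (Num 0))
     (FSeq (FSet ''q'' (Num 0)) (FSeq (FSet ''h'' (Num 0))
       (FSeq (FFor ''y'' ''N'' (FWhen (adjT (V ''x'') (V ''y''))
           (FSeq (FWhen (Equal (signE ''y'') (Num 1)) (FSet ''q'' (Num 1)))
                 (FWhen (Equal (signE ''y'') (Num 2)) (FSet ''h'' (Num 1))))))
         (FIf (Equal (V ''q'') (Num 0)) reject (FWhen (Equal (V ''h'') (Num 0)) reject)))))"

definition verify :: fprog where
  "verify = FSeq (FSet ''accept'' (Num 1))
     (FSeq (FFor ''x'' ''N'' check_row)
       (FSeq (FFor ''x'' ''N'' (FFor ''y'' ''N'' (FWhen (Neg (Equal (V ''x'') (V ''y''))) check_pair)))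
          (FFor ''x'' ''N'' (FFor ''e'' ''n'' check_element))))"

lemma writes_check [simp]:
  "writes check_row = {''d'', ''e'', ''accept''}"
  "writes check_pair = {''q'', ''h'', ''g'', ''e'', ''accept''}"
  "writes check_element = {''q'', ''h'', ''y'', ''accept''}"
  by (auto simp: check_row_def check_pair_def check_element_def)

context
  fixes N n z :: nat and A :: "nat \<Rightarrow> nat \<Rightarrow> bool" and \<sigma> :: "nat \<Rightarrow> nat \<Rightarrow> nat"
begin

definition checked :: "store \<Rightarrow> bool" where
  "checked s \<longleftrightarrow> graph_store N A s \<and> matrix_store N n s \<and> s ''z'' 0 = z \<and>
     (\<forall>x<N. \<forall>e<n. s ''cocircuits'' (x * n + e) = \<sigma> x e)"

lemma checked_cong:
  "checked s \<Longrightarrow> t ''N'' = s ''N'' \<Longrightarrow> t ''row'' = s ''row'' \<Longrightarrow> t ''adj'' = s ''adj'' \<Longrightarrow>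
    t ''n'' = s ''n'' \<Longrightarrow> t ''rn'' = s ''rn'' \<Longrightarrow> t ''z'' = s ''z'' \<Longrightarrow>
    t ''cocircuits'' = s ''cocircuits'' \<Longrightarrow> checked t"
  by (simp add: checked_def graph_store_def matrix_store_def)

lemma checked_val:
  assumes "checked s"
  shows "s x 0 < N \<Longrightarrow> s ''e'' 0 < n \<Longrightarrow> val (signE x) s = \<sigma> (s x 0) (s ''e'' 0)"
    "s ''x'' 0 < N \<Longrightarrow> s ''y'' 0 < N \<Longrightarrow> holds (adjT (V ''x'') (V ''y'')) s \<longleftrightarrow> A (s ''x'' 0) (s ''y'' 0)"
    "s ''N'' 0 = N" "s ''n'' 0 = n" "s ''z'' 0 = z"
  using assms by (simp_all add: checked_def matrix_store_def graph_store_def)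

lemma exec_check_row:
  assumes s: "checked s" and x: "s ''x'' 0 = x" "x < N"
  shows "exec check_row s ''accept'' 0 =
    (if (\<exists>e<n. \<not> \<sigma> x e < 3) \<or> card {e. e < n \<and> \<sigma> x e = 0} \<noteq> z then 0 else s ''accept'' 0)"
proof -
  define s1 where "s1 = exec (FSet ''d'' (Num 0)) s"
  let ?body = "FSeq (FWhen (Equal (signE ''x'') (Num 0)) (incr ''d''))
      (FWhen (Neg (Less (signE ''x'') (Num 3))) reject)"
  have s1: "checked s1" "s1 ''x'' 0 = x" "s1 ''d'' 0 = 0" "s1 ''accept'' = s ''accept''"
    using s x checked_cong[OF s, of s1] by (simp_all add: s1_def)
  have t: "val (signE ''x'') t = \<sigma> x i" if "i < s1 ''n'' 0" "t ''e'' 0 = i"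
    "\<And>a. a \<notin> insert ''e'' (writes ?body) \<Longrightarrow> t a = s1 a" for i t
  proof -
    have "checked t" using checked_cong[OF s1(1)] that(3) by simp
    moreover have "t ''x'' 0 = x" using that(3)[of "''x''"] s1 by simp
    ultimately show ?thesis using checked_val(1)[of t "''x''"] that(1,2) x checked_val(4)[OF s1(1)] by simp
  qed
  define s2 where "s2 = exec (FFor ''e'' ''n'' ?body) s1"
  have d: "s2 ''d'' 0 = s1 ''d'' 0 + card {i. i < s1 ''n'' 0 \<and> \<sigma> x i = 0}"
    unfolding s2_def by (rule exec_For_count) (use t in simp_all)
  have a: "s2 ''accept'' 0 = (if \<exists>i<s1 ''n'' 0. \<not> \<sigma> x i < 3 then 0 else s1 ''accept'' 0)"
    unfolding s2_def by (rule exec_For_flag) (use t in simp_all)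
  have z: "s2 ''z'' 0 = z"
    unfolding s2_def using checked_val(5)[OF s1(1)] by (subst exec_unchanged) simp_all
  have "exec check_row s = exec (FWhen (Neg (Equal (V ''d'') (V ''z''))) reject) s2"
    by (simp add: check_row_def s1_def s2_def)
  then show ?thesis using d a z s1 checked_val(4)[OF s1(1)] by auto
qed

lemma exec_check_pair:
  assumes s: "checked s" and x: "s ''x'' 0 = x" "x < N" and y: "s ''y'' 0 = y" "y < N"
  shows "exec check_pair s ''accept'' 0 =
    (if ((\<forall>e<n. \<sigma> x e = 0 \<longleftrightarrow> \<sigma> y e = 0) \<longrightarrow> (\<forall>e<n. \<sigma> x e = 0 \<or> \<sigma> x e \<noteq> \<sigma> y e)) \<and>
        (A x y \<longleftrightarrow> card {e. e < n \<and> (\<sigma> x e = 0) \<noteq> (\<sigma> y e = 0)} = 2 \<and>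
           (\<forall>e<n. \<sigma> x e = 0 \<or> \<sigma> y e = 0 \<or> \<sigma> x e = \<sigma> y e))
     then s ''accept'' 0 else 0)"
proof -
  define s1 where "s1 = exec (FSeq (FSet ''q'' (Num 0)) (FSeq (FSet ''h'' (Num 0)) (FSet ''g'' (Num 0)))) s"
  let ?body = "FIf (Equal (signE ''x'') (Num 0))
           (FIf (Equal (signE ''y'') (Num 0)) FSkip (incr ''q''))
           (FIf (Equal (signE ''y'') (Num 0)) (incr ''q'')
             (FIf (Equal (signE ''x'') (signE ''y'')) (FSet ''g'' (Num 1)) (FSet ''h'' (Num 1))))"
  have s1: "checked s1" "s1 ''x'' 0 = x" "s1 ''y'' 0 = y" "s1 ''q'' 0 = 0" "s1 ''h'' 0 = 0" "s1 ''g'' 0 = 0"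
    "s1 ''accept'' = s ''accept''"
    using s x y checked_cong[OF s, of s1] by (simp_all add: s1_def)
  have t: "val (signE ''x'') t = \<sigma> x i" "val (signE ''y'') t = \<sigma> y i" if "i < s1 ''n'' 0" "t ''e'' 0 = i"
    "\<And>a. a \<notin> insert ''e'' (writes ?body) \<Longrightarrow> t a = s1 a" for i t
  proof -
    have "checked t" using checked_cong[OF s1(1)] that(3) by simp
    moreover have "t ''x'' 0 = x" "t ''y'' 0 = y" using that(3)[of "''x''"] that(3)[of "''y''"] s1 by simp_all
    ultimately show "val (signE ''x'') t = \<sigma> x i" "val (signE ''y'') t = \<sigma> y i"
      using checked_val(1)[of t "''x''"] checked_val(1)[of t "''y''"] that(1,2) x y checked_val(4)[OF s1(1)] by simp_all
  qed
  define s2 where "s2 = exec (FFor ''e'' ''n'' ?body) s1"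
  have q: "s2 ''q'' 0 = s1 ''q'' 0 + card {i. i < s1 ''n'' 0 \<and> (\<sigma> x i = 0) \<noteq> (\<sigma> y i = 0)}"
    unfolding s2_def by (rule exec_For_count) (use t in simp_all)
  have g: "s2 ''g'' 0 = (if \<exists>i<s1 ''n'' 0. \<sigma> x i \<noteq> 0 \<and> \<sigma> y i \<noteq> 0 \<and> \<sigma> x i = \<sigma> y i then 1 else s1 ''g'' 0)"
    unfolding s2_def by (rule exec_For_flag) (use t in simp_all)
  have h: "s2 ''h'' 0 = (if \<exists>i<s1 ''n'' 0. \<sigma> x i \<noteq> 0 \<and> \<sigma> y i \<noteq> 0 \<and> \<sigma> x i \<noteq> \<sigma> y i then 1 else s1 ''h'' 0)"
    unfolding s2_def by (rule exec_For_flag) (use t in simp_all)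
  have fr: "s2 a = s1 a" if "a \<notin> {''e'', ''q'', ''g'', ''h''}" for a
    unfolding s2_def using that by (intro exec_unchanged) simp
  have s2: "checked s2" "s2 ''x'' 0 = x" "s2 ''y'' 0 = y" "s2 ''accept'' = s ''accept''"
    using checked_cong[OF s1(1), of s2] s1 by (simp_all add: fr)
  have adj: "holds (adjT (V ''x'') (V ''y'')) s2 \<longleftrightarrow> A x y"
    using checked_val(2)[OF s2(1)] s2 x y by simp
  have adj': "holds (adjT (V ''x'') (V ''y'')) (s2(''accept'' := w)) \<longleftrightarrow> A x y" for w
    using adj by simp
  have n: "s1 ''n'' 0 = n" using checked_val(4)[OF s1(1)] .
  have q0: "s2 ''q'' 0 = 0 \<longleftrightarrow> (\<forall>e<n. \<sigma> x e = 0 \<longleftrightarrow> \<sigma> y e = 0)"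
    using q s1 n by auto
  have q2: "s2 ''q'' 0 = 2 \<longleftrightarrow> card {e. e < n \<and> (\<sigma> x e = 0) \<noteq> (\<sigma> y e = 0)} = 2"
    using q s1 n by simp
  have g1: "s2 ''g'' 0 = 1 \<longleftrightarrow> \<not> (\<forall>e<n. \<sigma> x e = 0 \<or> \<sigma> y e = 0 \<or> \<sigma> x e \<noteq> \<sigma> y e)"
    using g s1 n by auto
  have h0: "s2 ''h'' 0 = 0 \<longleftrightarrow> (\<forall>e<n. \<sigma> x e = 0 \<or> \<sigma> y e = 0 \<or> \<sigma> x e = \<sigma> y e)"
    using h s1 n by auto
  have "exec check_pair s = exec (FSeq (FWhen (Conj (Equal (V ''q'') (Num 0)) (Equal (V ''g'') (Num 1))) reject)
         (FIf (Conj (Equal (V ''q'') (Num 2)) (Equal (V ''h'') (Num 0)))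
            (FWhen (Neg (adjT (V ''x'') (V ''y''))) reject)
            (FWhen (adjT (V ''x'') (V ''y'')) reject))) s2"
    by (simp add: check_pair_def s1_def s2_def)
  then have "exec check_pair s ''accept'' 0 =
     (if \<not> (s2 ''q'' 0 = 0 \<and> s2 ''g'' 0 = 1) \<and> (A x y \<longleftrightarrow> s2 ''q'' 0 = 2 \<and> s2 ''h'' 0 = 0) then s ''accept'' 0 else 0)"
    using adj adj' s2(4) by auto
  also have "\<not> (s2 ''q'' 0 = 0 \<and> s2 ''g'' 0 = 1) \<longleftrightarrow>
      ((\<forall>e<n. \<sigma> x e = 0 \<longleftrightarrow> \<sigma> y e = 0) \<longrightarrow> (\<forall>e<n. \<sigma> x e = 0 \<or> \<sigma> x e \<noteq> \<sigma> y e))"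
    unfolding q0 g1 by metis
  finally show ?thesis unfolding q2 h0 .
qed

lemma exec_check_element:
  assumes s: "checked s" and x: "s ''x'' 0 = x" "x < N" and e: "s ''e'' 0 = e" "e < n"
  shows "exec check_element s ''accept'' 0 =
    (if \<sigma> x e = 0 \<and> \<not> ((\<exists>y<N. A x y \<and> \<sigma> y e = 1) \<and> (\<exists>y<N. A x y \<and> \<sigma> y e = 2))
     then 0 else s ''accept'' 0)"
proof -
  define s1 where "s1 = exec (FSeq (FSet ''q'' (Num 0)) (FSet ''h'' (Num 0))) s"
  let ?body = "FWhen (adjT (V ''x'') (V ''y''))
           (FSeq (FWhen (Equal (signE ''y'') (Num 1)) (FSet ''q'' (Num 1)))
                 (FWhen (Equal (signE ''y'') (Num 2)) (FSet ''h'' (Num 1))))"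
  have s1: "checked s1" "s1 ''x'' 0 = x" "s1 ''e'' 0 = e" "s1 ''q'' 0 = 0" "s1 ''h'' 0 = 0"
    "s1 ''accept'' = s ''accept''"
    using s x e checked_cong[OF s, of s1] by (simp_all add: s1_def)
  have N: "s1 ''N'' 0 = N" using checked_val(3)[OF s1(1)] .
  have t: "val (signE ''y'') t = \<sigma> i e" "holds (adjT (V ''x'') (V ''y'')) t \<longleftrightarrow> A x i"
    if "i < s1 ''N'' 0" "t ''y'' 0 = i"
    "\<And>a. a \<notin> insert ''y'' (writes ?body) \<Longrightarrow> t a = s1 a" for i t
  proof -
    have "checked t" using checked_cong[OF s1(1)] that(3) by simp
    moreover have "t ''x'' 0 = x" "t ''e'' 0 = e" using that(3)[of "''x''"] that(3)[of "''e''"] s1 by simp_all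
    ultimately show "val (signE ''y'') t = \<sigma> i e" "holds (adjT (V ''x'') (V ''y'')) t \<longleftrightarrow> A x i"
      using checked_val(1)[of t "''y''"] checked_val(2)[of t] that(1,2) x e N by simp_all
  qed
  define s2 where "s2 = exec (FFor ''y'' ''N'' ?body) s1"
  have q: "s2 ''q'' 0 = (if \<exists>i<s1 ''N'' 0. A x i \<and> \<sigma> i e = 1 then 1 else s1 ''q'' 0)"
    unfolding s2_def by (rule exec_For_flag) (use t in \<open>simp_all del: holds.simps(2) add: holds.simps(2)[of "signE _"]\<close>)
  have h: "s2 ''h'' 0 = (if \<exists>i<s1 ''N'' 0. A x i \<and> \<sigma> i e = 2 then 1 else s1 ''h'' 0)"
    unfolding s2_def by (rule exec_For_flag) (use t in \<open>simp_all del: holds.simps(2) add: holds.simps(2)[of "signE _"]\<close>)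
  have a: "s2 ''accept'' = s1 ''accept''"
    unfolding s2_def by (rule exec_unchanged) simp
  have "val (signE ''x'') s = \<sigma> x e" using checked_val(1)[OF s, of "''x''"] x e by simp
  then have "exec check_element s = (if \<sigma> x e = 0 then
      exec (FIf (Equal (V ''q'') (Num 0)) reject (FWhen (Equal (V ''h'') (Num 0)) reject)) s2 else s)"
    by (simp add: check_element_def s1_def s2_def)
  then show ?thesis using q h a N s1 by auto
qed

lemma exec_verify:
  assumes s: "checked s"
  shows "exec verify s ''accept'' 0 = (if valid_matrix N n z A \<sigma> then 1 else 0)"
proof -
  define P1 where "P1 x \<longleftrightarrow> (\<exists>e<n. \<not> \<sigma> x e < 3) \<or> card {e. e < n \<and> \<sigma> x e = 0} \<noteq> z" for x
  define P2 where "P2 x y \<longleftrightarrow> ((\<forall>e<n. \<sigma> x e = 0 \<longleftrightarrow> \<sigma> y e = 0) \<longrightarrow> (\<forall>e<n. \<sigma> x e = 0 \<or> \<sigma> x e \<noteq> \<sigma> y e)) \<and>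
        (A x y \<longleftrightarrow> card {e. e < n \<and> (\<sigma> x e = 0) \<noteq> (\<sigma> y e = 0)} = 2 \<and>
           (\<forall>e<n. \<sigma> x e = 0 \<or> \<sigma> y e = 0 \<or> \<sigma> x e = \<sigma> y e))" for x y
  define P3 where "P3 x e \<longleftrightarrow> \<sigma> x e = 0 \<and> \<not> ((\<exists>y<N. A x y \<and> \<sigma> y e = 1) \<and> (\<exists>y<N. A x y \<and> \<sigma> y e = 2))" for x e
  define s1 where "s1 = exec (FSet ''accept'' (Num 1)) s"
  define s2 where "s2 = exec (FFor ''x'' ''N'' check_row) s1"
  define s3 where "s3 = exec (FFor ''x'' ''N'' (FFor ''y'' ''N'' (FWhen (Neg (Equal (V ''x'') (V ''y''))) check_pair))) s2"
  define s4 where "s4 = exec (FFor ''x'' ''N'' (FFor ''e'' ''n'' check_element)) s3"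
  have s1: "checked s1" "s1 ''accept'' 0 = 1"
    using checked_cong[OF s, of s1] by (simp_all add: s1_def)
  have s2: "checked s2"
    by (rule checked_cong[OF s1(1)]) (unfold s2_def, simp_all add: exec_unchanged del: exec.simps)
  have s3: "checked s3"
    by (rule checked_cong[OF s2(1)]) (unfold s3_def, simp_all add: exec_unchanged del: exec.simps)
  have a2: "s2 ''accept'' 0 = (if \<exists>i<s1 ''N'' 0. P1 i then 0 else s1 ''accept'' 0)"
    unfolding s2_def
  proof (rule exec_For_flag)
    fix i t assume i: "i < s1 ''N'' 0" "t ''x'' 0 = i" and fr: "\<And>a. a \<notin> insert ''x'' (writes check_row) \<Longrightarrow> t a = s1 a"
    have "checked t" using checked_cong[OF s1(1)] fr by simp
    then show "exec check_row t ''accept'' 0 = (if P1 i then 0 else t ''accept'' 0)"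
      unfolding P1_def by (rule exec_check_row) (use i checked_val(3)[OF s1(1)] in simp_all)
  qed simp_all
  have a3: "s3 ''accept'' 0 = (if \<exists>i<s2 ''N'' 0. \<exists>j<N. i \<noteq> j \<and> \<not> P2 i j then 0 else s2 ''accept'' 0)"
    unfolding s3_def
  proof (rule exec_For_flag)
    let ?p = "FWhen (Neg (Equal (V ''x'') (V ''y''))) check_pair"
    fix i t assume i: "i < s2 ''N'' 0" "t ''x'' 0 = i" and fr: "\<And>a. a \<notin> insert ''x'' (writes (FFor ''y'' ''N'' ?p)) \<Longrightarrow> t a = s2 a"
    have t: "checked t" using checked_cong[OF s2(1)] fr by simp
    have "exec (FFor ''y'' ''N'' ?p) t ''accept'' 0 = (if \<exists>j<t ''N'' 0. i \<noteq> j \<and> \<not> P2 i j then 0 else t ''accept'' 0)"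
    proof (rule exec_For_flag)
      fix j u assume j: "j < t ''N'' 0" "u ''y'' 0 = j" and fr': "\<And>a. a \<notin> insert ''y'' (writes ?p) \<Longrightarrow> u a = t a"
      have u: "checked u" "u ''x'' 0 = i" using checked_cong[OF t] fr' i by simp_all
      have "exec check_pair u ''accept'' 0 = (if P2 i j then u ''accept'' 0 else 0)"
        unfolding P2_def by (rule exec_check_pair) (use u i j checked_val(3)[OF s2] checked_val(3)[OF t] in simp_all)
      then show "exec ?p u ''accept'' 0 = (if i \<noteq> j \<and> \<not> P2 i j then 0 else u ''accept'' 0)"
        using u j by auto
    qed simp_all
    then show "exec (FFor ''y'' ''N'' ?p) t ''accept'' 0 = (if \<exists>j<N. i \<noteq> j \<and> \<not> P2 i j then 0 else t ''accept'' 0)"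
      using checked_val(3)[OF t] by simp
  qed simp_all
  have a4: "s4 ''accept'' 0 = (if \<exists>i<s3 ''N'' 0. \<exists>e<n. P3 i e then 0 else s3 ''accept'' 0)"
    unfolding s4_def
  proof (rule exec_For_flag)
    fix i t assume i: "i < s3 ''N'' 0" "t ''x'' 0 = i" and fr: "\<And>a. a \<notin> insert ''x'' (writes (FFor ''e'' ''n'' check_element)) \<Longrightarrow> t a = s3 a"
    have t: "checked t" using checked_cong[OF s3(1)] fr by simp
    have "exec (FFor ''e'' ''n'' check_element) t ''accept'' 0 = (if \<exists>j<t ''n'' 0. P3 i j then 0 else t ''accept'' 0)"
    proof (rule exec_For_flag)
      fix j u assume j: "j < t ''n'' 0" "u ''e'' 0 = j" and fr': "\<And>a. a \<notin> insert ''e'' (writes check_element) \<Longrightarrow> u a = t a"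
      have u: "checked u" "u ''x'' 0 = i" using checked_cong[OF t] fr' i by simp_all
      then show "exec check_element u ''accept'' 0 = (if P3 i j then 0 else u ''accept'' 0)"
        unfolding P3_def by (intro exec_check_element) (use i j checked_val(3)[OF s3] checked_val(4)[OF t] in simp_all)
    qed simp_all
    then show "exec (FFor ''e'' ''n'' check_element) t ''accept'' 0 = (if \<exists>e<n. P3 i e then 0 else t ''accept'' 0)"
      using checked_val(4)[OF t] by simp
  qed simp_all
  have N: "s1 ''N'' 0 = N" "s2 ''N'' 0 = N" "s3 ''N'' 0 = N"
    using checked_val(3) s1 s2 s3 by auto
  have "exec verify s = s4" by (simp add: verify_def s1_def s2_def s3_def s4_def)
  moreover have "valid_matrix N n z A \<sigma> \<longleftrightarrow> \<not> (\<exists>i<N. P1 i) \<and> \<not> (\<exists>i<N. \<exists>j<N. i \<noteq> j \<and> \<not> P2 i j) \<and> \<not> (\<exists>i<N. \<exists>e<n. P3 i e)"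
  proof -
    have "valid_matrix N n z A \<sigma> \<longleftrightarrow>
        (\<forall>x<N. (\<forall>e<n. \<sigma> x e < 3) \<and> card {e. e < n \<and> \<sigma> x e = 0} = z) \<and>
        (\<forall>x<N. \<forall>y<N. x \<noteq> y \<longrightarrow> P2 x y) \<and>
        (\<forall>x<N. \<forall>e<n. \<sigma> x e = 0 \<longrightarrow> (\<exists>y<N. A x y \<and> \<sigma> y e = 1) \<and> (\<exists>y<N. A x y \<and> \<sigma> y e = 2))"
      unfolding valid_matrix_def P2_def by (rule refl)
    moreover have "(\<forall>x<N. (\<forall>e<n. \<sigma> x e < 3) \<and> card {e. e < n \<and> \<sigma> x e = 0} = z) \<longleftrightarrow> \<not> (\<exists>i<N. P1 i)"
      unfolding P1_def by blast
    moreover have "(\<forall>x<N. \<forall>e<n. \<sigma> x e = 0 \<longrightarrow> (\<exists>y<N. A x y \<and> \<sigma> y e = 1) \<and> (\<exists>y<N. A x y \<and> \<sigma> y e = 2))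
        \<longleftrightarrow> \<not> (\<exists>i<N. \<exists>e<n. P3 i e)"
      unfolding P3_def by blast
    moreover have "(\<forall>x<N. \<forall>y<N. x \<noteq> y \<longrightarrow> P2 x y) \<longleftrightarrow> \<not> (\<exists>i<N. \<exists>j<N. i \<noteq> j \<and> \<not> P2 i j)"
      by blast
    ultimately show ?thesis by presburger
  qed
  ultimately show ?thesis using a2 a3 a4 N s1(2) by simp
qed

end

section \<open>Rank and number of elements\<close>

definition offsets :: "string \<Rightarrow> string \<Rightarrow> fprog" where
  "offsets a w = FSeq (FSet ''o'' (Num 0)) (FFor ''x'' ''N''
     (FSeq (FPut a (V ''x'') (V ''o'')) (FSet ''o'' (Add (V ''o'') (V w)))))"

lemma writes_offsets [simp]: "writes (offsets a w) = {''o'', ''x'', a}"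
  by (auto simp: offsets_def)

lemma exec_offsets:
  assumes "a \<notin> {''o'', ''x'', ''N''}" "w \<notin> {''o'', ''x'', a}" "x < s ''N'' 0"
  shows "exec (offsets a w) s a x = x * s w 0"
proof -
  let ?p = "FSeq (FPut a (V ''x'') (V ''o'')) (FSet ''o'' (Add (V ''o'') (V w)))"
  define s1 where "s1 = exec (FSet ''o'' (Num 0)) s"
  have "exec (FFor ''x'' ''N'' ?p) s1 ''o'' 0 = s1 ''N'' 0 * s w 0 \<and>
    (\<forall>y<s1 ''N'' 0. exec (FFor ''x'' ''N'' ?p) s1 a y = y * s w 0)"
  proof (rule exec_For[where I = "\<lambda>i t. t ''o'' 0 = i * s w 0 \<and> (\<forall>y<i. t a y = y * s w 0)"])
    fix i t assume i: "t ''o'' 0 = i * s w 0 \<and> (\<forall>y<i. t a y = y * s w 0)" "t ''x'' 0 = i"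
      and fr: "\<And>b. b \<notin> insert ''x'' (writes ?p) \<Longrightarrow> t b = s1 b"
    have "t w = s w" using fr[of w] assms(2) by (simp add: s1_def)
    then show "setv (exec ?p t) ''x'' (Suc i) ''o'' 0 = Suc i * s w 0 \<and>
      (\<forall>y<Suc i. setv (exec ?p t) ''x'' (Suc i) a y = y * s w 0)"
      using i assms by (auto simp: less_Suc_eq)
  qed (use assms in \<open>auto simp: s1_def\<close>)
  moreover have "s1 ''N'' 0 = s ''N'' 0" by (simp add: s1_def)
  moreover have "exec (offsets a w) s = exec (FFor ''x'' ''N'' ?p) s1" by (simp add: offsets_def s1_def)
  ultimately show ?thesis using assms(3) by simp
qed

definition degree_of :: fprog where
  "degree_of = FSeq (FSet ''d'' (Num 0)) (FFor ''j'' ''N'' (FWhen (adjT (V ''x'') (V ''j'')) (incr ''d'')))"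

lemma writes_degree_of [simp]: "writes degree_of = {''d'', ''j''}"
  by (auto simp: degree_of_def)

lemma exec_degree_of:
  assumes s: "graph_store N A s" "s ''x'' 0 = x" "x < N"
  shows "exec degree_of s ''d'' 0 = card {y. y < N \<and> A x y}"
proof -
  define s1 where "s1 = exec (FSet ''d'' (Num 0)) s"
  have s1: "graph_store N A s1" "s1 ''x'' 0 = x" "s1 ''d'' 0 = 0"
    using s graph_store_cong[OF s(1), of s1] by (simp_all add: s1_def)
  have N: "s1 ''N'' 0 = N" using s1 by (simp add: graph_store_def)
  have "exec (FFor ''j'' ''N'' (FWhen (adjT (V ''x'') (V ''j'')) (incr ''d''))) s1 ''d'' 0 =
    s1 ''d'' 0 + card {j. j < s1 ''N'' 0 \<and> A x j}"
  proof (rule exec_For_count)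
    fix i t assume i: "i < s1 ''N'' 0" "t ''j'' 0 = i"
      and fr: "\<And>a. a \<notin> insert ''j'' (writes (FWhen (adjT (V ''x'') (V ''j'')) (incr ''d''))) \<Longrightarrow> t a = s1 a"
    have "graph_store N A t" using graph_store_cong[OF s1(1), of t] fr by simp
    then have "holds (adjT (V ''x'') (V ''j'')) t \<longleftrightarrow> A x i"
      using holds_adjT[of N A t "V ''x''" "V ''j''"] i N s1 s fr[of "''x''"] by simp
    then show "exec (FWhen (adjT (V ''x'') (V ''j'')) (incr ''d'')) t ''d'' 0 = (if A x i then Suc (t ''d'' 0) else t ''d'' 0)"
      by simp
  qed simp_all
  then show ?thesis using s1 N by (simp add: degree_of_def s1_def)
qed

definition regularity :: fprog where
  "regularity = FSeq (FSet ''x'' (Num 0)) (FSeq degree_of (FSeq (FSet ''D'' (V ''d''))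
     (FFor ''x'' ''N'' (FSeq degree_of (FWhen (Neg (Equal (V ''d'') (V ''D''))) (FSet ''ok'' (Num 0)))))))"

lemma writes_regularity [simp]: "writes regularity = {''x'', ''d'', ''j'', ''D'', ''ok''}"
  by (auto simp: regularity_def)

lemma exec_regularity:
  assumes s: "graph_store N A s" "0 < N"
  shows "exec regularity s ''D'' 0 = card {y. y < N \<and> A 0 y}"
    "exec regularity s ''ok'' 0 = (if \<exists>x<N. card {y. y < N \<and> A x y} \<noteq> card {y. y < N \<and> A 0 y} then 0 else s ''ok'' 0)"
proof -
  define s0 where "s0 = exec (FSet ''x'' (Num 0)) s"
  have s0: "graph_store N A s0" "s0 ''x'' 0 = 0" "s0 ''ok'' = s ''ok''"
    using s graph_store_cong[OF s(1), of s0] by (simp_all add: s0_def)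
  define s1 where "s1 = exec (FSet ''D'' (V ''d'')) (exec degree_of s0)"
  have D: "s1 ''D'' 0 = card {y. y < N \<and> A 0 y}"
    using exec_degree_of[OF s0(1,2) s(2)] by (simp add: s1_def)
  have s1: "graph_store N A s1" "s1 ''ok'' = s ''ok''"
    using graph_store_cong[OF s0(1), of s1] s0(3) by (simp_all add: s1_def exec_unchanged)
  have N: "s1 ''N'' 0 = N" using s1 by (simp add: graph_store_def)
  let ?p = "FSeq degree_of (FWhen (Neg (Equal (V ''d'') (V ''D''))) (FSet ''ok'' (Num 0)))"
  have "exec (FFor ''x'' ''N'' ?p) s1 ''ok'' 0 =
    (if \<exists>x<s1 ''N'' 0. card {y. y < N \<and> A x y} \<noteq> card {y. y < N \<and> A 0 y} then 0 else s1 ''ok'' 0)"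
  proof (rule exec_For_flag)
    fix i t assume i: "i < s1 ''N'' 0" "t ''x'' 0 = i" and fr: "\<And>a. a \<notin> insert ''x'' (writes ?p) \<Longrightarrow> t a = s1 a"
    have "graph_store N A t" using graph_store_cong[OF s1(1), of t] fr by simp
    then have "exec degree_of t ''d'' 0 = card {y. y < N \<and> A i y}" using exec_degree_of i N by simp
    moreover have "exec degree_of t ''D'' 0 = card {y. y < N \<and> A 0 y}"
      using fr[of "''D''"] D by (simp add: exec_unchanged)
    moreover have "exec degree_of t ''ok'' = t ''ok''" by (simp add: exec_unchanged)
    ultimately show "exec ?p t ''ok'' 0 = (if card {y. y < N \<and> A i y} \<noteq> card {y. y < N \<and> A 0 y} then 0 else t ''ok'' 0)"
      by simp
  qed simp_all
  moreover have "exec regularity s = exec (FFor ''x'' ''N'' ?p) s1" by (simp add: regularity_def s0_def s1_def)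
  moreover have "exec (FFor ''x'' ''N'' ?p) s1 ''D'' = s1 ''D''" by (rule exec_unchanged) simp
  ultimately show "exec regularity s ''D'' 0 = card {y. y < N \<and> A 0 y}"
    "exec regularity s ''ok'' 0 = (if \<exists>x<N. card {y. y < N \<and> A x y} \<noteq> card {y. y < N \<and> A 0 y} then 0 else s ''ok'' 0)"
    unfolding N s1(2) D by (simp_all only: D)
qed

text \<open>Division by two as a search. Failure includes \<open>z = 0\<close>, i.e. rank 1, which
  is impossible for a connected graph.\<close>

definition halve :: fprog where
  "halve = FSeq (FSet ''z'' (Num 0))
     (FSeq (FFor ''i'' ''N'' (FWhen (Equal (Add (V ''i'') (V ''i'')) (V ''D'')) (FSet ''z'' (V ''i''))))
       (FWhen (Neg (Conj (Less (Num 0) (V ''z'')) (Equal (Add (V ''z'') (V ''z'')) (V ''D'')))) (FSet ''ok'' (Num 0))))"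

lemma writes_halve [simp]: "writes halve = {''z'', ''i'', ''ok''}"
  by (auto simp: halve_def)

lemma exec_halve:
  "exec halve s ''ok'' 0 = (if \<exists>i<s ''N'' 0. 0 < i \<and> 2 * i = s ''D'' 0 then s ''ok'' 0 else 0)"
  "i < s ''N'' 0 \<Longrightarrow> 2 * i = s ''D'' 0 \<Longrightarrow> exec halve s ''z'' 0 = i"
proof -
  let ?p = "FWhen (Equal (Add (V ''i'') (V ''i'')) (V ''D'')) (FSet ''z'' (V ''i''))"
  define s1 where "s1 = exec (FSet ''z'' (Num 0)) s"
  define s2 where "s2 = exec (FFor ''i'' ''N'' ?p) s1"
  have fr: "s2 ''D'' = s ''D''" "s2 ''ok'' = s ''ok''" "s1 ''N'' = s ''N''" "s1 ''D'' = s ''D''"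
    by (simp_all add: s1_def s2_def exec_unchanged del: exec.simps(5))
  have "(\<exists>i<s1 ''N'' 0. 2 * i = s ''D'' 0 \<and> s2 ''z'' 0 = i) \<or>
      ((\<forall>i<s1 ''N'' 0. \<not> 2 * i = s ''D'' 0) \<and> s2 ''z'' 0 = s1 ''z'' 0)"
    unfolding s2_def
  proof (rule exec_For_select)
    fix i t assume "t ''i'' 0 = i" and f: "\<And>a. a \<notin> insert ''i'' (writes ?p) \<Longrightarrow> t a = s1 a"
    then show "exec ?p t ''z'' 0 = (if 2 * i = s ''D'' 0 then i else t ''z'' 0)"
      using f[of "''D''"] fr by (simp add: mult_2)
  qed simp_all
  then have z: "(\<exists>i<s ''N'' 0. 2 * i = s ''D'' 0 \<and> s2 ''z'' 0 = i) \<or>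
      ((\<forall>i<s ''N'' 0. \<not> 2 * i = s ''D'' 0) \<and> s2 ''z'' 0 = 0)"
    by (simp add: s1_def)
  have e: "exec halve s = exec (FWhen (Neg (Conj (Less (Num 0) (V ''z'')) (Equal (Add (V ''z'') (V ''z'')) (V ''D'')))) (FSet ''ok'' (Num 0))) s2"
    by (simp add: halve_def s1_def s2_def)
  show "exec halve s ''ok'' 0 = (if \<exists>i<s ''N'' 0. 0 < i \<and> 2 * i = s ''D'' 0 then s ''ok'' 0 else 0)"
    unfolding e using z fr by auto
  show "exec halve s ''z'' 0 = i" if "i < s ''N'' 0" "2 * i = s ''D'' 0"
    unfolding e using z that by auto
qed

text \<open>The row is updated in place from right to left, so that the entry on the left still
  belongs to the old row. Column 0 stays 1.\<close>

definition pascal_row :: fprog where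
  "pascal_row = FSeq (FSet ''q'' (V ''N'')) (FFor ''j'' ''N''
     (FSeq (FPut ''B'' (V ''q'') (Add (Get ''B'' (V ''q'')) (Get ''B'' (Sub (V ''q'') (Num 1)))))
           (FSet ''q'' (Sub (V ''q'') (Num 1)))))"

lemma writes_pascal_row [simp]: "writes pascal_row = {''q'', ''j'', ''B''}"
  by (auto simp: pascal_row_def)

lemma exec_pascal_row:
  assumes B: "\<forall>j\<le>s ''N'' 0. s ''B'' j = i choose j" and l: "l \<le> s ''N'' 0"
  shows "exec pascal_row s ''B'' l = Suc i choose l"
proof -
  let ?p = "FSeq (FPut ''B'' (V ''q'') (Add (Get ''B'' (V ''q'')) (Get ''B'' (Sub (V ''q'') (Num 1)))))
           (FSet ''q'' (Sub (V ''q'') (Num 1)))"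
  define s1 where "s1 = exec (FSet ''q'' (V ''N'')) s"
  let ?N = "s ''N'' 0"
  let ?I = "\<lambda>j t. t ''q'' 0 = ?N - j \<and> (\<forall>l\<le>?N. t ''B'' l = (if ?N - j < l then Suc i choose l else i choose l))"
  have N: "s1 ''N'' 0 = ?N" by (simp add: s1_def)
  have "?I (s1 ''N'' 0) (exec (FFor ''j'' ''N'' ?p) s1)"
  proof (rule exec_For[where I = ?I])
    fix j t assume j: "j < s1 ''N'' 0" and I: "?I j t"
    then have q: "t ''q'' 0 = ?N - j" "0 < ?N - j" "?N - j \<le> ?N" using N by auto
    have "t ''B'' (?N - j) = i choose (?N - j)" using I q by auto
    moreover have "t ''B'' (?N - j - 1) = i choose (?N - j - 1)" using I q by auto
    moreover have "Suc i choose (?N - j) = (i choose (?N - j)) + (i choose (?N - j - 1))"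
      using q(2) by (cases "?N - j") auto
    moreover have "?N - Suc j < l \<longleftrightarrow> ?N - j < l \<or> l = ?N - j" for l using q(2) by auto
    ultimately show "?I (Suc j) (setv (exec ?p t) ''j'' (Suc j))"
      using I q by auto
  qed (use B in \<open>auto simp: s1_def\<close>)
  moreover have "exec pascal_row s = exec (FFor ''j'' ''N'' ?p) s1" by (simp add: pascal_row_def s1_def)
  ultimately show ?thesis using l N by (cases "l = 0") auto
qed

text \<open>The size \<open>n = i + 1\<close> is tried for all \<open>i < N\<close>, a sufficient
  range because \<open>n\<close> is at most the binomial coefficient. \<open>B\<close> then holds
  row \<open>i + 1\<close> of the triangle; the test that \<open>i\<close> is at least
  \<open>z\<close> encodes \<open>z < n\<close>, and 0 in \<open>n\<close> means that nothing was
  found.\<close>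

definition find_size :: fprog where
  "find_size = FSeq (FPut ''B'' (Num 0) (Num 1)) (FSeq (FFor ''i'' ''N'' (FSeq pascal_row
     (FWhen (Conj (Equal (Add (Get ''B'' (V ''z'')) (Get ''B'' (V ''z''))) (V ''N'')) (Neg (Less (V ''i'') (V ''z''))))
        (FSet ''n'' (Add (V ''i'') (Num 1))))))
     (FWhen (Equal (V ''n'') (Num 0)) (FSet ''ok'' (Num 0))))"

lemma writes_find_size [simp]: "writes find_size = {''B'', ''i'', ''q'', ''j'', ''n'', ''ok''}"
  by (auto simp: find_size_def)

lemma exec_find_size:
  assumes s: "\<And>j. s ''B'' j = 0" "s ''n'' 0 = 0" "s ''z'' 0 \<le> s ''N'' 0"
  defines "P \<equiv> \<lambda>n. s ''z'' 0 < n \<and> n \<le> s ''N'' 0 \<and> 2 * (n choose s ''z'' 0) = s ''N'' 0"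
  shows "exec find_size s ''ok'' 0 = (if \<exists>n. P n then s ''ok'' 0 else 0)"
    "\<exists>n. P n \<Longrightarrow> P (exec find_size s ''n'' 0)"
proof -
  let ?N = "s ''N'' 0" and ?z = "s ''z'' 0"
  let ?p = "FSeq pascal_row
     (FWhen (Conj (Equal (Add (Get ''B'' (V ''z'')) (Get ''B'' (V ''z''))) (V ''N'')) (Neg (Less (V ''i'') (V ''z''))))
        (FSet ''n'' (Add (V ''i'') (Num 1))))"
  define s1 where "s1 = exec (FPut ''B'' (Num 0) (Num 1)) s"
  define s2 where "s2 = exec (FFor ''i'' ''N'' ?p) s1"
  let ?I = "\<lambda>i t. (\<forall>j\<le>?N. t ''B'' j = i choose j) \<and>
     ((t ''n'' 0 = 0 \<and> (\<forall>n\<le>i. \<not> P n)) \<or> (t ''n'' 0 \<le> i \<and> P (t ''n'' 0)))"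
  have s1: "s1 ''N'' 0 = ?N" "s1 ''z'' 0 = ?z" "s1 ''n'' 0 = 0" by (simp_all add: s1_def s)
  have "?I (s1 ''N'' 0) s2"
    unfolding s2_def
  proof (rule exec_For[where I = ?I])
    have "s1 ''B'' j = 0 choose j" for j by (cases j) (simp_all add: s1_def s)
    then show "?I 0 (setv s1 ''i'' 0)" using s1 by (simp add: P_def)
  next
    fix i t assume i: "i < s1 ''N'' 0" "t ''i'' 0 = i" and I: "?I i t"
      and fr: "\<And>a. a \<notin> insert ''i'' (writes ?p) \<Longrightarrow> t a = s1 a"
    define u where "u = exec pascal_row t"
    have t: "t ''N'' 0 = ?N" "t ''z'' 0 = ?z" using fr s1 by simp_all
    have B: "\<forall>j\<le>?N. u ''B'' j = Suc i choose j"
      using exec_pascal_row[of t i] I t by (simp add: u_def)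
    have u: "u ''N'' 0 = ?N" "u ''z'' 0 = ?z" "u ''i'' 0 = i" "u ''n'' = t ''n''"
      using t i by (simp_all add: u_def exec_unchanged)
    have cond: "2 * (Suc i choose ?z) = ?N \<and> \<not> i < ?z \<longleftrightarrow> P (Suc i)"
      using i s1 by (auto simp: P_def)
    have e: "exec ?p t = (if P (Suc i) then u(''n'' := (u ''n'')(0 := Suc i)) else u)"
      using B s(3) u cond by (auto simp: u_def[symmetric] mult_2)
    show "?I (Suc i) (setv (exec ?p t) ''i'' (Suc i))"
      unfolding e using B I u by (auto simp: le_Suc_eq)
  qed simp_all
  then have I: "(s2 ''n'' 0 = 0 \<and> (\<forall>n\<le>?N. \<not> P n)) \<or> P (s2 ''n'' 0)" using s1 by auto
  have s2: "s2 ''ok'' = s ''ok''"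
    by (simp add: s2_def s1_def exec_unchanged del: exec.simps(5))
  have e: "exec find_size s = exec (FWhen (Equal (V ''n'') (Num 0)) (FSet ''ok'' (Num 0))) s2"
    by (simp add: find_size_def s1_def s2_def)
  have P0: "\<not> P 0" "P n \<Longrightarrow> n \<le> ?N" for n by (auto simp: P_def)
  show "exec find_size s ''ok'' 0 = (if \<exists>n. P n then s ''ok'' 0 else 0)"
    unfolding e using I P0 s2 by (cases "s2 ''n'' 0 = 0") auto
  show "P (exec find_size s ''n'' 0)" if "\<exists>n. P n"
  proof (cases "s2 ''n'' 0 = 0")
    case True
    then show ?thesis using I P0 that by metis
  next
    case False
    then show ?thesis unfolding e using I by simp
  qed
qed

definition parameters :: fprog where
  "parameters = FSeq (offsets ''row'' ''N'') (FSeq (FSet ''ok'' (Num 1)) (FSeq regularity (FSeq halve (FSeq find_size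
     (FSeq (FSet ''k'' (Sub (V ''n'') (V ''z''))) (FSet ''m'' (V ''N'')))))))"

text \<open>\<open>z\<close> stands for \<open>r - 1\<close>; the bounds on \<open>n\<close> delimit
  the range searched by \<open>find_size\<close>.\<close>

definition graph_parameters :: "nat \<Rightarrow> (nat \<Rightarrow> nat \<Rightarrow> bool) \<Rightarrow> nat \<Rightarrow> nat \<Rightarrow> bool" where
  "graph_parameters N A z n \<longleftrightarrow> 0 < z \<and> z < n \<and> n \<le> N \<and> N = 2 * (n choose z) \<and>
     (\<forall>x<N. card {y. y < N \<and> A x y} = 2 * z)"

lemma binomial_strict_mono: "0 < z \<Longrightarrow> z \<le> n \<Longrightarrow> n < n' \<Longrightarrow> n choose z < n' choose z"
proof (induction n')
  case (Suc n')
  have "n' choose z < Suc n' choose z" if "z \<le> n'"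
  proof -
    have "0 < n' choose (z - 1)" using that by simp
    then show ?thesis using Suc.prems(1) by (cases z) auto
  qed
  then show ?case using Suc by (cases "n = n'") auto
qed simp

text \<open>The degree fixes \<open>z\<close>, and then strict monotonicity of the binomial
  coefficient fixes \<open>n\<close>. Hence a time bound in the computed parameters holds for any
  admissible ones.\<close>

lemma graph_parameters_unique:
  assumes "graph_parameters N A z n" "graph_parameters N A z' n'" "0 < N"
  shows "z = z' \<and> n = n'"
proof -
  have "2 * z = 2 * z'" using assms unfolding graph_parameters_def by metis
  then have "z = z'" by simp
  moreover have "n = n'"
  proof (rule ccontr)
    assume "n \<noteq> n'"
    then have "n choose z \<noteq> n' choose z"
      using assms \<open>z = z'\<close> binomial_strict_mono[of z n n'] binomial_strict_mono[of z n' n]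
      by (auto simp: graph_parameters_def neq_iff)
    then show False using assms \<open>z = z'\<close> by (auto simp: graph_parameters_def)
  qed
  ultimately show ?thesis by simp
qed

lemma exec_parameters:
  assumes s: "s ''N'' 0 = N" "0 < N" "\<And>x y. x < N \<Longrightarrow> y < N \<Longrightarrow> s ''adj'' (x * N + y) = (if A x y then 1 else 0)"
    "\<And>j. s ''B'' j = 0" "s ''n'' 0 = 0"
  defines "s' \<equiv> exec parameters s"
  shows "graph_store N A s'"
    "s' ''ok'' 0 = (if \<exists>z n. graph_parameters N A z n then 1 else 0)"
    "graph_parameters N A z n \<Longrightarrow> s' ''z'' 0 = z \<and> s' ''n'' 0 = n \<and> s' ''k'' 0 = n - z \<and> s' ''m'' 0 = N"
proof -
  define s1 where "s1 = exec (FSet ''ok'' (Num 1)) (exec (offsets ''row'' ''N'') s)"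
  define s2 where "s2 = exec regularity s1"
  define s3 where "s3 = exec halve s2"
  define s4 where "s4 = exec find_size s3"
  have s': "s' = exec (FSeq (FSet ''k'' (Sub (V ''n'') (V ''z''))) (FSet ''m'' (V ''N''))) s4"
    by (simp add: s'_def parameters_def s1_def s2_def s3_def s4_def)
  have s1: "graph_store N A s1"
    using s exec_offsets[of "''row''" "''N''" _ s] by (auto simp: s1_def graph_store_def exec_unchanged)
  have ok1: "s1 ''ok'' 0 = 1" by (simp add: s1_def)
  have s4: "graph_store N A s4"
    using s1 by (rule graph_store_cong) (simp_all add: s2_def s3_def s4_def exec_unchanged)
  then show "graph_store N A s'" by (rule graph_store_cong) (simp_all add: s')
  have N: "s2 ''N'' 0 = N" "s3 ''N'' 0 = N" "s4 ''N'' 0 = N"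
    using s1 by (simp_all add: s2_def s3_def s4_def exec_unchanged graph_store_def)
  have z4: "s4 ''z'' = s3 ''z''" by (simp add: s4_def exec_unchanged)
  let ?deg = "\<lambda>x. card {y. y < N \<and> A x y}"
  note reg = exec_regularity[OF s1 s(2), folded s2_def]
  have B: "s3 ''B'' j = 0" "s3 ''n'' 0 = 0" for j
    using s by (simp_all add: s1_def s2_def s3_def exec_unchanged)
  have D2: "?deg 0 = 2 * z" if "graph_parameters N A z n" for z n
    using that s(2) unfolding graph_parameters_def by blast
  have z3: "s3 ''z'' 0 = z" "z < N" if "graph_parameters N A z n" for z n
  proof -
    show "z < N" using that by (auto simp: graph_parameters_def)
    then show "s3 ''z'' 0 = z" using exec_halve(2)[of z s2] D2[OF that] N reg(1) by (simp add: s3_def)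
  qed
  show "s' ''ok'' 0 = (if \<exists>z n. graph_parameters N A z n then 1 else 0)"
  proof (cases "(\<forall>x<N. ?deg x = ?deg 0) \<and> (\<exists>i<N. 0 < i \<and> 2 * i = ?deg 0)")
    case True
    then obtain z where z: "z < N" "0 < z" "2 * z = ?deg 0" by blast
    then have z3': "s3 ''z'' 0 = z" using exec_halve(2)[of z s2] N reg(1) by (simp add: s3_def)
    have "\<not> (\<exists>x<N. ?deg x \<noteq> ?deg 0)" using True by blast
    then have "s2 ''ok'' 0 = 1" unfolding reg(2) using ok1 by (simp only: if_False)
    moreover have "\<exists>i<s2 ''N'' 0. 0 < i \<and> 2 * i = s2 ''D'' 0" unfolding reg(1) N using True by blast
    ultimately have "s3 ''ok'' 0 = 1" unfolding s3_def exec_halve(1) by (simp only: if_True)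
    then have "s4 ''ok'' 0 = (if \<exists>n. z < n \<and> n \<le> N \<and> 2 * (n choose z) = N then 1 else 0)"
      using exec_find_size(1)[of s3] B z z3' N by (auto simp: s4_def)
    moreover have "(\<exists>n. z < n \<and> n \<le> N \<and> 2 * (n choose z) = N) \<longleftrightarrow> (\<exists>z n. graph_parameters N A z n)"
    proof
      assume "\<exists>n. z < n \<and> n \<le> N \<and> 2 * (n choose z) = N"
      then obtain n where "z < n" "n \<le> N" "N = 2 * (n choose z)" by metis
      moreover have "\<forall>x<N. ?deg x = 2 * z" using True unfolding z(3) by blast
      ultimately have "graph_parameters N A z n" using z(2) unfolding graph_parameters_def by blast
      then show "\<exists>z n. graph_parameters N A z n" by blast
    next
      assume "\<exists>z n. graph_parameters N A z n"
      then obtain z' n where p: "graph_parameters N A z' n" by blast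
      then have "z' = z" using z3 z3' by metis
      then show "\<exists>n. z < n \<and> n \<le> N \<and> 2 * (n choose z) = N" using p by (auto simp: graph_parameters_def)
    qed
    ultimately show ?thesis by (simp add: s')
  next
    case False
    have "\<not> graph_parameters N A z n" for z n
    proof
      assume p: "graph_parameters N A z n"
      then have "\<forall>x<N. ?deg x = ?deg 0" unfolding D2[OF p] graph_parameters_def by blast
      moreover have "z < N" "0 < z" "2 * z = ?deg 0" using p D2[OF p] z3[OF p] by (auto simp: graph_parameters_def)
      ultimately show False using False by blast
    qed
    moreover have "s3 ''ok'' 0 = 0"
    proof (cases "\<exists>i<s2 ''N'' 0. 0 < i \<and> 2 * i = s2 ''D'' 0")
      case True
      then have "\<exists>x<N. ?deg x \<noteq> ?deg 0" using False unfolding reg(1) N by blast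
      then have "s2 ''ok'' 0 = 0" unfolding reg(2) by (simp only: if_True)
      then show ?thesis unfolding s3_def exec_halve(1) by (simp only: if_cancel)
    next
      case False
      then show ?thesis unfolding s3_def exec_halve(1) by (simp only: if_False)
    qed
    then have "s4 ''ok'' 0 = 0"
    proof (cases "s3 ''z'' 0 \<le> s3 ''N'' 0")
      case True
      then show ?thesis using exec_find_size(1)[of s3, OF B] \<open>s3 ''ok'' 0 = 0\<close> by (simp add: s4_def)
    next
      case z: False
      have "s3 ''ok'' 0 = 0" by fact
      then show ?thesis unfolding s4_def find_size_def
        by (simp add: exec_unchanged del: exec.simps(5))
    qed
    ultimately show ?thesis by (simp add: s')
  qed
  assume p: "graph_parameters N A z n"
  note z = z3[OF p]
  have "z < n" "n \<le> N" "2 * (n choose z) = N" using p by (auto simp: graph_parameters_def)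
  then have "z < s4 ''n'' 0 \<and> s4 ''n'' 0 \<le> N \<and> 2 * (s4 ''n'' 0 choose z) = N"
    using exec_find_size(2)[of s3] B z N by (auto simp: s4_def)
  then have "graph_parameters N A z (s4 ''n'' 0)" using p by (auto simp: graph_parameters_def)
  then have "s4 ''n'' 0 = n" using graph_parameters_unique p s(2) by blast
  then show "s' ''z'' 0 = z \<and> s' ''n'' 0 = n \<and> s' ''k'' 0 = n - z \<and> s' ''m'' 0 = N"
    using z(1) z4 N by (simp add: s')
qed

section \<open>Distances and an order of the vertices\<close>

definition relation_store :: "nat \<Rightarrow> string \<Rightarrow> (nat \<Rightarrow> nat \<Rightarrow> bool) \<Rightarrow> store \<Rightarrow> bool" where
  "relation_store N a R s \<longleftrightarrow> (\<forall>x<N. \<forall>y<N. s a (x * N + y) = (if R x y then 1 else 0))"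

lemma graph_storeD:
  "graph_store N A s \<Longrightarrow> s ''N'' 0 = N"
  "graph_store N A s \<Longrightarrow> x < N \<Longrightarrow> s ''row'' x = x * N"
  by (auto simp: graph_store_def)

definition expand_ball :: fprog where
  "expand_ball = FFor ''w'' ''N'' (FWhen (Conj (Equal (Get ''near'' (Add (Get ''row'' (V ''x'')) (V ''w''))) (Num 1))
       (adjT (V ''w'') (V ''y''))) (FPut ''far'' (Add (Get ''row'' (V ''x'')) (V ''y'')) (Num 1)))"

text \<open>Each round copies \<open>far\<close> to \<open>near\<close> before enlarging it, so that
  \<open>near\<close> lags one step behind: after \<open>k\<close> rounds the radii are
  \<open>k\<close>, which serves the search for antipodes, and \<open>k - 1\<close>, which serves
  the search for elements. The cost of order \<open>k * N ^ 3\<close> arises only once.\<close>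

definition balls :: fprog where
  "balls = FSeq (FFor ''x'' ''N'' (FPut ''far'' (Add (Get ''row'' (V ''x'')) (V ''x'')) (Num 1)))
     (FFor ''l'' ''k'' (FSeq
        (FFor ''x'' ''N'' (FFor ''y'' ''N'' (FPut ''near'' (Add (Get ''row'' (V ''x'')) (V ''y''))
            (Get ''far'' (Add (Get ''row'' (V ''x'')) (V ''y''))))))
        (FFor ''x'' ''N'' (FFor ''y'' ''N'' expand_ball))))"

lemma writes_balls [simp]:
  "writes expand_ball = {''w'', ''far''}"
  "writes balls = {''x'', ''y'', ''w'', ''l'', ''near'', ''far''}"
  by (auto simp: expand_ball_def balls_def)

lemma exec_expand_ball:
  assumes s: "graph_store N A s" "relation_store N ''near'' R s" "s ''x'' 0 = x" "s ''y'' 0 = y" "x < N" "y < N"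
  shows "exec expand_ball s ''far'' =
    (s ''far'')(x * N + y := if \<exists>w<N. R x w \<and> A w y then 1 else s ''far'' (x * N + y))"
proof -
  let ?p = "FWhen (Conj (Equal (Get ''near'' (Add (Get ''row'' (V ''x'')) (V ''w''))) (Num 1))
       (adjT (V ''w'') (V ''y''))) (FPut ''far'' (Add (Get ''row'' (V ''x'')) (V ''y'')) (Num 1))"
  have N: "s ''N'' 0 = N" using s by (simp add: graph_store_def)
  have "exec (FFor ''w'' ''N'' ?p) s ''far'' =
    (s ''far'')(x * N + y := if \<exists>w<s ''N'' 0. R x w \<and> A w y then 1 else s ''far'' (x * N + y))"
  proof (rule exec_For[where I = "\<lambda>i t. t ''far'' = (s ''far'')(x * N + y := if \<exists>w<i. R x w \<and> A w y then 1 else s ''far'' (x * N + y))"])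
    fix i t assume i: "i < s ''N'' 0" "t ''w'' 0 = i"
      and I: "t ''far'' = (s ''far'')(x * N + y := if \<exists>w<i. R x w \<and> A w y then 1 else s ''far'' (x * N + y))"
      and fr: "\<And>a. a \<notin> insert ''w'' (writes ?p) \<Longrightarrow> t a = s a"
    have t: "graph_store N A t" using graph_store_cong[OF s(1), of t] fr by simp
    have xy: "t ''x'' 0 = x" "t ''y'' 0 = y" "t ''row'' x = x * N" using fr s by (simp_all add: graph_store_def)
    have "holds (adjT (V ''w'') (V ''y'')) t \<longleftrightarrow> A i y"
      using holds_adjT[OF t, of "V ''w''" "V ''y''"] i N xy s by simp
    moreover have "t ''near'' (x * N + i) = 1 \<longleftrightarrow> R x i"
      using fr[of "''near''"] s(2,5) i N by (simp add: relation_store_def)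
    ultimately have "exec ?p t ''far'' = (if R x i \<and> A i y then (t ''far'')(x * N + y := 1) else t ''far'')"
      using xy i by simp
    then show "setv (exec ?p t) ''w'' (Suc i) ''far'' =
        (s ''far'')(x * N + y := if \<exists>w<Suc i. R x w \<and> A w y then 1 else s ''far'' (x * N + y))"
      using I by (auto simp: less_Suc_eq)
  qed simp_all
  then show ?thesis using N by (simp add: expand_ball_def)
qed

lemma exec_balls:
  assumes s: "graph_store N A s" "\<And>c. s ''far'' c = 0" "0 < s ''k'' 0"
  shows "relation_store N ''far'' (gball N A (s ''k'' 0)) (exec balls s)"
    "relation_store N ''near'' (gball N A (s ''k'' 0 - 1)) (exec balls s)"
proof -
  let ?init = "FPut ''far'' (Add (Get ''row'' (V ''x'')) (V ''x'')) (Num 1)"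
  let ?copy = "FPut ''near'' (Add (Get ''row'' (V ''x'')) (V ''y'')) (Get ''far'' (Add (Get ''row'' (V ''x'')) (V ''y'')))"
  let ?copies = "FFor ''x'' ''N'' (FFor ''y'' ''N'' ?copy)"
  let ?expands = "FFor ''x'' ''N'' (FFor ''y'' ''N'' expand_ball)"
  define s1 where "s1 = exec (FFor ''x'' ''N'' ?init) s"
  have N: "s ''N'' 0 = N" using s by (simp add: graph_store_def)
  have "\<forall>x<N. \<forall>y<N. s1 ''far'' (x * N + y) = (if x < s ''N'' 0 \<and> x = y then 1 else 0)"
    unfolding s1_def
  proof (rule exec_For[where I = "\<lambda>i t. \<forall>x<N. \<forall>y<N. t ''far'' (x * N + y) = (if x < i \<and> x = y then 1 else 0)"])
    fix i t assume i: "i < s ''N'' 0" "t ''x'' 0 = i"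
      and I: "\<forall>x<N. \<forall>y<N. t ''far'' (x * N + y) = (if x < i \<and> x = y then 1 else 0)"
      and fr: "\<And>a. a \<notin> insert ''x'' (writes ?init) \<Longrightarrow> t a = s a"
    have "t ''row'' i = i * N" using fr s i N by (simp add: graph_store_def)
    then show "\<forall>x<N. \<forall>y<N. setv (exec ?init t) ''x'' (Suc i) ''far'' (x * N + y) = (if x < Suc i \<and> x = y then 1 else 0)"
      using I i N by (auto simp: matrix_index_eq less_Suc_eq)
  qed (use s(2) in simp_all)
  then have far: "relation_store N ''far'' (gball N A 0) s1" using N by (simp add: relation_store_def)
  have fr1: "s1 a = s a" if "a \<notin> {''x'', ''far''}" for a
    unfolding s1_def by (rule exec_unchanged) (use that in simp)
  have s1: "graph_store N A s1" "s1 ''k'' = s ''k''"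
    using graph_store_cong[OF s(1), of s1] fr1 by simp_all
  define s2 where "s2 = exec (FFor ''l'' ''k'' (FSeq ?copies ?expands)) s1"
  have "relation_store N ''far'' (gball N A (s1 ''k'' 0)) s2 \<and>
    (0 < s1 ''k'' 0 \<longrightarrow> relation_store N ''near'' (gball N A (s1 ''k'' 0 - 1)) s2)"
    unfolding s2_def
  proof (rule exec_For[where I = "\<lambda>i t. relation_store N ''far'' (gball N A i) t \<and>
      (0 < i \<longrightarrow> relation_store N ''near'' (gball N A (i - 1)) t)"])
    show "relation_store N ''far'' (gball N A 0) (setv s1 ''l'' 0) \<and>
      (0 < (0::nat) \<longrightarrow> relation_store N ''near'' (gball N A (0 - 1)) (setv s1 ''l'' 0))"
      using far by (simp add: relation_store_def)
  next
    fix i t assume I: "relation_store N ''far'' (gball N A i) t \<and> (0 < i \<longrightarrow> relation_store N ''near'' (gball N A (i - 1)) t)"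
      and fr: "\<And>a. a \<notin> insert ''l'' (writes (FSeq ?copies ?expands)) \<Longrightarrow> t a = s1 a"
    have t: "graph_store N A t" using graph_store_cong[OF s1(1), of t] fr by simp
    define t1 where "t1 = exec ?copies t"
    have t1fr: "t1 a = t a" if "a \<notin> {''x'', ''y'', ''near''}" for a
      unfolding t1_def by (rule exec_unchanged) (use that in simp)
    have t1: "graph_store N A t1" using graph_store_cong[OF t, of t1] t1fr by simp
    have near: "relation_store N ''near'' (gball N A i) t1"
      unfolding relation_store_def
    proof (intro allI impI)
      fix x y assume xy: "x < N" "y < N"
      show "t1 ''near'' (x * N + y) = (if gball N A i x y then 1 else 0)"
        unfolding t1_def
      proof (rule exec_For_matrix[where h = "\<lambda>x y. if gball N A i x y then 1 else 0"])
        fix x y u assume u: "x < N" "y < N" "u ''x'' 0 = x" "u ''y'' 0 = y"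
          "\<And>a. a \<notin> insert ''x'' (insert ''y'' (writes ?copy)) \<Longrightarrow> u a = t a"
        have "u ''row'' x = x * N" "u ''far'' = t ''far''" using u t by (simp_all add: graph_store_def)
        then show "exec ?copy u ''near'' = (u ''near'')(x * N + y := if gball N A i x y then 1 else 0)"
          using u(1-4) I by (simp add: relation_store_def)
      qed (use xy graph_storeD[OF t] in simp_all)
    qed
    define t2 where "t2 = exec ?expands t1"
    have "relation_store N ''far'' (gball N A (Suc i)) t2"
      unfolding relation_store_def
    proof (intro allI impI)
      fix x y assume xy: "x < N" "y < N"
      have "t2 ''far'' (x * N + y) = (if \<exists>w<N. gball N A i x w \<and> A w y then 1 else t1 ''far'' (x * N + y))"
        unfolding t2_def
      proof (rule exec_For_matrix[where h = "\<lambda>x y. if \<exists>w<N. gball N A i x w \<and> A w y then 1 else t1 ''far'' (x * N + y)"])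
        fix x y u assume u: "x < N" "y < N" "u ''x'' 0 = x" "u ''y'' 0 = y"
          "\<And>a. a \<notin> insert ''x'' (insert ''y'' (writes expand_ball)) \<Longrightarrow> u a = t1 a"
          "u ''far'' (x * N + y) = t1 ''far'' (x * N + y)"
        have g: "graph_store N A u" using graph_store_cong[OF t1, of u] u(5) by simp
        have nr: "relation_store N ''near'' (gball N A i) u" using near u(5) by (simp add: relation_store_def)
        show "exec expand_ball u ''far'' =
            (u ''far'')(x * N + y := if \<exists>w<N. gball N A i x w \<and> A w y then 1 else t1 ''far'' (x * N + y))"
          unfolding exec_expand_ball[OF g nr u(3,4,1,2)] u(6) by (rule refl)
      qed (use xy graph_storeD[OF t1] in simp_all)
      moreover have "t1 ''far'' (x * N + y) = (if gball N A i x y then 1 else 0)"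
        using I xy t1fr[of "''far''"] by (simp add: relation_store_def)
      ultimately show "t2 ''far'' (x * N + y) = (if gball N A (Suc i) x y then 1 else 0)" by auto
    qed
    moreover have "t2 ''near'' = t1 ''near''" unfolding t2_def by (rule exec_unchanged) simp
    moreover have "exec (FSeq ?copies ?expands) t = t2" by (simp only: exec.simps(3) t1_def t2_def)
    ultimately show "relation_store N ''far'' (gball N A (Suc i)) (setv (exec (FSeq ?copies ?expands) t) ''l'' (Suc i)) \<and>
      (0 < Suc i \<longrightarrow> relation_store N ''near'' (gball N A (Suc i - 1)) (setv (exec (FSeq ?copies ?expands) t) ''l'' (Suc i)))"
      using near by (simp add: relation_store_def del: exec.simps gball.simps)
  qed simp_all
  moreover have "exec balls s = s2" by (simp only: balls_def exec.simps(3) s1_def s2_def)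
  ultimately show "relation_store N ''far'' (gball N A (s ''k'' 0)) (exec balls s)"
    "relation_store N ''near'' (gball N A (s ''k'' 0 - 1)) (exec balls s)"
    using s1(2) s(3) by simp_all
qed

text \<open>The array \<open>par0\<close>, and \<open>par\<close> below, hold a predecessor plus one, 0 meaning that there is none yet.
  The root is its own predecessor.\<close>

definition order_step :: fprog where
  "order_step = FSeq (FSet ''x'' (Num 0))
     (FSeq (FFor ''j'' ''N'' (FWhen (Conj (Equal (Get ''vis0'' (V ''j'')) (Num 0)) (Less (Num 0) (Get ''par0'' (V ''j''))))
        (FSet ''x'' (V ''j''))))
     (FSeq (FPut ''ord'' (V ''t'') (V ''x''))
     (FSeq (FPut ''vis0'' (V ''x'') (Num 1))
        (FFor ''j'' ''N'' (FWhen (Conj (adjT (V ''x'') (V ''j'')) (Equal (Get ''par0'' (V ''j'')) (Num 0)))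
           (FPut ''par0'' (V ''j'') (Add (V ''x'') (Num 1))))))))"

definition order_vertices :: fprog where
  "order_vertices = FSeq (FPut ''par0'' (Num 0) (Num 1)) (FFor ''t'' ''N'' order_step)"

lemma writes_order [simp]:
  "writes order_step = {''x'', ''j'', ''ord'', ''vis0'', ''par0''}"
  "writes order_vertices = {''x'', ''j'', ''t'', ''ord'', ''vis0'', ''par0''}"
  by (auto simp: order_step_def order_vertices_def)

text \<open>Every vertex but the first comes after its predecessor, so antipodes and signs can be
  propagated in one pass through \<open>ord\<close>.\<close>

definition ordered_store :: "nat \<Rightarrow> (nat \<Rightarrow> nat \<Rightarrow> bool) \<Rightarrow> store \<Rightarrow> bool" where
  "ordered_store N A s \<longleftrightarrow> bij_betw (s ''ord'') {..<N} {..<N} \<and> s ''ord'' 0 = 0 \<and>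
     (\<forall>t<N. 0 < t \<longrightarrow> 0 < s ''par0'' (s ''ord'' t) \<and>
        (\<exists>u<t. s ''ord'' u = s ''par0'' (s ''ord'' t) - 1 \<and> A (s ''ord'' u) (s ''ord'' t)))"

definition order_inv :: "nat \<Rightarrow> (nat \<Rightarrow> nat \<Rightarrow> bool) \<Rightarrow> nat \<Rightarrow> store \<Rightarrow> bool" where
  "order_inv N A i t \<longleftrightarrow> (let ord = t ''ord''; par = t ''par0'' in
     (\<forall>u<i. ord u < N) \<and> inj_on ord {..<i} \<and> (\<forall>j<N. t ''vis0'' j = (if j \<in> ord ` {..<i} then 1 else 0)) \<and>
     (0 < i \<longrightarrow> ord 0 = 0) \<and> par 0 = 1 \<and>
     (\<forall>j<N. 0 < par j \<longrightarrow> j = 0 \<or> (\<exists>u<i. ord u = par j - 1 \<and> A (ord u) j)) \<and>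
     (\<forall>u<i. 0 < u \<longrightarrow> 0 < par (ord u) \<and> (\<exists>w<u. ord w = par (ord u) - 1 \<and> A (ord w) (ord u))) \<and>
     (\<forall>u<i. 0 < par (ord u)) \<and> (\<forall>u<i. \<forall>j<N. A (ord u) j \<longrightarrow> 0 < par j))"

lemma exec_order_step:
  assumes s: "graph_store N A s" "s ''t'' 0 = i" "i < N" and I: "order_inv N A i s"
    and conn: "\<And>S. S \<subseteq> {..<N} \<Longrightarrow> 0 \<in> S \<Longrightarrow> (\<And>x y. x \<in> S \<Longrightarrow> y < N \<Longrightarrow> A x y \<Longrightarrow> y \<in> S) \<Longrightarrow> S = {..<N}"
  shows "order_inv N A (Suc i) (exec order_step s)"
proof -
  let ?ord = "s ''ord''" and ?par = "s ''par0''"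
  have ord: "\<And>u. u < i \<Longrightarrow> ?ord u < N" "inj_on ?ord {..<i}"
    and vis: "\<And>j. j < N \<Longrightarrow> s ''vis0'' j = (if j \<in> ?ord ` {..<i} then 1 else 0)"
    and ord0: "0 < i \<Longrightarrow> ?ord 0 = 0" and par0: "?par 0 = 1"
    and par: "\<And>j. j < N \<Longrightarrow> 0 < ?par j \<Longrightarrow> j = 0 \<or> (\<exists>u<i. ?ord u = ?par j - 1 \<and> A (?ord u) j)"
    and tree: "\<And>u. u < i \<Longrightarrow> 0 < u \<Longrightarrow> 0 < ?par (?ord u) \<and> (\<exists>w<u. ?ord w = ?par (?ord u) - 1 \<and> A (?ord w) (?ord u))"
    and pos: "\<And>u. u < i \<Longrightarrow> 0 < ?par (?ord u)"
    and nb: "\<And>u j. u < i \<Longrightarrow> j < N \<Longrightarrow> A (?ord u) j \<Longrightarrow> 0 < ?par j"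
    using I by (simp_all add: order_inv_def Let_def)
  let ?Q = "\<lambda>j. s ''vis0'' j = 0 \<and> 0 < ?par j"
  let ?find = "FFor ''j'' ''N'' (FWhen (Conj (Equal (Get ''vis0'' (V ''j'')) (Num 0)) (Less (Num 0) (Get ''par0'' (V ''j''))))
        (FSet ''x'' (V ''j'')))"
  define s1 where "s1 = exec ?find (exec (FSet ''x'' (Num 0)) s)"
  define x where "x = s1 ''x'' 0"
  have N: "s ''N'' 0 = N" using graph_storeD(1)[OF s(1)] .
  \<comment> \<open>As long as a vertex is missing, connectedness yields an arc that leaves the
    visited set, and its head has already been given a predecessor.\<close>
  have ex: "\<exists>j<N. ?Q j"
  proof (cases "i = 0")
    case True
    then show ?thesis using vis par0 s(3) by auto
  next
    case False
    have "?ord ` {..<i} \<noteq> {..<N}"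
    proof
      assume "?ord ` {..<i} = {..<N}"
      then have "N = card (?ord ` {..<i})" by simp
      then show False using ord(2) s(3) by (simp add: card_image)
    qed
    moreover have "0 \<in> ?ord ` {..<i}" using ord0 False by force
    ultimately obtain u j where "u < i" "j < N" "A (?ord u) j" "j \<notin> ?ord ` {..<i}"
      using conn[of "?ord ` {..<i}"] ord(1) by blast
    then show ?thesis using nb vis by auto
  qed
  have "(s1 ''x'' 0 < s ''N'' 0 \<and> ?Q (s1 ''x'' 0)) \<or> ((\<forall>j<s ''N'' 0. \<not> ?Q j) \<and> s1 ''x'' 0 = 0)"
  proof -
    have "(s1 ''x'' 0 < exec (FSet ''x'' (Num 0)) s ''N'' 0 \<and> ?Q (s1 ''x'' 0)) \<or>
        ((\<forall>j<exec (FSet ''x'' (Num 0)) s ''N'' 0. \<not> ?Q j) \<and> s1 ''x'' 0 = exec (FSet ''x'' (Num 0)) s ''x'' 0)"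
      unfolding s1_def
    proof (rule exec_For_search)
      fix i t assume "t ''j'' 0 = i" and fr: "\<And>a. a \<notin> {''j'', ''x''} \<Longrightarrow> t a = exec (FSet ''x'' (Num 0)) s a"
      then show "holds (Conj (Equal (Get ''vis0'' (V ''j'')) (Num 0)) (Less (Num 0) (Get ''par0'' (V ''j'')))) t \<longleftrightarrow> ?Q i"
        by simp
    qed simp_all
    then show ?thesis by simp
  qed
  then have x: "x < N" "s ''vis0'' x = 0" "0 < ?par x" using ex N by (auto simp: x_def)
  have x_new: "x \<notin> ?ord ` {..<i}" using vis[OF x(1)] x(2) by (simp split: if_splits)
  have s1fr: "s1 a = s a" if "a \<notin> {''x'', ''j''}" for a
    unfolding s1_def using that by (subst exec_unchanged) simp_all
  define s2 where "s2 = exec (FSeq (FPut ''ord'' (V ''t'') (V ''x'')) (FPut ''vis0'' (V ''x'') (Num 1))) s1"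
  have s2: "s2 ''ord'' = ?ord(i := x)" "s2 ''vis0'' = (s ''vis0'')(x := 1)" "s2 ''x'' 0 = x"
    "s2 ''N'' = s ''N''" "s2 ''row'' = s ''row''" "s2 ''adj'' = s ''adj''" "s2 ''par0'' = ?par"
    using s(2) s1fr by (simp_all add: s2_def x_def)
  have g2: "graph_store N A s2" using graph_store_cong[OF s(1)] s2 by simp
  let ?link = "FWhen (Conj (adjT (V ''x'') (V ''j'')) (Equal (Get ''par0'' (V ''j'')) (Num 0)))
           (FPut ''par0'' (V ''j'') (Add (V ''x'') (Num 1)))"
  define s3 where "s3 = exec (FFor ''j'' ''N'' ?link) s2"
  have p3: "s3 ''par0'' j = (if j < s2 ''N'' 0 then if A x j \<and> ?par j = 0 then Suc x else ?par j else s2 ''par0'' j)" for j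
    unfolding s3_def
  proof (rule exec_For_update[where h = "\<lambda>j. if A x j \<and> ?par j = 0 then Suc x else ?par j"])
    fix j t assume j: "j < s2 ''N'' 0" "t ''j'' 0 = j" "t ''par0'' j = s2 ''par0'' j"
      and fr: "\<And>a. a \<notin> insert ''j'' (writes ?link) \<Longrightarrow> t a = s2 a"
    have "graph_store N A t" using graph_store_cong[OF g2, of t] fr by simp
    then have "holds (adjT (V ''x'') (V ''j'')) t \<longleftrightarrow> A x j"
      using holds_adjT[of N A t "V ''x''" "V ''j''"] j fr[of "''x''"] s2(3,4) N x(1) by simp
    then show "exec ?link t ''par0'' = (t ''par0'')(j := if A x j \<and> ?par j = 0 then Suc x else ?par j)"
      using j s2(3,7) fr[of "''x''"] by auto
  qed simp_all
  have s3: "s3 ''ord'' = ?ord(i := x)" "s3 ''vis0'' = (s ''vis0'')(x := 1)"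
  proof -
    have "s3 ''ord'' = s2 ''ord''" "s3 ''vis0'' = s2 ''vis0''"
      by (simp_all add: s3_def exec_unchanged del: exec.simps(5))
    then show "s3 ''ord'' = ?ord(i := x)" "s3 ''vis0'' = (s ''vis0'')(x := 1)"
      by (simp_all only: s2)
  qed
  have p3': "s3 ''par0'' j = (if j < N \<and> A x j \<and> ?par j = 0 then Suc x else ?par j)" for j
    using p3 s2 N by auto
  have ordi: "s3 ''ord'' u = ?ord u" if "u < i" for u using that s3(1) by simp
  have keep: "0 < ?par j \<Longrightarrow> s3 ''par0'' j = ?par j" for j using p3' by simp
  have fin: "exec order_step s = s3"
    by (simp only: order_step_def exec.simps(3) s1_def s2_def s3_def)
  have im: "s3 ''ord'' ` {..<Suc i} = insert x (?ord ` {..<i})"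
    unfolding s3 by (auto simp: lessThan_Suc image_iff)
  have xpar: "x = 0 \<or> (\<exists>u<i. ?ord u = ?par x - 1 \<and> A (?ord u) x)" using par x by blast
  have x0: "x = 0 \<longleftrightarrow> i = 0"
  proof
    assume "x = 0"
    show "i = 0"
    proof (rule ccontr)
      assume "i \<noteq> 0"
      then have "?ord 0 = x" "0 \<in> {..<i}" using ord0 \<open>x = 0\<close> by simp_all
      then show False using x_new by (metis imageI)
    qed
  qed (use xpar in auto)
  show ?thesis
    unfolding fin order_inv_def Let_def
  proof (intro conjI)
    show "\<forall>u<Suc i. s3 ''ord'' u < N" using ord x by (auto simp: s3 less_Suc_eq)
    show "inj_on (s3 ''ord'') {..<Suc i}"
      unfolding s3 using ord(2) x_new by (auto simp: lessThan_Suc inj_on_def)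
    show "\<forall>j<N. s3 ''vis0'' j = (if j \<in> s3 ''ord'' ` {..<Suc i} then 1 else 0)"
      unfolding im using vis by (auto simp: s3)
    show "0 < Suc i \<longrightarrow> s3 ''ord'' 0 = 0" using ord0 x0 by (auto simp: s3)
    show "s3 ''par0'' 0 = 1" using keep par0 by simp
    show "\<forall>j<N. 0 < s3 ''par0'' j \<longrightarrow> j = 0 \<or> (\<exists>u<Suc i. s3 ''ord'' u = s3 ''par0'' j - 1 \<and> A (s3 ''ord'' u) j)"
    proof (intro allI impI)
      fix j assume j: "j < N" "0 < s3 ''par0'' j"
      show "j = 0 \<or> (\<exists>u<Suc i. s3 ''ord'' u = s3 ''par0'' j - 1 \<and> A (s3 ''ord'' u) j)"
      proof (cases "0 < ?par j")
        case True
        then have "j = 0 \<or> (\<exists>u<i. ?ord u = s3 ''par0'' j - 1 \<and> A (?ord u) j)" using par j keep by simp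
        then show ?thesis using ordi by (metis less_SucI)
      next
        case False
        then have "s3 ''par0'' j = Suc x" "A x j" using p3'[of j] j by (auto split: if_splits)
        then show ?thesis by (auto simp: s3)
      qed
    qed
    show "\<forall>u<Suc i. 0 < u \<longrightarrow> 0 < s3 ''par0'' (s3 ''ord'' u) \<and>
        (\<exists>w<u. s3 ''ord'' w = s3 ''par0'' (s3 ''ord'' u) - 1 \<and> A (s3 ''ord'' w) (s3 ''ord'' u))"
    proof (intro allI impI)
      fix u assume u: "u < Suc i" "0 < u"
      show "0 < s3 ''par0'' (s3 ''ord'' u) \<and> (\<exists>w<u. s3 ''ord'' w = s3 ''par0'' (s3 ''ord'' u) - 1 \<and> A (s3 ''ord'' w) (s3 ''ord'' u))"
      proof (cases "u = i")
        case True
        then obtain w where "w < i" "?ord w = ?par x - 1" "A (?ord w) x" using xpar x0 u by auto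
        then show ?thesis using True keep[OF x(3)] x(3) by (auto simp: s3)
      next
        case False
        then have ui: "u < i" using u by simp
        then obtain w where "w < u" "?ord w = ?par (?ord u) - 1" "A (?ord w) (?ord u)" "0 < ?par (?ord u)"
          using tree u by blast
        moreover have "s3 ''ord'' u = ?ord u" "s3 ''ord'' w = ?ord w" using ordi ui \<open>w < u\<close> by simp_all
        ultimately show ?thesis using keep by metis
      qed
    qed
    show "\<forall>u<Suc i. 0 < s3 ''par0'' (s3 ''ord'' u)"
      using pos x keep by (auto simp: s3 less_Suc_eq)
    show "\<forall>u<Suc i. \<forall>j<N. A (s3 ''ord'' u) j \<longrightarrow> 0 < s3 ''par0'' j"
    proof (intro allI impI)
      fix u j assume u: "u < Suc i" "j < N" "A (s3 ''ord'' u) j"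
      show "0 < s3 ''par0'' j"
      proof (cases "u = i")
        case True
        then show ?thesis using u p3'[of j] by (auto simp: s3)
      next
        case False
        then have "u < i" using u(1) by simp
        then have "0 < ?par j" using nb u(2,3) ordi by metis
        then show ?thesis using keep by simp
      qed
    qed
  qed
qed

lemma exec_order_vertices:
  assumes s: "graph_store N A s" "0 < N" "\<And>c. s ''vis0'' c = 0" "\<And>c. s ''par0'' c = 0"
    and conn: "\<And>S. S \<subseteq> {..<N} \<Longrightarrow> 0 \<in> S \<Longrightarrow> (\<And>x y. x \<in> S \<Longrightarrow> y < N \<Longrightarrow> A x y \<Longrightarrow> y \<in> S) \<Longrightarrow> S = {..<N}"
  shows "ordered_store N A (exec order_vertices s)"
proof -
  define s1 where "s1 = exec (FPut ''par0'' (Num 0) (Num 1)) s"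
  have s1: "graph_store N A s1" using graph_store_cong[OF s(1), of s1] by (simp add: s1_def)
  have N: "s1 ''N'' 0 = N" using graph_storeD(1)[OF s1] .
  define s2 where "s2 = exec (FFor ''t'' ''N'' order_step) s1"
  have "order_inv N A (s1 ''N'' 0) s2"
    unfolding s2_def
  proof (rule exec_For[where I = "order_inv N A"])
    show "order_inv N A 0 (setv s1 ''t'' 0)"
      using s by (simp add: order_inv_def s1_def Let_def)
  next
    fix i t assume i: "i < s1 ''N'' 0" "order_inv N A i t" "t ''t'' 0 = i"
      and fr: "\<And>a. a \<notin> insert ''t'' (writes order_step) \<Longrightarrow> t a = s1 a"
    have "graph_store N A t" using graph_store_cong[OF s1, of t] fr by simp
    then have "order_inv N A (Suc i) (exec order_step t)"
      using exec_order_step[of N A t i] i N conn by blast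
    then show "order_inv N A (Suc i) (setv (exec order_step t) ''t'' (Suc i))"
      by (simp add: order_inv_def)
  qed simp_all
  then have I: "order_inv N A N s2" using N by simp
  have "s2 ''ord'' ` {..<N} \<subseteq> {..<N}" "inj_on (s2 ''ord'') {..<N}"
    using I by (auto simp: order_inv_def Let_def)
  then have "bij_betw (s2 ''ord'') {..<N} {..<N}"
    by (simp add: bij_betw_def endo_inj_surj)
  then have "ordered_store N A s2"
    using I s(2) unfolding order_inv_def ordered_store_def Let_def by blast
  moreover have "exec order_vertices s = s2" by (simp only: order_vertices_def exec.simps(3) s1_def s2_def)
  ultimately show ?thesis by simp
qed

section \<open>Antipodes and unlabelled arcs\<close>

definition antipode_step :: fprog where
  "antipode_step = FSeq (FSet ''x'' (Get ''ord'' (V ''t''))) (FIf (Equal (V ''t'') (Num 0))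
     (FPut ''al'' (V ''x'') (V ''c''))
     (FSeq (FSet ''y'' (Get ''al'' (Sub (Get ''par0'' (V ''x'')) (Num 1)))) (FSeq (FSet ''a'' (Num 0))
       (FSeq (FFor ''w'' ''N'' (FWhen (Conj (adjT (V ''y'') (V ''w''))
            (Neg (Equal (Get ''far'' (Add (Get ''row'' (V ''x'')) (V ''w''))) (Num 1)))) (FSet ''a'' (V ''w''))))
          (FPut ''al'' (V ''x'') (V ''a''))))))"

definition find_antipodes :: fprog where
  "find_antipodes = FFor ''t'' ''N'' antipode_step"

lemma writes_antipodes [simp]:
  "writes antipode_step = {''x'', ''al'', ''y'', ''a'', ''w''}"
  "writes find_antipodes = {''t'', ''x'', ''al'', ''y'', ''a'', ''w''}"
  by (auto simp: antipode_step_def find_antipodes_def)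

text \<open>The arrays are reused by successive guesses, so the labels of an earlier guess have to
  be erased.\<close>

definition clear_labels :: fprog where
  "clear_labels = FFor ''x'' ''N'' (FFor ''y'' ''N''
     (FPut ''lab'' (Add (Get ''row'' (V ''x'')) (V ''y'')) (Num 0)))"

lemma writes_clear_labels [simp]: "writes clear_labels = {''x'', ''y'', ''lab''}"
  by (auto simp: clear_labels_def)

lemma exec_clear_labels:
  assumes "graph_store N A s" "x < N" "y < N"
  shows "exec clear_labels s ''lab'' (x * N + y) = 0"
  unfolding clear_labels_def
proof (rule exec_For_matrix[where h = "\<lambda>_ _. 0"])
  let ?p = "FPut ''lab'' (Add (Get ''row'' (V ''x'')) (V ''y'')) (Num 0)"
  fix x y u assume u: "x < N" "y < N" "u ''x'' 0 = x" "u ''y'' 0 = y"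
    "\<And>a. a \<notin> insert ''x'' (insert ''y'' (writes ?p)) \<Longrightarrow> u a = s a"
  have "u ''row'' x = x * N" using u assms(1) by (simp add: graph_store_def)
  then show "exec ?p u ''lab'' = (u ''lab'')(x * N + y := 0)" using u(1-4) by simp
qed (use assms graph_storeD[OF assms(1)] in simp_all)

definition arc_free :: test where
  "arc_free = Conj (adjT (V ''x'') (V ''y'')) (Conj (Equal (Get ''lab'' (Add (Get ''row'' (V ''x'')) (V ''y''))) (Num 0))
     (Neg (Conj (Neg (Equal (V ''t'') (Num 0))) (Neg (Equal (Get ''par0'' (V ''x'')) (Add (V ''y'') (Num 1)))))))"

text \<open>The flag \<open>f\<close> preserves the earliest hit in the vertex order; that no
  earlier vertex has a free arc is what determines the sign of the root.\<close>

definition find_arc :: fprog where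
  "find_arc = FSeq (FSet ''f'' (Num 0)) (FFor ''t'' ''N'' (FSeq (FSet ''x'' (Get ''ord'' (V ''t'')))
     (FFor ''y'' ''N'' (FWhen (Conj (Equal (V ''f'') (Num 0)) arc_free)
        (FSeq (FSet ''f'' (Num 1)) (FSeq (FSet ''x0'' (V ''x'')) (FSet ''y0'' (V ''y''))))))))"

lemma writes_find_arc [simp]: "writes find_arc = {''f'', ''t'', ''x'', ''y'', ''x0'', ''y0''}"
  by (auto simp: find_arc_def)

lemma exec_find_arc:
  assumes s: "graph_store N A s" "\<And>t. t < N \<Longrightarrow> s ''ord'' t < N"
  defines "P \<equiv> \<lambda>t y. A (s ''ord'' t) y \<and> s ''lab'' (s ''ord'' t * N + y) = 0 \<and>
    (t = 0 \<or> s ''par0'' (s ''ord'' t) = y + 1)"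
  assumes ex: "t1 < N" "y1 < N" "P t1 y1"
  obtains t where "t < N" "exec find_arc s ''x0'' 0 = s ''ord'' t" "exec find_arc s ''y0'' 0 < N"
    "P t (exec find_arc s ''y0'' 0)" "\<And>u y. u < t \<Longrightarrow> y < N \<Longrightarrow> \<not> P u y"
proof -
  let ?mark = "FSeq (FSet ''f'' (Num 1)) (FSeq (FSet ''x0'' (V ''x'')) (FSet ''y0'' (V ''y'')))"
  let ?p = "FWhen (Conj (Equal (V ''f'') (Num 0)) arc_free) ?mark"
  let ?q = "FSeq (FSet ''x'' (Get ''ord'' (V ''t''))) (FFor ''y'' ''N'' ?p)"
  define s1 where "s1 = exec (FSet ''f'' (Num 0)) s"
  have s1: "graph_store N A s1" "s1 ''N'' 0 = N" "s1 ''ord'' = s ''ord''" "s1 ''lab'' = s ''lab''" "s1 ''par0'' = s ''par0''"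
    using graph_store_cong[OF s(1), of s1] graph_storeD(1)[OF s(1)] by (simp_all add: s1_def)
  define found where "found i u \<longleftrightarrow> u ''f'' 0 = 1 \<and> (\<exists>t<i. u ''x0'' 0 = s ''ord'' t \<and> u ''y0'' 0 < N \<and>
      P t (u ''y0'' 0) \<and> (\<forall>t'<t. \<forall>y<N. \<not> P t' y))" for i :: nat and u :: store
  have "(exec (FFor ''t'' ''N'' ?q) s1 ''f'' 0 = 0 \<and> (\<forall>t<s1 ''N'' 0. \<forall>y<N. \<not> P t y)) \<or> found (s1 ''N'' 0) (exec (FFor ''t'' ''N'' ?q) s1)"
  proof (rule exec_For[where I = "\<lambda>i u. (u ''f'' 0 = 0 \<and> (\<forall>t<i. \<forall>y<N. \<not> P t y)) \<or> found i u"])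
    show "(setv s1 ''t'' 0 ''f'' 0 = 0 \<and> (\<forall>t<(0::nat). \<forall>y<N. \<not> P t y)) \<or> found 0 (setv s1 ''t'' 0)"
      by (simp add: s1_def)
  next
    fix i u assume i: "i < s1 ''N'' 0" "u ''t'' 0 = i" and I: "(u ''f'' 0 = 0 \<and> (\<forall>t<i. \<forall>y<N. \<not> P t y)) \<or> found i u"
      and fr: "\<And>a. a \<notin> insert ''t'' (writes ?q) \<Longrightarrow> u a = s1 a"
    define u1 where "u1 = exec (FSet ''x'' (Get ''ord'' (V ''t''))) u"
    have u1: "graph_store N A u1" "u1 ''t'' 0 = i" "u1 ''x'' 0 = s ''ord'' i" "u1 ''f'' = u ''f''" "u1 ''x0'' = u ''x0''"
      "u1 ''y0'' = u ''y0''" "u1 ''lab'' = s ''lab''" "u1 ''par0'' = s ''par0''" "u1 ''N'' 0 = N" "s ''ord'' i < N"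
      using graph_store_cong[OF s1(1), of u1] fr i s1 s(2) by (simp_all add: u1_def arc_free_def)
    have xi: "u1 ''row'' (s ''ord'' i) = s ''ord'' i * N" using graph_storeD(2)[OF u1(1)] u1(10) by simp
    let ?J = "\<lambda>j w. (w ''f'' 0 = 0 \<and> (\<forall>t<i. \<forall>y<N. \<not> P t y) \<and> (\<forall>y<j. \<not> P i y)) \<or> found (Suc i) w"
    have "?J (u1 ''N'' 0) (exec (FFor ''y'' ''N'' ?p) u1)"
    proof (rule exec_For[where I = ?J])
      show "?J 0 (setv u1 ''y'' 0)"
        using I u1 by (auto simp: found_def less_Suc_eq)
    next
      fix j w assume j: "j < u1 ''N'' 0" "w ''y'' 0 = j" and J: "?J j w"
        and fr': "\<And>a. a \<notin> insert ''y'' (writes ?p) \<Longrightarrow> w a = u1 a"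
      have w: "graph_store N A w" using graph_store_cong[OF u1(1), of w] fr' by simp
      have wx: "w ''x'' 0 = s ''ord'' i" "w ''row'' (s ''ord'' i) = s ''ord'' i * N" "w ''t'' 0 = i" "w ''lab'' = s ''lab''" "w ''par0'' = s ''par0''"
        using fr' u1 xi by simp_all
      have jN: "j < N" using j u1 by simp
      have "holds (adjT (V ''x'') (V ''y'')) w \<longleftrightarrow> A (s ''ord'' i) j"
        using holds_adjT[OF w, of "V ''x''" "V ''y''"] wx j jN u1(10) by simp
      then have c: "holds arc_free w \<longleftrightarrow> P i j"
        using wx j(2) by (auto simp: arc_free_def P_def)
      show "?J (Suc j) (setv (exec ?p w) ''y'' (Suc j))"
      proof (cases "w ''f'' 0 = 0")
        case False
        then show ?thesis using J by (auto simp: found_def)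
      next
        case f0: True
        then have no: "\<forall>t<i. \<forall>y<N. \<not> P t y" "\<forall>y<j. \<not> P i y" using J by (auto simp: found_def)
        show ?thesis
        proof (cases "P i j")
          case True
          have "found (Suc i) (exec ?mark w)"
            unfolding found_def using True no wx j jN by auto
          moreover have "exec ?p w = exec ?mark w" using True c f0 by simp
          ultimately show ?thesis by (simp add: found_def)
        next
          case False
          then have "exec ?p w = w" using c f0 by simp
          then show ?thesis using False no f0 by (auto simp: less_Suc_eq)
        qed
      qed
    qed (simp_all add: arc_free_def)
    moreover have "exec ?q u = exec (FFor ''y'' ''N'' ?p) u1" by (simp only: exec.simps(3) u1_def)
    ultimately show "(setv (exec ?q u) ''t'' (Suc i) ''f'' 0 = 0 \<and> (\<forall>t<Suc i. \<forall>y<N. \<not> P t y)) \<or>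
        found (Suc i) (setv (exec ?q u) ''t'' (Suc i))"
      using u1(9) by (auto simp: found_def less_Suc_eq simp del: exec.simps)
  qed (simp_all add: arc_free_def)
  moreover have "exec find_arc s = exec (FFor ''t'' ''N'' ?q) s1" by (simp only: find_arc_def exec.simps(3) s1_def)
  ultimately have "found N (exec find_arc s)" using ex s1(2) by auto
  then show thesis using that unfolding found_def by blast
qed

section \<open>Propagation of the antipodal map along the vertex order\<close>

context labelled_graph
begin

lemma parent:
  assumes "ordered_store N A s" "t < N" "0 < t"
  defines "x \<equiv> s ''ord'' t"
  obtains u where "u < t" "s ''ord'' u = s ''par0'' x - 1" "A (s ''ord'' u) x" "0 < s ''par0'' x"
  using assms unfolding ordered_store_def by blast

lemma ord_less: "ordered_store N A s \<Longrightarrow> t < N \<Longrightarrow> s ''ord'' t < N"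
  using bij_betwE unfolding ordered_store_def by fastforce

lemma ord_surj: "ordered_store N A s \<Longrightarrow> x < N \<Longrightarrow> \<exists>t<N. s ''ord'' t = x"
  unfolding ordered_store_def by (metis bij_betw_imp_surj_on imageE lessThan_iff)

lemma exec_find_antipodes:
  assumes s: "graph_store N A s" "ordered_store N A s" "relation_store N ''far'' (gball N A k) s"
    and c: "s ''c'' 0 = anti 0" and x: "x < N"
  shows "exec find_antipodes s ''al'' x = anti x"
proof -
  have N: "s ''N'' 0 = N" using graph_storeD(1)[OF s(1)] .
  let ?ord = "s ''ord''"
  have "\<forall>u<s ''N'' 0. exec find_antipodes s ''al'' (?ord u) = anti (?ord u)"
    unfolding find_antipodes_def
  proof (rule exec_For[where I = "\<lambda>i t. \<forall>u<i. t ''al'' (?ord u) = anti (?ord u)"])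
    fix i t assume i: "i < s ''N'' 0" "t ''t'' 0 = i" and I: "\<forall>u<i. t ''al'' (?ord u) = anti (?ord u)"
      and fr: "\<And>a. a \<notin> insert ''t'' (writes antipode_step) \<Longrightarrow> t a = s a"
    define y where "y = ?ord i"
    have iN: "i < N" using i N by simp
    have y: "y < N" using ord_less[OF s(2)] i N by (simp add: y_def)
    have diff: "?ord u \<noteq> y" if "u < i" for u
    proof -
      have "inj_on ?ord {..<N}" using s(2) by (simp add: ordered_store_def bij_betw_def)
      then show ?thesis using that iN by (auto simp: y_def dest: inj_onD)
    qed
    have main: "exec antipode_step t ''al'' = (t ''al'')(y := anti y)"
    proof (cases "i = 0")
      case True
      then have "y = 0" using s(2) by (simp add: y_def ordered_store_def)
      then show ?thesis using True i fr c s(2) by (simp add: antipode_step_def ordered_store_def)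
    next
      case False
      then obtain u where u: "u < i" "?ord u = s ''par0'' y - 1" "A (?ord u) y"
        using parent[OF s(2), of i] iN unfolding y_def by blast
      define p where "p = ?ord u"
      have "u < N" using u(1) iN by simp
      then have p: "p < N" "A p y" "t ''al'' p = anti p"
        using ord_less[OF s(2)] u(1,3) I unfolding p_def by blast+
      let ?c = "Conj (adjT (V ''y'') (V ''w'')) (Neg (Equal (Get ''far'' (Add (Get ''row'' (V ''x'')) (V ''w''))) (Num 1)))"
      let ?F = "FFor ''w'' ''N'' (FWhen ?c (FSet ''a'' (V ''w'')))"
      define t1 where "t1 = exec (FSeq (FSet ''x'' (Get ''ord'' (V ''t''))) (FSeq (FSet ''y'' (Get ''al'' (Sub (Get ''par0'' (V ''x'')) (Num 1)))) (FSet ''a'' (Num 0)))) t"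
      have t1: "t1 ''x'' 0 = y" "t1 ''y'' 0 = anti p" "t1 ''a'' 0 = 0" "t1 ''al'' = t ''al''"
        using i fr p(3) u(2) by (simp_all add: t1_def y_def p_def)
      have g1: "graph_store N A t1" "t1 ''far'' = s ''far''"
        using graph_store_cong[OF s(1), of t1] fr by (simp_all add: t1_def)
      have "(exec ?F t1 ''a'' 0 < t1 ''N'' 0 \<and> exec ?F t1 ''a'' 0 = anti y) \<or>
          ((\<forall>i<t1 ''N'' 0. i \<noteq> anti y) \<and> exec ?F t1 ''a'' 0 = t1 ''a'' 0)"
      proof (rule exec_For_search[where Q = "\<lambda>w. w = anti y"])
        fix w v assume w: "w < t1 ''N'' 0" "v ''w'' 0 = w" and fr': "\<And>a. a \<notin> {''w'', ''a''} \<Longrightarrow> v a = t1 a"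
        have wN: "w < N" using w graph_storeD[OF g1(1)] by simp
        have gv: "graph_store N A v" using graph_store_cong[OF g1(1), of v] fr' by simp
        have "holds (adjT (V ''y'') (V ''w'')) v \<longleftrightarrow> A (anti p) w"
          using holds_adjT[OF gv, of "V ''y''" "V ''w''"] fr' t1 w wN anti(1)[OF p(1)] by simp
        moreover have "v ''row'' y = y * N" using graph_storeD(2)[OF gv y] .
        moreover have "s ''far'' (y * N + w) = 1 \<longleftrightarrow> gball N A k y w"
          using s(3) y wN by (simp add: relation_store_def)
        ultimately have "holds ?c v \<longleftrightarrow> A (anti p) w \<and> \<not> gball N A k y w"
          using fr' t1 g1(2) w(2) by simp
        then show "holds ?c v \<longleftrightarrow> w = anti y" using antipode_search[OF y p(1,2) wN] by simp
      qed simp_all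
      then have "exec ?F t1 ''a'' 0 = anti y" using anti(1)[OF y] graph_storeD(1)[OF g1(1)] by blast
      moreover have "exec ?F t1 ''x'' = t1 ''x''" "exec ?F t1 ''al'' = t1 ''al''" by (rule exec_unchanged; simp)+
      moreover have "exec antipode_step t = exec (FPut ''al'' (V ''x'') (V ''a'')) (exec ?F t1)"
        using False i by (simp add: antipode_step_def t1_def del: exec.simps(5))
      ultimately show ?thesis using t1 by (simp del: exec.simps(5))
    qed
    show "\<forall>u<Suc i. setv (exec antipode_step t) ''t'' (Suc i) ''al'' (?ord u) = anti (?ord u)"
      using main I diff by (auto simp: less_Suc_eq y_def)
  qed simp_all
  then show ?thesis using ord_surj[OF s(2) x] N by auto
qed

end

section \<open>The zero class of an element\<close>

abbreviation nearT :: "string \<Rightarrow> test" where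
  "nearT q \<equiv> Equal (Get ''near'' (Add (Get ''row'' (V q)) (Get ''al'' (V ''w'')))) (Num 1)"

text \<open>The arrays \<open>plus\<close> and \<open>minus\<close> hold, for a vertex of the zero class, its two neighbours outside
  of the class.  The search may also pass from a vertex to its antipode: for \<open>r = 2\<close> a zero class is
  a pair of antipodes and not connected otherwise.\<close>

definition transport :: "string \<Rightarrow> string \<Rightarrow> fprog" where
  "transport src dst = FSeq (FSet ''y'' (Get src (V ''p''))) (FSeq (FSet ''a'' (Num 0))
     (FSeq (FFor ''w'' ''N'' (FWhen (Conj (adjT (V ''x'') (V ''w'')) (Conj (nearT ''y'') (Neg (nearT ''p''))))
        (FSet ''a'' (V ''w'')))) (FPut dst (V ''x'') (V ''a''))))"

text \<open>A vertex entered from its antipode receives the antipodes of the exits, whose signs are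
  reversed, so \<open>plus\<close> and \<open>minus\<close> trade places. The case
  \<open>p = x\<close> is the root, whose exits are set by \<open>flood_init\<close>.\<close>

definition reach_vertex :: fprog where
  "reach_vertex = FIf (Equal (V ''p'') (V ''x'')) FSkip (FIf (Equal (V ''x'') (Get ''al'' (V ''p'')))
     (FSeq (FPut ''plus'' (V ''x'') (Get ''al'' (Get ''minus'' (V ''p''))))
           (FPut ''minus'' (V ''x'') (Get ''al'' (Get ''plus'' (V ''p'')))))
     (FSeq (transport ''plus'' ''minus'') (transport ''minus'' ''plus'')))"

text \<open>A neighbour of \<open>x\<close> other than the two exits stays in the zero class. The
  negated conjunction is the disjunction with being the antipode.\<close>

definition link_zeros :: fprog where
  "link_zeros = FFor ''j'' ''N'' (FWhen (Conj (Equal (Get ''par'' (V ''j'')) (Num 0))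
     (Neg (Conj (Neg (Conj (adjT (V ''x'') (V ''j''))
         (Conj (Neg (Equal (V ''j'') (Get ''plus'' (V ''x'')))) (Neg (Equal (V ''j'') (Get ''minus'' (V ''x'')))))))
       (Neg (Equal (V ''j'') (Get ''al'' (V ''x''))))))) (FPut ''par'' (V ''j'') (Add (V ''x'') (Num 1))))"

definition flood_init :: fprog where
  "flood_init = FSeq (FFor ''j'' ''N'' (FSeq (FPut ''vis'' (V ''j'') (Num 0)) (FPut ''par'' (V ''j'') (Num 0))))
     (FSeq (FPut ''par'' (V ''x0'') (Add (V ''x0'') (Num 1))) (FSeq (FPut ''plus'' (V ''x0'') (V ''y0''))
       (FSeq (FSet ''a'' (Num 0))
         (FSeq (FFor ''w'' ''N'' (FWhen (Conj (adjT (V ''x0'') (V ''w'')) (nearT ''y0'')) (FSet ''a'' (V ''w''))))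
           (FPut ''minus'' (V ''x0'') (V ''a''))))))"

text \<open>The value \<open>N\<close> in \<open>x\<close> signals that no marked vertex is left
  unvisited. The zero class may have fewer than \<open>N\<close> vertices, and the remaining rounds
  are then idle.\<close>

definition flood_step :: fprog where
  "flood_step = FSeq (FSet ''x'' (V ''N''))
     (FSeq (FFor ''j'' ''N'' (FWhen (Conj (Equal (Get ''vis'' (V ''j'')) (Num 0)) (Less (Num 0) (Get ''par'' (V ''j''))))
        (FSet ''x'' (V ''j''))))
     (FWhen (Less (V ''x'') (V ''N''))
        (FSeq (FPut ''vis'' (V ''x'') (Num 1)) (FSeq (FSet ''p'' (Sub (Get ''par'' (V ''x'')) (Num 1)))
          (FSeq reach_vertex link_zeros)))))"

definition flood :: fprog where
  "flood = FSeq flood_init (FFor ''t'' ''N'' flood_step)"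

lemma writes_flood [simp]:
  "writes (transport src dst) = {''y'', ''a'', ''w'', dst}"
  "writes reach_vertex = {''y'', ''a'', ''w'', ''plus'', ''minus''}"
  "writes link_zeros = {''j'', ''par''}"
  "writes flood_init = {''j'', ''vis'', ''par'', ''plus'', ''minus'', ''a'', ''w''}"
  "writes flood_step = {''x'', ''j'', ''vis'', ''p'', ''y'', ''a'', ''w'', ''plus'', ''minus'', ''par''}"
  "writes flood = {''x'', ''j'', ''t'', ''vis'', ''p'', ''y'', ''a'', ''w'', ''plus'', ''minus'', ''par''}"
  by (auto simp: transport_def reach_vertex_def link_zeros_def flood_init_def flood_step_def flood_def)

context labelled_graph
begin

definition antipodal_store :: "store \<Rightarrow> bool" where
  "antipodal_store s \<longleftrightarrow> graph_store N A s \<and> relation_store N ''near'' (gball N A (k - 1)) s \<and>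
     (\<forall>x<N. s ''al'' x = anti x)"

lemma antipodal_store_cong:
  "antipodal_store s \<Longrightarrow> t ''N'' = s ''N'' \<Longrightarrow> t ''row'' = s ''row'' \<Longrightarrow> t ''adj'' = s ''adj'' \<Longrightarrow>
    t ''near'' = s ''near'' \<Longrightarrow> t ''al'' = s ''al'' \<Longrightarrow> antipodal_store t"
  by (simp add: antipodal_store_def graph_store_def relation_store_def)

lemma antipodal_storeD:
  assumes "antipodal_store s"
  shows "graph_store N A s" "s ''N'' 0 = N" "x < N \<Longrightarrow> s ''al'' x = anti x"
    "s q 0 < N \<Longrightarrow> s ''w'' 0 < N \<Longrightarrow> holds (nearT q) s \<longleftrightarrow> gball N A (k - 1) (s q 0) (anti (s ''w'' 0))"
  using assms anti(1) by (auto simp: antipodal_store_def graph_store_def relation_store_def)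

lemma anti_drops: "drops g x y \<Longrightarrow> drops g (anti x) (anti y)"
proof -
  assume d: "drops g x y"
  then have xy: "x < N" "y < N" by (auto simp: drops_def)
  then have "A x y \<and> g \<in> E \<and> f x g = Zero \<and> f y g \<noteq> Zero" using d drops_iff by blast
  then show ?thesis using drops_iff A_anti anti xy by simp
qed

lemma f_anti: "x < N \<Longrightarrow> g \<in> E \<Longrightarrow> f (anti x) g = flip (f x g)"
  by (simp add: anti)

lemma dropsD:
  assumes "drops g x y"
  shows "x < N" "y < N" "A x y" "g \<in> E" "f x g = Zero" "f y g \<noteq> Zero"
proof -
  show "x < N" "y < N" using assms by (auto simp: drops_def)
  then show "A x y" "g \<in> E" "f x g = Zero" "f y g \<noteq> Zero" using assms drops_iff by blast+
qed

text \<open>One and the same \<open>\<epsilon>\<close> is used for all vertices of the class: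
  transport keeps the two sides of the element coherent, so that all \<open>plus\<close> exits lie
  on one side.\<close>

definition exits :: "nat \<Rightarrow> sign \<Rightarrow> nat \<Rightarrow> store \<Rightarrow> bool" where
  "exits g \<epsilon> x s \<longleftrightarrow> drops g x (s ''plus'' x) \<and> f (s ''plus'' x) g = \<epsilon> \<and>
     drops g x (s ''minus'' x) \<and> f (s ''minus'' x) g = flip \<epsilon>"

definition zero_link :: "nat \<Rightarrow> nat \<Rightarrow> nat \<Rightarrow> bool" where
  "zero_link g p x \<longleftrightarrow> (A p x \<and> f x g = Zero) \<or> x = anti p"

lemma exits_iff: "exits g \<epsilon> x s \<Longrightarrow> drops g x j \<longleftrightarrow> j = s ''plus'' x \<or> j = s ''minus'' x"
proof -
  assume e: "exits g \<epsilon> x s"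
  have "f j g = \<epsilon> \<or> f j g = flip \<epsilon>" if "drops g x j"
    using dropsD(6)[OF that] e dropsD(6) nonzero_signs unfolding exits_def by metis
  then show ?thesis using e drops_unique unfolding exits_def by metis
qed

text \<open>\<open>transport_search\<close> singles out one neighbour of \<open>x\<close>, and it
  lies on the side opposite to \<open>y\<close>; this is why \<open>plus\<close> is computed from
  \<open>minus\<close> and vice versa.\<close>

lemma exec_transport:
  assumes s: "antipodal_store s" "s ''x'' 0 = x" "s ''p'' 0 = p" "s src p = y"
    and x: "A p x" "x < N" "f x g = Zero" and y: "drops g p y"
    and names: "src \<noteq> ''y''" "dst \<notin> {''x'', ''y'', ''a'', ''w'', ''p''}"
  obtains w where "drops g x w" "f w g = flip (f y g)" "exec (transport src dst) s dst = (s dst)(x := w)"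
proof -
  let ?c = "Conj (adjT (V ''x'') (V ''w'')) (Conj (nearT ''y'') (Neg (nearT ''p'')))"
  let ?F = "FFor ''w'' ''N'' (FWhen ?c (FSet ''a'' (V ''w'')))"
  let ?Q = "\<lambda>w. drops g x w \<and> f w g = flip (f y g)"
  note yd = dropsD[OF y]
  define s1 where "s1 = exec (FSeq (FSet ''y'' (Get src (V ''p''))) (FSet ''a'' (Num 0))) s"
  have s1: "antipodal_store s1" "s1 ''x'' 0 = x" "s1 ''p'' 0 = p" "s1 ''y'' 0 = y" "s1 dst = s dst"
    using antipodal_store_cong[OF s(1), of s1] s names by (simp_all add: s1_def)
  note N = antipodal_storeD(2)[OF s1(1)]
  have "(exec ?F s1 ''a'' 0 < s1 ''N'' 0 \<and> ?Q (exec ?F s1 ''a'' 0)) \<or>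
      ((\<forall>i<s1 ''N'' 0. \<not> ?Q i) \<and> exec ?F s1 ''a'' 0 = s1 ''a'' 0)"
  proof (rule exec_For_search)
    fix w t assume w: "w < s1 ''N'' 0" "t ''w'' 0 = w" and fr: "\<And>a. a \<notin> {''w'', ''a''} \<Longrightarrow> t a = s1 a"
    have wN: "w < N" using w N by simp
    have t: "antipodal_store t" using antipodal_store_cong[OF s1(1), of t] fr by simp
    have "holds (adjT (V ''x'') (V ''w'')) t \<longleftrightarrow> A x w"
      using holds_adjT[OF antipodal_storeD(1)[OF t], of "V ''x''" "V ''w''"] fr s1 w wN x(2) by simp
    moreover have "holds (nearT ''y'') t \<longleftrightarrow> gball N A (k - 1) y (anti w)"
      using antipodal_storeD(4)[OF t, of "''y''"] fr s1 w wN yd by simp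
    moreover have "holds (nearT ''p'') t \<longleftrightarrow> gball N A (k - 1) p (anti w)"
      using antipodal_storeD(4)[OF t, of "''p''"] fr s1 w wN yd by simp
    ultimately show "holds ?c t \<longleftrightarrow> ?Q w"
      using transport_search[OF x(1-3) y wN] by simp
  qed simp_all
  moreover obtain w0 where "?Q w0"
    using drops_exists[OF x(2) yd(4) x(3), of "flip (f y g)"] yd(6) by auto
  moreover have "w0 < N" using dropsD(2) \<open>?Q w0\<close> by blast
  ultimately have Q: "?Q (exec ?F s1 ''a'' 0)" using N by blast
  moreover have "exec ?F s1 ''x'' = s1 ''x''" "exec ?F s1 dst = s1 dst"
    by (rule exec_unchanged; use names in simp)+
  moreover have "exec (transport src dst) s = exec (FPut dst (V ''x'') (V ''a'')) (exec ?F s1)"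
    by (simp only: transport_def exec.simps(3) s1_def)
  ultimately have "exec (transport src dst) s dst = (s dst)(x := exec ?F s1 ''a'' 0)"
    using s1 by (simp del: exec.simps(5))
  then show thesis using that Q by blast
qed

lemma exec_reach_vertex:
  assumes s: "antipodal_store s" "s ''x'' 0 = x" "s ''p'' 0 = p" and x: "x < N" "p < N" "p \<noteq> x"
    and p: "exits g \<epsilon> p s" "zero_link g p x"
  shows "exits g \<epsilon> x (exec reach_vertex s) \<and>
    (\<forall>j. j \<noteq> x \<longrightarrow> exec reach_vertex s ''plus'' j = s ''plus'' j \<and> exec reach_vertex s ''minus'' j = s ''minus'' j)"
proof (cases "x = anti p")
  case True
  let ?u = "s ''plus'' p" and ?v = "s ''minus'' p"
  have d: "drops g p ?u" "f ?u g = \<epsilon>" "drops g p ?v" "f ?v g = flip \<epsilon>" using p(1) by (auto simp: exits_def)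
  note du = dropsD[OF d(1)] and dv = dropsD[OF d(3)]
  have al: "s ''al'' p = anti p" "s ''al'' ?u = anti ?u" "s ''al'' ?v = anti ?v"
    using antipodal_storeD(3)[OF s(1)] du dv by auto
  have e: "exec reach_vertex s = s(''plus'' := (s ''plus'')(x := anti ?v), ''minus'' := (s ''minus'')(x := anti ?u))"
    using s x True al by (simp add: reach_vertex_def)
  have "drops g x (anti ?v)" "drops g x (anti ?u)" using anti_drops d True by auto
  moreover have "f (anti ?v) g = \<epsilon>" "f (anti ?u) g = flip \<epsilon>" using f_anti du dv d by auto
  ultimately show ?thesis unfolding e by (simp add: exits_def)
next
  case False
  then have Ax: "A p x" "f x g = Zero" using p(2) by (auto simp: zero_link_def)
  have d: "drops g p (s ''plus'' p)" "f (s ''plus'' p) g = \<epsilon>" "drops g p (s ''minus'' p)" "f (s ''minus'' p) g = flip \<epsilon>"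
    using p(1) by (auto simp: exits_def)
  obtain w where w: "drops g x w" "f w g = flip \<epsilon>" "exec (transport ''plus'' ''minus'') s ''minus'' = (s ''minus'')(x := w)"
    using exec_transport[OF s(1-3) refl Ax(1) x(1) Ax(2) d(1), of "''minus''"] d(2) by auto
  define s1 where "s1 = exec (transport ''plus'' ''minus'') s"
  have fr: "s1 a = s a" if "a \<notin> {''y'', ''a'', ''w'', ''minus''}" for a
    unfolding s1_def by (rule exec_unchanged) (use that in simp)
  have s1: "antipodal_store s1" "s1 ''x'' 0 = x" "s1 ''p'' 0 = p" "s1 ''minus'' p = s ''minus'' p"
    using antipodal_store_cong[OF s(1), of s1] s fr w(3) x(3) by (simp_all add: s1_def)
  obtain w' where w': "drops g x w'" "f w' g = flip (flip \<epsilon>)" "exec (transport ''minus'' ''plus'') s1 ''plus'' = (s1 ''plus'')(x := w')"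
    using exec_transport[OF s1(1-4) Ax(1) x(1) Ax(2) d(3), of "''plus''"] d(4) by auto
  have e: "exec reach_vertex s = exec (transport ''minus'' ''plus'') s1"
    using s x False antipodal_storeD(3)[OF s(1) x(2)] by (simp add: reach_vertex_def s1_def)
  have m: "exec (transport ''minus'' ''plus'') s1 ''minus'' = s1 ''minus''" by (rule exec_unchanged) simp
  have "s1 ''minus'' = (s ''minus'')(x := w)" "s1 ''plus'' = s ''plus''" using w(3) fr by (simp_all add: s1_def)
  then show ?thesis unfolding e exits_def m w'(3) using w w' by simp
qed

lemma exec_link_zeros:
  assumes s: "antipodal_store s" "s ''x'' 0 = x" "x < N" "exits g \<epsilon> x s" "j < N"
  shows "exec link_zeros s ''par'' j = (if s ''par'' j = 0 \<and> zero_link g x j then Suc x else s ''par'' j)"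
proof -
  let ?c = "Conj (Equal (Get ''par'' (V ''j'')) (Num 0))
     (Neg (Conj (Neg (Conj (adjT (V ''x'') (V ''j''))
         (Conj (Neg (Equal (V ''j'') (Get ''plus'' (V ''x'')))) (Neg (Equal (V ''j'') (Get ''minus'' (V ''x'')))))))
       (Neg (Equal (V ''j'') (Get ''al'' (V ''x''))))))"
  let ?p = "FWhen ?c (FPut ''par'' (V ''j'') (Add (V ''x'') (Num 1)))"
  note N = antipodal_storeD(2)[OF s(1)]
  have xd: "g \<in> E" "f x g = Zero" using s(4) dropsD unfolding exits_def by blast+
  have "exec (FFor ''j'' ''N'' ?p) s ''par'' j =
    (if j < s ''N'' 0 then if s ''par'' j = 0 \<and> zero_link g x j then Suc x else s ''par'' j else s ''par'' j)"
  proof (rule exec_For_update[where h = "\<lambda>j. if s ''par'' j = 0 \<and> zero_link g x j then Suc x else s ''par'' j"])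
    fix i t assume i: "i < s ''N'' 0" "t ''j'' 0 = i" and fr: "\<And>a. a \<notin> insert ''j'' (writes ?p) \<Longrightarrow> t a = s a"
      and old: "t ''par'' i = s ''par'' i"
    have iN: "i < N" using i N by simp
    have t: "antipodal_store t" using antipodal_store_cong[OF s(1), of t] fr by simp
    have tv: "t ''x'' 0 = x" "t ''j'' 0 = i" "t ''plus'' = s ''plus''" "t ''minus'' = s ''minus''" "t ''al'' x = anti x"
      using fr s(2) i(2) antipodal_storeD(3)[OF t s(3)] by simp_all
    have a: "holds (adjT (V ''x'') (V ''j'')) t \<longleftrightarrow> A x i"
      using holds_adjT[OF antipodal_storeD(1)[OF t], of "V ''x''" "V ''j''"] tv s(3) iN by simp
    have "holds ?c t \<longleftrightarrow> s ''par'' i = 0 \<and>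
        ((holds (adjT (V ''x'') (V ''j'')) t \<and> i \<noteq> s ''plus'' x \<and> i \<noteq> s ''minus'' x) \<or> i = anti x)"
      using tv old by (auto simp del: One_nat_def)
    moreover have "A x i \<Longrightarrow> i \<noteq> s ''plus'' x \<and> i \<noteq> s ''minus'' x \<longleftrightarrow> f i g = Zero"
      using exits_iff[OF s(4), of i] drops_iff[OF s(3) iN, of g] xd by blast
    ultimately have c: "holds ?c t \<longleftrightarrow> s ''par'' i = 0 \<and> zero_link g x i"
      unfolding a zero_link_def by argo
    then show "exec ?p t ''par'' = (t ''par'')(i := if s ''par'' i = 0 \<and> zero_link g x i then Suc x else s ''par'' i)"
      using tv by (auto simp: old[symmetric] simp del: holds.simps)
  qed simp_all
  then show ?thesis using s(5) N by (simp add: link_zeros_def)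
qed

text \<open>The last conjunct measures progress: at least \<open>i\<close> vertices have been
  visited, or the search is exhausted. For \<open>i = N\<close> both alternatives mean
  exhaustion.\<close>

definition flood_inv :: "nat \<Rightarrow> sign \<Rightarrow> nat \<Rightarrow> nat \<Rightarrow> store \<Rightarrow> bool" where
  "flood_inv g \<epsilon> x0 i s \<longleftrightarrow> (let vis = s ''vis''; par = s ''par'' in
     (\<forall>j<N. vis j \<le> 1) \<and> par x0 = Suc x0 \<and> exits g \<epsilon> x0 s \<and>
     (\<forall>j<N. 0 < par j \<longrightarrow> f j g = Zero \<and>
        (j = x0 \<or> (par j - 1 < N \<and> vis (par j - 1) = 1 \<and> zero_link g (par j - 1) j))) \<and>
     (\<forall>j<N. vis j = 1 \<longrightarrow> 0 < par j \<and> exits g \<epsilon> j s) \<and>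
     (\<forall>x<N. vis x = 1 \<longrightarrow> (\<forall>j<N. zero_link g x j \<longrightarrow> 0 < par j)) \<and>
     (i \<le> card {j. j < N \<and> vis j = 1} \<or> (\<forall>j<N. 0 < par j \<longrightarrow> vis j = 1)))"

lemma exec_flood_step:
  assumes s: "antipodal_store s" and I: "flood_inv g \<epsilon> x0 i s" and x0: "x0 < N" "g \<in> E"
  shows "flood_inv g \<epsilon> x0 (Suc i) (exec flood_step s)"
proof -
  let ?vis = "s ''vis''" and ?par = "s ''par''"
  have vis: "\<And>j. j < N \<Longrightarrow> ?vis j \<le> 1" and root: "?par x0 = Suc x0" "exits g \<epsilon> x0 s"
    and par: "\<And>j. j < N \<Longrightarrow> 0 < ?par j \<Longrightarrow> f j g = Zero \<and>
        (j = x0 \<or> (?par j - 1 < N \<and> ?vis (?par j - 1) = 1 \<and> zero_link g (?par j - 1) j))"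
    and finished: "\<And>j. j < N \<Longrightarrow> ?vis j = 1 \<Longrightarrow> 0 < ?par j \<and> exits g \<epsilon> j s"
    and nb: "\<And>x j. x < N \<Longrightarrow> ?vis x = 1 \<Longrightarrow> j < N \<Longrightarrow> zero_link g x j \<Longrightarrow> 0 < ?par j"
    and size: "i \<le> card {j. j < N \<and> ?vis j = 1} \<or> (\<forall>j<N. 0 < ?par j \<longrightarrow> ?vis j = 1)"
    using I unfolding flood_inv_def Let_def by blast+
  note N = antipodal_storeD(2)[OF s]
  let ?Q = "\<lambda>j. ?vis j = 0 \<and> 0 < ?par j"
  let ?find = "FFor ''j'' ''N'' (FWhen (Conj (Equal (Get ''vis'' (V ''j'')) (Num 0)) (Less (Num 0) (Get ''par'' (V ''j''))))
        (FSet ''x'' (V ''j'')))"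
  let ?visit = "FSeq (FPut ''vis'' (V ''x'') (Num 1)) (FSeq (FSet ''p'' (Sub (Get ''par'' (V ''x'')) (Num 1)))
          (FSeq reach_vertex link_zeros))"
  define s1 where "s1 = exec ?find (exec (FSet ''x'' (V ''N'')) s)"
  define x where "x = s1 ''x'' 0"
  have fr1: "s1 a = s a" if "a \<notin> {''x'', ''j''}" for a
    unfolding s1_def using that by (subst exec_unchanged) simp_all
  have s1: "antipodal_store s1" using antipodal_store_cong[OF s, of s1] fr1 by simp
  have find: "(x < N \<and> ?Q x) \<or> ((\<forall>j<N. \<not> ?Q j) \<and> x = N)"
  proof -
    have "(s1 ''x'' 0 < exec (FSet ''x'' (V ''N'')) s ''N'' 0 \<and> ?Q (s1 ''x'' 0)) \<or>
        ((\<forall>j<exec (FSet ''x'' (V ''N'')) s ''N'' 0. \<not> ?Q j) \<and> s1 ''x'' 0 = exec (FSet ''x'' (V ''N'')) s ''x'' 0)"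
      unfolding s1_def
    proof (rule exec_For_search)
      fix i t assume "t ''j'' 0 = i" and fr: "\<And>a. a \<notin> {''j'', ''x''} \<Longrightarrow> t a = exec (FSet ''x'' (V ''N'')) s a"
      then show "holds (Conj (Equal (Get ''vis'' (V ''j'')) (Num 0)) (Less (Num 0) (Get ''par'' (V ''j'')))) t \<longleftrightarrow> ?Q i"
        by simp
    qed simp_all
    then show ?thesis using N by (simp add: x_def)
  qed
  have fin: "exec flood_step s = (if x < N then exec ?visit s1 else s1)"
    using antipodal_storeD(2)[OF s1] by (simp add: flood_step_def x_def s1_def del: exec.simps(5))
  show ?thesis
  proof (cases "x < N")
    case False
    then have no: "\<forall>j<N. \<not> ?Q j" using find by simp
    have "\<forall>j<N. 0 < ?par j \<longrightarrow> ?vis j = 1"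
      using no vis by (metis One_nat_def le_SucE le_zero_eq)
    then have "flood_inv g \<epsilon> x0 (Suc i) s" using I unfolding flood_inv_def Let_def by blast
    moreover have "s1 ''vis'' = ?vis" "s1 ''par'' = ?par" "s1 ''plus'' = s ''plus''" "s1 ''minus'' = s ''minus''"
      using fr1 by simp_all
    ultimately show ?thesis using False fin by (simp add: flood_inv_def exits_def)
  next
    case True
    then have x: "x < N" "?vis x = 0" "0 < ?par x" using find by auto
    define p where "p = ?par x - 1"
    define s2 where "s2 = exec (FSeq (FPut ''vis'' (V ''x'') (Num 1)) (FSet ''p'' (Sub (Get ''par'' (V ''x'')) (Num 1)))) s1"
    have s2: "antipodal_store s2" "s2 ''x'' 0 = x" "s2 ''p'' 0 = p" "s2 ''vis'' = ?vis(x := 1)" "s2 ''par'' = ?par"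
      "s2 ''plus'' = s ''plus''" "s2 ''minus'' = s ''minus''"
      using antipodal_store_cong[OF s1, of s2] fr1 by (simp_all add: s2_def x_def p_def)
    have ex2: "exits g \<epsilon> j s2 \<longleftrightarrow> exits g \<epsilon> j s" for j using s2 by (simp add: exits_def)
    define s3 where "s3 = exec reach_vertex s2"
    have fr3: "s3 a = s2 a" if "a \<notin> {''y'', ''a'', ''w'', ''plus'', ''minus''}" for a
      unfolding s3_def by (rule exec_unchanged) (use that in simp)
    have zx: "f x g = Zero" using par x by blast
    have reach: "exits g \<epsilon> x s3 \<and> (\<forall>j. j \<noteq> x \<longrightarrow> s3 ''plus'' j = s ''plus'' j \<and> s3 ''minus'' j = s ''minus'' j)"
    proof (cases "x = x0")
      case True
      then have "p = x" using root by (simp add: p_def)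
      then have "s3 = s2" using s2 by (simp add: s3_def reach_vertex_def)
      then show ?thesis using root(2) True ex2 s2 by simp
    next
      case False
      then have pp: "p < N" "?vis p = 1" "zero_link g p x" using par[OF x(1,3)] by (auto simp: p_def)
      then have "p \<noteq> x" "exits g \<epsilon> p s2" using x(2) finished ex2 by auto
      then show ?thesis
        using exec_reach_vertex[OF s2(1,2,3) x(1) pp(1) _ _ pp(3)] s2(6,7) unfolding s3_def by simp
    qed
    have s3: "antipodal_store s3" "s3 ''x'' 0 = x" "s3 ''par'' = ?par" "s3 ''vis'' = ?vis(x := 1)"
      using antipodal_store_cong[OF s2(1), of s3] fr3 s2 by simp_all
    have ex3: "exits g \<epsilon> j s3" if "exits g \<epsilon> j s" for j
      using that reach by (cases "j = x") (auto simp: exits_def)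
    define s4 where "s4 = exec link_zeros s3"
    have s4: "s4 ''vis'' = ?vis(x := 1)" "s4 ''plus'' = s3 ''plus''" "s4 ''minus'' = s3 ''minus''"
    proof -
      have "s4 a = s3 a" if "a \<notin> {''j'', ''par''}" for a
        unfolding s4_def by (rule exec_unchanged) (use that in simp)
      then show "s4 ''vis'' = ?vis(x := 1)" "s4 ''plus'' = s3 ''plus''" "s4 ''minus'' = s3 ''minus''"
        using s3 by simp_all
    qed
    have ex4: "exits g \<epsilon> j s4 \<longleftrightarrow> exits g \<epsilon> j s3" for j using s4 by (simp add: exits_def)
    have p4: "s4 ''par'' j = (if ?par j = 0 \<and> zero_link g x j then Suc x else ?par j)" if "j < N" for j
      using exec_link_zeros[OF s3(1,2) x(1) conjunct1[OF reach] that] s3(3) by (simp add: s4_def)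
    have keep: "0 < ?par j \<Longrightarrow> j < N \<Longrightarrow> s4 ''par'' j = ?par j" for j using p4 by simp
    have v4: "s4 ''vis'' j = (if j = x then 1 else ?vis j)" for j using s4 by simp
    have "exec flood_step s = s4"
      using True by (simp only: fin if_True exec.simps(3) s2_def s3_def s4_def)
    moreover have "flood_inv g \<epsilon> x0 (Suc i) s4"
      unfolding flood_inv_def Let_def
    proof (intro conjI)
      show "\<forall>j<N. s4 ''vis'' j \<le> 1" using vis v4 by simp
      show "s4 ''par'' x0 = Suc x0" using keep[of x0] root(1) x0(1) by simp
      show "exits g \<epsilon> x0 s4" using ex3 root(2) ex4 by blast
      show "\<forall>j<N. 0 < s4 ''par'' j \<longrightarrow> f j g = Zero \<and> (j = x0 \<or> (s4 ''par'' j - 1 < N \<and>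
          s4 ''vis'' (s4 ''par'' j - 1) = 1 \<and> zero_link g (s4 ''par'' j - 1) j))"
      proof (intro allI impI)
        fix j assume j: "j < N" "0 < s4 ''par'' j"
        show "f j g = Zero \<and> (j = x0 \<or> (s4 ''par'' j - 1 < N \<and>
          s4 ''vis'' (s4 ''par'' j - 1) = 1 \<and> zero_link g (s4 ''par'' j - 1) j))"
        proof (cases "0 < ?par j")
          case True
          then show ?thesis using par[OF j(1) True] keep[OF True j(1)] v4 by auto
        next
          case False
          then have l: "s4 ''par'' j = Suc x" "zero_link g x j" using p4[OF j(1)] j by (auto split: if_splits)
          then have "f j g = Zero" using zx f_anti[OF x(1) x0(2)] by (auto simp: zero_link_def)
          then show ?thesis using l v4 x(1) by simp
        qed
      qed
      show "\<forall>j<N. s4 ''vis'' j = 1 \<longrightarrow> 0 < s4 ''par'' j \<and> exits g \<epsilon> j s4"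
      proof (intro allI impI)
        fix j assume j: "j < N" "s4 ''vis'' j = 1"
        show "0 < s4 ''par'' j \<and> exits g \<epsilon> j s4"
        proof (cases "j = x")
          case True
          then show ?thesis using x keep reach ex4 by simp
        next
          case False
          then have "0 < ?par j \<and> exits g \<epsilon> j s" using finished j v4 by simp
          then show ?thesis using ex3 ex4 keep j(1) by simp
        qed
      qed
      show "\<forall>y<N. s4 ''vis'' y = 1 \<longrightarrow> (\<forall>j<N. zero_link g y j \<longrightarrow> 0 < s4 ''par'' j)"
      proof (intro allI impI)
        fix y j assume y: "y < N" "s4 ''vis'' y = 1" "j < N" "zero_link g y j"
        show "0 < s4 ''par'' j"
        proof (cases "y = x")
          case True
          then show ?thesis using p4[OF y(3)] y(4) by simp
        next
          case False
          then have "0 < ?par j" using nb y v4 by simp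
          then show ?thesis using keep y(3) by simp
        qed
      qed
      have "{j. j < N \<and> s4 ''vis'' j = 1} = insert x {j. j < N \<and> ?vis j = 1}" using x(1) v4 by auto
      then have "card {j. j < N \<and> s4 ''vis'' j = 1} = Suc (card {j. j < N \<and> ?vis j = 1})"
        using x(2) by simp
      moreover have "i \<le> card {j. j < N \<and> ?vis j = 1}" using size x by auto
      ultimately show "Suc i \<le> card {j. j < N \<and> s4 ''vis'' j = 1} \<or> (\<forall>j<N. 0 < s4 ''par'' j \<longrightarrow> s4 ''vis'' j = 1)"
        by simp
    qed
    ultimately show ?thesis by simp
  qed
qed

lemma exec_flood_init:
  assumes s: "antipodal_store s" "s ''x0'' 0 = x0" "s ''y0'' 0 = y0" and d: "drops g x0 y0"
  shows "flood_inv g (f y0 g) x0 0 (exec flood_init s)"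
proof -
  let ?clear = "FFor ''j'' ''N'' (FSeq (FPut ''vis'' (V ''j'') (Num 0)) (FPut ''par'' (V ''j'') (Num 0)))"
  let ?c = "Conj (adjT (V ''x0'') (V ''w'')) (nearT ''y0'')"
  let ?F = "FFor ''w'' ''N'' (FWhen ?c (FSet ''a'' (V ''w'')))"
  let ?Q = "\<lambda>w. drops g x0 w \<and> f w g = flip (f y0 g)"
  note N = antipodal_storeD(2)[OF s(1)]
  note dd = dropsD[OF d]
  define s1 where "s1 = exec ?clear s"
  have v1: "s1 ''vis'' j = 0" if "j < N" for j
  proof -
    have "s1 ''vis'' j = (if j < s ''N'' 0 then 0 else s ''vis'' j)"
      unfolding s1_def by (rule exec_For_update[where h = "\<lambda>_. 0"]) simp_all
    then show ?thesis using that N by simp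
  qed
  have p1: "s1 ''par'' j = 0" if "j < N" for j
  proof -
    have "s1 ''par'' j = (if j < s ''N'' 0 then 0 else s ''par'' j)"
      unfolding s1_def by (rule exec_For_update[where h = "\<lambda>_. 0"]) simp_all
    then show ?thesis using that N by simp
  qed
  have fr1: "s1 a = s a" if "a \<notin> {''j'', ''vis'', ''par''}" for a
    unfolding s1_def by (rule exec_unchanged) (use that in simp)
  define s2 where "s2 = exec (FSeq (FPut ''par'' (V ''x0'') (Add (V ''x0'') (Num 1))) (FSeq (FPut ''plus'' (V ''x0'') (V ''y0'')) (FSet ''a'' (Num 0)))) s1"
  have s2: "antipodal_store s2" "s2 ''x0'' 0 = x0" "s2 ''y0'' 0 = y0" "s2 ''par'' = (s1 ''par'')(x0 := Suc x0)"
    "s2 ''plus'' x0 = y0" "s2 ''vis'' = s1 ''vis''"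
    using antipodal_store_cong[OF s(1), of s2] s fr1 by (simp_all add: s2_def)
  define s3 where "s3 = exec ?F s2"
  have "(exec ?F s2 ''a'' 0 < s2 ''N'' 0 \<and> ?Q (exec ?F s2 ''a'' 0)) \<or>
      ((\<forall>i<s2 ''N'' 0. \<not> ?Q i) \<and> exec ?F s2 ''a'' 0 = s2 ''a'' 0)"
  proof (rule exec_For_search)
    fix w t assume w: "w < s2 ''N'' 0" "t ''w'' 0 = w" and fr: "\<And>a. a \<notin> {''w'', ''a''} \<Longrightarrow> t a = s2 a"
    have wN: "w < N" using w antipodal_storeD(2)[OF s2(1)] by simp
    have t: "antipodal_store t" using antipodal_store_cong[OF s2(1), of t] fr by simp
    have "holds (adjT (V ''x0'') (V ''w'')) t \<longleftrightarrow> A x0 w"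
      using holds_adjT[OF antipodal_storeD(1)[OF t], of "V ''x0''" "V ''w''"] fr s2 w wN dd by simp
    moreover have "holds (nearT ''y0'') t \<longleftrightarrow> gball N A (k - 1) y0 (anti w)"
      using antipodal_storeD(4)[OF t, of "''y0''"] fr s2 w wN dd by simp
    ultimately show "holds ?c t \<longleftrightarrow> ?Q w"
      using opposite_search[OF d wN] by simp
  qed simp_all
  moreover obtain w0 where "?Q w0"
    using drops_exists[OF dd(1) dd(4) dd(5), of "flip (f y0 g)"] dd(6) by auto
  moreover have "w0 < N" using dropsD(2) \<open>?Q w0\<close> by blast
  ultimately have Q: "?Q (s3 ''a'' 0)" using antipodal_storeD(2)[OF s2(1)] unfolding s3_def by blast
  have fr3: "s3 a = s2 a" if "a \<notin> {''w'', ''a''}" for a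
    unfolding s3_def by (rule exec_unchanged) (use that in simp)
  have fin: "exec flood_init s = exec (FPut ''minus'' (V ''x0'') (V ''a'')) s3"
    by (simp only: flood_init_def exec.simps(3) s1_def s2_def s3_def)
  have e: "exec flood_init s ''vis'' = s1 ''vis''" "exec flood_init s ''par'' = (s1 ''par'')(x0 := Suc x0)"
    "exec flood_init s ''plus'' x0 = y0" "exec flood_init s ''minus'' x0 = s3 ''a'' 0"
    unfolding fin using fr3 s2 by simp_all
  have ex: "exits g (f y0 g) x0 (exec flood_init s)" unfolding exits_def e using Q d by simp
  show ?thesis
    unfolding flood_inv_def Let_def e using v1 p1 ex dd by simp
qed

text \<open>After \<open>N\<close> rounds no marked vertex is unvisited, so the visited set is
  closed under edges within the class and under antipodes; \<open>zero_class_connected\<close> makes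
  it the whole class.\<close>

lemma exec_flood:
  assumes s: "antipodal_store s" "s ''x0'' 0 = x0" "s ''y0'' 0 = y0" and d: "drops g x0 y0" and x: "x < N"
  shows "exec flood s ''vis'' x = (if f x g = Zero then 1 else 0)"
    "f x g = Zero \<Longrightarrow> exits g (f y0 g) x (exec flood s)"
proof -
  note dd = dropsD[OF d]
  define s1 where "s1 = exec flood_init s"
  have s1: "antipodal_store s1"
    by (rule antipodal_store_cong[OF s(1)]) (simp_all add: s1_def exec_unchanged)
  define s2 where "s2 = exec (FFor ''t'' ''N'' flood_step) s1"
  have "flood_inv g (f y0 g) x0 (s1 ''N'' 0) s2"
    unfolding s2_def
  proof (rule exec_For[where I = "flood_inv g (f y0 g) x0"])
    show "flood_inv g (f y0 g) x0 0 (setv s1 ''t'' 0)"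
      using exec_flood_init[OF s d] by (simp add: flood_inv_def exits_def s1_def)
  next
    fix i t assume I: "flood_inv g (f y0 g) x0 i t" and fr: "\<And>a. a \<notin> insert ''t'' (writes flood_step) \<Longrightarrow> t a = s1 a"
    have "antipodal_store t" using antipodal_store_cong[OF s1, of t] fr by simp
    then have "flood_inv g (f y0 g) x0 (Suc i) (exec flood_step t)" using exec_flood_step I dd by blast
    then show "flood_inv g (f y0 g) x0 (Suc i) (setv (exec flood_step t) ''t'' (Suc i))"
      by (simp add: flood_inv_def exits_def)
  qed simp_all
  then have I: "flood_inv g (f y0 g) x0 N s2" using antipodal_storeD(2)[OF s1] by simp
  let ?vis = "s2 ''vis''" and ?par = "s2 ''par''"
  let ?S = "{j. j < N \<and> ?vis j = 1}"
  have closed: "\<forall>j<N. 0 < ?par j \<longrightarrow> ?vis j = 1"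
  proof -
    have "N \<le> card ?S \<or> (\<forall>j<N. 0 < ?par j \<longrightarrow> ?vis j = 1)" using I unfolding flood_inv_def Let_def by blast
    moreover have "?S = {..<N}" if "N \<le> card ?S" using that by (intro card_seteq) auto
    ultimately show ?thesis by blast
  qed
  have nb: "\<And>u j. u < N \<Longrightarrow> ?vis u = 1 \<Longrightarrow> j < N \<Longrightarrow> zero_link g u j \<Longrightarrow> 0 < ?par j"
    and root: "?par x0 = Suc x0" and v: "\<And>j. j < N \<Longrightarrow> ?vis j \<le> 1"
    and par: "\<And>j. j < N \<Longrightarrow> 0 < ?par j \<Longrightarrow> f j g = Zero"
    and good: "\<And>j. j < N \<Longrightarrow> ?vis j = 1 \<Longrightarrow> 0 < ?par j \<and> exits g (f y0 g) j s2"
    using I unfolding flood_inv_def Let_def by blast+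
  have all: "y \<in> ?S" if "y < N" "f y g = Zero" for y
  proof (rule zero_class_connected[of x0 ?S g])
    show "x0 \<in> ?S" using closed root dd by simp
    show "anti u \<in> ?S" if "u \<in> ?S" "u < N" for u
      using that nb[of u "anti u"] closed anti(1) by (simp add: zero_link_def)
    show "w \<in> ?S" if "u \<in> ?S" "u < N" "w < N" "f u g = Zero" "f w g = Zero" "A u w" for u w
      using that nb[of u w] closed by (simp add: zero_link_def)
  qed (use that dd in auto)
  have e: "exec flood s = s2" by (simp only: flood_def exec.simps(3) s1_def s2_def)
  have iff: "?vis x = 1 \<longleftrightarrow> f x g = Zero" using all good par x by blast
  then show "exec flood s ''vis'' x = (if f x g = Zero then 1 else 0)"
    unfolding e using v[OF x] by auto
  show "exits g (f y0 g) x (exec flood s)" if "f x g = Zero"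
    unfolding e using iff that good x by blast
qed

end

section \<open>Signs, elements and candidates\<close>

text \<open>The root gets the sign \<open>Plus\<close> (if it is not in the zero class), because the arc that starts the
  search for an element leads from the first vertex of its zero class to the parent of this vertex,
  and no vertex before it lies in the zero class.\<close>

definition sign_step :: fprog where
  "sign_step = FSeq (FSet ''x'' (Get ''ord'' (V ''t'')))
     (FSeq (FIf (Equal (Get ''vis'' (V ''x'')) (Num 1)) (FSet ''v'' (Num 0))
        (FIf (Equal (V ''t'') (Num 0)) (FSet ''v'' (Num 1))
          (FSeq (FSet ''p'' (Sub (Get ''par0'' (V ''x'')) (Num 1)))
            (FIf (Equal (Get ''vis'' (V ''p'')) (Num 1))
               (FIf (Equal (Get ''plus'' (V ''p'')) (V ''x'')) (FSet ''v'' (Num 1)) (FSet ''v'' (Num 2)))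
               (FSet ''v'' (signE ''p''))))))
       (FPut ''cocircuits'' (Add (Get ''rn'' (V ''x'')) (V ''e'')) (V ''v'')))"

definition put_signs :: fprog where
  "put_signs = FFor ''t'' ''N'' sign_step"

definition label_arcs :: fprog where
  "label_arcs = FFor ''x'' ''N'' (FWhen (Equal (Get ''vis'' (V ''x'')) (Num 1))
     (FSeq (FPut ''lab'' (Add (Get ''row'' (V ''x'')) (Get ''plus'' (V ''x''))) (Num 1))
           (FPut ''lab'' (Add (Get ''row'' (V ''x'')) (Get ''minus'' (V ''x''))) (Num 1))))"

definition element_step :: fprog where
  "element_step = FSeq find_arc (FSeq flood (FSeq put_signs label_arcs))"

definition candidate :: fprog where
  "candidate = FSeq find_antipodes (FSeq clear_labels (FSeq (FFor ''e'' ''n'' element_step) verify))"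

text \<open>Once a guess is accepted all later ones are skipped, so that its matrix and the flag
  survive.\<close>

definition search :: fprog where
  "search = FFor ''c'' ''N'' (FWhen (Equal (V ''accept'') (Num 0)) candidate)"

definition main_program :: fprog where
  "main_program = FSeq (offsets ''rn'' ''n'') (FSeq order_vertices (FSeq balls search))"

lemma writes_elements [simp]:
  "writes sign_step = {''x'', ''v'', ''p'', ''cocircuits''}"
  "writes put_signs = {''t'', ''x'', ''v'', ''p'', ''cocircuits''}"
  "writes label_arcs = {''x'', ''lab''}"
  "writes element_step = {''f'', ''t'', ''x'', ''y'', ''x0'', ''y0'', ''j'', ''vis'', ''p'', ''a'', ''w'', ''plus'',
     ''minus'', ''par'', ''v'', ''cocircuits'', ''lab''}"
  "writes verify = {''accept'', ''x'', ''y'', ''d'', ''e'', ''q'', ''h'', ''g''}"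
  "writes candidate = {''f'', ''t'', ''x'', ''y'', ''x0'', ''y0'', ''j'', ''vis'', ''p'', ''a'', ''w'', ''plus'',
     ''minus'', ''par'', ''v'', ''cocircuits'', ''lab'', ''al'', ''e'', ''accept'', ''d'', ''q'', ''h'', ''g''}"
  by (auto simp: sign_step_def put_signs_def label_arcs_def element_step_def verify_def candidate_def)

section \<open>Recovery of the elements, one by one, for the correct antipode of the root\<close>

context labelled_graph
begin

text \<open>Code 1 is tied to \<open>\<epsilon>\<close> rather than to \<open>Plus\<close>, because
  the signs of an element are recovered only up to reorientation.\<close>

definition sign_code :: "nat \<Rightarrow> sign \<Rightarrow> nat \<Rightarrow> nat" where
  "sign_code g \<epsilon> x = (if f x g = Zero then 0 else if f x g = \<epsilon> then 1 else 2)"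

lemma ordered_store_cong:
  "ordered_store N B s \<Longrightarrow> t ''ord'' = s ''ord'' \<Longrightarrow> t ''par0'' = s ''par0'' \<Longrightarrow> ordered_store N B t"
  by (simp add: ordered_store_def)

text \<open>Signs are copied from the predecessor. If the predecessor lies in the zero class,
  uniqueness of the exits reduces the sign to a comparison with \<open>plus\<close>; at the root,
  the hypothesis on \<open>f 0 g\<close> makes 1 the right code.\<close>

lemma exec_put_signs:
  assumes s: "graph_store N A s" "ordered_store N A s" "matrix_store N n s" "s ''e'' 0 = e" "e < n"
    and vis: "\<And>x. x < N \<Longrightarrow> s ''vis'' x = (if f x g = Zero then 1 else 0)"
    and ex: "\<And>x. x < N \<Longrightarrow> f x g = Zero \<Longrightarrow> exits g \<epsilon> x s"
    and \<epsilon>: "\<epsilon> \<noteq> Zero" "g \<in> E" and root: "f 0 g \<noteq> Zero \<Longrightarrow> f 0 g = \<epsilon>"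
    and xe: "x < N" "e' < n"
  shows "exec put_signs s ''cocircuits'' (x * n + e') =
    (if e' = e then sign_code g \<epsilon> x else s ''cocircuits'' (x * n + e'))"
proof -
  let ?ord = "s ''ord''"
  note N = graph_storeD(1)[OF s(1)]
  have inj: "inj_on ?ord {..<N}" using s(2) by (simp add: ordered_store_def bij_betw_def)
  have "\<forall>x<N. \<forall>e'<n. exec put_signs s ''cocircuits'' (x * n + e') =
      (if e' = e \<and> x \<in> ?ord ` {..<s ''N'' 0} then sign_code g \<epsilon> x else s ''cocircuits'' (x * n + e'))"
    unfolding put_signs_def
  proof (rule exec_For[where I = "\<lambda>i t. \<forall>x<N. \<forall>e'<n. t ''cocircuits'' (x * n + e') =
      (if e' = e \<and> x \<in> ?ord ` {..<i} then sign_code g \<epsilon> x else s ''cocircuits'' (x * n + e'))"])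
    fix i t assume i: "i < s ''N'' 0" "t ''t'' 0 = i"
      and I: "\<forall>x<N. \<forall>e'<n. t ''cocircuits'' (x * n + e') =
        (if e' = e \<and> x \<in> ?ord ` {..<i} then sign_code g \<epsilon> x else s ''cocircuits'' (x * n + e'))"
      and fr: "\<And>a. a \<notin> insert ''t'' (writes sign_step) \<Longrightarrow> t a = s a"
    define x where "x = ?ord i"
    have iN: "i < N" using i N by simp
    have x: "x < N" using ord_less[OF s(2) iN] by (simp add: x_def)
    have t: "t ''ord'' = ?ord" "t ''vis'' = s ''vis''" "t ''par0'' = s ''par0''" "t ''plus'' = s ''plus''"
      "t ''rn'' = s ''rn''" "t ''e'' 0 = e" using fr s(4) by simp_all
    have rn: "s ''rn'' y = y * n" if "y < N" for y using s(3) that by (simp add: matrix_store_def)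
    have main: "exec sign_step t ''cocircuits'' = (t ''cocircuits'')(x * n + e := sign_code g \<epsilon> x)"
    proof (cases "f x g = Zero")
      case True
      then show ?thesis using i(2) t vis[OF x] rn[OF x] by (simp add: sign_step_def x_def sign_code_def)
    next
      case nz: False
      show ?thesis
      proof (cases "i = 0")
        case True
        then have "x = 0" using s(2) by (simp add: x_def ordered_store_def)
        then have "sign_code g \<epsilon> x = 1" using root nz by (simp add: sign_code_def)
        then show ?thesis using nz True i(2) t vis[OF x] rn[OF x] by (simp add: sign_step_def x_def)
      next
        case False
        then obtain u where u: "u < i" "?ord u = s ''par0'' x - 1" "A (?ord u) x"
          using parent[OF s(2) iN] unfolding x_def by blast
        define p where "p = ?ord u"
        have "u < N" using u(1) iN by simp
        then have p: "p < N" "A p x" "s ''par0'' x - 1 = p" using ord_less[OF s(2)] u unfolding p_def by metis+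
        have val: "exec sign_step t ''cocircuits'' = (t ''cocircuits'')(x * n + e :=
            (if s ''vis'' p = 1 then if s ''plus'' p = x then 1 else 2 else t ''cocircuits'' (p * n + e)))"
          using nz False i(2) t vis[OF x] rn[OF x] rn[OF p(1)] p(3) by (simp add: sign_step_def x_def)
        show ?thesis
        proof (cases "f p g = Zero")
          case True
          then have d: "drops g p x" using drops_iff p x nz \<epsilon> by simp
          have e: "exits g \<epsilon> p s" using ex[OF p(1) True] .
          have "s ''plus'' p = x \<longleftrightarrow> f x g = \<epsilon>"
            using e d drops_unique unfolding exits_def by metis
          then show ?thesis unfolding val using vis[OF p(1)] True nz by (simp add: sign_code_def)
        next
          case pz: False
          then have "f x g = f p g" using sign_constant p x nz \<epsilon> by metis
          moreover have "t ''cocircuits'' (p * n + e) = sign_code g \<epsilon> p"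
            using I p(1) s(5) u(1) by (auto simp: p_def)
          ultimately show ?thesis unfolding val using vis[OF p(1)] pz by (simp add: sign_code_def)
        qed
      qed
    qed
    have im: "y \<in> ?ord ` {..<Suc i} \<longleftrightarrow> y = x \<or> y \<in> ?ord ` {..<i}" for y
      by (auto simp: x_def lessThan_Suc)
    show "\<forall>y<N. \<forall>e'<n. setv (exec sign_step t) ''t'' (Suc i) ''cocircuits'' (y * n + e') =
        (if e' = e \<and> y \<in> ?ord ` {..<Suc i} then sign_code g \<epsilon> y else s ''cocircuits'' (y * n + e'))"
    proof (intro allI impI)
      fix y e' assume ye: "y < N" "e' < n"
      have "y * n + e' = x * n + e \<longleftrightarrow> y = x \<and> e' = e" using matrix_index_eq ye(2) s(5) by blast
      then show "setv (exec sign_step t) ''t'' (Suc i) ''cocircuits'' (y * n + e') =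
        (if e' = e \<and> y \<in> ?ord ` {..<Suc i} then sign_code g \<epsilon> y else s ''cocircuits'' (y * n + e'))"
        using I ye main unfolding im by auto
    qed
  qed simp_all
  moreover have "x \<in> ?ord ` {..<N}" using ord_surj[OF s(2) xe(1)] by auto
  ultimately show ?thesis using xe N by simp
qed

lemma exec_label_arcs:
  assumes s: "graph_store N A s"
    and vis: "\<And>x. x < N \<Longrightarrow> s ''vis'' x = (if f x g = Zero then 1 else 0)"
    and ex: "\<And>x. x < N \<Longrightarrow> f x g = Zero \<Longrightarrow> exits g \<epsilon> x s"
    and xy: "x < N" "y < N"
  shows "exec label_arcs s ''lab'' (x * N + y) = (if drops g x y then 1 else s ''lab'' (x * N + y))"
proof -
  note N = graph_storeD(1)[OF s]
  let ?m = "FSeq (FPut ''lab'' (Add (Get ''row'' (V ''x'')) (Get ''plus'' (V ''x''))) (Num 1))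
           (FPut ''lab'' (Add (Get ''row'' (V ''x'')) (Get ''minus'' (V ''x''))) (Num 1))"
  let ?p = "FWhen (Equal (Get ''vis'' (V ''x'')) (Num 1)) ?m"
  have "\<forall>x<N. \<forall>y<N. exec label_arcs s ''lab'' (x * N + y) =
      (if x < s ''N'' 0 \<and> drops g x y then 1 else s ''lab'' (x * N + y))"
    unfolding label_arcs_def
  proof (rule exec_For[where I = "\<lambda>i t. \<forall>x<N. \<forall>y<N. t ''lab'' (x * N + y) =
      (if x < i \<and> drops g x y then 1 else s ''lab'' (x * N + y))"])
    fix i t assume i: "i < s ''N'' 0" "t ''x'' 0 = i"
      and I: "\<forall>x<N. \<forall>y<N. t ''lab'' (x * N + y) = (if x < i \<and> drops g x y then 1 else s ''lab'' (x * N + y))"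
      and fr: "\<And>a. a \<notin> insert ''x'' (writes ?p) \<Longrightarrow> t a = s a"
    have iN: "i < N" using i N by simp
    have t: "t ''vis'' = s ''vis''" "t ''plus'' = s ''plus''" "t ''minus'' = s ''minus''" "t ''row'' i = i * N"
      using fr graph_storeD(2)[OF s iN] by simp_all
    have "exec ?p t ''lab'' (y * N + w) = (if y = i \<and> drops g i w then 1 else t ''lab'' (y * N + w))"
      if yw: "y < N" "w < N" for y w
    proof (cases "f i g = Zero")
      case True
      have e: "exits g \<epsilon> i s" using ex[OF iN True] .
      then have pm: "s ''plus'' i < N" "s ''minus'' i < N" unfolding exits_def using dropsD(2) by blast+
      have "y * N + w = i * N + s ''plus'' i \<longleftrightarrow> y = i \<and> w = s ''plus'' i"
        "y * N + w = i * N + s ''minus'' i \<longleftrightarrow> y = i \<and> w = s ''minus'' i"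
        using matrix_index_eq yw pm by blast+
      then show ?thesis using True vis[OF iN] t i(2) exits_iff[OF e, of w] by auto
    next
      case False
      then have "\<not> drops g i w" using dropsD(5) by blast
      then show ?thesis using False vis[OF iN] t i(2) by simp
    qed
    then show "\<forall>x<N. \<forall>y<N. setv (exec ?p t) ''x'' (Suc i) ''lab'' (x * N + y) =
        (if x < Suc i \<and> drops g x y then 1 else s ''lab'' (x * N + y))"
      using I by (auto simp: less_Suc_eq simp del: exec.simps)
  qed simp_all
  then show ?thesis using xy N by simp
qed

text \<open>\<open>el\<close> lists the elements found so far and \<open>h\<close> tells which of
  them were reoriented. As the labels mark exactly their arcs, the next free arc belongs to a new
  element.\<close>

definition elements_data :: "nat \<Rightarrow> nat \<Rightarrow> store \<Rightarrow> (nat \<Rightarrow> nat) \<Rightarrow> (nat \<Rightarrow> sign \<Rightarrow> sign) \<Rightarrow> bool" where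
  "elements_data n i s el h \<longleftrightarrow> inj_on el {..<i} \<and> el ` {..<i} \<subseteq> E \<and> (\<forall>e<i. h e = id \<or> h e = flip) \<and>
     (\<forall>x<N. \<forall>e<i. s ''cocircuits'' (x * n + e) < 3 \<and> sign_of_nat (s ''cocircuits'' (x * n + e)) = h e (f x (el e))) \<and>
     (\<forall>x<N. \<forall>y<N. s ''lab'' (x * N + y) = (if \<exists>e<i. drops (el e) x y then 1 else 0))"

definition elements_inv :: "nat \<Rightarrow> nat \<Rightarrow> store \<Rightarrow> bool" where
  "elements_inv n i s \<longleftrightarrow> (\<exists>el h. elements_data n i s el h)"

lemma drops_element_unique: "drops g x y \<Longrightarrow> drops g' x y \<Longrightarrow> g = g'"
proof -
  assume "drops g x y" "drops g' x y"
  then obtain b b' where 1: "step (f x) g b (f y)" and 2: "step (f x) g' b' (f y)" by (auto simp: drops_def)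
  then show ?thesis using stepD(3,5,8)[OF 1] stepD(13)[OF 2, of g] by blast
qed

lemma A_drops: "x < N \<Longrightarrow> y < N \<Longrightarrow> A x y \<Longrightarrow> \<exists>g\<in>E. drops g x y"
  using A_step[of x y] stepD(3) unfolding drops_def by blast

lemma zero_vertex_exists:
  assumes "0 < m" "g \<in> E" obtains x where "x < N" "f x g = Zero"
proof -
  have "m - 1 \<le> card (E - {g})" using m_less assms finite_E by simp
  then obtain L where L: "L \<subseteq> E - {g}" "card L = m - 1" "finite L" using obtain_subset_with_card_n by metis
  then have "card (insert g L) = m" using assms(1) by (subst card_insert_disjoint) auto
  moreover have "insert g L \<subseteq> E" using L assms by auto
  ultimately obtain X where X: "X \<in> C" "zs X = insert g L" using ex_zero_set by blast
  then have "X g = Zero" using zero_set_insertD by metis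
  moreover obtain x where "x < N" "f x = X" using f_surj X(1) by metis
  ultimately show thesis using that by auto
qed

lemma first_zero_arc:
  assumes s: "ordered_store N A s" and g: "g \<in> E" and t: "t < N" "f (s ''ord'' t) g = Zero"
    and first: "\<And>u. u < t \<Longrightarrow> f (s ''ord'' u) g \<noteq> Zero"
  shows "\<exists>y<N. drops g (s ''ord'' t) y \<and> (t = 0 \<or> s ''par0'' (s ''ord'' t) = y + 1)"
proof (cases "t = 0")
  case True
  obtain y where "drops g (s ''ord'' t) y" using drops_exists[OF ord_less[OF s t(1)] g t(2), of Plus] by auto
  then show ?thesis using True dropsD(2) by blast
next
  case False
  then obtain u where u: "u < t" "s ''ord'' u = s ''par0'' (s ''ord'' t) - 1" "A (s ''ord'' u) (s ''ord'' t)"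
    "0 < s ''par0'' (s ''ord'' t)" using parent[OF s t(1)] by blast
  have "u < N" using u(1) t(1) by simp
  then have "s ''ord'' u < N" using ord_less[OF s] by blast
  moreover have "drops g (s ''ord'' t) (s ''ord'' u)"
    using drops_iff ord_less[OF s t(1)] calculation u(3) A_sym g t(2) first[OF u(1)] by simp
  ultimately show ?thesis using u(2,4) by (intro exI[of _ "s ''ord'' u"]) simp
qed

lemma first_zero_exists:
  assumes s: "ordered_store N A s" and x: "x < N" "f x g = Zero"
  obtains t where "t < N" "f (s ''ord'' t) g = Zero" "\<And>u. u < t \<Longrightarrow> f (s ''ord'' u) g \<noteq> Zero"
proof -
  obtain t0 where t0: "t0 < N" "s ''ord'' t0 = x" using ord_surj[OF s x(1)] by blast
  define t where "t = (LEAST t. f (s ''ord'' t) g = Zero)"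
  have "f (s ''ord'' t) g = Zero" unfolding t_def by (rule LeastI[of _ t0]) (use t0 x in simp)
  moreover have "t \<le> t0" unfolding t_def by (rule Least_le) (use t0 x in simp)
  moreover have "f (s ''ord'' u) g \<noteq> Zero" if "u < t" for u
    using not_less_Least that unfolding t_def by blast
  ultimately show thesis using that t0(1) by (meson le_less_trans)
qed

text \<open>The arc found is unlabelled, hence drops a new element \<open>g\<close>. A free arc
  exists because an element still missing vanishes at some vertex, and the first such vertex in the
  order offers an admissible arc.\<close>

lemma exec_element_step:
  assumes s: "antipodal_store s" "ordered_store N A s" "matrix_store N n s" "s ''e'' 0 = i" "i < n"
    and n: "n = card E" and m: "0 < m" and I: "elements_inv n i s"
  shows "elements_inv n (Suc i) (exec element_step s)"
proof -
  let ?ord = "s ''ord''"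
  obtain el h where "elements_data n i s el h" using I unfolding elements_inv_def by blast
  then have el: "inj_on el {..<i}" "el ` {..<i} \<subseteq> E" and h: "\<And>e. e < i \<Longrightarrow> h e = id \<or> h e = flip"
    and co: "\<And>x e. x < N \<Longrightarrow> e < i \<Longrightarrow> s ''cocircuits'' (x * n + e) < 3 \<and>
      sign_of_nat (s ''cocircuits'' (x * n + e)) = h e (f x (el e))"
    and lab: "\<And>x y. x < N \<Longrightarrow> y < N \<Longrightarrow> s ''lab'' (x * N + y) = (if \<exists>e<i. drops (el e) x y then 1 else 0)"
    by (simp_all add: elements_data_def)
  have G: "graph_store N A s" using antipodal_storeD(1)[OF s(1)] .
  define P where "P t y \<longleftrightarrow> A (?ord t) y \<and> s ''lab'' (?ord t * N + y) = 0 \<and> (t = 0 \<or> s ''par0'' (?ord t) = y + 1)" for t y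
  have free: "\<exists>y<N. P t y" if gt: "g \<in> E" "g \<notin> el ` {..<i}" "t < N" "f (?ord t) g = Zero"
    "\<And>u. u < t \<Longrightarrow> f (?ord u) g \<noteq> Zero" for g t
  proof -
    obtain y where y: "y < N" "drops g (?ord t) y" "t = 0 \<or> s ''par0'' (?ord t) = y + 1"
      using first_zero_arc[OF s(2) gt(1,3,4,5)] by blast
    have "\<not> (\<exists>e<i. drops (el e) (?ord t) y)" using drops_element_unique[OF y(2)] gt(2) by blast
    then show ?thesis using y lab dropsD[OF y(2)] unfolding P_def by auto
  qed
  have "card (el ` {..<i}) < card E" using card_image_le[of "{..<i}" el] s(5) n by simp
  then have "el ` {..<i} \<noteq> E" by blast
  then obtain g1 where g1: "g1 \<in> E" "g1 \<notin> el ` {..<i}" using el(2) by blast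
  obtain x1 where "x1 < N" "f x1 g1 = Zero" using zero_vertex_exists[OF m g1(1)] .
  then obtain t1 where t1: "t1 < N" "f (?ord t1) g1 = Zero" "\<And>u. u < t1 \<Longrightarrow> f (?ord u) g1 \<noteq> Zero"
    using first_zero_exists[OF s(2)] by metis
  then obtain y1 where "y1 < N" "P t1 y1" using free[OF g1] by blast
  then obtain t where t: "t < N" "exec find_arc s ''x0'' 0 = ?ord t" "exec find_arc s ''y0'' 0 < N"
    "P t (exec find_arc s ''y0'' 0)" "\<And>u y. u < t \<Longrightarrow> y < N \<Longrightarrow> \<not> P u y"
    using exec_find_arc[OF G ord_less[OF s(2)] t1(1), of y1] unfolding P_def by blast
  define x0 y0 where "x0 = ?ord t" and "y0 = exec find_arc s ''y0'' 0"
  have x0: "x0 < N" "y0 < N" "A x0 y0" "s ''lab'' (x0 * N + y0) = 0" "t = 0 \<or> s ''par0'' x0 = y0 + 1"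
    using ord_less[OF s(2) t(1)] t(3,4) by (auto simp: x0_def y0_def P_def)
  obtain g where g: "g \<in> E" "drops g x0 y0" using A_drops[OF x0(1-3)] by blast
  note gd = dropsD[OF g(2)]
  define \<epsilon> where "\<epsilon> = f y0 g"
  have g_new: "g \<notin> el ` {..<i}" using lab[OF x0(1,2)] x0(4) g(2) by (auto split: if_splits)
  \<comment> \<open>If \<open>g\<close> vanished at an earlier vertex, its first zero vertex would
    offer a free arc before \<open>t\<close>.\<close>
  have before: "f (?ord u) g \<noteq> Zero" if "u < t" for u
  proof
    assume z: "f (?ord u) g = Zero"
    have uN: "u < N" using that t(1) by simp
    obtain u' where u': "u' < N" "f (?ord u') g = Zero" "\<And>w. w < u' \<Longrightarrow> f (?ord w) g \<noteq> Zero"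
      using first_zero_exists[OF s(2) ord_less[OF s(2) uN] z] by metis
    then have "u' \<le> u" using z by (meson not_le)
    moreover obtain y where "y < N" "P u' y" using free[OF g(1) g_new u'] by blast
    ultimately show False using t(5) that by (meson le_less_trans)
  qed
  have same: "f (?ord u) g = f (?ord 0) g" if "u < t" for u
    using that
  proof (induction u rule: less_induct)
    case (less u)
    show ?case
    proof (cases "u = 0")
      case False
      have uN: "u < N" using less.prems t(1) by simp
      obtain w where w: "w < u" "A (?ord w) (?ord u)" using parent[OF s(2) uN] False by blast
      have "?ord w < N" "?ord u < N" using ord_less[OF s(2)] w(1) uN by auto
      moreover have "f (?ord w) g \<noteq> Zero" "f (?ord u) g \<noteq> Zero" using before w(1) less.prems by auto
      ultimately have "f (?ord u) g = f (?ord w) g" using sign_constant w(2) g(1) by blast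
      moreover have "w < t" using w(1) less.prems by simp
      then have "f (?ord w) g = f (?ord 0) g" by (rule less.IH[OF w(1)])
      ultimately show ?thesis by (rule trans)
    qed simp
  qed
  \<comment> \<open>When the root is nonzero at \<open>g\<close>, \<open>y0\<close> is the
    predecessor of \<open>x0\<close>. No vertex before \<open>x0\<close> is a zero of
    \<open>g\<close>, so \<open>y0\<close> has the sign of the root.\<close>
  have root: "f 0 g = \<epsilon>" if "f 0 g \<noteq> Zero"
  proof -
    have o0: "?ord 0 = 0" using s(2) by (simp add: ordered_store_def)
    have "t \<noteq> 0" using that gd(5) o0 unfolding x0_def by metis
    then obtain u where u: "u < t" "?ord u = s ''par0'' x0 - 1" using parent[OF s(2) t(1)] unfolding x0_def by blast
    then have "?ord u = y0" using x0(5) \<open>t \<noteq> 0\<close> by simp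
    then show ?thesis using same[OF u(1)] o0 by (simp add: \<epsilon>_def)
  qed
  have \<epsilon>0: "\<epsilon> \<noteq> Zero" using gd(6) by (simp add: \<epsilon>_def)
  define s1 where "s1 = exec find_arc s"
  have fr1: "s1 a = s a" if "a \<notin> {''f'', ''t'', ''x'', ''y'', ''x0'', ''y0''}" for a
    unfolding s1_def by (rule exec_unchanged) (use that in simp)
  have s1: "antipodal_store s1" "s1 ''x0'' 0 = x0" "s1 ''y0'' 0 = y0"
    using antipodal_store_cong[OF s(1), of s1] fr1 t(2) by (simp_all add: s1_def x0_def y0_def)
  define s2 where "s2 = exec flood s1"
  have fr2: "s2 a = s a" if "a \<notin> {''f'', ''x'', ''y'', ''x0'', ''y0'', ''j'', ''t'', ''vis'', ''p'', ''a'', ''w'', ''plus'', ''minus'', ''par''}" for a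
  proof -
    have "s2 a = s1 a" unfolding s2_def by (rule exec_unchanged) (use that in simp)
    then show ?thesis using fr1 that by simp
  qed
  have vis2: "s2 ''vis'' x = (if f x g = Zero then 1 else 0)" and ex2: "f x g = Zero \<Longrightarrow> exits g \<epsilon> x s2" if "x < N" for x
    using exec_flood[OF s1 g(2) that] by (auto simp: s2_def \<epsilon>_def)
  have s2: "graph_store N A s2" "ordered_store N A s2" "matrix_store N n s2" "s2 ''e'' 0 = i"
    using graph_store_cong[OF G, of s2] ordered_store_cong[OF s(2), of s2] matrix_store_cong[OF s(3), of s2] s(4) fr2 by simp_all
  define s3 where "s3 = exec put_signs s2"
  have co3: "s3 ''cocircuits'' (x * n + e) = (if e = i then sign_code g \<epsilon> x else s ''cocircuits'' (x * n + e))"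
    if "x < N" "e < n" for x e
  proof -
    have "s2 ''cocircuits'' = s ''cocircuits''" using fr2 by simp
    moreover have "s3 ''cocircuits'' (x * n + e) = (if e = i then sign_code g \<epsilon> x else s2 ''cocircuits'' (x * n + e))"
      unfolding s3_def by (rule exec_put_signs[OF s2 s(5)]) (use vis2 ex2 \<epsilon>0 g(1) root that in blast)+
    ultimately show ?thesis by metis
  qed
  have fr3: "s3 a = s2 a" if "a \<notin> {''t'', ''x'', ''v'', ''p'', ''cocircuits''}" for a
    unfolding s3_def by (rule exec_unchanged) (use that in simp)
  have s3: "graph_store N A s3" using graph_store_cong[OF s2(1), of s3] fr3 by simp
  have ve3: "s3 ''vis'' x = (if f x g = Zero then 1 else 0)" "f x g = Zero \<Longrightarrow> exits g \<epsilon> x s3" if "x < N" for x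
    using vis2[OF that] ex2[OF that] fr3 by (simp_all add: exits_def)
  define s4 where "s4 = exec label_arcs s3"
  have lab4: "s4 ''lab'' (x * N + y) = (if drops g x y then 1 else s ''lab'' (x * N + y))" if "x < N" "y < N" for x y
  proof -
    have "s3 ''lab'' = s ''lab''" using fr3 fr2 by simp
    moreover have "s4 ''lab'' (x * N + y) = (if drops g x y then 1 else s3 ''lab'' (x * N + y))"
      unfolding s4_def by (rule exec_label_arcs[OF s3]) (use ve3 that in blast)+
    ultimately show ?thesis by metis
  qed
  have co4: "s4 ''cocircuits'' = s3 ''cocircuits''" unfolding s4_def by (rule exec_unchanged) simp
  have fin: "exec element_step s = s4" by (simp only: element_step_def exec.simps(3) s1_def s2_def s3_def s4_def)
  define el' where "el' = el(i := g)"
  \<comment> \<open>Code 1 stands for the sign \<open>\<epsilon>\<close> of \<open>y0\<close>; so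
    the new element appears reoriented exactly if \<open>\<epsilon>\<close> is
    \<open>Minus\<close>.\<close>
  define h' where "h' = h(i := (if \<epsilon> = Plus then id else flip))"
  show ?thesis
    unfolding fin elements_inv_def elements_data_def
  proof (intro exI[of _ el'] exI[of _ h'] conjI)
    show "inj_on el' {..<Suc i}"
      using el(1) g_new by (auto simp: el'_def lessThan_Suc inj_on_def)
    show "el' ` {..<Suc i} \<subseteq> E" using el(2) g(1) by (auto simp: el'_def lessThan_Suc)
    show "\<forall>e<Suc i. h' e = id \<or> h' e = flip" using h by (auto simp: h'_def less_Suc_eq)
    show "\<forall>x<N. \<forall>e<Suc i. s4 ''cocircuits'' (x * n + e) < 3 \<and>
        sign_of_nat (s4 ''cocircuits'' (x * n + e)) = h' e (f x (el' e))"
    proof (intro allI impI)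
      fix x e assume x: "x < N" and e: "e < Suc i"
      then have en: "e < n" using s(5) by simp
      show "s4 ''cocircuits'' (x * n + e) < 3 \<and> sign_of_nat (s4 ''cocircuits'' (x * n + e)) = h' e (f x (el' e))"
      proof (cases "e = i")
        case True
        have "sign_of_nat (sign_code g \<epsilon> x) = (if \<epsilon> = Plus then id else flip) (f x g)"
          using \<epsilon>0 by (cases \<epsilon>; cases "f x g") (auto simp: sign_code_def sign_of_nat_def)
        then show ?thesis using True co3[OF x en] co4 by (simp add: el'_def h'_def sign_code_def)
      next
        case False
        then show ?thesis using co[OF x, of e] co3[OF x en] co4 e by (simp add: el'_def h'_def)
      qed
    qed
    show "\<forall>x<N. \<forall>y<N. s4 ''lab'' (x * N + y) = (if \<exists>e<Suc i. drops (el' e) x y then 1 else 0)"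
    proof (intro allI impI)
      fix x y assume xy: "x < N" "y < N"
      have "(\<exists>e<Suc i. drops (el' e) x y) \<longleftrightarrow> drops g x y \<or> (\<exists>e<i. drops (el e) x y)"
        by (auto simp: el'_def less_Suc_eq)
      then show "s4 ''lab'' (x * N + y) = (if \<exists>e<Suc i. drops (el' e) x y then 1 else 0)"
        using lab4[OF xy] lab[OF xy] by simp
    qed
  qed
qed

lemma exec_candidate:
  assumes s: "graph_store N A s" "ordered_store N A s" "matrix_store N n s" "s ''z'' 0 = m"
    "relation_store N ''far'' (gball N A k) s" "relation_store N ''near'' (gball N A (k - 1)) s"
    and c: "s ''c'' 0 = anti 0" and n: "n = card E" and m: "0 < m"
  shows "exec candidate s ''accept'' 0 = 1"
proof -
  define s1 where "s1 = exec find_antipodes s"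
  have fr1: "s1 a = s a" if "a \<notin> {''t'', ''x'', ''al'', ''y'', ''a'', ''w''}" for a
    unfolding s1_def by (rule exec_unchanged) (use that in simp)
  have al: "s1 ''al'' x = anti x" if "x < N" for x
    using exec_find_antipodes[OF s(1,2,5) c that] by (simp add: s1_def)
  have g1: "graph_store N A s1" using graph_store_cong[OF s(1), of s1] fr1 by simp
  define s2 where "s2 = exec clear_labels s1"
  have fr2: "s2 a = s1 a" if "a \<notin> {''x'', ''y'', ''lab''}" for a
    unfolding s2_def by (rule exec_unchanged) (use that in simp)
  have lab: "s2 ''lab'' (x * N + y) = 0" if "x < N" "y < N" for x y
    using exec_clear_labels[OF g1 that] by (simp add: s2_def)
  have s2: "antipodal_store s2" "ordered_store N A s2" "matrix_store N n s2" "s2 ''z'' 0 = m"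
  proof -
    have "graph_store N A s2" using graph_store_cong[OF g1, of s2] fr2 by simp
    moreover have "s2 ''near'' = s ''near''" "s2 ''al'' = s1 ''al''" using fr1 fr2 by simp_all
    ultimately show "antipodal_store s2" using al s(6) by (simp add: antipodal_store_def relation_store_def)
    show "ordered_store N A s2" "matrix_store N n s2" "s2 ''z'' 0 = m"
      using ordered_store_cong[OF s(2), of s2] matrix_store_cong[OF s(3), of s2] s(4) fr1 fr2 by simp_all
  qed
  have nn: "s2 ''n'' 0 = n" using s2(3) by (simp add: matrix_store_def)
  define s3 where "s3 = exec (FFor ''e'' ''n'' element_step) s2"
  have "elements_inv n (s2 ''n'' 0) s3"
    unfolding s3_def
  proof (rule exec_For[where I = "elements_inv n"])
    show "elements_inv n 0 (setv s2 ''e'' 0)" using lab by (simp add: elements_inv_def elements_data_def)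
  next
    fix i t assume i: "i < s2 ''n'' 0" "elements_inv n i t" "t ''e'' 0 = i"
      and fr: "\<And>a. a \<notin> insert ''e'' (writes element_step) \<Longrightarrow> t a = s2 a"
    have "elements_inv n (Suc i) (exec element_step t)"
    proof (rule exec_element_step)
      show "antipodal_store t" using antipodal_store_cong[OF s2(1), of t] fr by simp
      show "ordered_store N A t" using ordered_store_cong[OF s2(2), of t] fr by simp
      show "matrix_store N n t" using matrix_store_cong[OF s2(3), of t] fr by simp
    qed (use i nn n m in simp_all)
    then show "elements_inv n (Suc i) (setv (exec element_step t) ''e'' (Suc i))"
      by (simp add: elements_inv_def elements_data_def)
  qed simp_all
  then obtain el h where "elements_data n n s3 el h" unfolding nn elements_inv_def by blast
  then have el: "inj_on el {..<n}" "el ` {..<n} \<subseteq> E" and h: "\<And>e. e < n \<Longrightarrow> h e = id \<or> h e = flip"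
    and co: "\<And>x e. x < N \<Longrightarrow> e < n \<Longrightarrow> s3 ''cocircuits'' (x * n + e) < 3 \<and>
      sign_of_nat (s3 ''cocircuits'' (x * n + e)) = h e (f x (el e))"
    by (simp_all add: elements_data_def)
  have "el ` {..<n} = E" using el finite_E n by (intro card_subset_eq) (auto simp: card_image)
  then have "bij_betw el {..<n} E" using el(1) by (simp add: bij_betw_def)
  then have V: "valid_matrix N n m A (\<lambda>x e. s3 ''cocircuits'' (x * n + e))"
    using valid_matrix_complete[of el n h "\<lambda>x e. s3 ''cocircuits'' (x * n + e)"] h co by blast
  have fr3: "s3 a = s2 a" if "a \<notin> {''e'', ''f'', ''t'', ''x'', ''y'', ''x0'', ''y0'', ''j'', ''vis'', ''p'', ''a'', ''w'', ''plus'',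
     ''minus'', ''par'', ''v'', ''cocircuits'', ''lab''}" for a
    unfolding s3_def by (rule exec_unchanged) (use that in simp)
  have "checked N n m A (\<lambda>x e. s3 ''cocircuits'' (x * n + e)) s3"
    unfolding checked_def
    using graph_store_cong[OF antipodal_storeD(1)[OF s2(1)], of s3] matrix_store_cong[OF s2(3), of s3] s2(4) fr3 by simp
  then have "exec verify s3 ''accept'' 0 = 1" using exec_verify V by simp
  moreover have "exec candidate s = exec verify s3"
    by (simp only: candidate_def exec.simps(3) s1_def s2_def s3_def)
  ultimately show ?thesis by simp
qed

end

text \<open>Nothing is assumed about the guess or the graph: whatever the earlier stages have
  written, the verification alone decides.\<close>

lemma exec_candidate_sound:
  assumes s: "graph_store N A s" "matrix_store N n s" "s ''z'' 0 = z"
  defines "s' \<equiv> exec candidate s"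
  shows "s' ''accept'' 0 = (if valid_matrix N n z A (\<lambda>x e. s' ''cocircuits'' (x * n + e)) then 1 else 0)"
proof -
  define s3 where "s3 = exec (FSeq find_antipodes (FSeq clear_labels (FFor ''e'' ''n'' element_step))) s"
  have fr: "s3 a = s a" if "a \<in> {''N'', ''row'', ''adj'', ''n'', ''rn'', ''z''}" for a
    unfolding s3_def by (rule exec_unchanged) (use that in auto)
  have "checked N n z A (\<lambda>x e. s3 ''cocircuits'' (x * n + e)) s3"
    unfolding checked_def
    using graph_store_cong[OF s(1), of s3] matrix_store_cong[OF s(2), of s3] s(3) fr by simp
  then have "exec verify s3 ''accept'' 0 = (if valid_matrix N n z A (\<lambda>x e. s3 ''cocircuits'' (x * n + e)) then 1 else 0)"
    by (rule exec_verify)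
  moreover have "s' = exec verify s3"
    by (simp only: s'_def candidate_def exec.simps(3) s3_def)
  moreover have "exec verify s3 ''cocircuits'' = s3 ''cocircuits''" by (rule exec_unchanged) simp
  ultimately show ?thesis by simp
qed

lemma exec_search_sound:
  assumes s: "graph_store N A s" "matrix_store N n s" "s ''z'' 0 = z" "s ''accept'' 0 = 0"
  defines "s' \<equiv> exec search s"
  shows "s' ''accept'' 0 = 0 \<or> (s' ''accept'' 0 = 1 \<and> valid_matrix N n z A (\<lambda>x e. s' ''cocircuits'' (x * n + e)))"
  unfolding s'_def search_def
proof (rule exec_For[where I = "\<lambda>i t. t ''accept'' 0 = 0 \<or>
    (t ''accept'' 0 = 1 \<and> valid_matrix N n z A (\<lambda>x e. t ''cocircuits'' (x * n + e)))"])
  let ?p = "FWhen (Equal (V ''accept'') (Num 0)) candidate"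
  fix i t assume I: "t ''accept'' 0 = 0 \<or> (t ''accept'' 0 = 1 \<and> valid_matrix N n z A (\<lambda>x e. t ''cocircuits'' (x * n + e)))"
    and fr: "\<And>a. a \<notin> insert ''c'' (writes ?p) \<Longrightarrow> t a = s a"
  show "setv (exec ?p t) ''c'' (Suc i) ''accept'' 0 = 0 \<or> (setv (exec ?p t) ''c'' (Suc i) ''accept'' 0 = 1 \<and>
      valid_matrix N n z A (\<lambda>x e. setv (exec ?p t) ''c'' (Suc i) ''cocircuits'' (x * n + e)))"
  proof (cases "t ''accept'' 0 = 0")
    case True
    have "graph_store N A t" "matrix_store N n t" "t ''z'' 0 = z"
      using graph_store_cong[OF s(1), of t] matrix_store_cong[OF s(2), of t] s(3) fr by simp_all
    from exec_candidate_sound[OF this] True show ?thesis by (simp split: if_splits)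
  qed (use I in simp)
qed (use s(4) in simp_all)

text \<open>The guess \<open>c = anti 0\<close> succeeds if it is tried, and it is skipped only
  after an earlier acceptance.\<close>

lemma (in labelled_graph) exec_search_complete:
  assumes s: "graph_store N A s" "ordered_store N A s" "matrix_store N n s" "s ''z'' 0 = m"
    "relation_store N ''far'' (gball N A k) s" "relation_store N ''near'' (gball N A (k - 1)) s"
    and n: "n = card E" and m: "0 < m" and N0: "0 < N"
  shows "exec search s ''accept'' 0 \<noteq> 0"
proof -
  note N = graph_storeD(1)[OF s(1)]
  have "anti 0 < s ''N'' 0 \<longrightarrow> exec search s ''accept'' 0 \<noteq> 0"
    unfolding search_def
  proof (rule exec_For[where I = "\<lambda>i t. anti 0 < i \<longrightarrow> t ''accept'' 0 \<noteq> 0"])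
    let ?p = "FWhen (Equal (V ''accept'') (Num 0)) candidate"
    fix i t assume I: "anti 0 < i \<longrightarrow> t ''accept'' 0 \<noteq> 0" and c: "t ''c'' 0 = i"
      and fr: "\<And>a. a \<notin> insert ''c'' (writes ?p) \<Longrightarrow> t a = s a"
    show "anti 0 < Suc i \<longrightarrow> setv (exec ?p t) ''c'' (Suc i) ''accept'' 0 \<noteq> 0"
    proof (cases "t ''accept'' 0 = 0 \<and> i = anti 0")
      case True
      have "exec candidate t ''accept'' 0 = 1"
      proof (rule exec_candidate)
        show "graph_store N A t" using graph_store_cong[OF s(1), of t] fr by simp
        show "ordered_store N A t" using ordered_store_cong[OF s(2), of t] fr by simp
        show "matrix_store N n t" using matrix_store_cong[OF s(3), of t] fr by simp
        show "relation_store N ''far'' (gball N A k) t" "relation_store N ''near'' (gball N A (k - 1)) t"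
          using s(5,6) fr by (simp_all add: relation_store_def)
      qed (use True c s(4) fr n m in simp_all)
      then show ?thesis using True by simp
    next
      case False
      then show ?thesis using I by auto
    qed
  qed simp_all
  then show ?thesis using anti(1)[OF N0] N by simp
qed

section \<open>The recognition algorithm\<close>

lemmas program_defs = parameters_def offsets_def regularity_def degree_of_def halve_def find_size_def pascal_row_def
  main_program_def order_vertices_def order_step_def balls_def expand_ball_def search_def candidate_def
  find_antipodes_def antipode_step_def clear_labels_def element_step_def find_arc_def arc_free_def flood_def flood_init_def
  flood_step_def reach_vertex_def transport_def link_zeros_def put_signs_def sign_step_def label_arcs_def
  verify_def check_row_def check_pair_def check_element_def

lemma counters_ok_programs: "counters_ok parameters" "counters_ok main_program"
  by (simp_all add: program_defs)

lemma bounds_programs: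
  "bounds parameters \<subseteq> {''N''}" "writes parameters \<inter> bounds parameters = {}"
  "bounds main_program \<subseteq> {''N'', ''n'', ''k''}" "writes main_program \<inter> bounds main_program = {}"
  by (simp_all add: program_defs)

text \<open>These are the shapes of monomials in the time bounds; \<open>c\<close> will be 1,
  \<open>n\<close> or \<open>k\<close>.\<close>

lemma monomial_bounds:
  fixes N q c :: nat
  assumes "1 \<le> N" "c \<le> q"
  shows "c \<le> q * (N * (N * N))" "c * N \<le> q * (N * (N * N))" "c * (N * N) \<le> q * (N * (N * N))"
    "c * (N * (N * N)) \<le> q * (N * (N * N))"
proof -
  have "N \<le> N * N" "N * N \<le> N * (N * N)" using assms(1) by simp_all
  then have "1 \<le> N * (N * N)" "N \<le> N * (N * N)" "N * N \<le> N * (N * N)" using assms(1) by linarith+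
  then show "c \<le> q * (N * (N * N))" "c * N \<le> q * (N * (N * N))" "c * (N * N) \<le> q * (N * (N * N))"
    "c * (N * (N * N)) \<le> q * (N * (N * N))"
    using mult_le_mono[OF assms(2)] by (metis mult.right_neutral, blast+)
qed

text \<open>10000 is a round bound for the sum of the coefficients: no nest of loops contains more
  than three of length \<open>N\<close> and one of length \<open>n\<close> or \<open>k\<close>, and
  \<open>q\<close> dominates 1, \<open>n\<close> and \<open>k\<close>.\<close>

lemma time_bound_programs:
  assumes "1 \<le> \<rho> ''N''" "1 \<le> q" "\<rho> ''n'' \<le> q" "\<rho> ''k'' \<le> q"
  shows "time_bound \<rho> parameters \<le> 10000 * (q * \<rho> ''N'' ^ 3)"
    "time_bound \<rho> main_program \<le> 10000 * (q * \<rho> ''N'' ^ 3)"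
proof -
  define N n k B where "N = \<rho> ''N''" and "n = \<rho> ''n''" and "k = \<rho> ''k''" and "B = q * (N * (N * N))"
  have N: "1 \<le> N" and q: "1 \<le> q" "n \<le> q" "k \<le> q" using assms by (simp_all add: N_def n_def k_def)
  note mono = monomial_bounds[OF N q(1), folded B_def] monomial_bounds[OF N q(2), folded B_def]
    monomial_bounds[OF N q(3), folded B_def]
  have eq: "q * N ^ 3 = B" by (simp add: B_def power3_eq_cube)
  have "time_bound \<rho> parameters \<le> 10000 * B"
    using mono by (simp add: program_defs N_def[symmetric] n_def[symmetric] k_def[symmetric] algebra_simps)
  then show "time_bound \<rho> parameters \<le> 10000 * (q * \<rho> ''N'' ^ 3)" using eq by (simp add: N_def)
  have "time_bound \<rho> main_program \<le> 10000 * B"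
    using mono by (simp add: program_defs N_def[symmetric] n_def[symmetric] k_def[symmetric] algebra_simps)
  then show "time_bound \<rho> main_program \<le> 10000 * (q * \<rho> ''N'' ^ 3)" using eq by (simp add: N_def)
qed

lemma le_binomial: "0 < z \<Longrightarrow> z < n \<Longrightarrow> n \<le> n choose z"
proof (induction n)
  case (Suc n)
  obtain z' where z': "z = Suc z'" using Suc.prems by (cases z) auto
  show ?case
  proof (cases "z = n")
    case False
    then have "n \<le> n choose z" using Suc by simp
    moreover have "0 < n choose z'" using Suc.prems z' by simp
    moreover have "Suc n choose z = (n choose z') + (n choose z)" by (simp add: z')
    ultimately show ?thesis by linarith
  qed simp
qed simp

text \<open>The two programs are joined outside the \<open>fprog\<close> language since
  \<open>parameters\<close> writes \<open>n\<close> and \<open>k\<close>, which bound loops of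
  \<open>main_program\<close>; each piece by itself leaves its own bounds untouched.\<close>

definition recognizer :: prog where
  "recognizer = Seq (compile parameters) (Branch (Equal (V ''ok'') (Num 1)) (compile main_program) Skip)"

lemma input_graph_facts:
  assumes G: "input_graph G" and N: "N = card (pverts G)" and A_def: "\<And>x y. A x y \<longleftrightarrow> (x, y) \<in> parcs G"
  shows "pair_graph G" "pverts G = {..<N}" "0 < N" "\<not> A x x" "A x y \<Longrightarrow> x < N \<and> y < N"
    "S \<subseteq> {..<N} \<Longrightarrow> 0 \<in> S \<Longrightarrow> (\<And>x y. x \<in> S \<Longrightarrow> y < N \<Longrightarrow> A x y \<Longrightarrow> y \<in> S) \<Longrightarrow> S = {..<N}"
proof -
  show pg: "pair_graph G" and pv: "pverts G = {..<N}" using G N by (auto simp: input_graph_def)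
  interpret pair_graph G by fact
  show "\<not> A x x" using pair_no_loops[of "(x, x)"] by (auto simp: A_def)
  show vs: "A x y \<Longrightarrow> x < N \<and> y < N" for x y using in_arcsD1 in_arcsD2 pv by (auto simp: A_def)
  have "Digraph_Component.connected (with_proj G)" using G by (simp add: input_graph_def)
  then have sc: "strongly_connected (with_proj G)"
    using symmetric_connected_imp_strongly_connected pair_sym_arcs by blast
  then have "pverts G \<noteq> {}" by (auto simp: strongly_connected_def)
  then show "0 < N" using pv by auto
  show "S = {..<N}" if S: "S \<subseteq> {..<N}" "0 \<in> S" "\<And>x y. x \<in> S \<Longrightarrow> y < N \<Longrightarrow> A x y \<Longrightarrow> y \<in> S"
  proof
    show "{..<N} \<subseteq> S"
    proof
      fix v assume "v \<in> {..<N}"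
      then have "0 \<rightarrow>\<^sup>*\<^bsub>with_proj G\<^esub> v" using sc pv \<open>0 < N\<close> by (auto simp: strongly_connected_def)
      then show "v \<in> S"
      proof (induction rule: reachable_induct)
        case base
        then show ?case using S(2) by simp
      next
        case (step x y)
        then have "A x y" by (simp add: A_def)
        then show ?case using S(3) vs step by blast
      qed
    qed
  qed (rule S(1))
qed

text \<open>For \<open>r = 1\<close> the parameters would describe two vertices without an edge,
  which connectedness forbids; hence \<open>0 < r - 1\<close>. The two binomial coefficients agree
  by symmetry.\<close>

lemma has_parameters_iff:
  assumes G: "input_graph G" and N_def: "N = card (pverts G)" and A_def: "\<And>x y. A x y \<longleftrightarrow> (x, y) \<in> parcs G"
  shows "has_parameters G n r \<longleftrightarrow> 1 \<le> r \<and> graph_parameters N A (r - 1) n"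
proof -
  note I = input_graph_facts[OF assms]
  have "out_degree (with_proj G) v = card {y. y < N \<and> A v y}" for v
  proof -
    have "{w. (v, w) \<in> parcs G} = {y. y < N \<and> A v y}" using I(5) by (auto simp: A_def)
    then show ?thesis by (simp add: out_degree_eq)
  qed
  then have reg: "regular d G \<longleftrightarrow> (\<forall>x<N. card {y. y < N \<and> A x y} = d)" for d
    by (auto simp: regular_def I(2))
  have bin: "n choose (n - r + 1) = n choose (r - 1)" if "1 \<le> r" "r \<le> n"
    using that by (subst binomial_symmetric) auto
  show ?thesis
  proof
    assume h: "has_parameters G n r"
    then have r: "1 \<le> r" "r \<le> n" and d: "\<forall>x<N. card {y. y < N \<and> A x y} = 2 * (r - 1)"
      and c: "N = 2 * (n choose (r - 1))" using bin reg by (auto simp: has_parameters_def N_def)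
    have "r \<noteq> 1"
    proof
      assume "r = 1"
      then have "N = 2" and empty: "\<forall>x<N. {y. y < N \<and> A x y} = {}" using c d by auto
      have "{0} = {..<N}"
      proof (rule I(6))
        fix x y assume "x \<in> {0::nat}" "y < N" "A x y"
        then have "x < N" "y \<in> {y. y < N \<and> A x y}" using I(3) by simp_all
        moreover have "{y. y < N \<and> A x y} = {}" using empty \<open>x < N\<close> by blast
        ultimately show "y \<in> {0}" by (metis empty_iff)
      qed (use I(3) in auto)
      then have "card {0::nat} = card {..<N}" by (rule arg_cong)
      then show False using \<open>N = 2\<close> by simp
    qed
    then have "0 < r - 1" "r - 1 < n" using r by auto
    moreover have "n \<le> N" using le_binomial[OF calculation] c by simp
    ultimately show "1 \<le> r \<and> graph_parameters N A (r - 1) n"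
      using r d c by (auto simp: graph_parameters_def)
  next
    assume h: "1 \<le> r \<and> graph_parameters N A (r - 1) n"
    then have r: "1 \<le> r" "r \<le> n" by (auto simp: graph_parameters_def)
    then show "has_parameters G n r"
      using h reg bin by (auto simp: has_parameters_def graph_parameters_def N_def)
  qed
qed

text \<open>The constant consists of 10000 for each of the two programs and 6 to cover the five
  steps of the branch between them. Acceptance is sound by the verification and complete by the
  guess of the true antipode.\<close>

lemma recognizer_correct:
  assumes G: "input_graph G"
  shows "\<exists>t s. runs recognizer (input_store G) t s \<and>
     (accepting s \<longleftrightarrow> (\<exists>(E :: nat set) r C. uniform_oriented_matroid E r C \<and>
        digraph_iso (with_proj G) (with_proj (cocircuit_graph E C)))) \<and>
     (accepting s \<longrightarrow> (\<exists>r. uniform_oriented_matroid (output_ground s) r (output_cocircuits s)) \<and>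
        digraph_iso (with_proj G) (with_proj (cocircuit_graph (output_ground s) (output_cocircuits s)))) \<and>
     ((\<nexists>n r. has_parameters G n r) \<longrightarrow> \<not> accepting s) \<and>
     (\<forall>n r. has_parameters G n r \<longrightarrow> t \<le> 20006 * (r * (n - r + 1) * card (pverts G) ^ 3))"
proof -
  define N where "N = card (pverts G)"
  define A where "A x y \<longleftrightarrow> (x, y) \<in> parcs G" for x y
  note I = input_graph_facts[OF G N_def A_def]
  note P = has_parameters_iff[OF G N_def A_def]
  define s0 where "s0 = input_store G"
  define s1 where "s1 = exec parameters s0"
  have init: "s0 a c = 0" if "a \<notin> {''N'', ''adj''}" for a c
    using that by (simp add: s0_def input_store_def Let_def)
  have N0: "s0 ''N'' 0 = N" by (simp add: s0_def input_store_def Let_def N_def)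
  have adj0: "s0 ''adj'' (x * N + y) = (if A x y then 1 else 0)" if "x < N" "y < N" for x y
  proof -
    have "x * N + y < N * N"
    proof -
      have "x * N + y < Suc x * N" using that by simp
      also have "\<dots> \<le> N * N" using that by (intro mult_le_mono1) simp
      finally show ?thesis .
    qed
    then show ?thesis using that by (simp add: s0_def input_store_def Let_def A_def N_def[symmetric])
  qed
  have par: "graph_store N A s1" "s1 ''ok'' 0 = (if \<exists>z n. graph_parameters N A z n then 1 else 0)"
    "graph_parameters N A z n \<Longrightarrow> s1 ''z'' 0 = z \<and> s1 ''n'' 0 = n \<and> s1 ''k'' 0 = n - z \<and> s1 ''m'' 0 = N" for z n
    unfolding s1_def by (rule exec_parameters[of s0 N A, OF N0 I(3)]; use adj0 init in simp)+
  have par_out: "s1 a = s0 a" if "a \<notin> {''o'', ''x'', ''row'', ''ok'', ''d'', ''j'', ''D'', ''z'', ''i'', ''B'', ''q'', ''n'', ''k'', ''m''}" for a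
    unfolding s1_def by (rule exec_unchanged) (use that in \<open>simp add: parameters_def\<close>)
  define \<rho> where "\<rho> = (\<lambda>b. s1 b 0)"
  have NB: "s0 b 0 = \<rho> b" if "b \<in> bounds parameters" for b
  proof -
    have "b = ''N''" using bounds_programs(1) that by blast
    then show ?thesis using par_out by (simp add: \<rho>_def)
  qed
  obtain t1 where t1: "t1 \<le> time_bound \<rho> parameters" "runs (compile parameters) s0 t1 s1"
    using runs_compile[of parameters s0 \<rho>, OF counters_ok_programs(1) bounds_programs(2) NB] unfolding s1_def by blast
  have iso_params: "\<exists>z n. graph_parameters N A z n" if "uniform_oriented_matroid E r C"
    "digraph_iso (with_proj G) (with_proj (cocircuit_graph E C))" for E :: "nat set" and r C
    using has_parameters_if_iso[OF I(1) that] P by blast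
  show ?thesis
  proof (cases "\<exists>z n. graph_parameters N A z n")
    case False
    then have "s1 ''ok'' 0 = 0" using par(2) by simp
    then have "runs (Branch (Equal (V ''ok'') (Num 1)) (compile main_program) Skip) s1 (1 + test_cost (Equal (V ''ok'') (Num 1)) + 1) s1"
      by (intro runs.BranchFalse runs.Skip) simp
    then have "runs recognizer s0 (t1 + (1 + test_cost (Equal (V ''ok'') (Num 1)) + 1)) s1"
      unfolding recognizer_def by (rule runs.Seq[OF t1(2)])
    moreover have "\<not> accepting s1" using par_out init by (simp add: accepting_def)
    moreover have "\<not> has_parameters G n r" for n r using False P by blast
    moreover have "\<not> (uniform_oriented_matroid E r C \<and> digraph_iso (with_proj G) (with_proj (cocircuit_graph E C)))"
      for E :: "nat set" and r C using False iso_params by blast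
    ultimately show ?thesis unfolding s0_def by blast
  next
    case True
    then obtain z n where zn: "graph_parameters N A z n" by blast
    have ok: "s1 ''ok'' 0 = 1" using par(2) True by simp
    have vals: "s1 ''z'' 0 = z" "s1 ''n'' 0 = n" "s1 ''k'' 0 = n - z" "s1 ''m'' 0 = N"
      using par(3)[OF zn] by simp_all
    have g1: "graph_store N A s1" by (rule par(1))
    have z: "0 < z" "z < n" "N = 2 * (n choose z)" using zn by (auto simp: graph_parameters_def)
    define s2 where "s2 = exec (offsets ''rn'' ''n'') s1"
    define s3 where "s3 = exec order_vertices s2"
    define s4 where "s4 = exec balls s3"
    define s5 where "s5 = exec search s4"
    have s5: "exec main_program s1 = s5"
      by (simp only: main_program_def exec.simps(3) s2_def s3_def s4_def s5_def)
    have fr2: "s2 a = s1 a" if "a \<notin> {''o'', ''x'', ''rn''}" for a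
      unfolding s2_def by (rule exec_unchanged) (use that in simp)
    have fr3: "s3 a = s2 a" if "a \<notin> {''x'', ''j'', ''t'', ''ord'', ''vis0'', ''par0''}" for a
      unfolding s3_def by (rule exec_unchanged) (use that in simp)
    have fr4: "s4 a = s3 a" if "a \<notin> {''x'', ''y'', ''w'', ''l'', ''near'', ''far''}" for a
      unfolding s4_def by (rule exec_unchanged) (use that in simp)
    have fr5: "s5 a = s4 a" if "a \<in> {''n'', ''m''}" for a
      unfolding s5_def by (rule exec_unchanged) (use that in \<open>auto simp: search_def\<close>)
    have g2: "graph_store N A s2" using graph_store_cong[OF g1, of s2] fr2 by simp
    have g3: "graph_store N A s3" using graph_store_cong[OF g2, of s3] fr3 by simp
    have g4: "graph_store N A s4" using graph_store_cong[OF g3, of s4] fr4 by simp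
    have rn: "s2 ''rn'' x = x * n" if "x < N" for x
      using exec_offsets[of "''rn''" "''n''" x s1] that graph_storeD(1)[OF g1] vals by (simp add: s2_def)
    have m4: "matrix_store N n s4" using rn fr2 fr3 fr4 vals by (simp add: matrix_store_def)
    have o3: "ordered_store N A s3"
      unfolding s3_def
    proof (rule exec_order_vertices[OF g2 I(3)])
      show "s2 ''vis0'' c = 0" "s2 ''par0'' c = 0" for c using fr2 par_out init by simp_all
    qed (rule I(6))
    have o4: "ordered_store N A s4" using o3 fr4 by (simp add: ordered_store_def)
    have "s3 ''far'' c = 0" for c using fr3 fr2 par_out init by simp
    moreover have k3: "s3 ''k'' 0 = n - z" using fr3 fr2 vals by simp
    ultimately have far: "relation_store N ''far'' (gball N A (n - z)) s4"
      and near: "relation_store N ''near'' (gball N A (n - z - 1)) s4"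
      using exec_balls[OF g3] z by (simp_all add: s4_def)
    have z4: "s4 ''z'' 0 = z" using fr4 fr3 fr2 vals by simp
    have acc4: "s4 ''accept'' 0 = 0" using fr4 fr3 fr2 par_out init by simp
    have out: "s5 ''n'' 0 = n" "s5 ''m'' 0 = N" using fr5 fr4 fr3 fr2 vals by simp_all
    define \<sigma> where "\<sigma> = (\<lambda>x e. s5 ''cocircuits'' (x * n + e))"
    have sound: "s5 ''accept'' 0 = 0 \<or> (s5 ''accept'' 0 = 1 \<and> valid_matrix N n z A \<sigma>)"
      using exec_search_sound[OF g4 m4 z4 acc4] by (simp add: s5_def \<sigma>_def)
    define row where "row = (\<lambda>x. \<lambda>e\<in>{..<n}. sign_of_nat (\<sigma> x e))"
    have oc: "output_ground s5 = {..<n}" "output_cocircuits s5 = row ` {..<N}"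
      by (simp_all add: output_ground_def output_cocircuits_def out row_def \<sigma>_def)
    have accept_sound: "(\<exists>r. uniform_oriented_matroid (output_ground s5) r (output_cocircuits s5)) \<and>
        digraph_iso (with_proj G) (with_proj (cocircuit_graph (output_ground s5) (output_cocircuits s5)))"
      if "accepting s5"
    proof -
      have v: "valid_matrix N n z A \<sigma>" using that sound by (simp add: accepting_def)
      note vs = valid_matrix_sound[OF v z(3,2) I(4), folded row_def]
      interpret coline_system "{..<n}" z "row ` {..<N}" by (rule vs(1))
      have "bij_betw row (pverts G) (row ` {..<N})" using vs(2) by (simp add: I(2) bij_betw_def)
      moreover have "(x, y) \<in> parcs G \<longleftrightarrow> adjacent {..<n} (row x) (row y)"
        if "x \<in> pverts G" "y \<in> pverts G" for x y
        using vs(3)[of x y] that unfolding I(2) A_def row_def by simp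
      ultimately have "digraph_iso (with_proj G) (with_proj (cocircuit_graph {..<n} (row ` {..<N})))"
        by (rule cocircuit_graph_isoI[OF I(1)])
      then show ?thesis unfolding oc using uniform_oriented_matroid by blast
    qed
    have complete: "accepting s5" if M: "uniform_oriented_matroid E r C"
      "digraph_iso (with_proj G) (with_proj (cocircuit_graph E C))" for E :: "nat set" and r C
    proof -
      have "graph_parameters N A (r - 1) (card E)" using has_parameters_if_iso[OF I(1) M] P by blast
      then have eq: "r - 1 = z" "card E = n" using graph_parameters_unique[OF _ zn I(3)] by blast+
      obtain f where f: "bij_betw f (pverts G) C"
        "\<And>x y. x \<in> pverts G \<Longrightarrow> y \<in> pverts G \<Longrightarrow> (x, y) \<in> parcs G \<longleftrightarrow> adjacent E (f x) (f y)"
        using cocircuit_graph_isoD[OF I(1) M(2)] by blast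
      interpret modular_system E z C using uniform_oriented_matroid_modular_system[OF M(1)] eq by simp
      interpret labelled_graph E z C N A f
        by unfold_locales (use f in \<open>auto simp: I(2) A_def\<close>)
      have "exec search s4 ''accept'' 0 \<noteq> 0"
        by (rule exec_search_complete[OF g4 o4 m4 z4]) (use far near eq z I(3) in simp_all)
      then show ?thesis using sound by (simp add: accepting_def s5_def)
    qed
    have NB1: "s1 b 0 = \<rho> b" for b by (simp add: \<rho>_def)
    obtain t2 where t2: "t2 \<le> time_bound \<rho> main_program" "runs (compile main_program) s1 t2 s5"
      using runs_compile[of main_program s1 \<rho>, OF counters_ok_programs(2) bounds_programs(4) NB1] unfolding s5 by blast
    let ?t = "t1 + (1 + test_cost (Equal (V ''ok'') (Num 1)) + t2)"
    have "runs (Branch (Equal (V ''ok'') (Num 1)) (compile main_program) Skip) s1 (1 + test_cost (Equal (V ''ok'') (Num 1)) + t2) s5"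
      using ok t2(2) by (intro runs.BranchTrue) simp_all
    then have run: "runs recognizer s0 ?t s5"
      unfolding recognizer_def by (rule runs.Seq[OF t1(2)])
    have time: "?t \<le> 20006 * (r * (n' - r + 1) * N ^ 3)" if "has_parameters G n' r" for n' r
    proof -
      have "1 \<le> r" "graph_parameters N A (r - 1) n'" using that P by auto
      then have eq: "r = z + 1" "n' = n" using graph_parameters_unique[OF _ zn I(3)] by fastforce+
      define q where "q = r * (n' - r + 1)"
      have "n' - r + 1 = n - z" using eq z by simp
      then have q: "q = (z + 1) * (n - z)" using eq by (simp only: q_def)
      have nz: "1 \<le> n - z" using z by simp
      have "1 * (n - z) \<le> q" unfolding q by (rule mult_le_mono1) simp
      then have q1: "n - z \<le> q" "1 \<le> q" using nz by simp_all
      \<comment> \<open>With \<open>r = z + 1\<close> and \<open>1 \<le> n - z\<close>, also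
        \<open>n\<close> itself is at most \<open>r * (n - r + 1)\<close>; this pays for the loops
        over the elements.\<close>
      have "n = z * 1 + (n - z)" using z by simp
      also have "\<dots> \<le> z * (n - z) + (n - z)" using nz by (intro add_right_mono mult_le_mono2)
      also have "\<dots> = q" by (simp add: q)
      finally have nq: "n \<le> q" .
      have \<rho>: "\<rho> ''N'' = N" "\<rho> ''n'' = n" "\<rho> ''k'' = n - z"
        using vals graph_storeD(1)[OF g1] by (simp_all add: \<rho>_def)
      have "time_bound \<rho> parameters \<le> 10000 * (q * N ^ 3)" "time_bound \<rho> main_program \<le> 10000 * (q * N ^ 3)"
        using time_bound_programs[of \<rho> q] q1 nq I(3) by (simp_all add: \<rho>)
      moreover have "1 \<le> q * N ^ 3" using q1 I(3) by simp
      ultimately have "t1 + (1 + test_cost (Equal (V ''ok'') (Num 1)) + t2) \<le> 20006 * (q * N ^ 3)"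
        using t1(1) t2(1) unfolding test_cost.simps expr_cost.simps by linarith
      then show ?thesis by (simp add: q_def)
    qed
    have np: "\<exists>n r. has_parameters G n r"
      using zn P[of n "z + 1"] by auto
    have iff: "accepting s5 \<longleftrightarrow> (\<exists>(E :: nat set) r C. uniform_oriented_matroid E r C \<and>
        digraph_iso (with_proj G) (with_proj (cocircuit_graph E C)))"
      using accept_sound complete by blast
    show ?thesis
      unfolding s0_def[symmetric] N_def[symmetric]
    proof (rule exI[of _ ?t], rule exI[of _ s5], intro conjI)
      show "accepting s5 \<longrightarrow> (\<exists>r. uniform_oriented_matroid (output_ground s5) r (output_cocircuits s5)) \<and>
          digraph_iso (with_proj G) (with_proj (cocircuit_graph (output_ground s5) (output_cocircuits s5)))"
        using accept_sound by blast
      show "\<forall>n r. has_parameters G n r \<longrightarrow> ?t \<le> 20006 * (r * (n - r + 1) * N ^ 3)"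
        using time by blast
      show "(\<nexists>n r. has_parameters G n r) \<longrightarrow> \<not> accepting s5" using np by blast
    qed (rule run iff)+
  qed
qed

text \<open>Ground sets are finite, so subsets of \<open>nat\<close> represent all uniform oriented
  matroids up to renaming of the elements.\<close>

theorem mainTheorem2:
  shows "(\<forall>G (E :: nat set) r C.
            input_graph G \<and> uniform_oriented_matroid E r C \<and>
            digraph_iso (with_proj G) (with_proj (cocircuit_graph E C)) \<longrightarrow>
            has_parameters G (card E) r) \<and>
         (\<exists>(p :: prog) (c :: nat). \<forall>G. input_graph G \<longrightarrow>
            (\<exists>t s. runs p (input_store G) t s \<and>
               (accepting s \<longleftrightarrow>
                  (\<exists>(E :: nat set) r C. uniform_oriented_matroid E r C \<and>
                     digraph_iso (with_proj G) (with_proj (cocircuit_graph E C)))) \<and>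
               (accepting s \<longrightarrow>
                  (\<exists>r. uniform_oriented_matroid (output_ground s) r (output_cocircuits s)) \<and>
                  digraph_iso (with_proj G)
                    (with_proj (cocircuit_graph (output_ground s) (output_cocircuits s)))) \<and>
               ((\<nexists>n r. has_parameters G n r) \<longrightarrow> \<not> accepting s) \<and>
               (\<forall>n r. has_parameters G n r \<longrightarrow>
                  t \<le> c * (r * (n - r + 1) * card (pverts G) ^ 3))))"
proof
  show "\<forall>G (E :: nat set) r C. input_graph G \<and> uniform_oriented_matroid E r C \<and>
      digraph_iso (with_proj G) (with_proj (cocircuit_graph E C)) \<longrightarrow> has_parameters G (card E) r"
    by (intro allI impI, elim conjE, rule has_parameters_if_iso) (simp_all add: input_graph_def)
qed (rule exI[of _ recognizer], rule exI[of _ 20006], intro allI impI, rule recognizer_correct)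

end
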